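(* Let $S^\epsilon$, $V^\epsilon$, $v^\epsilon$, $v^0$, $\rho\in(-1,1)$, $T>0$, $X^\epsilon$, $Y^\epsilon$ be as in the context. Assume: (1) the family $(Y^\epsilon)_{\epsilon>0}$ is uniformly integrable; (2) $(X^\epsilon,Y^\epsilon)$ converges in law, as $\epsilon\to 0$, to a pair of random variables $(X,Y)$ such that $x\mapsto \mathsf{E}[Y|X=x]$ is (has a version which is) twice continuously differentiable on $\mathbb{R}$ and, for this version, $$\lim_{|x|\to\infty}\mathsf{E}[Y|X=x]\,\phi(x)=\lim_{|x|\to\infty}\frac{\mathrm{d}}{\mathrm{d}x}\bigl(\mathsf{E}[Y|X=x]\,\phi(x)\bigr)=0;$$ (3) the function $$\phi^\epsilon(x):=\phi(x)+\frac{\epsilon}{2\sqrt{v^\epsilon}}\frac{\mathrm{d}}{\mathrm{d}x}\bigl(\mathsf{E}[Y|X=x]\phi(x)\bigr)+\frac{\epsilon}{2v^\epsilon}\frac{\mathrm{d}^2}{\mathrm{d}x^2}\bigl(\mathsf{E}[Y|X=x]\phi(x)\bigr)$$ is integrable on $\mathbb{R}$ (for each $\epsilon>0$). Then for every bounded Borel function $f:\mathbb{R}\to\mathbb{R}$, $$\mathsf{E}[f(S^\epsilon_T)]=\int_{\mathbb{R}} f\left(S_0\exp\left\{\sqrt{v^\epsilon}\,x-\frac{v^\epsilon}{2}\right\}\right)\phi^\epsilon(x)\,\mathrm{d}x+o(\epsilon)\quad\text{as }\epsilon\to0.$$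
   Context: Setting. $(\Omega,\mathscr{F},\mathsf{P},\{\mathscr{F}_t\}_{t\ge0})$ is a filtered probability space carrying a 2-dimensional standard Brownian motion $(W,W^\perp)$ (with respect to $\{\mathscr{F}_t\}$). $\{\mathscr{G}_t\}$ is a smaller filtration ($\mathscr{G}_t\subset\mathscr{F}_t$) such that $W$ is adapted to $\{\mathscr{G}_t\}$ while $W^\perp$ is independent of $\{\mathscr{G}_t\}$. Fix $\rho\in(-1,1)$, $T>0$ and a deterministic constant $S_0>0$, and put $B_t=\rho W_t+\sqrt{1-\rho^2}\,W^\perp_t$. For each $\epsilon>0$, $V^\epsilon$ is a nonnegative càdlàg process adapted to $\{\mathscr{G}_t\}$, and $S^\epsilon$ is the solution of $$\frac{\mathrm{d}S^\epsilon_t}{S^\epsilon_t}=\sqrt{V^\epsilon_t}\,\mathrm{d}B_t,\qquad S^\epsilon_0=S_0,$$ i.e. $S^\epsilon_t=S_0\exp\{\int_0^t\sqrt{V^\epsilon_s}\,\mathrm{d}B_s-\frac12\int_0^tV^\epsilon_s\,\mathrm{d}s\}$. Standing assumption: there are deterministic constants $v^\epsilon>0$ ($\epsilon>0$) with limit $v^0:=\lim_{\epsilon\to0}v^\epsilon>0$ such that $\int_0^TV^\epsilon_t\,\mathrm{d}t-v^\epsilon\to0$ in probability as $\epsilon\to0$. Notation: $$X^\epsilon=\frac{1}{\sqrt{v^\epsilon}}\int_0^T\frac{\mathrm{d}S^\epsilon_t}{S^\epsilon_t}=\frac{1}{\sqrt{v^\epsilon}}\int_0^T\sqrt{V^\epsilon_t}\,\mathrm{d}B_t,\qquad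 Y^\epsilon=\frac1\epsilon\left(\int_0^TV^\epsilon_t\,\mathrm{d}t-v^\epsilon\right),$$ and $\phi(x)=(2\pi)^{-1/2}e^{-x^2/2}$ is the standard normal density. The term $o(\epsilon)$ denotes a quantity which, divided by $\epsilon$, tends to $0$ as $\epsilon\to0$ (for fixed $f$). *)

theory Defs
  imports "HOL-Probability.Probability" "HOL-Library.Landau_Symbols"
begin

section \<open>Filtrations and Brownian motion on the time axis $[0,\infty)$\<close>

text \<open>Time is of type \<^typ>\<open>real\<close>; only indices \<open>t \<ge> 0\<close> are ever constrained. This is why the
  locale \<^locale>\<open>filtration\<close>, which is monotone over the whole index type, is not used.\<close>

definition filtration_on :: "'a measure \<Rightarrow> (real \<Rightarrow> 'a measure) \<Rightarrow> bool" where
  "filtration_on M F \<longleftrightarrow>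
     (\<forall>t\<ge>0. subalgebra M (F t)) \<and> (\<forall>s t. 0 \<le> s \<longrightarrow> s \<le> t \<longrightarrow> subalgebra (F t) (F s))"

definition adapted :: "(real \<Rightarrow> 'a measure) \<Rightarrow> (real \<Rightarrow> 'a \<Rightarrow> 'b::topological_space) \<Rightarrow> bool" where
  "adapted F Z \<longleftrightarrow> (\<forall>t\<ge>0. Z t \<in> borel_measurable (F t))"

definition cadlag :: "(real \<Rightarrow> real) \<Rightarrow> bool" where
  "cadlag z \<longleftrightarrow>
     (\<forall>t\<ge>0. (z \<longlongrightarrow> z t) (at_right t)) \<and> (\<forall>t>0. \<exists>l. (z \<longlongrightarrow> l) (at_left t))"

text \<open>Standard Brownian motion relative to \<open>F\<close> with values in a Euclidean space; its dimension is
  that of the space, so two-dimensional Brownian motion takes values in \<^typ>\<open>real \<times> real\<close>.\<close>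

definition brownian_motion ::
  "'a measure \<Rightarrow> (real \<Rightarrow> 'a measure) \<Rightarrow> (real \<Rightarrow> 'a \<Rightarrow> 'e::euclidean_space) \<Rightarrow> bool" where
  "brownian_motion M F B \<longleftrightarrow>
     adapted F B \<and>
     (AE \<omega> in M. B 0 \<omega> = 0) \<and>
     (AE \<omega> in M. continuous_on {0..} (\<lambda>t. B t \<omega>)) \<and>
     (\<forall>s t. 0 \<le> s \<longrightarrow> s < t \<longrightarrow>
        distributed M lborel (\<lambda>\<omega>. B t \<omega> - B s \<omega>)
          (\<lambda>x. ennreal (\<Prod>b\<in>Basis. normal_density 0 (sqrt (t - s)) (x \<bullet> b))) \<and>
        prob_space.indep_set M (sets (F s))
          (sets (vimage_algebra (space M) (\<lambda>\<omega>. B t \<omega> - B s \<omega>) borel)))"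

definition process_indep_of_filtration ::
  "'a measure \<Rightarrow> (real \<Rightarrow> 'a \<Rightarrow> real) \<Rightarrow> (real \<Rightarrow> 'a measure) \<Rightarrow> bool" where
  "process_indep_of_filtration M Z G \<longleftrightarrow>
     prob_space.indep_set M
       (sigma_sets (space M) (\<Union>t\<in>{0..}. sets (vimage_algebra (space M) (Z t) borel)))
       (sigma_sets (space M) (\<Union>t\<in>{0..}. sets (G t)))"


section \<open>Modes of convergence and uniform integrability\<close>

text \<open>The measurability clauses guard against the convention that non-measurable sets have
  measure \<open>0\<close> and non-measurable functions have integral \<open>0\<close>.\<close>

definition tendsto_in_prob ::
  "'a measure \<Rightarrow> ('i \<Rightarrow> 'a \<Rightarrow> real) \<Rightarrow> ('a \<Rightarrow> real) \<Rightarrow> 'i filter \<Rightarrow> bool" where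
  "tendsto_in_prob M Z L \<F> \<longleftrightarrow>
     (\<forall>\<^sub>F i in \<F>. Z i \<in> borel_measurable M) \<and> L \<in> borel_measurable M \<and>
     (\<forall>\<delta>>0. ((\<lambda>i. measure M {\<omega> \<in> space M. \<delta> < \<bar>Z i \<omega> - L \<omega>\<bar>}) \<longlongrightarrow> 0) \<F>)"

definition tendsto_in_law ::
  "'a measure \<Rightarrow> ('i \<Rightarrow> 'a \<Rightarrow> 'e::metric_space) \<Rightarrow> 'b measure \<Rightarrow> ('b \<Rightarrow> 'e) \<Rightarrow> 'i filter \<Rightarrow> bool" where
  "tendsto_in_law M Z N L \<F> \<longleftrightarrow>
     (\<forall>\<^sub>F i in \<F>. Z i \<in> borel_measurable M) \<and> L \<in> borel_measurable N \<and>
     (\<forall>g :: 'e \<Rightarrow> real. continuous_on UNIV g \<longrightarrow> bounded (range g) \<longrightarrow>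
        ((\<lambda>i. \<integral>\<omega>. g (Z i \<omega>) \<partial>M) \<longlongrightarrow> (\<integral>\<omega>. g (L \<omega>) \<partial>N)) \<F>)"

definition uniformly_integrable ::
  "'a measure \<Rightarrow> 'i set \<Rightarrow> ('i \<Rightarrow> 'a \<Rightarrow> real) \<Rightarrow> bool" where
  "uniformly_integrable M I Z \<longleftrightarrow>
     (\<forall>i\<in>I. Z i \<in> borel_measurable M) \<and>
     ((\<lambda>K::real. SUP i\<in>I. \<integral>\<^sup>+\<omega>. ennreal \<bar>Z i \<omega>\<bar> * indicator {\<omega>. K < \<bar>Z i \<omega>\<bar>} \<omega> \<partial>M)
        \<longlongrightarrow> 0) at_top"


section \<open>The It\^o integral\<close>

text \<open>The data \<open>n\<close>, \<open>\<tau>\<close>, \<open>\<xi>\<close> encode the simple process equal to \<open>\<xi> i\<close> on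
  \<open>(\<tau> i, \<tau> (i + 1)]\<close> for \<open>i < n\<close> and to \<open>0\<close> elsewhere.\<close>

definition simple_process ::
  "'a measure \<Rightarrow> (real \<Rightarrow> 'a measure) \<Rightarrow> nat \<Rightarrow> (nat \<Rightarrow> real) \<Rightarrow> (nat \<Rightarrow> 'a \<Rightarrow> real) \<Rightarrow> bool" where
  "simple_process M F n \<tau> \<xi> \<longleftrightarrow>
     0 \<le> \<tau> 0 \<and> (\<forall>i<n. \<tau> i \<le> \<tau> (Suc i)) \<and>
     (\<forall>i<n. \<xi> i \<in> borel_measurable (F (\<tau> i)) \<and> bounded (\<xi> i ` space M))"

definition simple_value ::
  "nat \<Rightarrow> (nat \<Rightarrow> real) \<Rightarrow> (nat \<Rightarrow> 'a \<Rightarrow> real) \<Rightarrow> real \<Rightarrow> 'a \<Rightarrow> real" where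
  "simple_value n \<tau> \<xi> s \<omega> = (\<Sum>i<n. \<xi> i \<omega> * indicator {\<tau> i<..\<tau> (Suc i)} s)"

definition simple_integral_wrt ::
  "(real \<Rightarrow> 'a \<Rightarrow> real) \<Rightarrow> nat \<Rightarrow> (nat \<Rightarrow> real) \<Rightarrow> (nat \<Rightarrow> 'a \<Rightarrow> real) \<Rightarrow> real \<Rightarrow> 'a \<Rightarrow> real" where
  "simple_integral_wrt B n \<tau> \<xi> t \<omega> =
     (\<Sum>i<n. \<xi> i \<omega> * (B (min t (\<tau> (Suc i))) \<omega> - B (min t (\<tau> i)) \<omega>))"

definition progressively_measurable ::
  "(real \<Rightarrow> 'a measure) \<Rightarrow> real \<Rightarrow> (real \<Rightarrow> 'a \<Rightarrow> real) \<Rightarrow> bool" where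
  "progressively_measurable F t H \<longleftrightarrow>
     (\<forall>u\<in>{0..t}. (\<lambda>(s, \<omega>). H s \<omega>) \<in> borel_measurable (restrict_space borel {0..u} \<Otimes>\<^sub>M F u))"

text \<open>\<open>has_ito_integral M F B H t J\<close> says that \<open>J\<close> is a version of $\int_0^t H_s\,dB_s$ for a
  Brownian motion \<open>B\<close> relative to \<open>F\<close>: for some simple processes $H^k$ with
  $\int_0^t (H^k_s - H_s)^2\,ds \to 0$ in probability, the elementary integrals of $H^k$ tend to
  \<open>J\<close> in probability. The limit is unique up to null sets, and it exists whenever \<open>H\<close> is
  progressive with $\int_0^t H_s^2\,ds < \infty$ a.s. The time integral is taken in \<^typ>\<open>ennreal\<close>,
  so that divergent integrals count as infinite.\<close>

definition has_ito_integral ::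
  "'a measure \<Rightarrow> (real \<Rightarrow> 'a measure) \<Rightarrow> (real \<Rightarrow> 'a \<Rightarrow> real) \<Rightarrow> (real \<Rightarrow> 'a \<Rightarrow> real) \<Rightarrow> real \<Rightarrow>
     ('a \<Rightarrow> real) \<Rightarrow> bool" where
  "has_ito_integral M F B H t J \<longleftrightarrow>
     progressively_measurable F t H \<and>
     (\<exists>n \<tau> \<xi>.
        (\<forall>k::nat. simple_process M F (n k) (\<tau> k) (\<xi> k)) \<and>
        (\<forall>\<delta>>0. (\<lambda>k. measure M {\<omega> \<in> space M.
             ennreal \<delta> < (\<integral>\<^sup>+s\<in>{0..t}. ennreal ((simple_value (n k) (\<tau> k) (\<xi> k) s \<omega> - H s \<omega>)\<^sup>2) \<partial>lborel)})
           \<longlonglongrightarrow> 0) \<and>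
        tendsto_in_prob M (\<lambda>k. simple_integral_wrt B (n k) (\<tau> k) (\<xi> k) t) J sequentially)"


section \<open>Regression functions and the corrected density\<close>

definition cond_exp_version :: "'b measure \<Rightarrow> ('b \<Rightarrow> real) \<Rightarrow> ('b \<Rightarrow> real) \<Rightarrow> (real \<Rightarrow> real) \<Rightarrow> bool" where
  "cond_exp_version N Y X m \<longleftrightarrow>
     integrable N Y \<and> m \<in> borel_measurable borel \<and>
     (AE \<omega> in N. real_cond_exp N (vimage_algebra (space N) X borel) Y \<omega> = m (X \<omega>))"

definition twice_continuously_differentiable :: "(real \<Rightarrow> real) \<Rightarrow> bool" where
  "twice_continuously_differentiable m \<longleftrightarrow>
     m differentiable_on UNIV \<and> deriv m C1_differentiable_on UNIV"

definition corrected_density :: "(real \<Rightarrow> real) \<Rightarrow> real \<Rightarrow> real \<Rightarrow> real \<Rightarrow> real" where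
  "corrected_density m v \<epsilon> x =
     std_normal_density x
     + \<epsilon> / (2 * sqrt v) * deriv (\<lambda>y. m y * std_normal_density y) x
     + \<epsilon> / (2 * v) * deriv (deriv (\<lambda>y. m y * std_normal_density y)) x"

end

theory Submission
  imports Defs
begin

text \<open>Write \<open>h z = f (S0 exp z)\<close>, \<open>R\<close> for the stochastic integral, \<open>I\<close> for the integrated variance, and
  \<open>P\<^sub>s\<close> for the Gaussian semigroup \<open>P\<^sub>s h x = E[h (x + sqrt s Z)]\<close>. The expectation to be expanded is
  \<open>E[h (R - I / 2)]\<close> and its leading term is \<open>P\<^sub>v h (- v / 2)\<close>. Since \<open>h\<close> is only bounded and Borel, all
  smoothness has to come from the independent Brownian motion \<open>W'\<close>.

  Put \<open>A\<close> for the integral of \<open>sqrt V\<close> against \<open>W\<close>. Two exact identities carry the proof. First, given the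
  smaller filtration \<open>R\<close> is normal with mean \<open>\<rho> A\<close> and variance \<open>(1 - \<rho>\<^sup>2) I\<close>, so that
  \<open>E[h (R - I / 2)] = E[P\<^bsub>(1 - \<rho>\<^sup>2) I\<^esub> h (\<rho> A - I / 2)]\<close>. Secondly, \<open>P\<^bsub>v - \<rho>\<^sup>2 I\<^esub> h (\<rho> A - v / 2)\<close> is the terminal value of
  a martingale that starts at \<open>P\<^sub>v h (- v / 2)\<close>. The two integrands agree when \<open>I = v\<close>; by the heat equation
  their difference is, to first order in \<open>I - v\<close>, the product of \<open>I - v\<close> with half of \<open>k'' - k'\<close>, where
  \<open>k = P\<^bsub>(1 - \<rho>\<^sup>2) v\<^esub> h\<close>, and the error is quadratic (\<open>heat_exchange\<close>). Smoothing \<open>h\<close> by a further \<open>P\<^sub>\<delta>\<close> allows the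
  first-order term to be written through \<open>R\<close> itself, at the price of an error of size \<open>\<delta> \<bar>I - v\<bar>\<close>.

  These identities are proved for step integrands on a grid (\<open>step_expansion\<close>), where they are statements
  about finitely many Gaussian increments, and cut off so that \<open>I \<le> v + \<kappa>\<close>. They pass to the limit for
  continuous \<open>h\<close>. Their error is a multiple of the supremum of \<open>h\<close> only, so they extend to
  Borel \<open>h\<close> because continuous functions are dense in \<open>L\<^sup>1\<close> of a finite measure (\<open>expansion\<close>).

  Finally \<open>I - v = \<epsilon> Y\<close>. Uniform integrability makes the quadratic error and the probability of
  \<open>I \<ge> v + \<kappa>\<close> of order \<open>o(\<epsilon>)\<close> (\<open>remainder_small\<close>). The order-zero part of the same inequality identifies
  the law of \<open>X\<close> as standard normal (\<open>X_law\<close>), convergence in law gives the limit of the first-order term,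
  and integration by parts turns it into an integral of \<open>P\<^sub>\<delta> h\<close> against the first and second
  derivative of \<open>E[Y|X=x] \<phi> x\<close> (\<open>corrector_limit\<close>). Letting \<open>\<delta>\<close> tend to \<open>0\<close> after \<open>\<epsilon>\<close>, with Scheffe's lemma, gives the
  theorem (\<open>martingale_expansion\<close>).\<close>

section \<open>The Gaussian semigroup\<close>

abbreviation "\<gamma> \<equiv> std_normal_distribution"

text \<open>The bound is kept as an explicit parameter because every error estimate below is proportional to it;
  this proportionality is what allows the passage from continuous to Borel functions.\<close>

definition bounded_borel :: "real \<Rightarrow> (real \<Rightarrow> real) \<Rightarrow> bool" where
  "bounded_borel C h \<longleftrightarrow> h \<in> borel_measurable borel \<and> (\<forall>x. \<bar>h x\<bar> \<le> C)"

lemma bounded_borelD: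
  assumes "bounded_borel C h"
  shows "h \<in> borel_measurable borel" "\<bar>h x\<bar> \<le> C" "0 \<le> C"
  using assms order_trans[OF abs_ge_zero, of "h x" C] by (auto simp: bounded_borel_def)

interpretation gauss: real_distribution \<gamma>
  by (rule real_dist_normal_dist)

lemma gauss_UNIV [simp]: "measure \<gamma> UNIV = 1"
  using gauss.prob_space by simp

lemma integrable_bounded_borel:
  assumes "prob_space M" "bounded_borel C h" "X \<in> borel_measurable M"
  shows "integrable M (\<lambda>\<omega>. h (X \<omega>))"
proof -
  interpret prob_space M by fact
  note [measurable] = assms(3) bounded_borelD(1)[OF assms(2)]
  show ?thesis
    by (rule integrable_const_bound[where B = C]) (use bounded_borelD(2)[OF assms(2)] in auto)
qed

lemma integral_gauss_eq:
  fixes g :: "real \<Rightarrow> real"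
  assumes "g \<in> borel_measurable borel"
  shows "(\<integral>z. g z \<partial>\<gamma>) = (\<integral>z. std_normal_density z * g z \<partial>lborel)"
  using assms by (subst integral_real_density) auto

lemma integrable_gauss_iff:
  fixes g :: "real \<Rightarrow> real"
  assumes "g \<in> borel_measurable borel"
  shows "integrable \<gamma> g \<longleftrightarrow> integrable lborel (\<lambda>z. std_normal_density z * g z)"
  using assms by (subst integrable_real_density) auto

text \<open>Both laws have the characteristic function \<open>exp (- (a\<^sup>2 + b\<^sup>2) t\<^sup>2 / 2)\<close>; comparing these
  instead of densities covers vanishing and negative coefficients at once.\<close>

lemma gauss_convolution:
  fixes g :: "real \<Rightarrow> real"
  assumes g: "bounded_borel C g"
  shows "(\<integral>z. (\<integral>w. g (a * z + b * w) \<partial>\<gamma>) \<partial>\<gamma>) = (\<integral>u. g (sqrt (a\<^sup>2 + b\<^sup>2) * u) \<partial>\<gamma>)"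
proof -
  interpret P: pair_prob_space \<gamma> \<gamma> ..
  have gm [measurable]: "g \<in> borel_measurable borel" using bounded_borelD[OF g] by simp
  have m2 [measurable]: "(\<lambda>(z, w). a * z + b * w) \<in> borel_measurable (\<gamma> \<Otimes>\<^sub>M \<gamma>)"
    by measurable
  define D where "D = distr (\<gamma> \<Otimes>\<^sub>M \<gamma>) borel (\<lambda>(z, w). a * z + b * w)"
  define E where "E = distr \<gamma> borel (\<lambda>u. sqrt (a\<^sup>2 + b\<^sup>2) * u)"
  have ch: "(CLINT z|\<gamma>. iexp (t * z)) = of_real (exp (- (t\<^sup>2) / 2))" for t
    using fun_cong[OF char_std_normal_distribution, of t] by (simp add: char_def)
  have "char D t = char E t" for t
  proof -
    have "char D t = (CLINT p|\<gamma> \<Otimes>\<^sub>M \<gamma>. iexp (t * (case p of (z, w) \<Rightarrow> a * z + b * w)))"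
      unfolding D_def char_def by (subst integral_distr) auto
    also have "\<dots> = (CLINT p|\<gamma> \<Otimes>\<^sub>M \<gamma>. (case p of (z, w) \<Rightarrow> iexp ((t * a) * z) * iexp ((t * b) * w)))"
      by (intro Bochner_Integration.integral_cong)
         (auto simp: algebra_simps exp_add[symmetric])
    also have "\<dots> = (CLINT z|\<gamma>. (CLINT w|\<gamma>. iexp ((t * a) * z) * iexp ((t * b) * w)))"
      by (subst P.integral_fst'[symmetric])
         (auto intro!: P.integrable_const_bound[where B = 1] simp: norm_mult simp del: of_real_mult)
    also have "\<dots> = (CLINT z|\<gamma>. iexp ((t * a) * z)) * (CLINT w|\<gamma>. iexp ((t * b) * w))"
      by simp
    also have "\<dots> = of_real (exp (- ((t * a)\<^sup>2) / 2) * exp (- ((t * b)\<^sup>2) / 2))"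
      using ch[of "t * a"] ch[of "t * b"] by (simp only: of_real_mult)
    also have "exp (- ((t * a)\<^sup>2) / 2) * exp (- ((t * b)\<^sup>2) / 2) = exp (- ((t * sqrt (a\<^sup>2 + b\<^sup>2))\<^sup>2) / 2)"
      by (simp add: exp_add[symmetric] power_mult_distrib algebra_simps add_divide_distrib)
    also have "of_real \<dots> = (CLINT u|\<gamma>. iexp ((t * sqrt (a\<^sup>2 + b\<^sup>2)) * u))"
      by (simp only: ch)
    also have "\<dots> = char E t"
      unfolding E_def char_def by (subst integral_distr) (auto simp: mult.assoc)
    finally show ?thesis .
  qed
  then have DE: "D = E"
    by (intro Levy_uniqueness ext)
       (auto simp: D_def E_def intro!: P.real_distribution_distr gauss.real_distribution_distr)
  have "(\<integral>z. (\<integral>w. g (a * z + b * w) \<partial>\<gamma>) \<partial>\<gamma>) = (\<integral>p. g (case p of (z, w) \<Rightarrow> a * z + b * w) \<partial>(\<gamma> \<Otimes>\<^sub>M \<gamma>))"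
    using bounded_borelD(2)[OF g]
    by (subst P.integral_fst'[symmetric]) (auto intro!: P.integrable_const_bound[where B = C])
  also have "\<dots> = (\<integral>x. g x \<partial>D)" unfolding D_def by (subst integral_distr) auto
  also have "\<dots> = (\<integral>u. g (sqrt (a\<^sup>2 + b\<^sup>2) * u) \<partial>\<gamma>)"
    unfolding DE E_def by (subst integral_distr) auto
  finally show ?thesis .
qed

text \<open>The heat semigroup with generator \<open>(1 / 2) d\<^sup>2 / d x\<^sup>2\<close>, and its derivative in \<open>x\<close> with the
  differentiation moved onto the Gaussian kernel, so that both make sense for Borel functions.\<close>

definition heat :: "real \<Rightarrow> (real \<Rightarrow> real) \<Rightarrow> real \<Rightarrow> real" where
  "heat s h x = (\<integral>z. h (x + sqrt s * z) \<partial>\<gamma>)"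

definition heat_grad :: "real \<Rightarrow> (real \<Rightarrow> real) \<Rightarrow> real \<Rightarrow> real" where
  "heat_grad s h x = (\<integral>z. h (x + sqrt s * z) * (z / sqrt s) \<partial>\<gamma>)"

lemma heat_0 [simp]: "heat 0 h x = h x"
  by (simp add: heat_def)

lemma measurable_heat [measurable (raw)]:
  assumes [measurable]: "(\<lambda>(w, y). h w y) \<in> borel_measurable (N \<Otimes>\<^sub>M borel)"
    "s \<in> borel_measurable N" "x \<in> borel_measurable N"
  shows "(\<lambda>w. heat (s w) (h w) (x w)) \<in> borel_measurable N"
proof -
  have "(\<lambda>(w, z). h w (x w + sqrt (s w) * z)) \<in> borel_measurable (N \<Otimes>\<^sub>M \<gamma>)"
    using measurable_compose[of "\<lambda>(w, z). (w, x w + sqrt (s w) * z)" "N \<Otimes>\<^sub>M \<gamma>" "N \<Otimes>\<^sub>M borel" "\<lambda>(w, y). h w y" borel]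
    by (auto simp: case_prod_beta')
  then show ?thesis unfolding heat_def by (rule gauss.borel_measurable_lebesgue_integral)
qed

lemma bounded_borel_heat:
  assumes h: "bounded_borel C h"
  shows "bounded_borel C (heat s h)"
proof -
  have hm [measurable]: "h \<in> borel_measurable borel" using bounded_borelD[OF h] by simp
  have "\<bar>heat s h x\<bar> \<le> C" for x
  proof -
    have "\<bar>heat s h x\<bar> \<le> (\<integral>z. \<bar>h (x + sqrt s * z)\<bar> \<partial>\<gamma>)"
      unfolding heat_def by (rule integral_abs_bound)
    also have "\<dots> \<le> (\<integral>z. C \<partial>\<gamma>)"
      by (intro integral_mono integrable_abs integrable_bounded_borel[OF _ h])
         (use bounded_borelD(2)[OF h] gauss.prob_space_axioms in auto)
    finally show ?thesis by simp
  qed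
  moreover have "(\<lambda>x. heat s h x) \<in> borel_measurable borel" by measurable
  ultimately show ?thesis by (simp add: bounded_borel_def)
qed

text \<open>Semigroup law in the form in which Gaussian increments use it: \<open>a\<close> may have either sign.\<close>

lemma heat_step:
  assumes h: "bounded_borel C h" and s: "0 \<le> s"
  shows "(\<integral>z. heat s h (x + a * z) \<partial>\<gamma>) = heat (s + a\<^sup>2) h x"
proof -
  have hm [measurable]: "h \<in> borel_measurable borel" using bounded_borelD[OF h] by simp
  have "bounded_borel C (\<lambda>y. h (x + y))"
    using h by (auto simp: bounded_borel_def)
  from gauss_convolution[OF this, of a "sqrt s"] s show ?thesis
    by (simp add: heat_def algebra_simps)
qed

lemma heat_heat:
  assumes h: "bounded_borel C h" and "0 \<le> s" "0 \<le> r"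
  shows "heat r (heat s h) x = heat (r + s) h x"
  using heat_step[OF h, of s x "sqrt r"] assms by (simp add: heat_def[of r] add.commute)

lemma gauss_moments:
  "integrable \<gamma> (\<lambda>z. z ^ k)" "(\<integral>z. z \<partial>\<gamma>) = 0" "(\<integral>z. z ^ 2 \<partial>\<gamma>) = 1"
  "(\<integral>z. z ^ 3 \<partial>\<gamma>) = 0" "(\<integral>z. z ^ 4 \<partial>\<gamma>) = 3" "(\<integral>z. \<bar>z\<bar> \<partial>\<gamma>) \<le> 1"
proof -
  show I: "integrable \<gamma> (\<lambda>z. z ^ k)" for k by (rule integrable_std_normal_distribution_moment)
  show "(\<integral>z. z \<partial>\<gamma>) = 0" "(\<integral>z. z ^ 3 \<partial>\<gamma>) = 0"
    using integral_std_normal_distribution_moment_odd[of 1]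
      integral_std_normal_distribution_moment_odd[of 3] by auto
  show two: "(\<integral>z. z ^ 2 \<partial>\<gamma>) = 1"
    using std_normal_distribution_even_moments(1)[of 1] by simp
  show "(\<integral>z. z ^ 4 \<partial>\<gamma>) = 3"
    using std_normal_distribution_even_moments(1)[of 2] by (simp add: fact_numeral)
  have "(\<integral>z. \<bar>z\<bar> \<partial>\<gamma>) \<le> (\<integral>z. (1 + z\<^sup>2) / 2 \<partial>\<gamma>)"
  proof (rule integral_mono)
    show "integrable \<gamma> (\<lambda>z. \<bar>z\<bar>)" using I[of 1] by auto
    show "integrable \<gamma> (\<lambda>z. (1 + z\<^sup>2) / 2)" using I[of 2] by auto
    show "\<bar>z\<bar> \<le> (1 + z\<^sup>2) / 2" for z :: real
      using zero_le_power2[of "\<bar>z\<bar> - 1"] by (auto simp: power2_eq_square algebra_simps)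
  qed
  also have "\<dots> = 1"
    using I[of 2] two by simp
  finally show "(\<integral>z. \<bar>z\<bar> \<partial>\<gamma>) \<le> 1" .
qed

lemma integrable_gauss_id: "integrable \<gamma> (\<lambda>z. z)" "integrable \<gamma> (\<lambda>z. \<bar>z\<bar>)"
  using gauss_moments(1)[of 1] by auto

text \<open>The Cameron--Martin formula in one dimension.\<close>

lemma gauss_shift:
  fixes g :: "real \<Rightarrow> real"
  assumes g [measurable]: "g \<in> borel_measurable borel"
  shows "(\<integral>z. g (z + \<theta>) \<partial>\<gamma>) = (\<integral>z. g z * exp (\<theta> * z - \<theta>\<^sup>2 / 2) \<partial>\<gamma>)"
proof -
  have "(\<integral>z. g (z + \<theta>) \<partial>\<gamma>) = (\<integral>z. std_normal_density z * g (z + \<theta>) \<partial>lborel)"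
    by (rule integral_gauss_eq) measurable
  also have "\<dots> = (\<integral>z. std_normal_density (z - \<theta>) * g z \<partial>lborel)"
    by (subst lborel_integral_real_affine[where c = 1 and t = "-\<theta>"]) auto
  also have "\<dots> = (\<integral>z. std_normal_density z * (g z * exp (\<theta> * z - \<theta>\<^sup>2 / 2)) \<partial>lborel)"
    by (intro Bochner_Integration.integral_cong)
       (auto simp: std_normal_density_def exp_add[symmetric] power2_diff field_simps)
  also have "\<dots> = (\<integral>z. g z * exp (\<theta> * z - \<theta>\<^sup>2 / 2) \<partial>\<gamma>)"
    by (rule integral_gauss_eq[symmetric]) measurable
  finally show ?thesis .
qed

lemma integrable_gauss_exp: "integrable \<gamma> (\<lambda>z. exp (c * z))"
proof -
  have "integrable lborel (\<lambda>z. exp (c\<^sup>2 / 2) * std_normal_density (-c + 1 * z))"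
    by (intro integrable_mult_right lborel_integrable_real_affine) auto
  also have "(\<lambda>z. exp (c\<^sup>2 / 2) * std_normal_density (-c + 1 * z)) = (\<lambda>z. std_normal_density z * exp (c * z))"
    by (intro ext) (simp add: std_normal_density_def exp_add[symmetric] power2_diff field_simps)
  finally show ?thesis by (subst integrable_gauss_iff) auto
qed

section \<open>Spatial derivatives and the heat equation\<close>

lemma integrable_bounded_mult:
  fixes f :: "'a \<Rightarrow> real"
  assumes h: "bounded_borel C h" and [measurable]: "X \<in> borel_measurable M" and f: "integrable M f"
  shows "integrable M (\<lambda>\<omega>. h (X \<omega>) * f \<omega>)"
proof -
  note [measurable] = bounded_borelD(1)[OF h] borel_measurable_integrable[OF f]
  show ?thesis
  proof (rule Bochner_Integration.integrable_bound)
    show "integrable M (\<lambda>\<omega>. C * f \<omega>)" using f by simp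
    show "AE \<omega> in M. norm (h (X \<omega>) * f \<omega>) \<le> norm (C * f \<omega>)"
      using bounded_borelD(2,3)[OF h] by (auto simp: abs_mult intro!: mult_right_mono)
  qed measurable
qed

lemma abs_integral_bounded_mult_le:
  fixes f :: "'a \<Rightarrow> real"
  assumes h: "bounded_borel C h" and [measurable]: "X \<in> borel_measurable M" and f: "integrable M f"
  shows "\<bar>\<integral>\<omega>. h (X \<omega>) * f \<omega> \<partial>M\<bar> \<le> C * (\<integral>\<omega>. \<bar>f \<omega>\<bar> \<partial>M)"
proof -
  have "\<bar>\<integral>\<omega>. h (X \<omega>) * f \<omega> \<partial>M\<bar> \<le> (\<integral>\<omega>. \<bar>h (X \<omega>) * f \<omega>\<bar> \<partial>M)" by (rule integral_abs_bound)
  also have "\<dots> \<le> (\<integral>\<omega>. C * \<bar>f \<omega>\<bar> \<partial>M)"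
  proof (rule integral_mono)
    show "integrable M (\<lambda>\<omega>. \<bar>h (X \<omega>) * f \<omega>\<bar>)"
      by (rule integrable_abs[OF integrable_bounded_mult[OF assms]])
    show "\<bar>h (X \<omega>) * f \<omega>\<bar> \<le> C * \<bar>f \<omega>\<bar>" for \<omega>
      using bounded_borelD(2)[OF h] by (auto simp: abs_mult intro!: mult_right_mono)
  qed (use f in auto)
  finally show ?thesis by simp
qed

lemma measurable_heat_grad [measurable]:
  assumes [measurable]: "h \<in> borel_measurable borel"
  shows "heat_grad s h \<in> borel_measurable borel"
  unfolding heat_grad_def[abs_def] by measurable

lemma bounded_borel_heat_grad:
  assumes h: "bounded_borel C h" and s: "0 < s"
  shows "bounded_borel (C / sqrt s) (heat_grad s h)"
proof -
  have [measurable]: "h \<in> borel_measurable borel" using bounded_borelD[OF h] by simp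
  have "\<bar>heat_grad s h x\<bar> \<le> C / sqrt s" for x
  proof -
    have "\<bar>heat_grad s h x\<bar> \<le> C * (\<integral>z. \<bar>z / sqrt s\<bar> \<partial>\<gamma>)"
      unfolding heat_grad_def
      by (rule abs_integral_bounded_mult_le[OF h _ integrable_divide[OF integrable_gauss_id(1)]]) auto
    also have "(\<integral>z. \<bar>z / sqrt s\<bar> \<partial>\<gamma>) = (\<integral>z. \<bar>z\<bar> \<partial>\<gamma>) / sqrt s"
      using s by (simp add: abs_divide)
    also have "C * \<dots> \<le> C * (1 / sqrt s)"
      using s gauss_moments(6) bounded_borelD(3)[OF h] by (intro mult_left_mono divide_right_mono) auto
    finally show ?thesis by simp
  qed
  then show ?thesis by (simp add: bounded_borel_def)
qed

lemma abs_exp_minus_1_le: "\<bar>exp u - 1\<bar> \<le> \<bar>u\<bar> * exp \<bar>u\<bar>" for u :: real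
proof (cases "0 \<le> u")
  case True
  have "1 - u \<le> exp (- u)" using exp_ge_add_one_self[of "-u"] by simp
  then have "exp u * (1 - u) \<le> exp u * exp (- u)" by (intro mult_left_mono) auto
  then show ?thesis using True by (simp add: exp_minus algebra_simps)
next
  case False
  have "1 + u \<le> exp u" using exp_ge_add_one_self[of "u"] by simp
  moreover have "- u * 1 \<le> - u * exp (- u)" using False by (intro mult_left_mono) auto
  moreover have "\<bar>u\<bar> * exp \<bar>u\<bar> = - u * exp (- u)" "\<bar>exp u - 1\<bar> = 1 - exp u" using False by auto
  ultimately show ?thesis by linarith
qed

text \<open>Translating the Gaussian turns the increment in \<open>x\<close> into the exponential weight
  \<open>exp (\<theta> z - \<theta>\<^sup>2 / 2)\<close>, so \<open>h\<close> itself is never differentiated.\<close>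

lemma heat_has_derivative:
  assumes h: "bounded_borel C h" and s: "0 < s"
  shows "(heat s h has_real_derivative heat_grad s h x) (at x)"
proof -
  note hm [measurable] = bounded_borelD(1)[OF h]
  define q where "q t z = (exp (t / sqrt s * z - (t / sqrt s)\<^sup>2 / 2) - 1) / t" for t z :: real
  have eq: "(heat s h (x + t) - heat s h x) / t = (\<integral>z. h (x + sqrt s * z) * q t z \<partial>\<gamma>)" for t
  proof -
    have i: "integrable \<gamma> (\<lambda>z. exp (t / sqrt s * z - (t / sqrt s)\<^sup>2 / 2))"
      unfolding exp_diff by (intro integrable_divide integrable_gauss_exp)
    have "heat s h (x + t) = (\<integral>z. h (x + sqrt s * (z + t / sqrt s)) \<partial>\<gamma>)"
      using s by (simp add: heat_def distrib_left add.assoc add.commute[of t])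
    also have "\<dots> = (\<integral>z. h (x + sqrt s * z) * exp (t / sqrt s * z - (t / sqrt s)\<^sup>2 / 2) \<partial>\<gamma>)"
      by (rule gauss_shift) measurable
    finally have e: "heat s h (x + t) = (\<integral>z. h (x + sqrt s * z) * exp (t / sqrt s * z - (t / sqrt s)\<^sup>2 / 2) \<partial>\<gamma>)" .
    have "heat s h (x + t) - heat s h x = (\<integral>z. h (x + sqrt s * z) * (exp (t / sqrt s * z - (t / sqrt s)\<^sup>2 / 2) - 1) \<partial>\<gamma>)"
      unfolding e unfolding heat_def using integrable_bounded_mult[OF h _ i, of "\<lambda>z. x + sqrt s * z"]
        integrable_bounded_borel[OF gauss.prob_space_axioms h, of "\<lambda>z. x + sqrt s * z"]
      by (simp add: right_diff_distrib)
    then show ?thesis by (simp add: q_def)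
  qed
  have bound: "\<bar>q t z\<bar> \<le> 2 / sqrt s * (exp (2 * z) + exp (- 2 * z))" if t: "t \<in> {-sqrt s<..<sqrt s} - {0}" for t z
  proof -
    define \<theta> where "\<theta> = t / sqrt s"
    have \<theta>: "\<bar>\<theta>\<bar> \<le> 1" "\<theta> \<noteq> 0" using t s by (auto simp: \<theta>_def abs_le_iff field_simps)
    let ?u = "\<theta> * z - \<theta>\<^sup>2 / 2"
    have "\<bar>?u\<bar> \<le> \<bar>\<theta> * z\<bar> + \<bar>\<theta> * \<theta> / 2\<bar>" unfolding power2_eq_square by (rule abs_triangle_ineq4)
    also have "\<dots> = \<bar>\<theta>\<bar> * (\<bar>z\<bar> + \<bar>\<theta>\<bar> / 2)" by (simp add: abs_mult algebra_simps)
    also have "\<dots> \<le> \<bar>\<theta>\<bar> * (\<bar>z\<bar> + 1 / 2)" using \<theta> by (intro mult_left_mono) auto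
    finally have u: "\<bar>?u\<bar> \<le> \<bar>\<theta>\<bar> * (\<bar>z\<bar> + 1 / 2)" .
    moreover have "\<bar>\<theta>\<bar> * (\<bar>z\<bar> + 1 / 2) \<le> 1 * (\<bar>z\<bar> + 1 / 2)" using \<theta> by (intro mult_right_mono) auto
    ultimately have u2: "\<bar>?u\<bar> \<le> \<bar>z\<bar> + 1 / 2" by (simp only: mult_1)
    have "exp (1 / 2) \<le> (2 :: real)" using exp_bound_half[of "1/2 :: real"] by simp
    then have "exp \<bar>z\<bar> * exp (1 / 2) \<le> exp \<bar>z\<bar> * 2" by (intro mult_left_mono) auto
    moreover have "exp \<bar>?u\<bar> \<le> exp (\<bar>z\<bar> + 1 / 2)" using u2 by (simp only: exp_le_cancel_iff)
    ultimately have e: "exp \<bar>?u\<bar> \<le> 2 * exp \<bar>z\<bar>" unfolding exp_add by linarith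
    have "\<bar>exp ?u - 1\<bar> \<le> \<bar>?u\<bar> * exp \<bar>?u\<bar>" by (rule abs_exp_minus_1_le)
    also have "\<dots> \<le> (\<bar>\<theta>\<bar> * (\<bar>z\<bar> + 1 / 2)) * (2 * exp \<bar>z\<bar>)" by (intro mult_mono u e) auto
    also have "\<dots> \<le> (\<bar>\<theta>\<bar> * exp \<bar>z\<bar>) * (2 * exp \<bar>z\<bar>)"
    proof (intro mult_mono)
      show "\<bar>z\<bar> + 1 / 2 \<le> exp \<bar>z\<bar>" using exp_ge_add_one_self[of "\<bar>z\<bar>"] by linarith
    qed auto
    also have "\<dots> = 2 * \<bar>\<theta>\<bar> * exp (2 * \<bar>z\<bar>)" by (simp add: exp_add[symmetric])
    also have "\<dots> \<le> 2 * \<bar>\<theta>\<bar> * (exp (2 * z) + exp (- 2 * z))" by (intro mult_left_mono) (auto simp: abs_if)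
    finally have eu: "\<bar>exp ?u - 1\<bar> \<le> 2 * \<bar>\<theta>\<bar> * (exp (2 * z) + exp (- 2 * z))" .
    have "\<bar>q t z\<bar> = \<bar>exp ?u - 1\<bar> / (\<bar>\<theta>\<bar> * sqrt s)"
      using s by (simp add: q_def \<theta>_def abs_divide)
    also have "\<dots> \<le> 2 * \<bar>\<theta>\<bar> * (exp (2 * z) + exp (- 2 * z)) / (\<bar>\<theta>\<bar> * sqrt s)"
      using s by (intro divide_right_mono eu) auto
    also have "\<dots> = 2 / sqrt s * (exp (2 * z) + exp (- 2 * z))" using \<theta> s by simp
    finally show ?thesis .
  qed
  have lim: "((\<lambda>t. q t z) \<longlongrightarrow> z / sqrt s) (at 0)" for z
  proof -
    have "((\<lambda>t. exp (t / sqrt s * z - (t / sqrt s)\<^sup>2 / 2)) has_real_derivative z / sqrt s) (at 0)"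
    proof -
      have "z * sqrt s / s = z * (sqrt s / s)" by simp
      also have "\<dots> = z / sqrt s" using s sqrt_divide_self_eq[of s] by (simp add: divide_inverse[of z])
      finally show ?thesis using s by (auto intro!: derivative_eq_intros)
    qed
    then show ?thesis by (simp add: DERIV_def q_def)
  qed
  have "((\<lambda>t. (heat s h (x + t) - heat s h x) / t) \<longlongrightarrow> heat_grad s h x) (at 0 within {-sqrt s<..<sqrt s})"
    unfolding eq tendsto_at_iff_sequentially comp_def heat_grad_def
  proof (intro allI impI)
    fix X assume X: "\<forall>i. X i \<in> {-sqrt s<..<sqrt s} - {0}" "X \<longlonglongrightarrow> 0"
    show "(\<lambda>i. \<integral>z. h (x + sqrt s * z) * q (X i) z \<partial>\<gamma>) \<longlonglongrightarrow> (\<integral>z. h (x + sqrt s * z) * (z / sqrt s) \<partial>\<gamma>)"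
    proof (rule integral_dominated_convergence[where w = "\<lambda>z. C * (2 / sqrt s * (exp (2 * z) + exp (- 2 * z)))"])
      show "integrable \<gamma> (\<lambda>z. C * (2 / sqrt s * (exp (2 * z) + exp (- 2 * z))))"
        by (intro integrable_mult_right Bochner_Integration.integrable_add integrable_gauss_exp)
      show "AE z in \<gamma>. (\<lambda>i. h (x + sqrt s * z) * q (X i) z) \<longlonglongrightarrow> h (x + sqrt s * z) * (z / sqrt s)"
        by (intro AE_I2 tendsto_mult tendsto_const filterlim_compose[OF lim])
           (use X in \<open>auto simp: filterlim_at\<close>)
      show "AE z in \<gamma>. norm (h (x + sqrt s * z) * q (X i) z) \<le> C * (2 / sqrt s * (exp (2 * z) + exp (- 2 * z)))" for i
      proof (rule AE_I2)
        fix z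
        have "\<bar>h (x + sqrt s * z)\<bar> * \<bar>q (X i) z\<bar> \<le> C * (2 / sqrt s * (exp (2 * z) + exp (- 2 * z)))"
          using X bound[of "X i" z] bounded_borelD(2,3)[OF h] by (intro mult_mono) auto
        then show "norm (h (x + sqrt s * z) * q (X i) z) \<le> C * (2 / sqrt s * (exp (2 * z) + exp (- 2 * z)))"
          by (simp add: abs_mult)
      qed
    qed (auto simp: q_def)
  qed
  then show ?thesis
    using s by (subst (asm) at_within_open) (auto simp: DERIV_def)
qed

text \<open>Both sides are the same double Gaussian integral, read in the two possible orders.\<close>

lemma heat_heat_grad_commute:
  assumes h: "bounded_borel C h" and s: "0 < s"
  shows "heat_grad s (heat r h) x = heat r (heat_grad s h) x"
proof -
  interpret P: pair_sigma_finite \<gamma> \<gamma> ..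
  note hm [measurable] = bounded_borelD(1)[OF h]
  let ?f = "\<lambda>z w. h (x + sqrt s * z + sqrt r * w) * (z / sqrt s)"
  have "integrable (\<gamma> \<Otimes>\<^sub>M \<gamma>) (\<lambda>p. case p of (z, w) \<Rightarrow> z / sqrt s)"
    using integrable_divide[OF integrable_gauss_id(2), of "sqrt s"] s
    by (intro P.Fubini_integrable) (simp_all add: abs_divide)
  from integrable_bounded_mult[OF h _ this, of "\<lambda>(z, w). x + sqrt s * z + sqrt r * w"]
  have "integrable (\<gamma> \<Otimes>\<^sub>M \<gamma>) (case_prod ?f)"
    by (simp add: case_prod_beta')
  note F = P.Fubini_integral[OF this]
  have "heat_grad s (heat r h) x = (\<integral>z. (\<integral>w. ?f z w \<partial>\<gamma>) \<partial>\<gamma>)"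
    by (simp add: heat_grad_def heat_def)
  also have "\<dots> = (\<integral>w. (\<integral>z. ?f z w \<partial>\<gamma>) \<partial>\<gamma>)" by (rule F[symmetric])
  also have "\<dots> = heat r (heat_grad s h) x"
    by (simp add: heat_grad_def heat_def algebra_simps)
  finally show ?thesis .
qed

text \<open>Splitting the time \<open>s\<close> into four equal pieces lets each piece absorb one derivative.\<close>

definition heat_deriv :: "nat \<Rightarrow> real \<Rightarrow> (real \<Rightarrow> real) \<Rightarrow> real \<Rightarrow> real" where
  "heat_deriv j s h = (heat_grad (s / 4) ^^ j) ((heat (s / 4) ^^ (4 - j)) h)"

lemma bounded_borel_heat_pow: "bounded_borel C h \<Longrightarrow> bounded_borel C ((heat s ^^ k) h)"
  by (induction k) (auto intro: bounded_borel_heat)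

lemma bounded_borel_heat_grad_pow:
  "bounded_borel C h \<Longrightarrow> 0 < s \<Longrightarrow> bounded_borel (C / sqrt s ^ j) ((heat_grad s ^^ j) h)"
  by (induction j) (auto dest: bounded_borel_heat_grad simp: mult.commute)

lemma bounded_borel_heat_deriv:
  assumes h: "bounded_borel C h" and s: "0 < s"
  shows "bounded_borel (C * (2 / sqrt s) ^ j) (heat_deriv j s h)"
  using bounded_borel_heat_grad_pow[OF bounded_borel_heat_pow[OF h], of "s / 4" j] s
  by (simp add: heat_deriv_def real_sqrt_divide power_divide)

lemma heat_pow_commute:
  assumes "bounded_borel C h" "0 \<le> s" "0 \<le> r"
  shows "(heat s ^^ k) (heat r h) = heat r ((heat s ^^ k) h)"
  using assms
proof (induction k)
  case (Suc k)
  have "bounded_borel C ((heat s ^^ k) h)" by (rule bounded_borel_heat_pow[OF Suc.prems(1)])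
  from heat_heat[OF this] Suc.prems
  have "heat s (heat r ((heat s ^^ k) h)) = heat r (heat s ((heat s ^^ k) h))"
    by (auto simp: fun_eq_iff add.commute)
  then show ?case by (simp only: funpow.simps o_apply Suc.IH[OF Suc.prems])
qed simp

lemma heat_grad_pow_commute:
  assumes "bounded_borel C h" "0 < s"
  shows "(heat_grad s ^^ k) (heat r h) = heat r ((heat_grad s ^^ k) h)"
  using assms
proof (induction k)
  case (Suc k)
  note c = heat_heat_grad_commute[OF bounded_borel_heat_grad_pow[OF Suc.prems(1,2), of k] Suc.prems(2)]
  show ?case
    by (simp only: funpow.simps o_apply Suc.IH[OF Suc.prems]) (rule ext, rule c)
qed simp

lemma heat_deriv_heat_commute:
  assumes "bounded_borel C h" "0 < s" "0 \<le> r"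
  shows "heat_deriv j s (heat r h) = heat r (heat_deriv j s h)"
  using assms
  by (simp add: heat_deriv_def heat_pow_commute[OF assms(1)]
      heat_grad_pow_commute[OF bounded_borel_heat_pow[OF assms(1)]])

lemma heat_deriv_0:
  assumes h: "bounded_borel C h" and s: "0 < s"
  shows "heat_deriv 0 s h = heat s h"
proof -
  note b = bounded_borel_heat[OF h, of "s / 4"]
  note b2 = bounded_borel_heat[OF b, of "s / 4"]
  have "heat (s/4) (heat (s/4) h) = heat (s/2) h"
    using s by (auto simp: fun_eq_iff heat_heat[OF h])
  moreover have "heat (s/4) (heat (s/4) (heat (s/2) h)) = heat s h"
    using s by (auto simp: fun_eq_iff heat_heat[OF h] heat_heat[OF bounded_borel_heat[OF h]])
  ultimately show ?thesis by (simp add: heat_deriv_def numeral_eq_Suc)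
qed

lemma heat_deriv_has_derivative:
  assumes h: "bounded_borel C h" and s: "0 < s" and j: "j < 4"
  shows "(heat_deriv j s h has_real_derivative heat_deriv (Suc j) s h x) (at x)"
proof -
  define g where "g = (heat (s / 4) ^^ (3 - j)) h"
  have g: "bounded_borel C g" unfolding g_def by (rule bounded_borel_heat_pow[OF h])
  have "4 - j = Suc (3 - j)" using j by simp
  then have "heat_deriv j s h = (heat_grad (s / 4) ^^ j) (heat (s / 4) g)"
    by (simp add: heat_deriv_def g_def)
  also have "\<dots> = heat (s / 4) ((heat_grad (s / 4) ^^ j) g)"
    using s by (intro heat_grad_pow_commute[OF g]) auto
  finally have 1: "heat_deriv j s h = heat (s / 4) ((heat_grad (s / 4) ^^ j) g)" .
  have 2: "heat_deriv (Suc j) s h = heat_grad (s / 4) ((heat_grad (s / 4) ^^ j) g)"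
    using j by (simp add: heat_deriv_def g_def)
  show ?thesis unfolding 1 2
    by (rule heat_has_derivative[OF bounded_borel_heat_grad_pow[OF g]]) (use s in auto)
qed

text \<open>By induction on the order: two equal functions have the same derivative. This removes the arbitrary
  splitting of the time from the definition of \<open>heat_deriv\<close>.\<close>

lemma heat_heat_deriv:
  assumes h: "bounded_borel C h" and s: "0 < s" "0 \<le> r" and j: "j \<le> 4"
  shows "heat r (heat_deriv j s h) = heat_deriv j (s + r) h"
  using j
proof (induction j)
  case 0
  show ?case using s by (auto simp: heat_deriv_0[OF h] fun_eq_iff heat_heat[OF h] add.commute)
next
  case (Suc j)
  have IH: "heat_deriv j s (heat r h) = heat_deriv j (s + r) h"
    using Suc heat_deriv_heat_commute[OF h s] by simp
  have "heat_deriv (Suc j) s (heat r h) x = heat_deriv (Suc j) (s + r) h x" for x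
  proof (rule DERIV_unique)
    show "(heat_deriv j s (heat r h) has_real_derivative heat_deriv (Suc j) s (heat r h) x) (at x)"
      by (rule heat_deriv_has_derivative[OF bounded_borel_heat[OF h]]) (use s Suc in auto)
    show "(heat_deriv j s (heat r h) has_real_derivative heat_deriv (Suc j) (s + r) h x) (at x)"
      unfolding IH by (rule heat_deriv_has_derivative[OF h]) (use s Suc in auto)
  qed
  then show ?case using heat_deriv_heat_commute[OF h s] by (auto simp: fun_eq_iff)
qed

text \<open>The maximum with \<open>1\<close> lets a single constant serve for all orders \<open>j \<le> 4\<close>.\<close>

definition deriv_bound :: "real \<Rightarrow> real" where
  "deriv_bound \<kappa> = max 1 ((2 / sqrt \<kappa>) ^ 4)"

lemma deriv_bound_ge: "1 \<le> deriv_bound \<kappa>"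
  by (simp add: deriv_bound_def)

lemma heat_deriv_bound:
  assumes h: "bounded_borel C h" and \<kappa>: "0 < \<kappa>" "\<kappa> \<le> s" and j: "j \<le> 4"
  shows "bounded_borel (C * deriv_bound \<kappa>) (heat_deriv j s h)"
proof -
  have "(2 / sqrt s) ^ j \<le> (2 / sqrt \<kappa>) ^ j"
    using \<kappa> by (intro power_mono divide_left_mono) auto
  also have "\<dots> \<le> deriv_bound \<kappa>"
  proof (cases "2 / sqrt \<kappa> \<le> 1")
    case True
    then have "(2 / sqrt \<kappa>) ^ j \<le> 1" using \<kappa> by (intro power_le_one) auto
    then show ?thesis by (simp add: deriv_bound_def)
  next
    case False
    then show ?thesis using j unfolding deriv_bound_def
      by (intro max.coboundedI2 power_increasing) auto
  qed
  finally have "C * (2 / sqrt s) ^ j \<le> C * deriv_bound \<kappa>"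
    by (rule mult_left_mono) (rule bounded_borelD(3)[OF h])
  with bounded_borel_heat_deriv[OF h, of s j] \<kappa> show ?thesis
    by (auto simp: bounded_borel_def intro: order_trans)
qed

lemma heat_deriv_taylor:
  assumes h: "bounded_borel C h" and \<kappa>: "0 < \<kappa>" "\<kappa> \<le> s" and j: "j + n < 4"
  shows "\<bar>heat_deriv j s h (x + t) - (\<Sum>i\<le>n. heat_deriv (j + i) s h x * t ^ i / fact i)\<bar>
    \<le> C * deriv_bound \<kappa> * \<bar>t\<bar> ^ Suc n / fact n"
  using field_Taylor[of UNIV n "\<lambda>i. heat_deriv (j + i) s h" "C * deriv_bound \<kappa>" x "x + t"]
    heat_deriv_has_derivative[OF h, of s] \<kappa> j bounded_borelD(2)[OF heat_deriv_bound[OF h \<kappa>]]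
  by auto

lemma heat_deriv_time_diff:
  assumes h: "bounded_borel C h" and \<kappa>: "0 < \<kappa>" "\<kappa> \<le> s" "\<kappa> \<le> s'" and j: "j \<le> 2"
  shows "\<bar>heat_deriv j s' h x - heat_deriv j s h x\<bar> \<le> C * deriv_bound \<kappa> * \<bar>s' - s\<bar>"
proof -
  have main: "\<bar>heat_deriv j (s + d) h x - heat_deriv j s h x\<bar> \<le> C * deriv_bound \<kappa> * d"
    if s: "\<kappa> \<le> s" "0 \<le> d" for s d
  proof -
    let ?k = "\<lambda>i. heat_deriv (j + i) s h"
    have bb: "bounded_borel (C * deriv_bound \<kappa>) (heat_deriv j s h)"
      by (rule heat_deriv_bound[OF h]) (use s \<kappa> j in auto)
    have i1: "integrable \<gamma> (\<lambda>z. ?k 0 (x + sqrt d * z))"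
      using bounded_borelD(1)[OF bb] by (intro integrable_bounded_borel[OF _ heat_deriv_bound[OF h]])
        (use s \<kappa> j gauss.prob_space_axioms in auto)
    have i2: "integrable \<gamma> (\<lambda>z. ?k 0 x + ?k 1 x * (sqrt d * z))"
      using integrable_gauss_id by auto
    have "heat_deriv j (s + d) h x = (\<integral>z. ?k 0 (x + sqrt d * z) \<partial>\<gamma>)"
      using heat_heat_deriv[OF h, of s d j] s \<kappa> j by (simp add: heat_def fun_eq_iff)
    moreover have "heat_deriv j s h x = (\<integral>z. ?k 0 x + ?k 1 x * (sqrt d * z) \<partial>\<gamma>)"
      using integrable_gauss_id gauss_moments(2) by simp
    ultimately have "\<bar>heat_deriv j (s + d) h x - heat_deriv j s h x\<bar>
        = \<bar>\<integral>z. ?k 0 (x + sqrt d * z) - (?k 0 x + ?k 1 x * (sqrt d * z)) \<partial>\<gamma>\<bar>"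
      using Bochner_Integration.integral_diff[OF i1 i2] by simp
    also have "\<dots> \<le> (\<integral>z. \<bar>?k 0 (x + sqrt d * z) - (?k 0 x + ?k 1 x * (sqrt d * z))\<bar> \<partial>\<gamma>)"
      by (rule integral_abs_bound)
    also have "\<dots> \<le> (\<integral>z. C * deriv_bound \<kappa> * d * z ^ 2 \<partial>\<gamma>)"
    proof (rule integral_mono)
      show "integrable \<gamma> (\<lambda>z. \<bar>?k 0 (x + sqrt d * z) - (?k 0 x + ?k 1 x * (sqrt d * z))\<bar>)"
        using i1 i2 by (intro integrable_abs Bochner_Integration.integrable_diff)
      show "integrable \<gamma> (\<lambda>z. C * deriv_bound \<kappa> * d * z ^ 2)"
        using gauss_moments(1)[of 2] by simp
      show "\<bar>?k 0 (x + sqrt d * z) - (?k 0 x + ?k 1 x * (sqrt d * z))\<bar> \<le> C * deriv_bound \<kappa> * d * z ^ 2" for z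
        using heat_deriv_taylor[OF h \<kappa>(1) s(1), of j 1 x "sqrt d * z"] j s
        by (simp add: power_mult_distrib abs_mult power2_eq_square[symmetric] mult.assoc)
    qed
    also have "\<dots> = C * deriv_bound \<kappa> * d" using gauss_moments(3) by simp
    finally show ?thesis .
  qed
  show ?thesis
    using main[of s "s' - s"] main[of s' "s - s'"] \<kappa>
    by (cases "s \<le> s'") (auto simp: abs_minus_commute)
qed

text \<open>The heat equation \<open>\<partial>\<^sub>s P\<^sub>s h = (P\<^sub>s h)'' / 2\<close> in integrated form. Time derivatives are avoided: a time
  step \<open>d\<close> is an average over spatial steps \<open>sqrt d z\<close>, whose odd Taylor terms vanish by symmetry.\<close>

lemma heat_time_taylor:
  assumes h: "bounded_borel C h" and \<kappa>: "0 < \<kappa>" "\<kappa> \<le> s" "\<kappa> \<le> s'"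
  shows "\<bar>heat s' h x - heat s h x - (s' - s) / 2 * heat_deriv 2 s h x\<bar> \<le> C * deriv_bound \<kappa> * (s' - s)\<^sup>2"
proof -
  have L0: "0 \<le> C * deriv_bound \<kappa>" using bounded_borelD(3)[OF h] deriv_bound_ge[of \<kappa>] by simp
  have main: "\<bar>heat (s + d) h x - heat s h x - d / 2 * heat_deriv 2 s h x\<bar> \<le> C * deriv_bound \<kappa> * d\<^sup>2 / 2"
    if s: "\<kappa> \<le> s" "0 \<le> d" for s d
  proof -
    let ?k = "\<lambda>i. heat_deriv i s h"
    let ?p = "\<lambda>z. ?k 0 x + ?k 1 x * (sqrt d * z) + ?k 2 x * d / 2 * z ^ 2 + ?k 3 x * sqrt d ^ 3 / 6 * z ^ 3"
    have bb: "bounded_borel (C * deriv_bound \<kappa>) (?k 0)"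
      by (rule heat_deriv_bound[OF h]) (use s \<kappa> in auto)
    have i1: "integrable \<gamma> (\<lambda>z. ?k 0 (x + sqrt d * z))"
      using bounded_borelD(1)[OF bb] by (intro integrable_bounded_borel[OF _ bb])
        (use s \<kappa> gauss.prob_space_axioms in auto)
    have i2: "integrable \<gamma> ?p"
      using integrable_gauss_id gauss_moments(1)[of 2] gauss_moments(1)[of 3] by auto
    have s0: "0 < s" using s \<kappa> by simp
    have "heat (s + d) h x = (\<integral>z. ?k 0 (x + sqrt d * z) \<partial>\<gamma>)"
      using heat_heat_deriv[OF h s0 s(2), of 0] heat_deriv_0[OF h, of "s + d"] s0 s by (simp add: heat_def fun_eq_iff)
    moreover have "heat s h x + d / 2 * ?k 2 x = (\<integral>z. ?p z \<partial>\<gamma>)"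
      using integrable_gauss_id gauss_moments(1)[of 2] gauss_moments(1)[of 3] gauss_moments(2,3,4)
        heat_deriv_0[OF h s0] by simp
    ultimately have "\<bar>heat (s + d) h x - heat s h x - d / 2 * heat_deriv 2 s h x\<bar>
        = \<bar>\<integral>z. ?k 0 (x + sqrt d * z) - ?p z \<partial>\<gamma>\<bar>"
      using Bochner_Integration.integral_diff[OF i1 i2] by (simp add: algebra_simps)
    also have "\<dots> \<le> (\<integral>z. \<bar>?k 0 (x + sqrt d * z) - ?p z\<bar> \<partial>\<gamma>)"
      by (rule integral_abs_bound)
    also have "\<dots> \<le> (\<integral>z. C * deriv_bound \<kappa> * d\<^sup>2 / 6 * z ^ 4 \<partial>\<gamma>)"
    proof (rule integral_mono)
      show "integrable \<gamma> (\<lambda>z. \<bar>?k 0 (x + sqrt d * z) - ?p z\<bar>)"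
        using i1 i2 by (intro integrable_abs Bochner_Integration.integrable_diff)
      show "integrable \<gamma> (\<lambda>z. C * deriv_bound \<kappa> * d\<^sup>2 / 6 * z ^ 4)"
        using gauss_moments(1)[of 4] by simp
      fix z
      have "sqrt d ^ 4 = d\<^sup>2" using s real_sqrt_pow2[of d] by (simp add: power2_eq_square power4_eq_xxxx)
      then have t4: "\<bar>sqrt d * z\<bar> ^ 4 = d\<^sup>2 * z ^ 4" by (simp add: power_mult_distrib)
      have sd: "(sqrt d * z) ^ 2 = d * z ^ 2" using s by (simp add: power_mult_distrib)
      have "(\<Sum>i\<le>3. ?k i x * (sqrt d * z) ^ i / fact i) = ?p z"
        using s sd by (simp add: eval_nat_numeral numeral_3_eq_3 power_mult_distrib fact_numeral)
      then show "\<bar>?k 0 (x + sqrt d * z) - ?p z\<bar> \<le> C * deriv_bound \<kappa> * d\<^sup>2 / 6 * z ^ 4"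
        using heat_deriv_taylor[OF h \<kappa>(1) s(1), of 0 3 x "sqrt d * z"] t4
        by (simp add: fact_numeral mult.assoc)
    qed
    also have "\<dots> = C * deriv_bound \<kappa> * d\<^sup>2 / 2" using gauss_moments(5) by simp
    finally show ?thesis .
  qed
  show ?thesis
  proof (cases "s \<le> s'")
    case True
    have "C * deriv_bound \<kappa> * (s' - s)\<^sup>2 / 2 \<le> C * deriv_bound \<kappa> * (s' - s)\<^sup>2"
      using mult_nonneg_nonneg[OF L0 zero_le_power2[of "s' - s"]] by linarith
    with main[of s "s' - s"] \<kappa> True show ?thesis by simp
  next
    case False
    let ?d = "s - s'"
    have "\<bar>?d / 2 * (heat_deriv 2 s h x - heat_deriv 2 s' h x)\<bar> \<le> ?d / 2 * (C * deriv_bound \<kappa> * ?d)"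
      using heat_deriv_time_diff[OF h \<kappa>(1,3,2), of 2 x] False
      by (auto simp: abs_mult intro!: mult_left_mono)
    moreover have "\<bar>heat s h x - heat s' h x - ?d / 2 * heat_deriv 2 s' h x\<bar> \<le> C * deriv_bound \<kappa> * ?d\<^sup>2 / 2"
      using main[of s' ?d] \<kappa> False by simp
    moreover have "heat s' h x - heat s h x - (s' - s) / 2 * heat_deriv 2 s h x
      = - (heat s h x - heat s' h x - ?d / 2 * heat_deriv 2 s' h x) + ?d / 2 * (heat_deriv 2 s h x - heat_deriv 2 s' h x)"
      by (simp add: algebra_simps diff_divide_distrib)
    moreover have "?d / 2 * (C * deriv_bound \<kappa> * ?d) = C * deriv_bound \<kappa> * ?d\<^sup>2 / 2"
      by (simp add: power2_eq_square)
    moreover have "(s' - s)\<^sup>2 = ?d\<^sup>2" by (rule power2_commute)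
    moreover have "\<bar>t\<bar> \<le> k" if "\<bar>a\<bar> \<le> k / 2" "\<bar>b\<bar> \<le> k / 2" "t = - b + a" for a b t k :: real
      using that by linarith
    ultimately show ?thesis by metis
  qed
qed

text \<open>Moving the time forward by \<open>(1 - \<theta>) D\<close> in the first term and backward by \<open>\<theta> D\<close> in the second adds up to
  a full time step \<open>D\<close>, whatever \<open>\<theta>\<close> is; this is why the correlation does not appear in the final density.\<close>

lemma heat_shift_taylor:
  assumes h: "bounded_borel C h" and \<kappa>: "0 < \<kappa>" and \<theta>: "0 \<le> \<theta>" "\<theta> \<le> 1"
    and s: "\<kappa> \<le> s" "\<kappa> \<le> s + (1 - \<theta>) * D" "\<kappa> \<le> s - \<theta> * D"
  shows "\<bar>heat (s + (1 - \<theta>) * D) h (y - D / 2) - heat (s - \<theta> * D) h y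
           - D * ((heat_deriv 2 s h y - heat_deriv 1 s h y) / 2)\<bar> \<le> 3 * (C * deriv_bound \<kappa>) * D\<^sup>2"
proof -
  define K where "K = C * deriv_bound \<kappa>"
  define s1 where "s1 = s + (1 - \<theta>) * D"
  have K0: "0 \<le> K" using bounded_borelD(3)[OF h] deriv_bound_ge[of \<kappa>] by (simp add: K_def)
  have s1: "\<kappa> \<le> s1" using s by (simp add: s1_def)
  have s10: "0 < s1" using s1 \<kappa> by simp
  have q: "((1 - \<theta>) * D)\<^sup>2 \<le> D\<^sup>2" "(\<theta> * D)\<^sup>2 \<le> D\<^sup>2"
    using \<theta> by (auto simp: power_mult_distrib intro!: mult_left_le_one_le power_le_one)
  have "\<bar>heat s1 h (y - D / 2) - heat s1 h y + D / 2 * heat_deriv 1 s1 h y\<bar> \<le> K * (D\<^sup>2 / 4)"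
    using heat_deriv_taylor[OF h \<kappa> s1, of 0 1 y "- D / 2"] heat_deriv_0[OF h s10]
    by (simp add: K_def power2_eq_square field_simps)
  moreover have "\<bar>D / 2 * (heat_deriv 1 s1 h y - heat_deriv 1 s h y)\<bar> \<le> K * (D\<^sup>2 / 2)"
  proof -
    have "\<bar>s1 - s\<bar> \<le> \<bar>D\<bar>" using \<theta> by (auto simp: s1_def abs_mult intro!: mult_left_le_one_le)
    then have "K * \<bar>s1 - s\<bar> \<le> K * \<bar>D\<bar>" using K0 by (rule mult_left_mono)
    then have "\<bar>heat_deriv 1 s1 h y - heat_deriv 1 s h y\<bar> \<le> K * \<bar>D\<bar>"
      using heat_deriv_time_diff[OF h \<kappa> s(1) s1, of 1 y] by (simp add: K_def)
    then have "\<bar>D / 2\<bar> * \<bar>heat_deriv 1 s1 h y - heat_deriv 1 s h y\<bar> \<le> \<bar>D / 2\<bar> * (K * \<bar>D\<bar>)"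
      by (rule mult_left_mono) simp
    then show ?thesis by (simp add: abs_mult power2_eq_square) (simp add: algebra_simps)
  qed
  moreover have "\<bar>heat s1 h y - heat s h y - (1 - \<theta>) * D / 2 * heat_deriv 2 s h y\<bar> \<le> K * D\<^sup>2"
    using heat_time_taylor[OF h \<kappa> s(1) s1, of y] mult_left_mono[OF q(1) K0] by (simp add: s1_def K_def)
  moreover have "\<bar>heat (s - \<theta> * D) h y - heat s h y + \<theta> * D / 2 * heat_deriv 2 s h y\<bar> \<le> K * D\<^sup>2"
    using heat_time_taylor[OF h \<kappa> s(1,3), of y] mult_left_mono[OF q(2) K0] by (simp add: K_def)
  moreover have "0 \<le> K * D\<^sup>2" using K0 by simp
  moreover have "heat s1 h (y - D / 2) - heat (s - \<theta> * D) h y - D * ((heat_deriv 2 s h y - heat_deriv 1 s h y) / 2)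
    = (heat s1 h (y - D / 2) - heat s1 h y + D / 2 * heat_deriv 1 s1 h y)
      - D / 2 * (heat_deriv 1 s1 h y - heat_deriv 1 s h y)
      + (heat s1 h y - heat s h y - (1 - \<theta>) * D / 2 * heat_deriv 2 s h y)
      - (heat (s - \<theta> * D) h y - heat s h y + \<theta> * D / 2 * heat_deriv 2 s h y)"
    by (simp add: field_simps)
  ultimately have "\<bar>heat s1 h (y - D / 2) - heat (s - \<theta> * D) h y
           - D * ((heat_deriv 2 s h y - heat_deriv 1 s h y) / 2)\<bar> \<le> 3 * (K * D\<^sup>2)"
    by linarith
  then show ?thesis by (simp add: s1_def K_def mult.assoc)
qed

section \<open>Gaussian martingale transforms\<close>

text \<open>The identity map, read into two independent sub-sigma-algebras, is a pair of independent random
  variables. Freezing one of two independent sources of randomness is then just Fubini, without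
  singling out random vectors that generate them.\<close>

lemma integral_indep_sigma_algebras:
  fixes F :: "'a \<times> 'a \<Rightarrow> real"
  assumes M: "prob_space M" and M1: "subalgebra M M1" and M2: "subalgebra M M2"
    and ind: "prob_space.indep_set M (sets M1) (sets M2)"
    and F [measurable]: "F \<in> borel_measurable (M1 \<Otimes>\<^sub>M M2)" and bd: "\<And>p. \<bar>F p\<bar> \<le> C"
  shows "(\<integral>\<omega>. F (\<omega>, \<omega>) \<partial>M) = (\<integral>\<omega>. (\<integral>\<omega>'. F (\<omega>, \<omega>') \<partial>M) \<partial>M)"
proof -
  interpret prob_space M by fact
  have rv [measurable]: "(\<lambda>x. x) \<in> measurable M M1" "(\<lambda>x. x) \<in> measurable M M2"
    by (auto intro: measurable_from_subalg[OF M1] measurable_from_subalg[OF M2])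
  have *: "sigma_sets (space M) {(\<lambda>x. x) -` A \<inter> space M |A. A \<in> sets M'} = sets M'"
    if "subalgebra M M'" for M'
  proof -
    have sp: "space M' = space M" using that by (simp add: subalgebra_def)
    have "{(\<lambda>x. x) -` A \<inter> space M |A. A \<in> sets M'} = sets M'"
      using sets.sets_into_space[of _ M'] sp by (auto simp: Int_absorb2)
    then show ?thesis using sets.sigma_sets_eq[of M'] sp by simp
  qed
  have "indep_var M1 (\<lambda>x. x) M2 (\<lambda>x. x)"
    unfolding indep_var_eq using rv ind *[OF M1] *[OF M2] by simp
  then have D: "distr M M1 (\<lambda>x. x) \<Otimes>\<^sub>M distr M M2 (\<lambda>x. x) = distr M (M1 \<Otimes>\<^sub>M M2) (\<lambda>x. (x, x))"
    unfolding indep_var_distribution_eq by simp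
  interpret D1: prob_space "distr M M1 (\<lambda>x. x)" by (rule prob_space_distr) (rule rv)
  interpret D2: prob_space "distr M M2 (\<lambda>x. x)" by (rule prob_space_distr) (rule rv)
  interpret P: pair_prob_space "distr M M1 (\<lambda>x. x)" "distr M M2 (\<lambda>x. x)" ..
  have "(\<integral>\<omega>. F (\<omega>, \<omega>) \<partial>M) = (\<integral>p. F p \<partial>(distr M (M1 \<Otimes>\<^sub>M M2) (\<lambda>x. (x, x))))"
    by (subst integral_distr) auto
  also have "\<dots> = (\<integral>x. (\<integral>y. F (x, y) \<partial>distr M M2 (\<lambda>x. x)) \<partial>distr M M1 (\<lambda>x. x))"
    unfolding D[symmetric] using bd
    by (intro P.integral_fst'[symmetric] P.integrable_const_bound[where B = C]) auto
  also have "\<dots> = (\<integral>x. (\<integral>y. F (x, y) \<partial>distr M M2 (\<lambda>x. x)) \<partial>M)"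
  proof (rule integral_distr)
    show "(\<lambda>x. \<integral>y. F (x, y) \<partial>distr M M2 (\<lambda>x. x)) \<in> borel_measurable M1"
      by (rule D2.borel_measurable_lebesgue_integral) simp
  qed (rule rv)
  also have "\<dots> = (\<integral>x. (\<integral>y. F (x, y) \<partial>M) \<partial>M)"
  proof (rule Bochner_Integration.integral_cong)
    fix x assume "x \<in> space M"
    then have "x \<in> space M1" using M1 by (simp add: subalgebra_def)
    then have "(\<lambda>y. F (x, y)) \<in> borel_measurable M2" by measurable
    then show "(\<integral>y. F (x, y) \<partial>distr M M2 (\<lambda>x. x)) = (\<integral>y. F (x, y) \<partial>M)"
      by (subst integral_distr) (auto simp: rv)
  qed simp
  finally show ?thesis .
qed

text \<open>Stated through expectations so that the degenerate case \<open>d = 0\<close> is included.\<close>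

definition normal_law :: "'a measure \<Rightarrow> real \<Rightarrow> ('a \<Rightarrow> real) \<Rightarrow> bool" where
  "normal_law M d Z \<longleftrightarrow>
     (\<forall>C g. bounded_borel C g \<longrightarrow> (\<integral>\<omega>. g (Z \<omega>) \<partial>M) = (\<integral>z. g (sqrt d * z) \<partial>\<gamma>))"

definition generated_by :: "'a measure \<Rightarrow> ('a \<Rightarrow> real) \<Rightarrow> 'a measure" where
  "generated_by M Z = vimage_algebra (space M) Z borel"

lemma subalgebra_generated_by:
  "Z \<in> borel_measurable M \<Longrightarrow> subalgebra M (generated_by M Z)"
  by (auto simp: subalgebra_def generated_by_def sets_vimage_algebra2 intro: measurable_sets)

lemma measurable_generated_by: "Z \<in> borel_measurable (generated_by M Z)"
  unfolding generated_by_def by (rule measurable_vimage_algebra1) auto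

definition gaussian_increments ::
  "'a measure \<Rightarrow> (nat \<Rightarrow> 'a measure) \<Rightarrow> nat \<Rightarrow> (nat \<Rightarrow> real) \<Rightarrow> (nat \<Rightarrow> 'a \<Rightarrow> real) \<Rightarrow> bool" where
  "gaussian_increments M H n d Z \<longleftrightarrow>
     (\<forall>i\<le>n. subalgebra M (H i)) \<and> (\<forall>i j. i \<le> j \<longrightarrow> j \<le> n \<longrightarrow> sets (H i) \<subseteq> sets (H j)) \<and>
     (\<forall>i<n. 0 \<le> d i \<and> Z i \<in> borel_measurable (H (Suc i)) \<and> normal_law M (d i) (Z i) \<and>
        prob_space.indep_set M (sets (H i)) (sets (generated_by M (Z i))))"

lemma measurable_mono_subalgebra:
  assumes "f \<in> borel_measurable M1" "space M1 = space M2" "sets M1 \<subseteq> sets M2"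
  shows "f \<in> borel_measurable M2"
  using assms by (auto simp: measurable_def)

text \<open>The process \<open>P\<^bsub>v - J\<^sub>k\<^esub> h (x + N\<^sub>k)\<close> is a martingale, because adding the increment
  \<open>\<xi> Z\<close> to the space variable costs exactly the time \<open>\<xi>\<^sup>2 d\<close> in the semigroup law.\<close>

lemma heat_martingale:
  assumes M: "prob_space M" and Z: "gaussian_increments M H n d Z"
    and \<xi>: "\<And>i. i < n \<Longrightarrow> \<xi> i \<in> borel_measurable (H i)"
    and v: "\<And>\<omega>. \<omega> \<in> space M \<Longrightarrow> (\<Sum>i<n. (\<xi> i \<omega>)\<^sup>2 * d i) \<le> v"
    and h: "bounded_borel C h"
  shows "(\<integral>\<omega>. heat (v - (\<Sum>i<n. (\<xi> i \<omega>)\<^sup>2 * d i)) h (x + (\<Sum>i<n. \<xi> i \<omega> * Z i \<omega>)) \<partial>M) = heat v h x"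
  using Z \<xi> v
proof (induction n)
  case 0
  interpret prob_space M by fact
  show ?case by (simp add: prob_space)
next
  case (Suc n)
  interpret prob_space M by fact
  note hm [measurable] = bounded_borelD(1)[OF h]
  have sub: "subalgebra M (H i)" if "i \<le> Suc n" for i
    using Suc.prems(1) that by (auto simp: gaussian_increments_def)
  have sp: "space (H i) = space M" if "i \<le> Suc n" for i
    using sub[OF that] by (simp add: subalgebra_def)
  have mono: "sets (H i) \<subseteq> sets (H j)" if "i \<le> j" "j \<le> Suc n" for i j
    using Suc.prems(1) that unfolding gaussian_increments_def by blast
  have Zn: "0 \<le> d i" "Z i \<in> borel_measurable (H (Suc i))" "normal_law M (d i) (Z i)"
    "indep_set (sets (H i)) (sets (generated_by M (Z i)))" if "i \<le> n" for i
    using Suc.prems(1) that by (auto simp: gaussian_increments_def)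
  have ZM: "Z n \<in> borel_measurable M"
    using measurable_mono_subalgebra[OF Zn(2)[of n], of M] sub[of "Suc n"]
    by (auto simp: subalgebra_def)
  have up: "f \<in> borel_measurable (H n)" if "f \<in> borel_measurable (H i)" "i \<le> n" for i f
    by (rule measurable_mono_subalgebra[OF that(1)]) (use that sp mono in auto)
  define U where "U \<omega> = (\<Sum>i<n. \<xi> i \<omega> * Z i \<omega>)" for \<omega>
  define J where "J \<omega> = (\<Sum>i<n. (\<xi> i \<omega>)\<^sup>2 * d i)" for \<omega>
  have Um [measurable]: "U \<in> borel_measurable (H n)"
    unfolding U_def[abs_def]
    by (intro borel_measurable_sum borel_measurable_times up[OF Suc.prems(2)] up[OF Zn(2)]) auto
  have Jm [measurable]: "J \<in> borel_measurable (H n)"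
    unfolding J_def[abs_def]
    by (intro borel_measurable_sum borel_measurable_times borel_measurable_power up[OF Suc.prems(2)]) auto
  have \<xi>m [measurable]: "\<xi> n \<in> borel_measurable (H n)" using Suc.prems(2) by simp
  note Zm [measurable] = measurable_generated_by[of "Z n" M]
  let ?s = "\<lambda>\<omega>. v - J \<omega> - (\<xi> n \<omega>)\<^sup>2 * d n"
  define F where "F = (\<lambda>(\<omega>, \<omega>'). heat (?s \<omega>) h (x + U \<omega> + \<xi> n \<omega> * Z n \<omega>'))"
  have Fm: "F \<in> borel_measurable (H n \<Otimes>\<^sub>M generated_by M (Z n))"
    unfolding F_def by measurable
  have "(\<integral>\<omega>. heat (v - (\<Sum>i<Suc n. (\<xi> i \<omega>)\<^sup>2 * d i)) h (x + (\<Sum>i<Suc n. \<xi> i \<omega> * Z i \<omega>)) \<partial>M)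
    = (\<integral>\<omega>. F (\<omega>, \<omega>) \<partial>M)"
    by (simp add: F_def U_def J_def algebra_simps)
  also have "\<dots> = (\<integral>\<omega>. (\<integral>\<omega>'. F (\<omega>, \<omega>') \<partial>M) \<partial>M)"
  proof (rule integral_indep_sigma_algebras[OF M sub[of n] subalgebra_generated_by[OF ZM] _ Fm])
    show "\<bar>F p\<bar> \<le> C" for p
      using bounded_borelD(2)[OF bounded_borel_heat[OF h]] by (auto simp: F_def split: prod.split)
  qed (use Zn(4)[of n] in auto)
  also have "\<dots> = (\<integral>\<omega>. heat (v - J \<omega>) h (x + U \<omega>) \<partial>M)"
  proof (rule Bochner_Integration.integral_cong)
    fix \<omega> assume \<omega>: "\<omega> \<in> space M"
    have s: "0 \<le> ?s \<omega>" using Suc.prems(3)[OF \<omega>] by (simp add: J_def)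
    have hb: "bounded_borel C (\<lambda>z. heat (?s \<omega>) h (x + U \<omega> + \<xi> n \<omega> * z))"
      using bounded_borelD(2)[OF bounded_borel_heat[OF h]] by (auto simp: bounded_borel_def)
    have "(\<integral>\<omega>'. F (\<omega>, \<omega>') \<partial>M) = (\<integral>z. heat (?s \<omega>) h (x + U \<omega> + (\<xi> n \<omega> * sqrt (d n)) * z) \<partial>\<gamma>)"
      using Zn(3)[of n] hb unfolding normal_law_def F_def by (fastforce simp: mult.assoc)
    also have "\<dots> = heat (v - J \<omega>) h (x + U \<omega>)"
      using Zn(1)[of n] by (subst heat_step[OF h s]) (simp add: power_mult_distrib)
    finally show "(\<integral>\<omega>'. F (\<omega>, \<omega>') \<partial>M) = heat (v - J \<omega>) h (x + U \<omega>)" .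
  qed simp
  also have "\<dots> = heat v h x"
    unfolding U_def J_def
  proof (rule Suc.IH)
    show "gaussian_increments M H n d Z"
      using Suc.prems(1) by (auto simp: gaussian_increments_def)
    show "(\<Sum>i<n. (\<xi> i \<omega>)\<^sup>2 * d i) \<le> v" if "\<omega> \<in> space M" for \<omega>
    proof -
      have "0 \<le> (\<xi> n \<omega>)\<^sup>2 * d n" using Zn(1)[of n] by simp
      then show ?thesis using Suc.prems(3)[OF that] by simp
    qed
  qed (use Suc.prems(2) in auto)
  finally show ?case .
qed

lemma integral_gaussian_sum:
  assumes "prob_space M" "gaussian_increments M H n d Z" "bounded_borel C h"
  shows "(\<integral>\<omega>. h (x + (\<Sum>i<n. c i * Z i \<omega>)) \<partial>M) = heat (\<Sum>i<n. (c i)\<^sup>2 * d i) h x"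
  using heat_martingale[OF assms(1,2), of "\<lambda>i \<omega>. c i" "\<Sum>i<n. (c i)\<^sup>2 * d i" C h x] assms(3) by simp

text \<open>By symmetry the increments \<open>z\<close> and \<open>- z\<close> are equally likely, and one of them leads away from the interval.\<close>

lemma heat_outside_interval:
  assumes x: "\<delta> \<le> \<bar>x\<bar>"
  shows "1 / 2 \<le> heat s (indicator {y. \<delta> \<le> \<bar>y\<bar>}) x"
proof -
  define a where "a = sqrt s"
  have sq: "(\<lambda>z. indicator {y. \<delta> \<le> \<bar>y\<bar>} (x + a * z) :: real) \<in> borel_measurable borel"
    "(\<lambda>z. indicator {y. \<delta> \<le> \<bar>y\<bar>} (x - a * z) :: real) \<in> borel_measurable borel"
    by measurable
  have i: "integrable \<gamma> (\<lambda>z. indicator {y. \<delta> \<le> \<bar>y\<bar>} (x + a * z) :: real)"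
    "integrable \<gamma> (\<lambda>z. indicator {y. \<delta> \<le> \<bar>y\<bar>} (x - a * z) :: real)"
    using sq by (auto intro!: gauss.integrable_const_bound[where B = 1] simp: indicator_def)
  have "(\<integral>z. indicator {y. \<delta> \<le> \<bar>y\<bar>} (x - a * z) \<partial>\<gamma>) = heat s (indicator {y. \<delta> \<le> \<bar>y\<bar>}) x"
  proof -
    have "(\<integral>z. indicator {y. \<delta> \<le> \<bar>y\<bar>} (x - a * z) \<partial>\<gamma>)
      = (\<integral>z. std_normal_density z * indicator {y. \<delta> \<le> \<bar>y\<bar>} (x - a * z) \<partial>lborel)"
      by (rule integral_gauss_eq) (rule sq)
    also have "\<dots> = (\<integral>z. std_normal_density z * indicator {y. \<delta> \<le> \<bar>y\<bar>} (x + a * z) \<partial>lborel)"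
      by (subst lborel_integral_real_affine[where c = "-1" and t = 0]) (auto simp: std_normal_density_def)
    also have "\<dots> = heat s (indicator {y. \<delta> \<le> \<bar>y\<bar>}) x"
      unfolding heat_def a_def[symmetric] by (rule integral_gauss_eq[symmetric]) (rule sq)
    finally show ?thesis .
  qed
  then have "2 * heat s (indicator {y. \<delta> \<le> \<bar>y\<bar>}) x
      = (\<integral>z. indicator {y. \<delta> \<le> \<bar>y\<bar>} (x + a * z) + indicator {y. \<delta> \<le> \<bar>y\<bar>} (x - a * z) \<partial>\<gamma>)"
    using i by (simp add: heat_def a_def)
  also have "\<dots> \<ge> (\<integral>z. 1 \<partial>\<gamma>)"
  proof (rule integral_mono)
    fix z
    have "\<delta> \<le> \<bar>x + a * z\<bar> \<or> \<delta> \<le> \<bar>x - a * z\<bar>" using x by linarith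
    then show "1 \<le> (indicator {y. \<delta> \<le> \<bar>y\<bar>} (x + a * z) + indicator {y. \<delta> \<le> \<bar>y\<bar>} (x - a * z) :: real)"
      by (auto simp: indicator_def)
  qed (use i in auto)
  finally show ?thesis by simp
qed

lemma heat_outside_interval_0_le:
  assumes "0 < \<delta>" "0 \<le> \<eta>"
  shows "heat \<eta> (indicator {y. \<delta> \<le> \<bar>y\<bar>}) 0 \<le> \<eta> / \<delta>\<^sup>2"
proof -
  have "(\<integral>z. indicator {y. \<delta> \<le> \<bar>y\<bar>} (0 + sqrt \<eta> * z) \<partial>\<gamma>) \<le> (\<integral>z. \<eta> / \<delta>\<^sup>2 * z\<^sup>2 \<partial>\<gamma>)"
  proof (rule integral_mono)
    have "(\<lambda>z. indicator {y. \<delta> \<le> \<bar>y\<bar>} (0 + sqrt \<eta> * z) :: real) \<in> borel_measurable borel" by measurable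
    then show "integrable \<gamma> (\<lambda>z. indicator {y. \<delta> \<le> \<bar>y\<bar>} (0 + sqrt \<eta> * z) :: real)"
      by (intro gauss.integrable_const_bound[where B = 1]) (auto simp: indicator_def)
    show "integrable \<gamma> (\<lambda>z. \<eta> / \<delta>\<^sup>2 * z\<^sup>2)" using gauss_moments(1)[of 2] by simp
    show "indicator {y. \<delta> \<le> \<bar>y\<bar>} (0 + sqrt \<eta> * z) \<le> \<eta> / \<delta>\<^sup>2 * z\<^sup>2" for z
    proof (cases "\<delta> \<le> \<bar>sqrt \<eta> * z\<bar>")
      case True
      then have "\<delta>\<^sup>2 \<le> (\<bar>sqrt \<eta> * z\<bar>)\<^sup>2" using assms by (intro power_mono) auto
      then show ?thesis using assms True by (simp add: power_mult_distrib field_simps)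
    qed (use assms in auto)
  qed
  then show ?thesis using gauss_moments(3) by (simp add: heat_def)
qed

text \<open>This plays the role of Chebyshev's inequality with the Ito isometry. Applying the martingale to the
  indicator of \<open>\<delta> \<le> \<bar>y\<bar>\<close> instead of \<open>y\<^sup>2\<close> keeps every expectation bounded, although the integrand
  may fail to have moments.\<close>

lemma gaussian_transform_tail:
  assumes M: "prob_space M" and Z: "gaussian_increments M H n d Z"
    and \<xi>: "\<And>i. i < n \<Longrightarrow> \<xi> i \<in> borel_measurable (H i)"
    and v: "\<And>\<omega>. \<omega> \<in> space M \<Longrightarrow> (\<Sum>i<n. (\<xi> i \<omega>)\<^sup>2 * d i) \<le> \<eta>"
    and \<delta>: "0 < \<delta>" "0 \<le> \<eta>" and N: "(\<lambda>\<omega>. \<Sum>i<n. \<xi> i \<omega> * Z i \<omega>) \<in> borel_measurable M"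
    and J: "(\<lambda>\<omega>. \<Sum>i<n. (\<xi> i \<omega>)\<^sup>2 * d i) \<in> borel_measurable M"
  shows "measure M {\<omega> \<in> space M. \<delta> \<le> \<bar>\<Sum>i<n. \<xi> i \<omega> * Z i \<omega>\<bar>} \<le> 2 * \<eta> / \<delta>\<^sup>2"
proof -
  interpret prob_space M by fact
  define N where "N \<omega> = (\<Sum>i<n. \<xi> i \<omega> * Z i \<omega>)" for \<omega>
  define J where "J \<omega> = (\<Sum>i<n. (\<xi> i \<omega>)\<^sup>2 * d i)" for \<omega>
  have [measurable]: "N \<in> borel_measurable M" "J \<in> borel_measurable M"
    using assms(7,8) by (simp_all add: N_def[abs_def] J_def[abs_def])
  define h :: "real \<Rightarrow> real" where "h = indicator {y. \<delta> \<le> \<bar>y\<bar>}"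
  have hb: "bounded_borel 1 h" by (auto simp: bounded_borel_def h_def indicator_def)
  note [measurable] = bounded_borelD(1)[OF hb]
  have "measure M {\<omega> \<in> space M. \<delta> \<le> \<bar>N \<omega>\<bar>} = (\<integral>\<omega>. indicator {\<omega> \<in> space M. \<delta> \<le> \<bar>N \<omega>\<bar>} \<omega> \<partial>M)"
    by simp
  also have "\<dots> \<le> (\<integral>\<omega>. 2 * heat (\<eta> - J \<omega>) h (0 + N \<omega>) \<partial>M)"
  proof (rule integral_mono)
    show "integrable M (\<lambda>\<omega>. indicator {\<omega> \<in> space M. \<delta> \<le> \<bar>N \<omega>\<bar>} \<omega> :: real)"
      by (intro integrable_const_bound[where B = 1]) (auto simp: indicator_def)
    show "integrable M (\<lambda>\<omega>. 2 * heat (\<eta> - J \<omega>) h (0 + N \<omega>))"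
      using bounded_borelD(2)[OF bounded_borel_heat[OF hb]]
      by (intro integrable_mult_right integrable_const_bound[where B = 1]) auto
    show "indicator {\<omega> \<in> space M. \<delta> \<le> \<bar>N \<omega>\<bar>} \<omega> \<le> 2 * heat (\<eta> - J \<omega>) h (0 + N \<omega>)" for \<omega>
    proof (cases "\<delta> \<le> \<bar>N \<omega>\<bar>")
      case True
      then show ?thesis using heat_outside_interval[OF True, of "\<eta> - J \<omega>"] by (simp add: h_def indicator_def)
    next
      case False
      have "0 \<le> heat (\<eta> - J \<omega>) h (0 + N \<omega>)"
        unfolding heat_def by (rule integral_nonneg_AE) (auto simp: h_def)
      with False show ?thesis by simp
    qed
  qed
  also have "\<dots> = 2 * heat \<eta> h 0"
    using heat_martingale[OF M Z \<xi> v hb, of 0] by (simp add: N_def J_def)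
  also have "\<dots> \<le> 2 * (\<eta> / \<delta>\<^sup>2)"
    using heat_outside_interval_0_le[OF \<delta>] by (simp add: h_def)
  finally show ?thesis by (simp add: N_def)
qed

section \<open>Brownian increments and conditional normality\<close>

lemma integral_normal_density_eq_gauss:
  fixes g :: "real \<Rightarrow> real"
  assumes [measurable]: "g \<in> borel_measurable borel" and \<sigma>: "0 < \<sigma>"
  shows "(\<integral>x. normal_density 0 \<sigma> x * g x \<partial>lborel) = (\<integral>z. g (\<sigma> * z) \<partial>\<gamma>)"
proof -
  have "(\<integral>x. normal_density 0 \<sigma> x * g x \<partial>lborel) = \<sigma> * (\<integral>z. normal_density 0 \<sigma> (\<sigma> * z) * g (\<sigma> * z) \<partial>lborel)"
    using \<sigma> by (subst lborel_integral_real_affine[where c = \<sigma> and t = 0]) auto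
  also have "\<dots> = (\<integral>z. \<sigma> * (normal_density 0 \<sigma> (\<sigma> * z) * g (\<sigma> * z)) \<partial>lborel)" by simp
  also have "\<dots> = (\<integral>z. std_normal_density z * g (\<sigma> * z) \<partial>lborel)"
    using \<sigma> by (intro Bochner_Integration.integral_cong)
      (auto simp: normal_density_def std_normal_density_def power_mult_distrib real_sqrt_mult)
  also have "\<dots> = (\<integral>z. g (\<sigma> * z) \<partial>\<gamma>)" by (rule integral_gauss_eq[symmetric]) measurable
  finally show ?thesis .
qed

lemma borel_measurable_fst_snd_pair:
  fixes X Y :: "'a \<Rightarrow> real"
  assumes "(\<lambda>\<omega>. (X \<omega>, Y \<omega>)) \<in> borel_measurable M"
  shows "X \<in> borel_measurable M" "Y \<in> borel_measurable M"
  using measurable_compose[OF assms, of fst borel] measurable_compose[OF assms, of snd borel]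
  by (auto simp: borel_prod[symmetric])

lemma partition_mono:
  fixes p :: "nat \<Rightarrow> real"
  assumes "\<And>i. i < n \<Longrightarrow> p i < p (Suc i)" "i \<le> j" "j \<le> n"
  shows "p i \<le> p j"
  using assms(2,3)
proof (induction j rule: dec_induct)
  case (step k)
  then show ?case using assms(1)[of k] by simp
qed simp

lemma brownian_motion_measurable:
  fixes W W' :: "real \<Rightarrow> 'a \<Rightarrow> real"
  assumes "brownian_motion M F (\<lambda>t \<omega>. (W t \<omega>, W' t \<omega>))" "0 \<le> t"
  shows "W t \<in> borel_measurable (F t)" "W' t \<in> borel_measurable (F t)"
  using assms borel_measurable_fst_snd_pair[of "W t" "W' t" "F t"]
  by (auto simp: brownian_motion_def adapted_def)

text \<open>General unit coefficients treat \<open>W\<close>, \<open>W'\<close> and the correlated motion \<open>B\<close> at once.\<close>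

lemma brownian_increment_normal:
  fixes W W' :: "real \<Rightarrow> 'a \<Rightarrow> real"
  assumes bm: "brownian_motion M F (\<lambda>t \<omega>. (W t \<omega>, W' t \<omega>))" and st: "0 \<le> s" "s < t"
    and ab: "a\<^sup>2 + b\<^sup>2 = 1"
  shows "normal_law M (t - s) (\<lambda>\<omega>. a * (W t \<omega> - W s \<omega>) + b * (W' t \<omega> - W' s \<omega>))"
  unfolding normal_law_def
proof (intro allI impI)
  fix C g assume g: "bounded_borel C g"
  note [measurable] = bounded_borelD(1)[OF g]
  define \<sigma> where "\<sigma> = sqrt (t - s)"
  have \<sigma>: "0 < \<sigma>" using st by (simp add: \<sigma>_def)
  define X where "X \<omega> = (W t \<omega> - W s \<omega>, W' t \<omega> - W' s \<omega>)" for \<omega>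
  define k :: "real \<times> real \<Rightarrow> real" where "k = (\<lambda>x. normal_density 0 \<sigma> (fst x) * normal_density 0 \<sigma> (snd x))"
  let ?g = "\<lambda>x. g (a * fst x + b * snd x)"
  have kB: "(\<Prod>c\<in>Basis. normal_density 0 (sqrt (t - s)) (x \<bullet> c)) = k x" for x :: "real \<times> real"
    by (cases x) (simp add: k_def \<sigma>_def Basis_prod_def)
  have D: "distributed M lborel X (\<lambda>x. ennreal (k x))"
    using bm st unfolding brownian_motion_def X_def
    by (simp only: kB[symmetric]) auto
  have gm [measurable]: "?g \<in> borel_measurable (lborel \<Otimes>\<^sub>M lborel)"
    by measurable
  have km [measurable]: "k \<in> borel_measurable (lborel \<Otimes>\<^sub>M lborel)"
    unfolding k_def by measurable
  have ki: "integrable (lborel \<Otimes>\<^sub>M lborel) k"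
    using \<sigma> by (intro lborel_pair.Fubini_integrable) (auto simp: k_def abs_mult)
  have "(\<integral>\<omega>. g (a * (W t \<omega> - W s \<omega>) + b * (W' t \<omega> - W' s \<omega>)) \<partial>M) = (\<integral>\<omega>. ?g (X \<omega>) \<partial>M)"
    by (simp add: X_def)
  also have "\<dots> = (\<integral>x. k x * ?g x \<partial>lborel)"
    using gm by (intro distributed_integral[symmetric, OF D]) (auto simp: k_def lborel_prod)
  also have "\<dots> = (\<integral>x. ?g x * k x \<partial>(lborel \<Otimes>\<^sub>M lborel))" by (simp add: lborel_prod mult.commute)
  also have "\<dots> = (\<integral>x. (\<integral>y. ?g (x, y) * k (x, y) \<partial>lborel) \<partial>lborel)"
    using integrable_bounded_mult[OF g _ ki, of "\<lambda>x. a * fst x + b * snd x"]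
    by (intro lborel_pair.integral_fst'[symmetric]) auto
  also have "\<dots> = (\<integral>x. normal_density 0 \<sigma> x * (\<integral>y. normal_density 0 \<sigma> y * g (a * x + b * y) \<partial>lborel) \<partial>lborel)"
    by (simp add: k_def mult.assoc mult.commute mult.left_commute)
  also have "\<dots> = (\<integral>z. (\<integral>w. g (a * (\<sigma> * z) + b * (\<sigma> * w)) \<partial>\<gamma>) \<partial>\<gamma>)"
    using \<sigma> by (subst integral_normal_density_eq_gauss | simp)+
  also have "\<dots> = (\<integral>z. (\<integral>w. g ((a * \<sigma>) * z + (b * \<sigma>) * w) \<partial>\<gamma>) \<partial>\<gamma>)" by (simp add: mult.assoc)
  also have "\<dots> = (\<integral>u. g (sqrt ((a * \<sigma>)\<^sup>2 + (b * \<sigma>)\<^sup>2) * u) \<partial>\<gamma>)" by (rule gauss_convolution[OF g])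
  also have "(a * \<sigma>)\<^sup>2 + (b * \<sigma>)\<^sup>2 = t - s"
    using ab st by (simp add: power_mult_distrib \<sigma>_def distrib_right[symmetric])
  finally show "(\<integral>\<omega>. g (a * (W t \<omega> - W s \<omega>) + b * (W' t \<omega> - W' s \<omega>)) \<partial>M) = (\<integral>z. g (sqrt (t - s) * z) \<partial>\<gamma>)" .
qed

lemma (in prob_space) indep_set_mono_right:
  assumes "indep_set A B" "B' \<subseteq> B"
  shows "indep_set A B'"
  using assms indep_setD_ev1[OF assms(1)] indep_setD_ev2[OF assms(1)]
  by (intro indep_setI) (auto dest: indep_setD)

lemma (in prob_space) indep_set_commute: "indep_set A B \<Longrightarrow> indep_set B A"
  using indep_setD_ev1 indep_setD_ev2
  by (intro indep_setI) (auto dest: indep_setD simp: Int_commute mult.commute)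

lemma brownian_gaussian_increments:
  fixes W W' :: "real \<Rightarrow> 'a \<Rightarrow> real"
  assumes M: "prob_space M" and fil: "filtration_on M F"
    and bm: "brownian_motion M F (\<lambda>t \<omega>. (W t \<omega>, W' t \<omega>))"
    and p: "0 \<le> p 0" "\<And>i. i < n \<Longrightarrow> p i < p (Suc i)" and ab: "a\<^sup>2 + b\<^sup>2 = 1"
  shows "gaussian_increments M (\<lambda>i. F (p i)) n (\<lambda>i. p (Suc i) - p i)
    (\<lambda>i \<omega>. a * (W (p (Suc i)) \<omega> - W (p i) \<omega>) + b * (W' (p (Suc i)) \<omega> - W' (p i) \<omega>))"
proof -
  interpret prob_space M by fact
  have mono: "p i \<le> p j" if "i \<le> j" "j \<le> n" for i j
    using partition_mono[of n p i j] p(2) that by simp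
  have p0: "0 \<le> p i" if "i \<le> n" for i using mono[of 0 i] that p(1) by simp
  have sub: "subalgebra M (F t)" "0 \<le> s \<Longrightarrow> s \<le> t \<Longrightarrow> subalgebra (F t) (F s)" if "0 \<le> t" for s t
    using fil that by (auto simp: filtration_on_def)
  note meas = brownian_motion_measurable[OF bm]
  show ?thesis
    unfolding gaussian_increments_def
  proof (intro conjI allI impI)
    fix i assume i: "i < n"
    note si = p(2)[OF i] p0[of i]
    have i': "0 \<le> p i" using p0 i by simp
    have i'': "0 \<le> p (Suc i)" using p0 i by simp
    let ?X = "\<lambda>\<omega>. (W (p (Suc i)) \<omega> - W (p i) \<omega>, W' (p (Suc i)) \<omega> - W' (p i) \<omega>)"
    let ?Z = "\<lambda>\<omega>. a * (W (p (Suc i)) \<omega> - W (p i) \<omega>) + b * (W' (p (Suc i)) \<omega> - W' (p i) \<omega>)"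
    show "0 \<le> p (Suc i) - p i" using p(2)[OF i] by simp
    have "W (p i) \<in> borel_measurable (F (p (Suc i)))" "W' (p i) \<in> borel_measurable (F (p (Suc i)))"
      using measurable_from_subalg[OF sub(2)[OF i'' i'] meas(1)[OF i']]
        measurable_from_subalg[OF sub(2)[OF i'' i'] meas(2)[OF i']] p(2)[OF i] by auto
    note [measurable] = this meas[OF i'']
    show "?Z \<in> borel_measurable (F (p (Suc i)))" by measurable
    show "normal_law M (p (Suc i) - p i) ?Z"
      by (rule brownian_increment_normal[OF bm i' p(2)[OF i] ab])
    have indX: "indep_set (sets (F (p i))) (sets (vimage_algebra (space M) ?X borel))"
      using bm i' p(2)[OF i] unfolding brownian_motion_def by simp
    have "sets (generated_by M ?Z) \<subseteq> sets (vimage_algebra (space M) ?X borel)"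
    proof -
      have "(\<lambda>x :: real \<times> real. a * fst x + b * snd x) \<in> borel_measurable borel"
        by (auto simp: borel_prod[symmetric])
      then have "(\<lambda>\<omega>. a * fst (?X \<omega>) + b * snd (?X \<omega>)) \<in> borel_measurable (vimage_algebra (space M) ?X borel)"
        by (rule measurable_compose[rotated]) (rule measurable_vimage_algebra1, simp)
      then have "?Z \<in> borel_measurable (vimage_algebra (space M) ?X borel)" by simp
      then show ?thesis
        unfolding generated_by_def sets_vimage_algebra2[of ?Z "space M" borel, simplified]
        by (auto dest: measurable_sets)
    qed
    then show "indep_set (sets (F (p i))) (sets (generated_by M ?Z))"
      by (rule indep_set_mono_right[OF indX])
  next
    fix i assume "i \<le> n"
    then show "subalgebra M (F (p i))" using sub p0 by simp
  next
    fix i j assume "i \<le> j" "j \<le> n"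
    then show "sets (F (p i)) \<subseteq> sets (F (p j))"
      using sub(2)[of "p j" "p i"] p0[of i] p0[of j] mono[of i j] by (auto simp: subalgebra_def)
  qed
qed

locale correlated_brownian =
  fixes M :: "'a measure" and F G :: "real \<Rightarrow> 'a measure" and W W' :: "real \<Rightarrow> 'a \<Rightarrow> real" and \<rho> :: real
  assumes M: "prob_space M" and filF: "filtration_on M F"
    and bm: "brownian_motion M F (\<lambda>t \<omega>. (W t \<omega>, W' t \<omega>))"
    and filG: "filtration_on M G" and GF: "\<And>t. 0 \<le> t \<Longrightarrow> sets (G t) \<subseteq> sets (F t)"
    and WG: "adapted G W" and W'G: "process_indep_of_filtration M W' G"
    and \<rho>: "-1 < \<rho>" "\<rho> < 1"
begin

definition B :: "real \<Rightarrow> 'a \<Rightarrow> real" where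
  "B t \<omega> = \<rho> * W t \<omega> + sqrt (1 - \<rho>\<^sup>2) * W' t \<omega>"

lemma \<rho>2: "\<rho>\<^sup>2 < 1" "\<rho>\<^sup>2 + (sqrt (1 - \<rho>\<^sup>2))\<^sup>2 = 1"
proof -
  have "\<bar>\<rho>\<bar> < 1" using \<rho> by linarith
  then show "\<rho>\<^sup>2 < 1" by (simp add: abs_square_less_1)
  then show "\<rho>\<^sup>2 + (sqrt (1 - \<rho>\<^sup>2))\<^sup>2 = 1" by simp
qed

lemma increment_B:
  "\<rho> * (W t \<omega> - W s \<omega>) + sqrt (1 - \<rho>\<^sup>2) * (W' t \<omega> - W' s \<omega>) = B t \<omega> - B s \<omega>"
  by (simp add: B_def algebra_simps)

text \<open>Given the smaller filtration, a step integral with respect to \<open>B\<close> is normal, because the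
  integrand and \<open>W\<close> are frozen while \<open>W'\<close> is independent of them.\<close>

lemma step_integral_conditionally_normal:
  fixes \<Phi> :: "real \<times> real \<Rightarrow> real" and \<xi> :: "nat \<Rightarrow> 'a \<Rightarrow> real"
  assumes p: "0 \<le> p 0" "\<And>i. i < n \<Longrightarrow> p i < p (Suc i)"
    and \<xi>: "\<And>i. i < n \<Longrightarrow> \<xi> i \<in> borel_measurable (G (p i))"
    and \<Phi>: "\<Phi> \<in> borel_measurable (borel \<Otimes>\<^sub>M borel)" "\<And>q. \<bar>\<Phi> q\<bar> \<le> C"
  defines "I \<equiv> \<lambda>\<omega>. \<Sum>i<n. (\<xi> i \<omega>)\<^sup>2 * (p (Suc i) - p i)"
    and "A \<equiv> \<lambda>\<omega>. \<Sum>i<n. \<xi> i \<omega> * (W (p (Suc i)) \<omega> - W (p i) \<omega>)"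
    and "R \<equiv> \<lambda>\<omega>. \<Sum>i<n. \<xi> i \<omega> * (B (p (Suc i)) \<omega> - B (p i) \<omega>)"
  shows "(\<integral>\<omega>. \<Phi> (I \<omega>, R \<omega>) \<partial>M) = (\<integral>\<omega>. heat ((1 - \<rho>\<^sup>2) * I \<omega>) (\<lambda>y. \<Phi> (I \<omega>, y)) (\<rho> * A \<omega>) \<partial>M)"
proof -
  interpret prob_space M by (rule M)
  note [measurable] = \<Phi>(1)
  define G' where "G' = sigma (space M) (\<Union>t\<in>{0..}. sets (G t))"
  define H' where "H' = sigma (space M) (\<Union>t\<in>{0..}. sets (vimage_algebra (space M) (W' t) borel))"
  have mono: "p i \<le> p j" if "i \<le> j" "j \<le> n" for i j
    using partition_mono[of n p i j] p(2) that by simp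
  have p0: "0 \<le> p i" if "i \<le> n" for i using mono[of 0 i] that p(1) by simp
  have subG: "subalgebra M (G t)" if "0 \<le> t" for t using filG that by (auto simp: filtration_on_def)
  have subF: "subalgebra M (F t)" if "0 \<le> t" for t using filF that by (auto simp: filtration_on_def)
  have W'M: "W' t \<in> borel_measurable M" if "0 \<le> t" for t
    by (rule measurable_from_subalg[OF subF[OF that] brownian_motion_measurable(2)[OF bm that]])
  have cG: "(\<Union>t\<in>{0..}. sets (G t)) \<subseteq> Pow (space M)"
    using subG sets.sets_into_space by (fastforce simp: subalgebra_def)
  have cG': "(\<Union>t\<in>{0..}. sets (G t)) \<subseteq> sets M"
    using subG by (auto simp: subalgebra_def)
  have cH': "(\<Union>t\<in>{0..}. sets (vimage_algebra (space M) (W' t) borel)) \<subseteq> sets M"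
    using subalgebra_generated_by[OF W'M] by (auto simp: generated_by_def subalgebra_def)
  have cH: "(\<Union>t\<in>{0..}. sets (vimage_algebra (space M) (W' t) borel)) \<subseteq> Pow (space M)"
    using cH' sets.sets_into_space by fastforce
  have sG: "sets G' = sigma_sets (space M) (\<Union>t\<in>{0..}. sets (G t))" "space G' = space M"
    unfolding G'_def using cG by (auto simp: space_measure_of_conv)
  have sH: "sets H' = sigma_sets (space M) (\<Union>t\<in>{0..}. sets (vimage_algebra (space M) (W' t) borel))"
    "space H' = space M"
    unfolding H'_def using cH by (auto simp: space_measure_of_conv)
  have ind: "indep_set (sets G') (sets H')"
    using W'G unfolding process_indep_of_filtration_def sG sH by (rule indep_set_commute)
  have MG': "subalgebra M G'" using cG' sets.sigma_sets_subset[of _ M] by (auto simp: subalgebra_def sG)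
  have MH': "subalgebra M H'" using cH' sets.sigma_sets_subset[of _ M] by (auto simp: subalgebra_def sH)
  have upG: "f \<in> borel_measurable G'" if "f \<in> borel_measurable (G t)" "0 \<le> t" for f :: "'a \<Rightarrow> real" and t
    by (rule measurable_mono_subalgebra[OF that(1)]) (use subG that sG in \<open>auto simp: subalgebra_def\<close>)
  have upH: "W' t \<in> borel_measurable H'" if "0 \<le> t" for t
    by (rule measurable_mono_subalgebra[OF measurable_generated_by[of "W' t" M]])
       (use that sH in \<open>auto simp: generated_by_def\<close>)
  have \<xi>m: "\<xi> i \<in> borel_measurable G'" if "i < n" for i using upG[OF \<xi>[OF that]] p0 that by simp
  have Wm: "W (p i) \<in> borel_measurable G'" if "i \<le> n" for i
    using upG[of "W (p i)" "p i"] WG p0[OF that] by (auto simp: adapted_def)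
  have Im [measurable]: "I \<in> borel_measurable G'"
    unfolding I_def by (intro borel_measurable_sum borel_measurable_times borel_measurable_power \<xi>m) auto
  have Am [measurable]: "A \<in> borel_measurable G'"
    unfolding A_def by (intro borel_measurable_sum borel_measurable_times borel_measurable_diff \<xi>m Wm) auto
  define r where "r = sqrt (1 - \<rho>\<^sup>2)"
  define U where "U = (\<lambda>(\<omega>, \<omega>'). \<Sum>i<n. (r * \<xi> i \<omega>) * (W' (p (Suc i)) \<omega>' - W' (p i) \<omega>'))"
  have Um [measurable]: "U \<in> borel_measurable (G' \<Otimes>\<^sub>M H')"
    unfolding U_def case_prod_beta'
  proof (intro borel_measurable_sum borel_measurable_times borel_measurable_diff borel_measurable_const)
    fix i assume i: "i \<in> {..<n}"
    show "(\<lambda>x. \<xi> i (fst x)) \<in> borel_measurable (G' \<Otimes>\<^sub>M H')"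
      using \<xi>m i by (intro measurable_compose[OF measurable_fst]) auto
    show "(\<lambda>x. W' (p (Suc i)) (snd x)) \<in> borel_measurable (G' \<Otimes>\<^sub>M H')"
      "(\<lambda>x. W' (p i) (snd x)) \<in> borel_measurable (G' \<Otimes>\<^sub>M H')"
      using upH p0 i by (auto intro!: measurable_compose[OF measurable_snd])
  qed
  define Fn where "Fn = (\<lambda>q. \<Phi> (I (fst q), \<rho> * A (fst q) + U q))"
  have Fm: "Fn \<in> borel_measurable (G' \<Otimes>\<^sub>M H')" unfolding Fn_def by measurable
  have "R \<omega> = \<rho> * A \<omega> + U (\<omega>, \<omega>)" for \<omega>
    by (simp add: R_def A_def U_def r_def increment_B[symmetric] sum_distrib_left sum.distrib[symmetric] algebra_simps)
  then have "(\<integral>\<omega>. \<Phi> (I \<omega>, R \<omega>) \<partial>M) = (\<integral>\<omega>. Fn (\<omega>, \<omega>) \<partial>M)" by (simp add: Fn_def)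
  also have "\<dots> = (\<integral>\<omega>. (\<integral>\<omega>'. Fn (\<omega>, \<omega>') \<partial>M) \<partial>M)"
    by (rule integral_indep_sigma_algebras[OF M MG' MH' ind Fm, of C]) (use \<Phi>(2) in \<open>auto simp: Fn_def\<close>)
  also have "\<dots> = (\<integral>\<omega>. heat ((1 - \<rho>\<^sup>2) * I \<omega>) (\<lambda>y. \<Phi> (I \<omega>, y)) (\<rho> * A \<omega>) \<partial>M)"
  proof (rule Bochner_Integration.integral_cong)
    fix \<omega>
    have Z: "gaussian_increments M (\<lambda>i. F (p i)) n (\<lambda>i. p (Suc i) - p i)
        (\<lambda>i \<omega>. 0 * (W (p (Suc i)) \<omega> - W (p i) \<omega>) + 1 * (W' (p (Suc i)) \<omega> - W' (p i) \<omega>))"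
      by (rule brownian_gaussian_increments[OF M filF bm p]) auto
    have b: "bounded_borel C (\<lambda>y. \<Phi> (I \<omega>, y))" using \<Phi>(2) by (auto simp: bounded_borel_def)
    have "r\<^sup>2 = 1 - \<rho>\<^sup>2" using \<rho>2 by (simp add: r_def)
    then have "(\<Sum>i<n. (r * \<xi> i \<omega>)\<^sup>2 * (p (Suc i) - p i)) = (1 - \<rho>\<^sup>2) * I \<omega>"
      by (simp add: I_def power_mult_distrib sum_distrib_left mult.assoc)
    with integral_gaussian_sum[OF M Z b, of "\<rho> * A \<omega>" "\<lambda>i. r * \<xi> i \<omega>"]
    show "(\<integral>\<omega>'. Fn (\<omega>, \<omega>') \<partial>M) = heat ((1 - \<rho>\<^sup>2) * I \<omega>) (\<lambda>y. \<Phi> (I \<omega>, y)) (\<rho> * A \<omega>)"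
      by (simp add: Fn_def U_def)
  qed simp
  finally show ?thesis .
qed

end

section \<open>The expansion for step integrands\<close>

text \<open>The first-order coefficient of the expansion for the smoothed function \<open>k = P\<^sub>\<delta> h\<close>, namely half of
  \<open>k'' - k'\<close>: the second derivative comes from the excess variance, the first one from the
  compensator \<open>- I / 2\<close>.\<close>

definition corrector :: "real \<Rightarrow> (real \<Rightarrow> real) \<Rightarrow> real \<Rightarrow> real" where
  "corrector \<delta> h x = (heat_deriv 2 \<delta> h x - heat_deriv 1 \<delta> h x) / 2"

lemma abs_half_diff_le:
  fixes a b a' b' K :: real
  assumes "\<bar>a - a'\<bar> \<le> K" "\<bar>b - b'\<bar> \<le> K"
  shows "\<bar>(a - b) / 2 - (a' - b') / 2\<bar> \<le> K"
  using assms unfolding abs_le_iff diff_divide_distrib by linarith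

lemma bounded_borel_corrector:
  assumes h: "bounded_borel C h" and \<delta>: "0 < \<delta>" "\<delta> \<le> s"
  shows "bounded_borel (C * deriv_bound \<delta>) (corrector s h)"
proof -
  note b = heat_deriv_bound[OF h \<delta>, of 2] heat_deriv_bound[OF h \<delta>, of 1]
  have "corrector s h \<in> borel_measurable borel"
    using bounded_borelD(1)[OF b(1)] bounded_borelD(1)[OF b(2)] by (simp add: corrector_def[abs_def])
  moreover have "\<bar>corrector s h x\<bar> \<le> C * deriv_bound \<delta>" for x
  proof -
    have "\<bar>heat_deriv 2 s h x\<bar> \<le> C * deriv_bound \<delta>" "\<bar>heat_deriv 1 s h x\<bar> \<le> C * deriv_bound \<delta>"
      using bounded_borelD(2)[OF b(1)] bounded_borelD(2)[OF b(2)] by auto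
    then show ?thesis using abs_half_diff_le[of _ 0 _ _ 0] by (simp add: corrector_def)
  qed
  ultimately show ?thesis by (simp add: bounded_borel_def)
qed

lemma heat_corrector:
  assumes h: "bounded_borel C h" and \<delta>: "0 < \<delta>" "0 \<le> s"
  shows "heat s (corrector \<delta> h) x = corrector (\<delta> + s) h x"
proof -
  have b: "integrable \<gamma> (\<lambda>z. heat_deriv j \<delta> h (x + sqrt s * z))" if "j \<le> 4" for j
    using heat_deriv_bound[OF h \<delta>(1) order_refl that] bounded_borelD(1)[OF heat_deriv_bound[OF h \<delta>(1) order_refl that]]
    by (intro integrable_bounded_borel[OF gauss.prob_space_axioms]) auto
  have "heat s (corrector \<delta> h) x = (heat s (heat_deriv 2 \<delta> h) x - heat s (heat_deriv 1 \<delta> h) x) / 2"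
    using b[of 2] b[of 1] by (simp add: heat_def corrector_def)
  also have "\<dots> = corrector (\<delta> + s) h x"
    using heat_heat_deriv[OF h \<delta>] by (simp add: corrector_def)
  finally show ?thesis .
qed

definition expansion_const :: "real \<Rightarrow> real \<Rightarrow> real" where
  "expansion_const \<kappa> \<delta> = 4 * deriv_bound \<kappa> + 2 / \<kappa>\<^sup>2 + deriv_bound \<delta> / \<kappa>"

text \<open>Comparison of the conditional expectation with the terminal value of the heat martingale, pointwise in
  the integrated variance \<open>i\<close>. Near \<open>i = v\<close> all times stay
  above \<open>\<kappa>\<close> and Taylor's formula applies; away from \<open>v\<close> the left-hand side is bounded by a multiple of
  \<open>1 + \<bar>i - v\<bar>\<close>, hence of \<open>(i - v)\<^sup>2\<close>. The term with \<open>\<delta>\<close> is the effect of smoothing the corrector.\<close>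

lemma heat_exchange:
  assumes h: "bounded_borel C h" and \<theta>: "0 \<le> \<theta>" "\<theta> < 1"
    and \<kappa>: "0 < \<kappa>" "\<kappa> \<le> (1 - \<theta>) * v / 2" and \<delta>: "0 < \<delta>"
    and i: "0 \<le> i" "i \<le> v + \<kappa>"
  shows "\<bar>heat ((1 - \<theta>) * i) h (x - i / 2) - heat (v - \<theta> * i) h (x - v / 2)
      - (i - v) * heat ((1 - \<theta>) * i) (corrector \<delta> h) (x - v / 2)\<bar>
    \<le> C * (expansion_const \<kappa> \<delta> * (i - v)\<^sup>2 + deriv_bound \<kappa> * (\<delta> * \<bar>i - v\<bar>))"
proof -
  define D where "D = i - v"
  define y where "y = x - v / 2"
  define s where "s = (1 - \<theta>) * v"
  define t where "t = (1 - \<theta>) * i"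
  define L where "L = deriv_bound \<kappa>"
  have C0: "0 \<le> C" using bounded_borelD(3)[OF h] .
  have L1: "1 \<le> L" "1 \<le> deriv_bound \<delta>" using deriv_bound_ge by (auto simp: L_def)
  have s2: "2 * \<kappa> \<le> s" using \<kappa> by (simp add: s_def)
  have t0: "0 \<le> t" using \<theta> i by (simp add: t_def)
  have eqs: "t = s + (1 - \<theta>) * D" "v - \<theta> * i = s - \<theta> * D" "x - i / 2 = y - D / 2"
    by (simp_all add: t_def s_def D_def y_def field_simps)
  have hc: "heat t (corrector \<delta> h) y = corrector (\<delta> + t) h y"
    by (rule heat_corrector[OF h \<delta> t0])
  let ?E = "heat t h (y - D / 2) - heat (s - \<theta> * D) h y - D * corrector (\<delta> + t) h y"
  have "\<bar>?E\<bar> \<le> C * (expansion_const \<kappa> \<delta> * D\<^sup>2 + L * (\<delta> * \<bar>D\<bar>))"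
  proof (cases "\<bar>D\<bar> \<le> \<kappa>")
    case True
    have td: "\<bar>(1 - \<theta>) * D\<bar> \<le> \<bar>D\<bar>" "\<bar>\<theta> * D\<bar> \<le> \<bar>D\<bar>"
      using \<theta> by (auto simp: abs_mult intro!: mult_left_le_one_le)
    have k: "\<kappa> \<le> s" "\<kappa> \<le> s + (1 - \<theta>) * D" "\<kappa> \<le> s - \<theta> * D" "\<kappa> \<le> \<delta> + t"
      using s2 td True \<kappa> \<delta> by (auto simp: abs_le_iff eqs(1))
    have main: "\<bar>heat t h (y - D / 2) - heat (s - \<theta> * D) h y - D * corrector s h y\<bar> \<le> 3 * (C * L) * D\<^sup>2"
      using heat_shift_taylor[OF h \<kappa>(1) \<theta>(1) less_imp_le[OF \<theta>(2)] k(1,2,3), of y]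
      by (simp add: eqs(1) corrector_def L_def)
    have dt: "\<bar>\<delta> + t - s\<bar> \<le> \<delta> + \<bar>D\<bar>" using td \<delta> by (auto simp: eqs(1))
    have CL0: "0 \<le> C * L" using C0 L1 by simp
    have "\<bar>corrector (\<delta> + t) h y - corrector s h y\<bar> \<le> C * L * \<bar>\<delta> + t - s\<bar>"
      unfolding corrector_def L_def
      by (intro abs_half_diff_le heat_deriv_time_diff[OF h \<kappa>(1) k(1,4)]) auto
    also have "\<dots> \<le> C * L * (\<delta> + \<bar>D\<bar>)" by (rule mult_left_mono[OF dt CL0])
    finally have "\<bar>D\<bar> * \<bar>corrector (\<delta> + t) h y - corrector s h y\<bar> \<le> \<bar>D\<bar> * (C * L * (\<delta> + \<bar>D\<bar>))"
      by (rule mult_left_mono) simp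
    also have "\<dots> = C * L * (\<delta> * \<bar>D\<bar>) + C * L * D\<^sup>2"
      by (simp add: algebra_simps power2_eq_square)
    finally have "\<bar>D * (corrector (\<delta> + t) h y - corrector s h y)\<bar> \<le> C * L * (\<delta> * \<bar>D\<bar>) + C * L * D\<^sup>2"
      by (simp only: abs_mult)
    moreover have "?E = (heat t h (y - D / 2) - heat (s - \<theta> * D) h y - D * corrector s h y)
      - D * (corrector (\<delta> + t) h y - corrector s h y)" by (simp add: algebra_simps)
    ultimately have "\<bar>?E\<bar> \<le> 3 * (C * L) * D\<^sup>2 + (C * L * (\<delta> * \<bar>D\<bar>) + C * L * D\<^sup>2)"
      using main by linarith
    also have "\<dots> = C * (4 * L * D\<^sup>2 + L * (\<delta> * \<bar>D\<bar>))" by (simp add: algebra_simps)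
    also have "\<dots> \<le> C * (expansion_const \<kappa> \<delta> * D\<^sup>2 + L * (\<delta> * \<bar>D\<bar>))"
      using C0 \<kappa>(1) L1 by (intro mult_left_mono add_mono mult_right_mono) (auto simp: expansion_const_def L_def)
    finally show ?thesis .
  next
    case False
    have "\<bar>heat t h (y - D / 2)\<bar> \<le> C" "\<bar>heat (s - \<theta> * D) h y\<bar> \<le> C"
      using bounded_borelD(2)[OF bounded_borel_heat[OF h]] by auto
    moreover have "\<bar>corrector (\<delta> + t) h y\<bar> \<le> C * deriv_bound \<delta>"
      using bounded_borelD(2)[OF bounded_borel_corrector[OF h \<delta>, of "\<delta> + t"]] t0 by simp
    then have "\<bar>D * corrector (\<delta> + t) h y\<bar> \<le> \<bar>D\<bar> * (C * deriv_bound \<delta>)"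
      unfolding abs_mult by (rule mult_left_mono) simp
    ultimately have "\<bar>?E\<bar> \<le> 2 * C + \<bar>D\<bar> * (C * deriv_bound \<delta>)" by linarith
    also have "\<dots> = C * (2 * 1 + deriv_bound \<delta> * (\<bar>D\<bar> * 1))" by (simp add: algebra_simps)
    also have "\<dots> \<le> C * (2 * (D\<^sup>2 / \<kappa>\<^sup>2) + deriv_bound \<delta> * (\<bar>D\<bar> * (\<bar>D\<bar> / \<kappa>)))"
    proof (intro mult_left_mono add_mono C0)
      have "\<kappa>\<^sup>2 \<le> \<bar>D\<bar>\<^sup>2" using False \<kappa> by (intro power_mono) auto
      then show "1 \<le> D\<^sup>2 / \<kappa>\<^sup>2" using \<kappa> by (simp add: field_simps)
      show "1 \<le> \<bar>D\<bar> / \<kappa>" using False \<kappa> by (simp add: field_simps)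
    qed (use L1 in auto)
    also have "\<dots> = C * ((2 / \<kappa>\<^sup>2 + deriv_bound \<delta> / \<kappa>) * D\<^sup>2)"
      by (simp add: algebra_simps power2_eq_square)
    also have "\<dots> \<le> C * (expansion_const \<kappa> \<delta> * D\<^sup>2 + L * (\<delta> * \<bar>D\<bar>))"
    proof (intro mult_left_mono C0)
      have "(2 / \<kappa>\<^sup>2 + deriv_bound \<delta> / \<kappa>) * D\<^sup>2 \<le> expansion_const \<kappa> \<delta> * D\<^sup>2"
        using L1 by (intro mult_right_mono) (auto simp: expansion_const_def L_def)
      moreover have "0 \<le> L * (\<delta> * \<bar>D\<bar>)" using L1 \<delta> by simp
      ultimately show "(2 / \<kappa>\<^sup>2 + deriv_bound \<delta> / \<kappa>) * D\<^sup>2 \<le> expansion_const \<kappa> \<delta> * D\<^sup>2 + L * (\<delta> * \<bar>D\<bar>)"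
        by linarith
    qed
    finally show ?thesis .
  qed
  then show ?thesis
    by (simp only: t_def[symmetric] eqs(2,3) hc D_def[symmetric] y_def[symmetric] L_def)
qed

lemma heat_translate: "heat s (\<lambda>y. h (y + c)) x = heat s h (x + c)"
  by (simp add: heat_def algebra_simps)

lemma heat_scale: "heat s (\<lambda>y. c * h y) x = c * heat s h x"
  by (simp add: heat_def)

context correlated_brownian
begin

text \<open>The bound on \<open>I\<close> keeps the remaining time \<open>v - \<rho>\<^sup>2 I\<close> of the martingale nonnegative.\<close>

lemma step_expansion:
  fixes \<xi> :: "nat \<Rightarrow> 'a \<Rightarrow> real"
  assumes p: "0 \<le> p 0" "\<And>i. i < n \<Longrightarrow> p i < p (Suc i)"
    and \<xi>: "\<And>i. i < n \<Longrightarrow> \<xi> i \<in> borel_measurable (G (p i))"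
    and I: "\<And>\<omega>. \<omega> \<in> space M \<Longrightarrow> I \<omega> = (\<Sum>i<n. (\<xi> i \<omega>)\<^sup>2 * (p (Suc i) - p i))"
    and R: "\<And>\<omega>. \<omega> \<in> space M \<Longrightarrow> R \<omega> = (\<Sum>i<n. \<xi> i \<omega> * (B (p (Suc i)) \<omega> - B (p i) \<omega>))"
    and \<kappa>: "0 < \<kappa>" "\<kappa> \<le> (1 - \<rho>\<^sup>2) * v / 2" and Iv: "\<And>\<omega>. \<omega> \<in> space M \<Longrightarrow> I \<omega> \<le> v + \<kappa>"
    and h: "bounded_borel C h" and \<delta>: "0 < \<delta>"
  shows "\<bar>(\<integral>\<omega>. h (R \<omega> - I \<omega> / 2) \<partial>M) - heat v h (- v / 2)
      - (\<integral>\<omega>. (I \<omega> - v) * corrector \<delta> h (R \<omega> - v / 2) \<partial>M)\<bar>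
    \<le> C * (expansion_const \<kappa> \<delta> * (\<integral>\<omega>. (I \<omega> - v)\<^sup>2 \<partial>M) + deriv_bound \<kappa> * (\<delta> * (\<integral>\<omega>. \<bar>I \<omega> - v\<bar> \<partial>M)))"
proof -
  interpret prob_space M by (rule M)
  define A where "A \<omega> = (\<Sum>i<n. \<xi> i \<omega> * (W (p (Suc i)) \<omega> - W (p i) \<omega>))" for \<omega>
  define k where "k = 1 - \<rho>\<^sup>2"
  have k: "0 < k" "k \<le> 1" using \<rho>2 by (auto simp: k_def)
  have "0 < k * v" using \<kappa> unfolding k_def by linarith
  then have v0: "0 < v" using k(1) by (rule zero_less_mult_pos)
  have mono: "p i \<le> p j" if "i \<le> j" "j \<le> n" for i j
    using partition_mono[of n p i j] p(2) that by simp
  have p0: "0 \<le> p i" if "i \<le> n" for i using mono[of 0 i] that p(1) by simp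
  have subG: "subalgebra M (G t)" if "0 \<le> t" for t using filG that by (auto simp: filtration_on_def)
  have subF: "subalgebra M (F t)" if "0 \<le> t" for t using filF that by (auto simp: filtration_on_def)
  have \<xi>M: "\<xi> i \<in> borel_measurable M" if "i < n" for i
    using measurable_from_subalg[OF subG \<xi>] p0 that by simp
  have WM: "W t \<in> borel_measurable M" "W' t \<in> borel_measurable M" if "0 \<le> t" for t
    using measurable_from_subalg[OF subF[OF that]] brownian_motion_measurable[OF bm that] by auto
  have BM: "B t \<in> borel_measurable M" if "0 \<le> t" for t
    using WM[OF that] by (simp add: B_def[abs_def])
  have Im [measurable]: "I \<in> borel_measurable M"
    by (subst measurable_cong[OF I], assumption)
       (intro borel_measurable_sum borel_measurable_times borel_measurable_power \<xi>M; simp)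
  have Rm [measurable]: "R \<in> borel_measurable M"
    by (subst measurable_cong[OF R], assumption)
       (intro borel_measurable_sum borel_measurable_times borel_measurable_diff \<xi>M BM; use p0 in simp)
  have Am [measurable]: "A \<in> borel_measurable M"
    unfolding A_def[abs_def]
    by (intro borel_measurable_sum borel_measurable_times borel_measurable_diff \<xi>M WM; use p0 in simp)
  have I0: "0 \<le> I \<omega>" if "\<omega> \<in> space M" for \<omega>
    unfolding I[OF that] using p(2) by (intro sum_nonneg) (auto simp: less_imp_le)
  note hm [measurable] = bounded_borelD(1)[OF h]
  let ?G = "corrector \<delta> h"
  have Gb: "bounded_borel (C * deriv_bound \<delta>) ?G" by (rule bounded_borel_corrector[OF h \<delta> order_refl])
  note Gm [measurable] = bounded_borelD(1)[OF Gb]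
  have cond: "(\<integral>\<omega>. \<Phi> (I \<omega>, R \<omega>) \<partial>M) = (\<integral>\<omega>. heat (k * I \<omega>) (\<lambda>y. \<Phi> (I \<omega>, y)) (\<rho> * A \<omega>) \<partial>M)"
    if "\<Phi> \<in> borel_measurable (borel \<Otimes>\<^sub>M borel)" "\<And>q. \<bar>\<Phi> q\<bar> \<le> K" for \<Phi> :: "real \<times> real \<Rightarrow> real" and K
    using step_integral_conditionally_normal[OF p \<xi> that] I R
    by (simp add: A_def k_def cong: Bochner_Integration.integral_cong)
  have first: "(\<integral>\<omega>. h (R \<omega> - I \<omega> / 2) \<partial>M) = (\<integral>\<omega>. heat (k * I \<omega>) h (\<rho> * A \<omega> - I \<omega> / 2) \<partial>M)"
    using cond[of "\<lambda>q. h (snd q - fst q / 2)" C] bounded_borelD(2)[OF h]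
      heat_translate[of _ h "- I _ / 2"] by simp
  define cl where "cl i = max (- v) (min \<kappa> (i - v))" for i
  have clb: "\<bar>cl i\<bar> \<le> v + \<kappa>" for i using v0 \<kappa> by (auto simp: cl_def max_def min_def)
  have clI: "cl (I \<omega>) = I \<omega> - v" if "\<omega> \<in> space M" for \<omega>
    using I0[OF that] Iv[OF that] by (simp add: cl_def)
  have clm [measurable]: "cl \<in> borel_measurable borel" unfolding cl_def[abs_def] by measurable
  have third: "(\<integral>\<omega>. (I \<omega> - v) * ?G (R \<omega> - v / 2) \<partial>M) = (\<integral>\<omega>. (I \<omega> - v) * heat (k * I \<omega>) ?G (\<rho> * A \<omega> - v / 2) \<partial>M)"
  proof -
    have "\<bar>cl (fst q) * ?G (snd q - v / 2)\<bar> \<le> (v + \<kappa>) * (C * deriv_bound \<delta>)" for q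
      unfolding abs_mult using clb bounded_borelD(2)[OF Gb] v0 \<kappa> by (intro mult_mono) auto
    from cond[of "\<lambda>q. cl (fst q) * ?G (snd q - v / 2)", OF _ this]
    show ?thesis
      using clI heat_translate[of _ ?G "- v / 2"]
      by (simp add: heat_scale cong: Bochner_Integration.integral_cong)
  qed
  have second: "(\<integral>\<omega>. heat (v - \<rho>\<^sup>2 * I \<omega>) h (\<rho> * A \<omega> - v / 2) \<partial>M) = heat v h (- v / 2)"
  proof -
    have Z: "gaussian_increments M (\<lambda>i. F (p i)) n (\<lambda>i. p (Suc i) - p i)
        (\<lambda>i \<omega>. 1 * (W (p (Suc i)) \<omega> - W (p i) \<omega>) + 0 * (W' (p (Suc i)) \<omega> - W' (p i) \<omega>))"
      by (rule brownian_gaussian_increments[OF M filF bm p]) auto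
    have \<xi>F: "(\<lambda>\<omega>. \<rho> * \<xi> i \<omega>) \<in> borel_measurable (F (p i))" if "i < n" for i
    proof -
      have "\<xi> i \<in> borel_measurable (F (p i))"
        by (rule measurable_mono_subalgebra[OF \<xi>[OF that]])
           (use p0 that subG[of "p i"] subF[of "p i"] GF in \<open>auto simp: subalgebra_def\<close>)
      then show ?thesis by simp
    qed
    have J: "(\<Sum>i<n. (\<rho> * \<xi> i \<omega>)\<^sup>2 * (p (Suc i) - p i)) = \<rho>\<^sup>2 * I \<omega>" if "\<omega> \<in> space M" for \<omega>
      by (simp add: I[OF that] power_mult_distrib sum_distrib_left mult.assoc)
    have "\<rho>\<^sup>2 * I \<omega> \<le> v" if "\<omega> \<in> space M" for \<omega>
    proof -
      have "\<rho>\<^sup>2 * I \<omega> \<le> \<rho>\<^sup>2 * (v + \<kappa>)" using Iv[OF that] by (intro mult_left_mono) auto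
      also have "\<dots> \<le> \<rho>\<^sup>2 * v + \<kappa>" using \<kappa> \<rho>2 by (simp add: algebra_simps mult_left_le_one_le)
      also have "\<kappa> \<le> k * v" using \<kappa> k v0 by (simp add: k_def[symmetric] less_imp_le)
      finally show ?thesis by (simp add: k_def algebra_simps)
    qed
    then have "(\<Sum>i<n. (\<rho> * \<xi> i \<omega>)\<^sup>2 * (p (Suc i) - p i)) \<le> v" if "\<omega> \<in> space M" for \<omega>
      using J that by simp
    from heat_martingale[OF M Z \<xi>F this h, of "- v / 2"] J
    show ?thesis
      by (simp add: A_def sum_distrib_left mult.assoc cong: Bochner_Integration.integral_cong)
  qed
  define e where "e \<omega> = heat (k * I \<omega>) h (\<rho> * A \<omega> - I \<omega> / 2) - heat (v - \<rho>\<^sup>2 * I \<omega>) h (\<rho> * A \<omega> - v / 2)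
      - (I \<omega> - v) * heat (k * I \<omega>) ?G (\<rho> * A \<omega> - v / 2)" for \<omega>
  have hb: "\<bar>heat s h x\<bar> \<le> C" "\<bar>heat s ?G x\<bar> \<le> C * deriv_bound \<delta>" for s x
    using bounded_borelD(2)[OF bounded_borel_heat[OF h]] bounded_borelD(2)[OF bounded_borel_heat[OF Gb]] by auto
  have DI: "\<bar>I \<omega> - v\<bar> \<le> v + \<kappa>" if "\<omega> \<in> space M" for \<omega> using clb[of "I \<omega>"] clI[OF that] by simp
  have i: "integrable M (\<lambda>\<omega>. heat (k * I \<omega>) h (\<rho> * A \<omega> - I \<omega> / 2))"
    "integrable M (\<lambda>\<omega>. heat (v - \<rho>\<^sup>2 * I \<omega>) h (\<rho> * A \<omega> - v / 2))"
    using hb by (auto intro!: integrable_const_bound[where B = C])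
  have i3: "integrable M (\<lambda>\<omega>. (I \<omega> - v) * heat (k * I \<omega>) ?G (\<rho> * A \<omega> - v / 2))"
  proof (rule integrable_const_bound[where B = "(v + \<kappa>) * (C * deriv_bound \<delta>)"])
    show "AE \<omega> in M. norm ((I \<omega> - v) * heat (k * I \<omega>) ?G (\<rho> * A \<omega> - v / 2)) \<le> (v + \<kappa>) * (C * deriv_bound \<delta>)"
      using DI hb(2) v0 \<kappa> by (intro AE_I2) (auto simp: abs_mult intro!: mult_mono)
  qed measurable
  have iD: "integrable M (\<lambda>\<omega>. \<bar>I \<omega> - v\<bar>)"
    using DI by (intro integrable_const_bound[where B = "v + \<kappa>"] AE_I2) auto
  have iD2: "integrable M (\<lambda>\<omega>. (I \<omega> - v)\<^sup>2)"
  proof (rule integrable_const_bound[where B = "(v + \<kappa>)\<^sup>2"])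
    show "AE \<omega> in M. norm ((I \<omega> - v)\<^sup>2) \<le> (v + \<kappa>)\<^sup>2"
    proof (rule AE_I2)
      fix \<omega> assume "\<omega> \<in> space M"
      from DI[OF this] have "\<bar>I \<omega> - v\<bar>\<^sup>2 \<le> (v + \<kappa>)\<^sup>2" by (intro power_mono) auto
      then show "norm ((I \<omega> - v)\<^sup>2) \<le> (v + \<kappa>)\<^sup>2" by simp
    qed
  qed measurable
  let ?b = "\<lambda>\<omega>. C * (expansion_const \<kappa> \<delta> * (I \<omega> - v)\<^sup>2 + deriv_bound \<kappa> * (\<delta> * \<bar>I \<omega> - v\<bar>))"
  have "(\<integral>\<omega>. h (R \<omega> - I \<omega> / 2) \<partial>M) - heat v h (- v / 2) - (\<integral>\<omega>. (I \<omega> - v) * ?G (R \<omega> - v / 2) \<partial>M) = (\<integral>\<omega>. e \<omega> \<partial>M)"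
    unfolding first second[symmetric] third e_def using i i3 by simp
  also have "\<bar>\<dots>\<bar> \<le> (\<integral>\<omega>. \<bar>e \<omega>\<bar> \<partial>M)" by (rule integral_abs_bound)
  also have "\<dots> \<le> (\<integral>\<omega>. ?b \<omega> \<partial>M)"
  proof (rule integral_mono)
    show "integrable M (\<lambda>\<omega>. \<bar>e \<omega>\<bar>)" unfolding e_def using i i3 by (intro integrable_abs Bochner_Integration.integrable_diff)
    show "integrable M ?b" using iD iD2 by (intro integrable_mult_right Bochner_Integration.integrable_add)
    show "\<bar>e \<omega>\<bar> \<le> ?b \<omega>" if "\<omega> \<in> space M" for \<omega>
      unfolding e_def k_def
      by (rule heat_exchange[OF h _ _ \<kappa> \<delta> I0[OF that] Iv[OF that]]) (use \<rho>2 in auto)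
  qed
  also have "\<dots> = C * (expansion_const \<kappa> \<delta> * (\<integral>\<omega>. (I \<omega> - v)\<^sup>2 \<partial>M) + deriv_bound \<kappa> * (\<delta> * (\<integral>\<omega>. \<bar>I \<omega> - v\<bar> \<partial>M)))"
    using iD iD2 by simp
  finally show ?thesis .
qed

end

section \<open>Elementary integrals and their tails\<close>

text \<open>Switching the integrand off just before its energy would exceed \<open>c\<close>; the test at step \<open>i\<close>
  only involves \<open>\<xi>\<^sub>0, \<dots>, \<xi>\<^sub>i\<close>, so adaptedness survives.\<close>

definition cut_off :: "real \<Rightarrow> (nat \<Rightarrow> real) \<Rightarrow> (nat \<Rightarrow> 'a \<Rightarrow> real) \<Rightarrow> nat \<Rightarrow> 'a \<Rightarrow> real" where
  "cut_off c d \<xi> i \<omega> = (if (\<Sum>j\<le>i. (\<xi> j \<omega>)\<^sup>2 * d j) \<le> c then \<xi> i \<omega> else 0)"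

lemma cut_off_energy_le:
  assumes "0 \<le> c" "\<And>i. i < n \<Longrightarrow> 0 \<le> d i"
  shows "(\<Sum>i<n. (cut_off c d \<xi> i \<omega>)\<^sup>2 * d i) \<le> c"
  using assms(2)
proof (induction n)
  case (Suc n)
  have le: "(cut_off c d \<xi> i \<omega>)\<^sup>2 * d i \<le> (\<xi> i \<omega>)\<^sup>2 * d i" if "i \<le> n" for i
    using Suc.prems that by (auto simp: cut_off_def)
  show ?case
  proof (cases "(\<Sum>j\<le>n. (\<xi> j \<omega>)\<^sup>2 * d j) \<le> c")
    case True
    have "(\<Sum>i<Suc n. (cut_off c d \<xi> i \<omega>)\<^sup>2 * d i) \<le> (\<Sum>i<Suc n. (\<xi> i \<omega>)\<^sup>2 * d i)"
      by (intro sum_mono le) auto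
    with True show ?thesis by (simp add: lessThan_Suc_atMost)
  next
    case False
    then show ?thesis using Suc by (simp add: cut_off_def)
  qed
qed (use assms in simp)

lemma cut_off_eq:
  assumes "(\<Sum>i<n. (\<xi> i \<omega>)\<^sup>2 * d i) \<le> c" "\<And>i. i < n \<Longrightarrow> 0 \<le> d i" "i < n"
  shows "cut_off c d \<xi> i \<omega> = \<xi> i \<omega>"
proof -
  have "(\<Sum>j\<le>i. (\<xi> j \<omega>)\<^sup>2 * d j) \<le> (\<Sum>j<n. (\<xi> j \<omega>)\<^sup>2 * d j)"
    using assms by (intro sum_mono2) auto
  then show ?thesis using assms by (simp add: cut_off_def)
qed

lemma measurable_cut_off:
  assumes "\<And>j. j \<le> i \<Longrightarrow> \<xi> j \<in> borel_measurable N"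
  shows "cut_off c d \<xi> i \<in> borel_measurable N"
proof -
  have "(\<lambda>\<omega>. \<Sum>j\<le>i. (\<xi> j \<omega>)\<^sup>2 * d j) \<in> borel_measurable N"
    using assms by (intro borel_measurable_sum borel_measurable_times borel_measurable_power) auto
  note [measurable] = this assms[OF order_refl]
  show ?thesis unfolding cut_off_def[abs_def] by measurable
qed

lemma strict_enumeration:
  fixes P :: "real set"
  assumes "finite P" "P \<noteq> {}"
  shows "\<exists>m p. P = p ` {..m :: nat} \<and> (\<forall>i j. i < j \<longrightarrow> j \<le> m \<longrightarrow> p i < p j)"
proof -
  define xs where "xs = sorted_list_of_set P"
  have xs: "set xs = P" "sorted_wrt (<) xs" "xs \<noteq> []"
    using assms by (auto simp: xs_def strict_sorted_list_of_set)
  have "{..length xs - 1} = {..<length xs}" using xs(3) by (cases xs) auto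
  then have "P = (!) xs ` {..length xs - 1}"
    using xs(1) by (auto simp: set_conv_nth)
  moreover have "xs ! i < xs ! j" if "i < j" "j \<le> length xs - 1" for i j
  proof -
    have "j < length xs" using that xs(3) by (cases xs) auto
    then show ?thesis using sorted_wrt_nth_less[OF xs(2) that(1)] by simp
  qed
  ultimately show ?thesis by (intro exI[of _ "length xs - 1"] exI[of _ "(!) xs"] conjI) auto
qed

lemma partition_cell:
  fixes p :: "nat \<Rightarrow> real"
  assumes p: "\<And>i. i < m \<Longrightarrow> p i < p (Suc i)" and s: "p 0 < s" "s \<le> p m"
  shows "\<exists>i<m. \<forall>i'<m. s \<in> {p i'<..p (Suc i')} \<longleftrightarrow> i' = i"
proof -
  define j where "j = (LEAST j. s \<le> p j)"
  have j: "s \<le> p j" "j \<le> m" unfolding j_def using s by (auto intro: LeastI[of _ m] Least_le)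
  have "j \<noteq> 0" using j s by (cases j) auto
  then obtain i where ji: "j = Suc i" by (cases j) auto
  have ips: "p i < s" using not_less_Least[of i "\<lambda>j. s \<le> p j"] ji unfolding j_def by auto
  have i: "i < m" "s \<le> p (Suc i)" using j ji by auto
  have "s \<in> {p i'<..p (Suc i')} \<longleftrightarrow> i' = i" if "i' < m" for i'
  proof (cases i' i rule: linorder_cases)
    case less
    then have "p (Suc i') \<le> p i" using partition_mono[of m p "Suc i'" i] p i by simp
    then show ?thesis using ips less by auto
  next
    case greater
    then have "p (Suc i) \<le> p i'" using partition_mono[of m p "Suc i" i'] p that by simp
    then show ?thesis using i greater by auto
  qed (use ips i in auto)
  with i(1) show ?thesis by blast
qed

context correlated_brownian
begin

lemma measurable_B:
  assumes "0 \<le> t" shows "B t \<in> borel_measurable M"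
proof -
  have "subalgebra M (F t)" using filF assms by (auto simp: filtration_on_def)
  note [measurable] = measurable_from_subalg[OF this brownian_motion_measurable(1)[OF bm assms]]
    measurable_from_subalg[OF this brownian_motion_measurable(2)[OF bm assms]]
  show ?thesis unfolding B_def[abs_def] by measurable
qed

text \<open>The intervals may overlap and be listed in any order: the difference of two elementary integrals on
  different partitions is of this form. On a common refinement it becomes a transform of independent
  increments, which is cut off at energy \<open>\<eta>\<close>.\<close>

lemma elementary_integral_tail:
  fixes \<xi> :: "'k \<Rightarrow> 'a \<Rightarrow> real" and a b :: "'k \<Rightarrow> real"
  assumes K: "finite K" and ab: "\<And>k. k \<in> K \<Longrightarrow> 0 \<le> a k" "\<And>k. k \<in> K \<Longrightarrow> a k \<le> b k"
    and \<xi>: "\<And>k. k \<in> K \<Longrightarrow> \<xi> k \<in> borel_measurable (F (a k))"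
    and T: "0 < T" and \<delta>: "0 < \<delta>" "0 \<le> \<eta>"
  defines "N \<equiv> \<lambda>\<omega>. \<Sum>k\<in>K. \<xi> k \<omega> * (B (min T (b k)) \<omega> - B (min T (a k)) \<omega>)"
    and "Q \<equiv> \<lambda>\<omega>. \<integral>\<^sup>+s\<in>{0..T}. ennreal ((\<Sum>k\<in>K. \<xi> k \<omega> * indicator {a k<..b k} s)\<^sup>2) \<partial>lborel"
  shows "measure M {\<omega> \<in> space M. \<delta> \<le> \<bar>N \<omega>\<bar>} \<le> 2 * \<eta> / \<delta>\<^sup>2 + measure M {\<omega> \<in> space M. ennreal \<eta> < Q \<omega>}"
proof -
  interpret prob_space M by (rule M)
  define P where "P = {0, T} \<union> (\<lambda>k. min T (a k)) ` K \<union> (\<lambda>k. min T (b k)) ` K"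
  have "finite P" "P \<noteq> {}" using K by (auto simp: P_def)
  from strict_enumeration[OF this] obtain m :: nat
    where "\<exists>p. P = p ` {..m} \<and> (\<forall>i j. i < j \<longrightarrow> j \<le> m \<longrightarrow> p i < p j)" by (rule exE)
  then obtain p where pP': "P = p ` {..m} \<and> (\<forall>i j. i < j \<longrightarrow> j \<le> m \<longrightarrow> p i < p j)" by (rule exE)
  note pP = conjunct1[OF pP'] and plt = conjunct2[OF pP', rule_format]
  have PT: "q \<in> P \<Longrightarrow> 0 \<le> q \<and> q \<le> T" for q
    using T ab(1) order_trans[OF ab(1) ab(2)] by (auto simp: P_def min_def)
  have pT: "0 \<le> p i" "p i \<le> T" if "i \<le> m" for i using PT[of "p i"] that pP by auto
  have pss: "p i < p (Suc i)" if "i < m" for i using plt[of i "Suc i"] that by simp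
  have ple: "p i < p j \<longleftrightarrow> i < j" if "i \<le> m" "j \<le> m" for i j
    using plt[of i j] plt[of j i] that by (cases i j rule: linorder_cases) auto
  have p0: "p 0 = 0"
  proof -
    have "0 \<in> p ` {..m}" unfolding pP[symmetric] by (simp add: P_def)
    then obtain i where i: "i \<le> m" "p i = 0" by auto
    show ?thesis
    proof (cases "i = 0")
      case False
      then show ?thesis using plt[of 0 i] i pT(1)[of 0] by linarith
    qed (use i in simp)
  qed
  have pm: "p m = T"
  proof -
    have "T \<in> p ` {..m}" unfolding pP[symmetric] by (simp add: P_def)
    then obtain i where i: "i \<le> m" "p i = T" by auto
    show ?thesis
    proof (cases "i = m")
      case False
      then show ?thesis using plt[of i m] i pT(2)[of m] by linarith
    qed (use i in simp)
  qed
  \<comment> \<open>no point of the grid separates two points of the same cell\<close>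
  have cell: "q < s \<longleftrightarrow> q < p (Suc i)" 
    if qi: "q \<in> P" "i < m" "p i < s" "s \<le> p (Suc i)" for q s i
  proof
    assume "q < p (Suc i)"
    obtain j where j: "j \<le> m" "q = p j" using pP qi(1) by auto
    then have "j < Suc i" using ple[of j "Suc i"] \<open>q < p (Suc i)\<close> qi(2) by simp
    then have "q \<le> p i" using ple[of i j] j qi(2) by (simp add: not_less[symmetric])
    then show "q < s" using qi by simp
  qed (use qi in auto)
  have inP: "min T (a k) \<in> P" "min T (b k) \<in> P" if "k \<in> K" for k using that by (auto simp: P_def)
  have ind: "indicator {a k<..b k} s = (indicator {a k<..b k} (p (Suc i)) :: real)"
    if "k \<in> K" "i < m" "p i < s" "s \<le> p (Suc i)" for k i s
  proof -
    have "p (Suc i) \<le> T" using pT that by simp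
    then have "a k < s \<longleftrightarrow> a k < p (Suc i)" "b k < s \<longleftrightarrow> b k < p (Suc i)"
      using cell[OF inP(1)[OF that(1)] that(2-4)] cell[OF inP(2)[OF that(1)] that(2-4)] that(4) by auto
    then show ?thesis by (simp add: indicator_def not_less[symmetric])
  qed
  define \<zeta> where "\<zeta> i \<omega> = (\<Sum>k\<in>K. \<xi> k \<omega> * indicator {a k<..b k} (p (Suc i)))" for i \<omega>
  define d where "d i = p (Suc i) - p i" for i
  have d0: "0 \<le> d i" if "i < m" for i using pss[OF that] by (simp add: d_def)
  have subF: "subalgebra M (F t)" if "0 \<le> t" for t using filF that by (auto simp: filtration_on_def)
  have \<zeta>m: "\<zeta> i \<in> borel_measurable (F (p i))" if i: "i < m" for i
    unfolding \<zeta>_def[abs_def]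
  proof (rule borel_measurable_sum)
    fix k assume k: "k \<in> K"
    show "(\<lambda>\<omega>. \<xi> k \<omega> * indicator {a k<..b k} (p (Suc i))) \<in> borel_measurable (F (p i))"
    proof (cases "a k < p (Suc i)")
      case True
      have "p (Suc i) \<le> T" using pT i by simp
      then have ak: "a k \<in> P" using inP(1)[OF k] True by simp
      then obtain j where j: "j \<le> m" "a k = p j" using pP by auto
      then have "j < Suc i" using ple[of j "Suc i"] True i by simp
      then have "a k \<le> p i" using ple[of i j] j i by (simp add: not_less[symmetric])
      then have "\<xi> k \<in> borel_measurable (F (p i))"
        using measurable_from_subalg[OF _ \<xi>[OF k], of "F (p i)"] filF ab(1)[OF k] by (auto simp: filtration_on_def)
      then show ?thesis by simp
    qed simp
  qed
  have telescope: "B (min T (b k)) \<omega> - B (min T (a k)) \<omega>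
      = (\<Sum>i<m. indicator {a k<..b k} (p (Suc i)) * (B (p (Suc i)) \<omega> - B (p i) \<omega>))" if k: "k \<in> K" for k \<omega>
  proof -
    obtain j l where j: "j \<le> m" "min T (a k) = p j" and l: "l \<le> m" "min T (b k) = p l"
      using inP[OF k] pP by auto
    have "p j \<le> p l" using ab(2)[OF k] j l by (auto simp flip: j(2) l(2))
    then have jl: "j \<le> l" using ple[of l j] j l by (simp add: not_less[symmetric])
    have i: "indicator {a k<..b k} (p (Suc i)) = (if i \<in> {j..<l} then 1 else 0 :: real)" if "i < m" for i
    proof -
      have pt: "p (Suc i) \<le> T" using pT that by simp
      have "a k < p (Suc i) \<longleftrightarrow> min T (a k) < p (Suc i)" using pt by auto
      also have "\<dots> \<longleftrightarrow> j < Suc i" unfolding j(2) using ple j that by simp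
      finally have 1: "a k < p (Suc i) \<longleftrightarrow> j \<le> i" by (simp only: less_Suc_eq_le)
      have "b k < p (Suc i) \<longleftrightarrow> min T (b k) < p (Suc i)" using pt by auto
      also have "\<dots> \<longleftrightarrow> l < Suc i" unfolding l(2) using ple l that by simp
      finally have 2: "p (Suc i) \<le> b k \<longleftrightarrow> i < l" by (auto simp: not_less[symmetric] less_Suc_eq_le)
      from 1 2 show ?thesis by (simp add: indicator_def)
    qed
    have "(\<Sum>i<m. indicator {a k<..b k} (p (Suc i)) * (B (p (Suc i)) \<omega> - B (p i) \<omega>))
      = (\<Sum>i<m. if i \<in> {j..<l} then B (p (Suc i)) \<omega> - B (p i) \<omega> else 0)"
      using i by (intro sum.cong) auto
    also have "\<dots> = (\<Sum>i\<in>{j..<l}. B (p (Suc i)) \<omega> - B (p i) \<omega>)"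
      using l(1) by (subst sum.inter_restrict[symmetric]) (auto intro!: sum.cong)
    also have "\<dots> = B (p l) \<omega> - B (p j) \<omega>" using jl by (rule sum_Suc_diff')
    finally show ?thesis using j l by simp
  qed
  have N: "N \<omega> = (\<Sum>i<m. \<zeta> i \<omega> * (B (p (Suc i)) \<omega> - B (p i) \<omega>))" for \<omega>
  proof -
    have "N \<omega> = (\<Sum>k\<in>K. \<Sum>i<m. \<xi> k \<omega> * indicator {a k<..b k} (p (Suc i)) * (B (p (Suc i)) \<omega> - B (p i) \<omega>))"
      unfolding N_def by (intro sum.cong refl) (simp only: telescope sum_distrib_left mult.assoc)
    also have "\<dots> = (\<Sum>i<m. \<zeta> i \<omega> * (B (p (Suc i)) \<omega> - B (p i) \<omega>))"
      by (subst sum.swap) (simp only: \<zeta>_def sum_distrib_right)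
    finally show ?thesis .
  qed
  define J where "J \<omega> = (\<Sum>i<m. (\<zeta> i \<omega>)\<^sup>2 * d i)" for \<omega>
  have Q: "Q \<omega> = ennreal (J \<omega>)" for \<omega>
  proof -
    have pt: "ennreal ((\<Sum>k\<in>K. \<xi> k \<omega> * indicator {a k<..b k} s)\<^sup>2) * indicator {0..T} s
      = (\<Sum>i<m. ennreal ((\<zeta> i \<omega>)\<^sup>2) * indicator {p i<..p (Suc i)} s)" for s
    proof (cases "0 < s \<and> s \<le> T")
      case True
      then obtain i where i: "i < m" "\<And>i'. i' < m \<Longrightarrow> s \<in> {p i'<..p (Suc i')} \<longleftrightarrow> i' = i"
        using partition_cell[of m p s] pss p0 pm by auto
      then have ips: "p i < s" "s \<le> p (Suc i)" by auto
      have "indicator {p i'<..p (Suc i')} s = (if i' = i then 1 else 0 :: ennreal)" if "i' < m" for i'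
        using i(2)[OF that] by (simp only: indicator_def of_bool_def)
      then have "(\<Sum>i<m. ennreal ((\<zeta> i \<omega>)\<^sup>2) * indicator {p i<..p (Suc i)} s)
        = (\<Sum>i'<m. if i' = i then ennreal ((\<zeta> i' \<omega>)\<^sup>2) else 0)" by (intro sum.cong) auto
      also have "\<dots> = ennreal ((\<zeta> i \<omega>)\<^sup>2)" using i by simp
      also have "\<zeta> i \<omega> = (\<Sum>k\<in>K. \<xi> k \<omega> * indicator {a k<..b k} s)"
        unfolding \<zeta>_def by (intro sum.cong refl) (simp add: ind[OF _ i(1) ips])
      finally show ?thesis using True by simp
    next
      case False
      have "(\<Sum>i<m. ennreal ((\<zeta> i \<omega>)\<^sup>2) * indicator {p i<..p (Suc i)} s) = 0"
      proof (intro sum.neutral ballI)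
        fix i assume "i \<in> {..<m}"
        then have "s \<notin> {p i<..p (Suc i)}" using False pT[of i] pT[of "Suc i"] by auto
        then show "ennreal ((\<zeta> i \<omega>)\<^sup>2) * indicator {p i<..p (Suc i)} s = 0" by simp
      qed
      moreover have "indicator {0..T} s = (0 :: ennreal) \<or> (\<Sum>k\<in>K. \<xi> k \<omega> * indicator {a k<..b k} s) = 0"
      proof (cases "s = 0")
        case True
        then have "(\<Sum>k\<in>K. \<xi> k \<omega> * indicator {a k<..b k} s) = 0"
          using ab(1) by (intro sum.neutral) (auto simp: indicator_def not_less)
        then show ?thesis by simp
      qed (use False in auto)
      ultimately show ?thesis by auto
    qed
    have "Q \<omega> = (\<Sum>i<m. ennreal ((\<zeta> i \<omega>)\<^sup>2) * ennreal (d i))"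
      unfolding Q_def pt
      by (subst nn_integral_sum) (auto simp: nn_integral_cmult_indicator d_def pss less_imp_le intro!: sum.cong)
    also have "\<dots> = (\<Sum>i<m. ennreal ((\<zeta> i \<omega>)\<^sup>2 * d i))"
      using d0 by (intro sum.cong) (auto simp: ennreal_mult)
    also have "\<dots> = ennreal (J \<omega>)" unfolding J_def using d0 by (intro sum_ennreal) auto
    finally show ?thesis .
  qed
  have up: "f \<in> borel_measurable M" if "f \<in> borel_measurable (F (p i))" "i \<le> m" for f :: "'a \<Rightarrow> real" and i
    by (rule measurable_from_subalg[OF subF that(1)]) (use pT that in auto)
  have Bm: "B (p i) \<in> borel_measurable M" if "i \<le> m" for i using measurable_B pT that by simp
  have \<zeta>M: "\<zeta> i \<in> borel_measurable M" if "i < m" for i using up[OF \<zeta>m[OF that]] that by simp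
  have Jm [measurable]: "J \<in> borel_measurable M"
    unfolding J_def[abs_def] using \<zeta>M by (intro borel_measurable_sum borel_measurable_times borel_measurable_power) auto
  have Nm [measurable]: "N \<in> borel_measurable M"
    unfolding N[abs_def] using \<zeta>M Bm by (intro borel_measurable_sum borel_measurable_times borel_measurable_diff) auto
  define \<zeta>' where "\<zeta>' = cut_off \<eta> d \<zeta>"
  have mono: "p i \<le> p j" if "i \<le> j" "j \<le> m" for i j using plt[of i j] that by (cases "i = j") auto
  have \<zeta>'m: "\<zeta>' i \<in> borel_measurable (F (p i))" if i: "i < m" for i
    unfolding \<zeta>'_def
  proof (rule measurable_cut_off)
    fix j assume "j \<le> i"
    then show "\<zeta> j \<in> borel_measurable (F (p i))"
      using measurable_from_subalg[OF _ \<zeta>m, of "F (p i)" j] filF i mono pT by (auto simp: filtration_on_def)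
  qed
  have \<zeta>'M: "\<zeta>' i \<in> borel_measurable M" if "i < m" for i using up[OF \<zeta>'m[OF that]] that by simp
  define N' where "N' \<omega> = (\<Sum>i<m. \<zeta>' i \<omega> * (B (p (Suc i)) \<omega> - B (p i) \<omega>))" for \<omega>
  have N'm [measurable]: "N' \<in> borel_measurable M"
    unfolding N'_def[abs_def] using \<zeta>'M Bm by (intro borel_measurable_sum borel_measurable_times borel_measurable_diff) auto
  have Z: "gaussian_increments M (\<lambda>i. F (p i)) m d (\<lambda>i \<omega>. B (p (Suc i)) \<omega> - B (p i) \<omega>)"
    using brownian_gaussian_increments[OF M filF bm _ _ \<rho>2(2), of p m] p0 pss
    by (simp add: increment_B d_def[abs_def])
  have tail': "measure M {\<omega> \<in> space M. \<delta> \<le> \<bar>N' \<omega>\<bar>} \<le> 2 * \<eta> / \<delta>\<^sup>2"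
    unfolding N'_def
  proof (rule gaussian_transform_tail[OF M Z \<zeta>'m _ \<delta>])
    show "(\<Sum>i<m. (\<zeta>' i \<omega>)\<^sup>2 * d i) \<le> \<eta>" for \<omega>
      unfolding \<zeta>'_def by (rule cut_off_energy_le[OF \<delta>(2) d0])
    show "(\<lambda>\<omega>. \<Sum>i<m. \<zeta>' i \<omega> * (B (p (Suc i)) \<omega> - B (p i) \<omega>)) \<in> borel_measurable M"
      using N'm by (simp add: N'_def[abs_def])
    show "(\<lambda>\<omega>. \<Sum>i<m. (\<zeta>' i \<omega>)\<^sup>2 * d i) \<in> borel_measurable M"
      using \<zeta>'M by (intro borel_measurable_sum borel_measurable_times borel_measurable_power) auto
  qed
  have "N \<omega> = N' \<omega>" if "J \<omega> \<le> \<eta>" for \<omega>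
    unfolding N N'_def \<zeta>'_def using that d0
    by (intro sum.cong refl) (simp add: cut_off_eq[where n = m] J_def)
  then have "{\<omega> \<in> space M. \<delta> \<le> \<bar>N \<omega>\<bar>} \<subseteq> {\<omega> \<in> space M. \<delta> \<le> \<bar>N' \<omega>\<bar>} \<union> {\<omega> \<in> space M. \<eta> < J \<omega>}"
    by (auto simp: not_less[symmetric])
  then have "measure M {\<omega> \<in> space M. \<delta> \<le> \<bar>N \<omega>\<bar>} \<le> measure M ({\<omega> \<in> space M. \<delta> \<le> \<bar>N' \<omega>\<bar>} \<union> {\<omega> \<in> space M. \<eta> < J \<omega>})"
    by (intro finite_measure_mono) auto
  also have "\<dots> \<le> measure M {\<omega> \<in> space M. \<delta> \<le> \<bar>N' \<omega>\<bar>} + measure M {\<omega> \<in> space M. \<eta> < J \<omega>}"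
    by (rule measure_Un_le) auto
  also have "{\<omega> \<in> space M. \<eta> < J \<omega>} = {\<omega> \<in> space M. ennreal \<eta> < Q \<omega>}"
    using \<delta> by (auto simp: Q ennreal_less_iff)
  finally show ?thesis using tail' by simp
qed

end

section \<open>Left-endpoint approximation of cadlag paths\<close>

lemma cadlag_bounded:
  assumes z: "cadlag z"
  shows "\<exists>K. \<forall>s\<in>{0..T}. \<bar>z s\<bar> \<le> K"
proof (cases "0 \<le> T")
  case True
  define bd where "bd a b \<longleftrightarrow> (\<exists>K. \<forall>s. a \<le> s \<and> s \<le> b \<and> 0 \<le> s \<longrightarrow> \<bar>z s\<bar> \<le> K)" for a b
  have "bd 0 T"
    using True
  proof (induction rule: Bolzano)
    case (trans a b c)
    from \<open>bd a b\<close> obtain K where K: "\<forall>s. a \<le> s \<and> s \<le> b \<and> 0 \<le> s \<longrightarrow> \<bar>z s\<bar> \<le> K"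
      unfolding bd_def by (rule exE)
    from \<open>bd b c\<close> obtain K' where K': "\<forall>s. b \<le> s \<and> s \<le> c \<and> 0 \<le> s \<longrightarrow> \<bar>z s\<bar> \<le> K'"
      unfolding bd_def by (rule exE)
    have "\<bar>z s\<bar> \<le> max K K'" if "a \<le> s" "s \<le> c" "0 \<le> s" for s
      using K[rule_format, of s] K'[rule_format, of s] that by (cases "s \<le> b") auto
    then show ?case unfolding bd_def by blast
  next
    case (local x)
    have "(z \<longlongrightarrow> z x) (at_right x)" using z local by (simp add: cadlag_def)
    from tendstoD[OF this zero_less_one] obtain d1 where d1: "0 < d1" "\<And>s. x < s \<Longrightarrow> s < x + d1 \<Longrightarrow> dist (z s) (z x) < 1"
      unfolding eventually_at_right_field by (metis add.commute diff_add_cancel diff_gt_0_iff_gt)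
    obtain d2 l where d2: "0 < d2" "\<And>s. 0 \<le> s \<Longrightarrow> x - d2 < s \<Longrightarrow> s < x \<Longrightarrow> dist (z s) l < 1"
    proof (cases "x = 0")
      case True
      show ?thesis by (rule that[of 1 0]) (use True in auto)
    next
      case False
      then have "0 < x" using local by simp
      then have "\<exists>l. (z \<longlongrightarrow> l) (at_left x)" using z by (simp add: cadlag_def)
      then obtain l where l: "(z \<longlongrightarrow> l) (at_left x)" by (rule exE)
      from tendstoD[OF l zero_less_one] obtain c where c: "c < x" "\<And>s. c < s \<Longrightarrow> s < x \<Longrightarrow> dist (z s) l < 1"
        unfolding eventually_at_left_field by blast
      show ?thesis by (rule that[of "x - c" l]) (use c in auto)
    qed
    show ?case
    proof (intro exI[of _ "min d1 d2"] conjI allI impI)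
      fix a b assume ab: "a \<le> x \<and> x \<le> b \<and> b - a < min d1 d2"
      have "\<bar>z s\<bar> \<le> \<bar>z x\<bar> + \<bar>l\<bar> + 1" if "a \<le> s \<and> s \<le> b \<and> 0 \<le> s" for s
        using d1(2)[of s] d2(2)[of s] that ab by (cases s x rule: linorder_cases) (auto simp: dist_real_def)
      then show "bd a b" unfolding bd_def by blast
    qed (use d1 d2 in auto)
  qed
  then obtain K where "\<forall>s. 0 \<le> s \<and> s \<le> T \<and> 0 \<le> s \<longrightarrow> \<bar>z s\<bar> \<le> K" unfolding bd_def by (rule exE)
  then show ?thesis by (intro exI[of _ K]) simp
qed auto

definition grid :: "real \<Rightarrow> nat \<Rightarrow> nat \<Rightarrow> real" where
  "grid T k i = T * real i / real (Suc k)"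

lemma grid_simps:
  "grid T k 0 = 0" "grid T k (Suc k) = T" "grid T k (Suc i) - grid T k i = T / real (Suc k)"
proof -
  show "grid T k 0 = 0" by (simp add: grid_def)
  show "grid T k (Suc k) = T" by (simp add: grid_def del: of_nat_Suc)
  have "T * real (Suc i) - T * real i = T" by (simp add: algebra_simps)
  then show "grid T k (Suc i) - grid T k i = T / real (Suc k)"
    unfolding grid_def diff_divide_distrib[symmetric] by simp
qed

lemma grid_less: "0 < T \<Longrightarrow> grid T k i < grid T k (Suc i)"
  by (simp add: grid_def divide_strict_right_mono)

lemma grid_nonneg: "0 < T \<Longrightarrow> 0 \<le> grid T k i"
  by (simp add: grid_def)

lemma grid_le: "0 < T \<Longrightarrow> i \<le> Suc k \<Longrightarrow> grid T k i \<le> T"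
  using partition_mono[of "Suc k" "grid T k" i "Suc k"] grid_less[of T k] by (simp add: grid_simps)

definition grid_step :: "real \<Rightarrow> (real \<Rightarrow> real) \<Rightarrow> nat \<Rightarrow> real \<Rightarrow> real" where
  "grid_step T z k s = (\<Sum>i<Suc k. z (grid T k i) * indicator {grid T k i<..grid T k (Suc i)} s)"

lemma grid_step_0: "0 < T \<Longrightarrow> s \<le> 0 \<Longrightarrow> grid_step T z k s = 0"
  unfolding grid_step_def
proof (intro sum.neutral ballI)
  fix i assume "0 < T" "s \<le> 0"
  then have "s \<le> grid T k i" using grid_nonneg[of T k i] by simp
  then show "z (grid T k i) * indicator {grid T k i<..grid T k (Suc i)} s = 0" by simp
qed

lemma grid_step_eq:
  assumes T: "0 < T" and s: "0 < s" "s \<le> T"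
  shows "\<exists>i<Suc k. grid T k i < s \<and> s \<le> grid T k (Suc i) \<and> (\<forall>z. grid_step T z k s = z (grid T k i))"
proof -
  obtain i where i: "i < Suc k" "\<And>i'. i' < Suc k \<Longrightarrow> s \<in> {grid T k i'<..grid T k (Suc i')} \<longleftrightarrow> i' = i"
    using partition_cell[of "Suc k" "grid T k" s] grid_less[OF T] s by (auto simp: grid_simps)
  have "grid_step T z k s = (\<Sum>i'<Suc k. if i' = i then z (grid T k i') else 0)" for z
    unfolding grid_step_def
  proof (rule sum.cong)
    fix i' assume "i' \<in> {..<Suc k}"
    then have "indicator {grid T k i'<..grid T k (Suc i')} s = (if i' = i then 1 else 0 :: real)"
      using i(2)[of i'] by (simp only: indicator_def of_bool_def lessThan_iff)
    then show "z (grid T k i') * indicator {grid T k i'<..grid T k (Suc i')} s = (if i' = i then z (grid T k i') else 0)"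
      by simp
  qed simp
  then have "grid_step T z k s = z (grid T k i)" for z using i(1) by (simp del: sum.lessThan_Suc)
  with i show ?thesis by (metis greaterThanAtMost_iff)
qed

lemma grid_step_measurable [measurable]: "grid_step T z k \<in> borel_measurable borel"
  unfolding grid_step_def[abs_def] by measurable

text \<open>Translating time by the mesh moves the left end points of the grid to the right of the
  point that they approximate, where right continuity applies.\<close>

lemma cadlag_grid_step_L1:
  fixes z y :: "real \<Rightarrow> real"
  assumes T: "0 < T" and z: "cadlag z" and y [measurable]: "y \<in> borel_measurable borel"
    and yz: "\<And>s. s \<in> {0..T} \<Longrightarrow> y s = z s"
  shows "integrable lborel (\<lambda>s. \<bar>grid_step T z k s - y s\<bar> * indicator {0..T} s)"
    and "(\<lambda>k. \<integral>s. \<bar>grid_step T z k s - y s\<bar> * indicator {0..T} s \<partial>lborel) \<longlonglongrightarrow> 0"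
proof -
  obtain K where K': "\<forall>s\<in>{0..T}. \<bar>z s\<bar> \<le> K" using cadlag_bounded[OF z, of T] by blast
  note K = bspec[OF K']
  have K0: "0 \<le> K" using K[of 0] T by auto
  define e where "e k s = \<bar>grid_step T z k s - y s\<bar> * indicator {0..T} s" for k s
  have e0: "e k s = 0" if "s < 0 \<or> T < s" for k s using that by (auto simp: e_def)
  have eb: "\<bar>e k s\<bar> \<le> 2 * K * indicator {0..T} s" for k s
  proof (cases "s \<in> {0..T}")
    case True
    have "\<bar>grid_step T z k s\<bar> \<le> K"
    proof (cases "s = 0")
      case False
      then obtain i where i: "i < Suc k" "grid_step T z k s = z (grid T k i)"
        using grid_step_eq[OF T, of s k] True by auto
      then show ?thesis using K[of "grid T k i"] grid_nonneg[OF T] grid_le[OF T, of i k] by simp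
    qed (use grid_step_0[OF T] K0 in simp)
    moreover have "\<bar>y s\<bar> \<le> K" using K[OF True] yz[OF True] by simp
    ultimately show ?thesis using True by (simp add: e_def)
  qed (use K0 in \<open>simp add: e_def\<close>)
  have em [measurable]: "e k \<in> borel_measurable borel" for k unfolding e_def[abs_def] by measurable
  have int_ind: "integrable lborel (\<lambda>s. c * indicator {a..b} s :: real)" for a b c :: real
    by (intro integrable_mult_right integrable_real_indicator) (auto simp: emeasure_lborel_Icc_eq)
  show "integrable lborel (\<lambda>s. \<bar>grid_step T z k s - y s\<bar> * indicator {0..T} s)"
    unfolding e_def[symmetric]
  proof (rule Bochner_Integration.integrable_bound[OF int_ind[of "2 * K" 0 T]])
    show "AE s in lborel. norm (e k s) \<le> norm (2 * K * indicator {0..T} s :: real)"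
      using eb[of k] by (intro AE_I2) (auto intro: order_trans[OF _ abs_ge_self])
  qed simp
  let ?\<Delta> = "\<lambda>k. T / real (Suc k)"
  have \<Delta>: "?\<Delta> \<longlonglongrightarrow> 0" using LIMSEQ_Suc[OF lim_const_over_n[of T]] by simp
  have \<Delta>T: "?\<Delta> k \<le> T" "0 < ?\<Delta> k" for k using T by (auto simp: field_simps)
  have lim: "(\<lambda>k. e k (?\<Delta> k + 1 * s)) \<longlonglongrightarrow> 0" if s: "s \<noteq> 0" "s \<noteq> T" for s
  proof -
    consider "s < 0" | "T < s" | "0 < s" "s < T" using s by linarith
    then show ?thesis
    proof cases
      case 1
      have "eventually (\<lambda>k. ?\<Delta> k < - s) sequentially" using order_tendstoD(2)[OF \<Delta>, of "- s"] 1 by simp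
      then show ?thesis by (intro tendsto_eventually) (auto elim!: eventually_mono intro!: e0)
    next
      case 2
      have "T < ?\<Delta> k + 1 * s" for k using 2 \<Delta>T(2)[of k] by linarith
      then show ?thesis using e0 by simp
    next
      case 3
      show ?thesis
      proof (rule LIMSEQ_I)
        fix r :: real assume r: "0 < r"
        have "(z \<longlongrightarrow> z s) (at_right s)" using z 3 by (simp add: cadlag_def)
        from tendstoD[OF this, of "r / 2"] r obtain b where b: "s < b" "\<And>u. s < u \<Longrightarrow> u < b \<Longrightarrow> dist (z u) (z s) < r / 2"
          unfolding eventually_at_right_field by auto
        have near: "\<bar>z u - z s\<bar> < r / 2" if "s \<le> u" "u < b" for u
          using b(2)[of u] that r by (cases "u = s") (auto simp: dist_real_def)
        have "eventually (\<lambda>k. ?\<Delta> k < min (b - s) (T - s)) sequentially"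
          using order_tendstoD(2)[OF \<Delta>, of "min (b - s) (T - s)"] b 3 by simp
        then obtain N where N: "\<And>k. N \<le> k \<Longrightarrow> ?\<Delta> k < min (b - s) (T - s)" by (auto simp: eventually_sequentially)
        show "\<exists>no. \<forall>n\<ge>no. norm (e n (?\<Delta> n + 1 * s) - 0) < r"
        proof (intro exI allI impI)
          fix k assume "N \<le> k"
          note Nk = N[OF this]
          let ?u = "?\<Delta> k + 1 * s"
          have u: "0 < ?u" "?u \<le> T" "s \<le> ?u" "?u < b" using Nk 3 \<Delta>T(2)[of k] by linarith+
          obtain i where i: "i < Suc k" "grid T k i < ?u" "?u \<le> grid T k (Suc i)"
            "grid_step T z k ?u = z (grid T k i)"
            using grid_step_eq[OF T u(1,2)] by blast
          have gs: "grid T k (Suc i) - grid T k i = ?\<Delta> k" by (rule grid_simps)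
          have "s \<le> grid T k i" "grid T k i < b" using i(2,3) gs u by linarith+
          then have "\<bar>z (grid T k i) - z s\<bar> < r / 2" "\<bar>z ?u - z s\<bar> < r / 2" using near u by auto
          moreover have "y ?u = z ?u" by (rule yz) (use u in auto)
          ultimately have "\<bar>grid_step T z k ?u - y ?u\<bar> < r" using i(4) by linarith
          then show "norm (e k ?u - 0) < r" using u by (simp add: e_def)
        qed
      qed
    qed
  qed
  have "(\<lambda>k. \<integral>s. e k (?\<Delta> k + 1 * s) \<partial>lborel) \<longlonglongrightarrow> (\<integral>s. 0 \<partial>(lborel :: real measure))"
  proof (rule integral_dominated_convergence[where w = "\<lambda>s. 2 * K * indicator {- T..T} s"])
    show "AE s in lborel. (\<lambda>k. e k (?\<Delta> k + 1 * s)) \<longlonglongrightarrow> 0"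
      using AE_lborel_singleton[of 0] AE_lborel_singleton[of T] by eventually_elim (use lim in auto)
    show "AE s in lborel. norm (e k (?\<Delta> k + 1 * s)) \<le> 2 * K * indicator {- T..T} s" for k
    proof (rule AE_I2)
      fix s :: real
      have "(indicator {0..T} (?\<Delta> k + 1 * s) :: real) \<le> indicator {- T..T} s"
        using \<Delta>T[of k] by (auto simp: indicator_def)
      then have "2 * K * indicator {0..T} (?\<Delta> k + 1 * s) \<le> 2 * K * indicator {- T..T} s"
        using K0 by (intro mult_left_mono) auto
      with eb[of k "?\<Delta> k + 1 * s"] show "norm (e k (?\<Delta> k + 1 * s)) \<le> 2 * K * indicator {- T..T} s"
        unfolding real_norm_def by (rule order_trans)
    qed
  qed (use int_ind in auto)
  moreover have "(\<integral>s. e k (?\<Delta> k + 1 * s) \<partial>lborel) = (\<integral>s. e k s \<partial>lborel)" for k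
    using lborel_integral_real_affine[of 1 "e k" "?\<Delta> k"] by simp
  ultimately show "(\<lambda>k. \<integral>s. \<bar>grid_step T z k s - y s\<bar> * indicator {0..T} s \<partial>lborel) \<longlonglongrightarrow> 0"
    by (simp add: e_def[symmetric])
qed

lemma cadlag_riemann_sum:
  fixes z y :: "real \<Rightarrow> real"
  assumes T: "0 < T" and z: "cadlag z" and y [measurable]: "y \<in> borel_measurable borel"
    and yz: "\<And>s. s \<in> {0..T} \<Longrightarrow> y s = z s"
  shows "(\<lambda>k. \<Sum>i<Suc k. z (grid T k i) * (grid T k (Suc i) - grid T k i)) \<longlonglongrightarrow> (LBINT s:{0..T}. z s)"
proof -
  obtain K where K': "\<forall>s\<in>{0..T}. \<bar>z s\<bar> \<le> K" using cadlag_bounded[OF z, of T] by blast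
  note K = bspec[OF K']
  have K0: "0 \<le> K" using K[of 0] T by auto
  have iy: "integrable lborel (\<lambda>s. y s * indicator {0..T} s)"
  proof (rule Bochner_Integration.integrable_bound)
    show "integrable lborel (\<lambda>s. K * indicator {0..T} s :: real)"
      by (intro integrable_mult_right integrable_real_indicator) (auto simp: emeasure_lborel_Icc_eq)
    show "AE s in lborel. norm (y s * indicator {0..T} s) \<le> norm (K * indicator {0..T} s :: real)"
    proof (rule AE_I2)
      fix s show "norm (y s * indicator {0..T} s) \<le> norm (K * indicator {0..T} s :: real)"
        using yz[of s] K[of s] K0 by (cases "s \<in> {0..T}") auto
    qed
  qed auto
  have g: "has_bochner_integral lborel (\<lambda>s. grid_step T z k s * indicator {0..T} s)
      (\<Sum>i<Suc k. z (grid T k i) * (grid T k (Suc i) - grid T k i))" for k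
  proof -
    have "has_bochner_integral lborel (grid_step T z k) (\<Sum>i<Suc k. z (grid T k i) * (grid T k (Suc i) - grid T k i))"
      unfolding grid_step_def[abs_def]
    proof (intro has_bochner_integral_sum has_bochner_integral_mult_right)
      fix i
      show "has_bochner_integral lborel (indicator {grid T k i<..grid T k (Suc i)}) (grid T k (Suc i) - grid T k i)"
        using has_bochner_integral_real_indicator[of "{grid T k i<..grid T k (Suc i)}" lborel] grid_less[OF T, of k i]
        by (simp add: measure_def)
    qed
    moreover have "grid_step T z k s * indicator {0..T} s = grid_step T z k s" for s
    proof (cases "s \<le> 0 \<or> s \<le> T")
      case True
      then show ?thesis using grid_step_0[OF T, of s z k] by (cases "s \<le> 0") auto
    next
      case False
      have "grid_step T z k s = 0" unfolding grid_step_def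
      proof (intro sum.neutral ballI)
        fix i assume "i \<in> {..<Suc k}"
        then have "grid T k (Suc i) < s" using grid_le[OF T, of "Suc i" k] False by simp
        then show "z (grid T k i) * indicator {grid T k i<..grid T k (Suc i)} s = 0" by simp
      qed
      then show ?thesis by simp
    qed
    ultimately show ?thesis by (simp only:)
  qed
  have eq: "(LBINT s:{0..T}. z s) = (\<integral>s. y s * indicator {0..T} s \<partial>lborel)"
    unfolding set_lebesgue_integral_def
    by (intro Bochner_Integration.integral_cong) (auto simp: indicator_def yz)
  have "\<bar>(\<Sum>i<Suc k. z (grid T k i) * (grid T k (Suc i) - grid T k i)) - (LBINT s:{0..T}. z s)\<bar>
      \<le> (\<integral>s. \<bar>grid_step T z k s - y s\<bar> * indicator {0..T} s \<partial>lborel)" for k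
  proof -
    have "(\<Sum>i<Suc k. z (grid T k i) * (grid T k (Suc i) - grid T k i)) - (LBINT s:{0..T}. z s)
      = (\<integral>s. grid_step T z k s * indicator {0..T} s - y s * indicator {0..T} s \<partial>lborel)"
      (is "?l = ?r") using g[of k] iy by (simp add: has_bochner_integral_iff eq del: sum.lessThan_Suc)
    then have "\<bar>?l\<bar> = \<bar>?r\<bar>" by (rule arg_cong)
    also have "\<bar>?r\<bar> \<le> (\<integral>s. \<bar>grid_step T z k s * indicator {0..T} s - y s * indicator {0..T} s\<bar> \<partial>lborel)"
      by (rule integral_abs_bound)
    also have "\<dots> = (\<integral>s. \<bar>grid_step T z k s - y s\<bar> * indicator {0..T} s \<partial>lborel)"
      by (intro Bochner_Integration.integral_cong) (auto simp: indicator_def)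
    finally show ?thesis .
  qed
  then have "(\<lambda>k. (\<Sum>i<Suc k. z (grid T k i) * (grid T k (Suc i) - grid T k i)) - (LBINT s:{0..T}. z s)) \<longlonglongrightarrow> 0"
    by (intro Lim_null_comparison[OF _ cadlag_grid_step_L1(2)[OF T z y yz]]) auto
  then show ?thesis by (rule LIM_zero_cancel)
qed

lemma sqrt_diff_square_le:
  assumes "0 \<le> a" "0 \<le> (b :: real)" shows "(sqrt a - sqrt b)\<^sup>2 \<le> \<bar>a - b\<bar>"
proof -
  have "(sqrt a - sqrt b)\<^sup>2 = \<bar>sqrt a - sqrt b\<bar> * \<bar>sqrt a - sqrt b\<bar>" by (simp add: power2_eq_square flip: abs_mult)
  also have "\<dots> \<le> \<bar>sqrt a - sqrt b\<bar> * (sqrt a + sqrt b)"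
    using assms by (intro mult_left_mono) (auto simp: abs_le_iff)
  also have "\<dots> = \<bar>(sqrt a - sqrt b) * (sqrt a + sqrt b)\<bar>"
    using assms by (simp add: abs_mult)
  also have "(sqrt a - sqrt b) * (sqrt a + sqrt b) = a - b"
    using assms by (simp add: algebra_simps)
  finally show ?thesis .
qed

section \<open>Approximation of the stochastic integral\<close>

locale stochastic_volatility = correlated_brownian M F G W W' \<rho>
  for M :: "'a measure" and F G :: "real \<Rightarrow> 'a measure" and W W' :: "real \<Rightarrow> 'a \<Rightarrow> real" and \<rho> :: real +
  fixes T :: real and V :: "real \<Rightarrow> 'a \<Rightarrow> real" and R :: "'a \<Rightarrow> real"
  assumes T: "0 < T" and V_adapted: "adapted G V"
    and V_nonneg: "\<And>t \<omega>. 0 \<le> t \<Longrightarrow> \<omega> \<in> space M \<Longrightarrow> 0 \<le> V t \<omega>"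
    and V_cadlag: "\<And>\<omega>. \<omega> \<in> space M \<Longrightarrow> cadlag (\<lambda>t. V t \<omega>)"
    and ito: "has_ito_integral M F B (\<lambda>s \<omega>. sqrt (V s \<omega>)) T R"
begin

definition I :: "'a \<Rightarrow> real" where "I \<omega> = (LBINT s:{0..T}. V s \<omega>)"

definition stepI :: "nat \<Rightarrow> 'a \<Rightarrow> real" where
  "stepI k \<omega> = (\<Sum>i<Suc k. (sqrt (V (grid T k i) \<omega>))\<^sup>2 * (grid T k (Suc i) - grid T k i))"

definition stepR :: "nat \<Rightarrow> 'a \<Rightarrow> real" where
  "stepR k \<omega> = (\<Sum>i<Suc k. sqrt (V (grid T k i) \<omega>) * (B (grid T k (Suc i)) \<omega> - B (grid T k i) \<omega>))"

text \<open>Off \<open>[0, T]\<close> and off the sample space nothing is known about \<open>V\<close>. Clipping the time and squaring the root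
  give a nonnegative version that is jointly measurable on the whole line.\<close>

definition clip :: "real \<Rightarrow> real" where "clip s = max 0 (min T s)"

definition Vc :: "real \<Rightarrow> 'a \<Rightarrow> real" where "Vc s \<omega> = (sqrt (V (clip s) \<omega>))\<^sup>2"

lemma clip_eq: "s \<in> {0..T} \<Longrightarrow> clip s = s"
  by (auto simp: clip_def)

lemma Vc_eq: "s \<in> {0..T} \<Longrightarrow> \<omega> \<in> space M \<Longrightarrow> Vc s \<omega> = V s \<omega>"
  using V_nonneg by (auto simp: Vc_def clip_eq)

lemma Vc_nonneg: "0 \<le> Vc s \<omega>"
  by (simp add: Vc_def)

lemma subM: "0 \<le> t \<Longrightarrow> subalgebra M (F t)" "0 \<le> t \<Longrightarrow> subalgebra M (G t)"
  using filF filG by (auto simp: filtration_on_def)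

lemma V_measurable: "0 \<le> t \<Longrightarrow> V t \<in> borel_measurable M"
  using measurable_from_subalg[OF subM(2)] V_adapted by (auto simp: adapted_def)

lemma Vc_measurable [measurable]: "(\<lambda>(s, \<omega>). Vc s \<omega>) \<in> borel_measurable (borel \<Otimes>\<^sub>M M)"
proof -
  have H: "(\<lambda>(s, \<omega>). sqrt (V s \<omega>)) \<in> borel_measurable (restrict_space borel {0..T} \<Otimes>\<^sub>M F T)"
    using ito T unfolding has_ito_integral_def progressively_measurable_def by auto
  have c: "clip \<in> measurable borel (restrict_space borel {0..T})"
    using T by (intro measurable_restrict_space2) (auto simp: clip_def[abs_def])
  have i: "(\<lambda>\<omega>. \<omega>) \<in> measurable M (F T)"
    using measurable_from_subalg[OF subM(1)[of T] measurable_ident_sets[OF refl]] T by simp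
  have "(\<lambda>p. (clip (fst p), snd p)) \<in> measurable (borel \<Otimes>\<^sub>M M) (restrict_space borel {0..T} \<Otimes>\<^sub>M F T)"
    using measurable_compose[OF measurable_fst c] measurable_compose[OF measurable_snd i]
    by (intro measurable_Pair) (auto simp: comp_def)
  from measurable_compose[OF this H] show ?thesis by (simp add: Vc_def case_prod_beta')
qed

lemma Vc_section: "\<omega> \<in> space M \<Longrightarrow> (\<lambda>s. Vc s \<omega>) \<in> borel_measurable borel"
  by measurable

lemma I_eq: "\<omega> \<in> space M \<Longrightarrow> I \<omega> = (\<integral>s. Vc s \<omega> * indicator {0..T} s \<partial>lborel)"
  unfolding I_def set_lebesgue_integral_def
  by (intro Bochner_Integration.integral_cong) (auto simp: indicator_def Vc_eq)

lemma I_measurable [measurable]: "I \<in> borel_measurable M"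
proof -
  have "(\<lambda>(\<omega>, s). Vc s \<omega> * indicator {0..T} s) \<in> borel_measurable (M \<Otimes>\<^sub>M lborel)" by measurable
  from lborel.borel_measurable_lebesgue_integral[OF this] show ?thesis
    by (subst measurable_cong[OF I_eq])
qed

lemma I_nonneg: "\<omega> \<in> space M \<Longrightarrow> 0 \<le> I \<omega>"
  unfolding I_eq by (rule integral_nonneg_AE) (auto simp: Vc_nonneg)

lemma R_measurable [measurable]: "R \<in> borel_measurable M"
  using ito by (auto simp: has_ito_integral_def tendsto_in_prob_def)

lemma stepI_tendsto:
  assumes \<omega>: "\<omega> \<in> space M"
  shows "(\<lambda>k. stepI k \<omega>) \<longlonglongrightarrow> I \<omega>"
proof -
  have "stepI k \<omega> = (\<Sum>i<Suc k. V (grid T k i) \<omega> * (grid T k (Suc i) - grid T k i))" for k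
    unfolding stepI_def
    by (intro sum.cong refl) (simp add: V_nonneg[OF grid_nonneg[OF T] \<omega>])
  then show ?thesis
    unfolding I_def using cadlag_riemann_sum[OF T V_cadlag[OF \<omega>] Vc_section[OF \<omega>] Vc_eq[OF _ \<omega>]] by (simp only:)
qed

definition grid_error :: "nat \<Rightarrow> 'a \<Rightarrow> ennreal" where
  "grid_error k \<omega> = (\<integral>\<^sup>+s\<in>{0..T}. ennreal ((grid_step T (\<lambda>t. sqrt (V t \<omega>)) k s - sqrt (V s \<omega>))\<^sup>2) \<partial>lborel)"

lemma grid_error_eq:
  "grid_error k \<omega> = (\<integral>\<^sup>+s\<in>{0..T}. ennreal ((grid_step T (\<lambda>t. sqrt (V t \<omega>)) k s - sqrt (Vc s \<omega>))\<^sup>2) \<partial>lborel)"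
  if "\<omega> \<in> space M"
  unfolding grid_error_def by (intro nn_integral_cong) (auto simp: indicator_def Vc_eq that)

lemma grid_step_joint:
  "(\<lambda>(\<omega>, s). grid_step T (\<lambda>t. sqrt (V t \<omega>)) k s) \<in> borel_measurable (M \<Otimes>\<^sub>M lborel)"
  unfolding grid_step_def case_prod_beta'
proof (intro borel_measurable_sum borel_measurable_times)
  fix i
  show "(\<lambda>x. sqrt (V (grid T k i) (fst x))) \<in> borel_measurable (M \<Otimes>\<^sub>M lborel)"
    by (intro measurable_compose[OF measurable_compose[OF measurable_fst V_measurable[OF grid_nonneg[OF T]]]]) auto
  show "(\<lambda>x. indicator {grid T k i<..grid T k (Suc i)} (snd x) :: real) \<in> borel_measurable (M \<Otimes>\<^sub>M lborel)"
    by measurable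
qed

lemma grid_error_measurable [measurable]: "grid_error k \<in> borel_measurable M"
proof -
  note [measurable] = grid_step_joint[of k]
  have "(\<lambda>(\<omega>, s). ennreal ((grid_step T (\<lambda>t. sqrt (V t \<omega>)) k s - sqrt (Vc s \<omega>))\<^sup>2) * indicator {0..T} s)
    \<in> borel_measurable (M \<Otimes>\<^sub>M lborel)" by measurable
  from lborel.borel_measurable_nn_integral[OF this] show ?thesis
    by (subst measurable_cong[OF grid_error_eq])
qed

lemma grid_error_tendsto:
  assumes \<omega>: "\<omega> \<in> space M"
  shows "(\<lambda>k. grid_error k \<omega>) \<longlonglongrightarrow> 0"
proof -
  note L = cadlag_grid_step_L1[OF T V_cadlag[OF \<omega>] Vc_section[OF \<omega>] Vc_eq[OF _ \<omega>]]
  let ?e = "\<lambda>k s. \<bar>grid_step T (\<lambda>t. V t \<omega>) k s - Vc s \<omega>\<bar> * indicator {0..T} s"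
  have le: "grid_error k \<omega> \<le> ennreal (\<integral>s. ?e k s \<partial>lborel)" for k
  proof -
    have "(grid_step T (\<lambda>t. sqrt (V t \<omega>)) k s - sqrt (Vc s \<omega>))\<^sup>2 \<le> \<bar>grid_step T (\<lambda>t. V t \<omega>) k s - Vc s \<omega>\<bar>"
      if s: "s \<in> {0..T}" for s
    proof (cases "s = 0")
      case True
      then show ?thesis using Vc_nonneg[of s \<omega>] by (simp add: grid_step_0[OF T])
    next
      case False
      then obtain i where "grid_step T (\<lambda>t. sqrt (V t \<omega>)) k s = sqrt (V (grid T k i) \<omega>)"
        "grid_step T (\<lambda>t. V t \<omega>) k s = V (grid T k i) \<omega>"
        using grid_step_eq[OF T, of s k] s by auto
      then show ?thesis
        using sqrt_diff_square_le V_nonneg[OF grid_nonneg[OF T] \<omega>] Vc_nonneg by simp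
    qed
    then have "grid_error k \<omega> \<le> (\<integral>\<^sup>+s. ennreal (?e k s) \<partial>lborel)"
      unfolding grid_error_eq[OF \<omega>] by (intro nn_integral_mono) (auto simp: indicator_def intro!: ennreal_leI)
    also have "\<dots> = ennreal (\<integral>s. ?e k s \<partial>lborel)"
      using L(1)[of k] by (intro nn_integral_eq_integral) auto
    finally show ?thesis .
  qed
  have "(\<lambda>k. ennreal (\<integral>s. ?e k s \<partial>lborel)) \<longlonglongrightarrow> ennreal 0" by (rule tendsto_ennrealI[OF L(2)])
  then have lim: "(\<lambda>k. ennreal (\<integral>s. ?e k s \<partial>lborel)) \<longlonglongrightarrow> 0" by (simp only: ennreal_0)
  show ?thesis
    by (rule tendsto_sandwich[OF always_eventually always_eventually tendsto_const lim]) (simp_all only: le zero_le simp_thms)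
qed

lemma grid_error_in_prob:
  assumes \<eta>: "0 < \<eta>"
  shows "(\<lambda>k. measure M {\<omega> \<in> space M. ennreal \<eta> < grid_error k \<omega>}) \<longlonglongrightarrow> 0"
proof -
  interpret prob_space M by (rule M)
  have "(\<lambda>k. \<integral>\<omega>. indicator {\<omega> \<in> space M. ennreal \<eta> < grid_error k \<omega>} \<omega> \<partial>M) \<longlonglongrightarrow> (\<integral>\<omega>. (0 :: real) \<partial>M)"
  proof (rule integral_dominated_convergence[where w = "\<lambda>_. 1"])
    show "AE \<omega> in M. (\<lambda>k. indicator {\<omega> \<in> space M. ennreal \<eta> < grid_error k \<omega>} \<omega> :: real) \<longlonglongrightarrow> 0"
    proof (rule AE_I2)
      fix \<omega> assume "\<omega> \<in> space M"
      from order_tendstoD(2)[OF grid_error_tendsto[OF this], of "ennreal \<eta>"] \<eta>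
      have "eventually (\<lambda>k. grid_error k \<omega> < ennreal \<eta>) sequentially" by simp
      then have "eventually (\<lambda>k. indicator {\<omega> \<in> space M. ennreal \<eta> < grid_error k \<omega>} \<omega> = (0 :: real)) sequentially"
        by eventually_elim (auto simp: indicator_def)
      then show "(\<lambda>k. indicator {\<omega> \<in> space M. ennreal \<eta> < grid_error k \<omega>} \<omega> :: real) \<longlonglongrightarrow> 0"
        by (rule tendsto_eventually)
    qed
    show "AE \<omega> in M. norm (indicator {\<omega> \<in> space M. ennreal \<eta> < grid_error k \<omega>} \<omega> :: real) \<le> 1" for k
      by (intro AE_I2) (simp add: indicator_def)
  qed simp_all
  then show ?thesis by simp
qed

lemma square_diff_le: "ennreal ((x - y)\<^sup>2) \<le> 2 * ennreal ((x - w)\<^sup>2) + 2 * ennreal ((y - w)\<^sup>2)"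
proof -
  have "2 * (x - w)\<^sup>2 + 2 * (y - w)\<^sup>2 - (x - y)\<^sup>2 = (x + y - 2 * w)\<^sup>2" by (simp add: power2_eq_square algebra_simps)
  then have "(x - y)\<^sup>2 \<le> 2 * (x - w)\<^sup>2 + 2 * (y - w)\<^sup>2" using zero_le_power2[of "x + y - 2 * w"] by linarith
  then have "ennreal ((x - y)\<^sup>2) \<le> ennreal (2 * (x - w)\<^sup>2 + 2 * (y - w)\<^sup>2)" by (rule ennreal_leI)
  also have "\<dots> = 2 * ennreal ((x - w)\<^sup>2) + 2 * ennreal ((y - w)\<^sup>2)"
    by (simp add: ennreal_plus ennreal_mult)
  finally show ?thesis .
qed

text \<open>The simple processes in the definition of the Ito integral are only adapted to the large filtration.
  They are replaced by left-endpoint values of \<open>sqrt V\<close>, which are adapted to the small one: both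
  approximate \<open>sqrt V\<close> in energy, so the tail estimate applies to their difference.\<close>

lemma stepR_tendsto:
  assumes \<delta>: "0 < \<delta>"
  shows "(\<lambda>k. measure M {\<omega> \<in> space M. \<delta> < \<bar>stepR k \<omega> - R \<omega>\<bar>}) \<longlonglongrightarrow> 0"
proof -
  interpret prob_space M by (rule M)
  obtain n \<tau> \<xi> where sp: "\<And>k :: nat. simple_process M F (n k) (\<tau> k) (\<xi> k)"
    and H: "\<And>\<delta>. 0 < \<delta> \<Longrightarrow> (\<lambda>k. measure M {\<omega> \<in> space M.
             ennreal \<delta> < (\<integral>\<^sup>+s\<in>{0..T}. ennreal ((simple_value (n k) (\<tau> k) (\<xi> k) s \<omega> - sqrt (V s \<omega>))\<^sup>2) \<partial>lborel)}) \<longlonglongrightarrow> 0"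
    and J: "tendsto_in_prob M (\<lambda>k. simple_integral_wrt B (n k) (\<tau> k) (\<xi> k) T) R sequentially"
    using ito unfolding has_ito_integral_def by blast
  define N where "N k \<omega> = simple_integral_wrt B (n k) (\<tau> k) (\<xi> k) T \<omega>" for k \<omega>
  define E where "E k \<omega> = (\<integral>\<^sup>+s\<in>{0..T}. ennreal ((simple_value (n k) (\<tau> k) (\<xi> k) s \<omega> - sqrt (V s \<omega>))\<^sup>2) \<partial>lborel)" for k \<omega>
  have \<tau>mono: "\<tau> k i \<le> \<tau> k (Suc i)" if "i < n k" for k i
    using sp[of k] that by (auto simp: simple_process_def)
  have \<tau>0: "0 \<le> \<tau> k i" if "i \<le> n k" for k i
    using that
  proof (induction i)
    case (Suc i)
    then show ?case using \<tau>mono[of i k] by simp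
  qed (use sp[of k] in \<open>simp add: simple_process_def\<close>)
  have \<xi>F: "\<xi> k i \<in> borel_measurable (F (\<tau> k i))" if "i < n k" for k i
    using sp[of k] that by (auto simp: simple_process_def)
  have \<xi>M: "\<xi> k i \<in> borel_measurable M" if "i < n k" for k i
    using measurable_from_subalg[OF subM(1) \<xi>F] \<tau>0 that by simp
  have svM: "(\<lambda>(\<omega>, s). simple_value (n k) (\<tau> k) (\<xi> k) s \<omega>) \<in> borel_measurable (M \<Otimes>\<^sub>M lborel)" for k
    unfolding simple_value_def case_prod_beta'
  proof (intro borel_measurable_sum borel_measurable_times)
    fix i assume "i \<in> {..<n k}"
    then show "(\<lambda>x. \<xi> k i (fst x)) \<in> borel_measurable (M \<Otimes>\<^sub>M lborel)"
      using measurable_compose[OF measurable_fst \<xi>M] by auto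
    show "(\<lambda>x. indicator {\<tau> k i<..\<tau> k (Suc i)} (snd x) :: real) \<in> borel_measurable (M \<Otimes>\<^sub>M lborel)"
      by measurable
  qed
  have E_eq: "E k \<omega> = (\<integral>\<^sup>+s\<in>{0..T}. ennreal ((simple_value (n k) (\<tau> k) (\<xi> k) s \<omega> - sqrt (Vc s \<omega>))\<^sup>2) \<partial>lborel)"
    if "\<omega> \<in> space M" for k \<omega>
    unfolding E_def by (intro nn_integral_cong) (auto simp: indicator_def Vc_eq that)
  have Em [measurable]: "E k \<in> borel_measurable M" for k
  proof -
    note [measurable] = svM[of k]
    have "(\<lambda>(\<omega>, s). ennreal ((simple_value (n k) (\<tau> k) (\<xi> k) s \<omega> - sqrt (Vc s \<omega>))\<^sup>2) * indicator {0..T} s)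
      \<in> borel_measurable (M \<Otimes>\<^sub>M lborel)" by measurable
    from lborel.borel_measurable_nn_integral[OF this] show ?thesis
      by (subst measurable_cong[OF E_eq])
  qed
  have Nm [measurable]: "N k \<in> borel_measurable M" for k
    unfolding N_def[abs_def] simple_integral_wrt_def
    using \<xi>M \<tau>0 T
    by (intro borel_measurable_sum borel_measurable_times borel_measurable_diff measurable_B) auto
  have sRm [measurable]: "stepR k \<in> borel_measurable M" for k
    unfolding stepR_def[abs_def]
    by (intro borel_measurable_sum borel_measurable_times borel_measurable_diff measurable_B grid_nonneg T
        measurable_compose[OF V_measurable[OF grid_nonneg[OF T]]]) auto
  have diff: "measure M {\<omega> \<in> space M. \<delta>' \<le> \<bar>N k \<omega> - stepR k \<omega>\<bar>}
      \<le> 2 * \<eta> / \<delta>'\<^sup>2 + (measure M {\<omega> \<in> space M. ennreal (\<eta> / 4) < E k \<omega>}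
          + measure M {\<omega> \<in> space M. ennreal (\<eta> / 4) < grid_error k \<omega>})" if pos: "0 < \<delta>'" "0 < \<eta>" for k \<delta>' \<eta>
  proof -
    let ?K = "{..<n k} <+> {..<Suc k}"
    let ?a = "case_sum (\<tau> k) (grid T k)" and ?b = "case_sum (\<lambda>i. \<tau> k (Suc i)) (\<lambda>i. grid T k (Suc i))"
    let ?x = "case_sum (\<xi> k) (\<lambda>i \<omega>. - sqrt (V (grid T k i) \<omega>))"
    define Q where "Q \<omega> = (\<integral>\<^sup>+s\<in>{0..T}. ennreal ((\<Sum>l\<in>?K. ?x l \<omega> * indicator {?a l<..?b l} s)\<^sup>2) \<partial>lborel)" for \<omega>
    have val: "(\<Sum>l\<in>?K. ?x l \<omega> * indicator {?a l<..?b l} s)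
      = simple_value (n k) (\<tau> k) (\<xi> k) s \<omega> - grid_step T (\<lambda>t. sqrt (V t \<omega>)) k s" for s \<omega>
      by (subst sum.Plus) (simp_all add: simple_value_def grid_step_def sum_negf del: sum.lessThan_Suc)
    have int: "(\<Sum>l\<in>?K. ?x l \<omega> * (B (min T (?b l)) \<omega> - B (min T (?a l)) \<omega>)) = N k \<omega> - stepR k \<omega>" for \<omega>
    proof -
      have g: "min T (grid T k i) = grid T k i" if "i \<le> Suc k" for i using grid_le[OF T that] by simp
      have "(\<Sum>i<Suc k. - sqrt (V (grid T k i) \<omega>) * (B (min T (grid T k (Suc i))) \<omega> - B (min T (grid T k i)) \<omega>))
        = - stepR k \<omega>"
        unfolding stepR_def sum_negf[symmetric] by (intro sum.cong refl) (simp add: g)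
      then show ?thesis
        by (subst sum.Plus) (simp_all add: N_def simple_integral_wrt_def del: sum.lessThan_Suc)
    qed
    have "measure M {\<omega> \<in> space M. \<delta>' \<le> \<bar>\<Sum>l\<in>?K. ?x l \<omega> * (B (min T (?b l)) \<omega> - B (min T (?a l)) \<omega>)\<bar>}
      \<le> 2 * \<eta> / \<delta>'\<^sup>2 + measure M {\<omega> \<in> space M. ennreal \<eta> < Q \<omega>}"
      unfolding Q_def
    proof (rule elementary_integral_tail[OF _ _ _ _ T pos(1) less_imp_le[OF pos(2)]])
      fix l assume l: "l \<in> ?K"
      show "0 \<le> ?a l" "?a l \<le> ?b l" using l \<tau>0 \<tau>mono grid_nonneg[OF T] grid_less[OF T] by (auto simp: less_imp_le)
      show "?x l \<in> borel_measurable (F (?a l))"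
      proof (cases l)
        case (Inr i)
        have t: "0 \<le> grid T k i" by (rule grid_nonneg[OF T])
        have "V (grid T k i) \<in> borel_measurable (F (grid T k i))"
          by (rule measurable_mono_subalgebra[of _ "G (grid T k i)"])
             (use V_adapted t subM[OF t] GF[OF t] in \<open>auto simp: adapted_def subalgebra_def\<close>)
        then show ?thesis using Inr by simp
      qed (use l \<xi>F in auto)
    qed auto
    also have "measure M {\<omega> \<in> space M. ennreal \<eta> < Q \<omega>}
      \<le> measure M ({\<omega> \<in> space M. ennreal (\<eta> / 4) < E k \<omega>} \<union> {\<omega> \<in> space M. ennreal (\<eta> / 4) < grid_error k \<omega>})"
    proof (rule finite_measure_mono)
      have "Q \<omega> \<le> ennreal \<eta>" if \<omega>: "\<omega> \<in> space M" and le: "E k \<omega> \<le> ennreal (\<eta> / 4)" "grid_error k \<omega> \<le> ennreal (\<eta> / 4)" for \<omega>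
      proof -
        note [measurable] = Vc_section[OF \<omega>]
        have [measurable]: "(\<lambda>s. simple_value (n k) (\<tau> k) (\<xi> k) s \<omega>) \<in> borel_measurable borel"
          unfolding simple_value_def by measurable
        let ?u = "\<lambda>s. ennreal ((simple_value (n k) (\<tau> k) (\<xi> k) s \<omega> - sqrt (Vc s \<omega>))\<^sup>2) * indicator {0..T} s"
        let ?w = "\<lambda>s. ennreal ((grid_step T (\<lambda>t. sqrt (V t \<omega>)) k s - sqrt (Vc s \<omega>))\<^sup>2) * indicator {0..T} s"
        have "Q \<omega> \<le> (\<integral>\<^sup>+s. 2 * ?u s + 2 * ?w s \<partial>lborel)"
          unfolding Q_def val
        proof (rule nn_integral_mono)
          fix s :: real
          show "ennreal ((simple_value (n k) (\<tau> k) (\<xi> k) s \<omega> - grid_step T (\<lambda>t. sqrt (V t \<omega>)) k s)\<^sup>2) * indicator {0..T} s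
            \<le> 2 * ?u s + 2 * ?w s"
            using square_diff_le by (cases "s \<in> {0..T}") auto
        qed
        also have "\<dots> = 2 * E k \<omega> + 2 * grid_error k \<omega>"
          unfolding E_eq[OF \<omega>] grid_error_eq[OF \<omega>] by (simp add: nn_integral_add nn_integral_cmult)
        also have "\<dots> \<le> 2 * ennreal (\<eta> / 4) + 2 * ennreal (\<eta> / 4)" by (intro add_mono mult_left_mono le) auto
        also have "2 * ennreal (\<eta> / 4) = ennreal (\<eta> / 2)" using ennreal_mult[of 2 "\<eta> / 4"] pos by simp
        also have "ennreal (\<eta> / 2) + ennreal (\<eta> / 2) = ennreal \<eta>"
          using ennreal_plus[of "\<eta> / 2" "\<eta> / 2"] pos by simp
        finally show ?thesis .
      qed
      then show "{\<omega> \<in> space M. ennreal \<eta> < Q \<omega>}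
        \<subseteq> {\<omega> \<in> space M. ennreal (\<eta> / 4) < E k \<omega>} \<union> {\<omega> \<in> space M. ennreal (\<eta> / 4) < grid_error k \<omega>}"
        by (auto simp: not_less[symmetric])
    qed auto
    also have "\<dots> \<le> measure M {\<omega> \<in> space M. ennreal (\<eta> / 4) < E k \<omega>}
        + measure M {\<omega> \<in> space M. ennreal (\<eta> / 4) < grid_error k \<omega>}"
      by (rule measure_Un_le) auto
    finally show ?thesis by (simp add: int)
  qed
  show ?thesis
  proof (rule LIMSEQ_I)
    fix r :: real assume r: "0 < r"
    define \<eta> where "\<eta> = r * (\<delta> / 2)\<^sup>2 / 8"
    have \<eta>: "0 < \<eta>" using r \<delta> by (simp add: \<eta>_def)
    have "(\<lambda>k. measure M {\<omega> \<in> space M. ennreal (\<eta> / 4) < E k \<omega>}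
        + measure M {\<omega> \<in> space M. ennreal (\<eta> / 4) < grid_error k \<omega>}
        + measure M {\<omega> \<in> space M. \<delta> / 2 < \<bar>N k \<omega> - R \<omega>\<bar>}) \<longlonglongrightarrow> 0 + 0 + 0"
    proof (intro tendsto_add)
      show "(\<lambda>k. measure M {\<omega> \<in> space M. ennreal (\<eta> / 4) < E k \<omega>}) \<longlonglongrightarrow> 0"
        unfolding E_def by (rule H) (use \<eta> in simp)
      show "(\<lambda>k. measure M {\<omega> \<in> space M. ennreal (\<eta> / 4) < grid_error k \<omega>}) \<longlonglongrightarrow> 0"
        by (rule grid_error_in_prob) (use \<eta> in simp)
      have "0 < \<delta> / 2" using \<delta> by simp
      with J show "(\<lambda>k. measure M {\<omega> \<in> space M. \<delta> / 2 < \<bar>N k \<omega> - R \<omega>\<bar>}) \<longlonglongrightarrow> 0"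
        unfolding N_def tendsto_in_prob_def by blast
    qed
    then have "eventually (\<lambda>k. measure M {\<omega> \<in> space M. ennreal (\<eta> / 4) < E k \<omega>}
        + measure M {\<omega> \<in> space M. ennreal (\<eta> / 4) < grid_error k \<omega>}
        + measure M {\<omega> \<in> space M. \<delta> / 2 < \<bar>N k \<omega> - R \<omega>\<bar>} < r / 2) sequentially"
      using r by (intro order_tendstoD(2)[where y = "0 + 0 + 0"]) auto
    then obtain K where K: "\<And>k. K \<le> k \<Longrightarrow> measure M {\<omega> \<in> space M. ennreal (\<eta> / 4) < E k \<omega>}
        + measure M {\<omega> \<in> space M. ennreal (\<eta> / 4) < grid_error k \<omega>}
        + measure M {\<omega> \<in> space M. \<delta> / 2 < \<bar>N k \<omega> - R \<omega>\<bar>} < r / 2"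
      by (auto simp: eventually_sequentially)
    show "\<exists>no. \<forall>k\<ge>no. norm (measure M {\<omega> \<in> space M. \<delta> < \<bar>stepR k \<omega> - R \<omega>\<bar>} - 0) < r"
    proof (intro exI allI impI)
      fix k assume k: "K \<le> k"
      have "measure M {\<omega> \<in> space M. \<delta> < \<bar>stepR k \<omega> - R \<omega>\<bar>}
        \<le> measure M ({\<omega> \<in> space M. \<delta> / 2 \<le> \<bar>N k \<omega> - stepR k \<omega>\<bar>} \<union> {\<omega> \<in> space M. \<delta> / 2 < \<bar>N k \<omega> - R \<omega>\<bar>})"
      proof (rule finite_measure_mono)
        have "\<delta> / 2 \<le> \<bar>a - b\<bar> \<or> \<delta> / 2 < \<bar>a - c\<bar>" if "\<delta> < \<bar>b - c\<bar>" for a b c :: real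
          using that by arith
        then show "{\<omega> \<in> space M. \<delta> < \<bar>stepR k \<omega> - R \<omega>\<bar>} \<subseteq>
          {\<omega> \<in> space M. \<delta> / 2 \<le> \<bar>N k \<omega> - stepR k \<omega>\<bar>} \<union> {\<omega> \<in> space M. \<delta> / 2 < \<bar>N k \<omega> - R \<omega>\<bar>}"
          by blast
      qed auto
      also have "\<dots> \<le> measure M {\<omega> \<in> space M. \<delta> / 2 \<le> \<bar>N k \<omega> - stepR k \<omega>\<bar>}
          + measure M {\<omega> \<in> space M. \<delta> / 2 < \<bar>N k \<omega> - R \<omega>\<bar>}" by (rule measure_Un_le) auto
      moreover have "2 * \<eta> / (\<delta> / 2)\<^sup>2 = r / 4" using \<delta> by (simp add: \<eta>_def)
      ultimately show "norm (measure M {\<omega> \<in> space M. \<delta> < \<bar>stepR k \<omega> - R \<omega>\<bar>} - 0) < r"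
        using diff[of "\<delta> / 2" \<eta> k] \<delta> \<eta> K[OF k] r by simp
    qed
  qed
qed

end

section \<open>Limits on an event and density of continuous functions\<close>

lemma (in prob_space) integral_tendsto_on_event:
  fixes u :: "nat \<Rightarrow> 'a \<Rightarrow> real"
  assumes [measurable]: "\<And>k. u k \<in> borel_measurable M" "l \<in> borel_measurable M" "D \<in> events"
    and K: "\<And>k \<omega>. \<omega> \<in> space M \<Longrightarrow> \<bar>u k \<omega>\<bar> \<le> K"
    and lim: "AE \<omega> in M. \<omega> \<in> D \<longrightarrow> (\<lambda>k. u k \<omega>) \<longlonglongrightarrow> l \<omega>"
  shows "(\<lambda>k. \<integral>\<omega>. u k \<omega> * indicator D \<omega> \<partial>M) \<longlonglongrightarrow> (\<integral>\<omega>. l \<omega> * indicator D \<omega> \<partial>M)"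
proof (rule integral_dominated_convergence[where w = "\<lambda>_. K"])
  have K0: "0 \<le> K" using K[of _ 0] not_empty by (meson abs_ge_zero all_not_in_conv order_trans)
  show "AE \<omega> in M. (\<lambda>k. u k \<omega> * indicator D \<omega>) \<longlonglongrightarrow> l \<omega> * indicator D \<omega>"
    using lim
  proof eventually_elim
    case (elim \<omega>)
    then show ?case by (cases "\<omega> \<in> D") auto
  qed
  show "AE \<omega> in M. norm (u k \<omega> * indicator D \<omega>) \<le> K" for k
    using K K0 by (intro AE_I2) (auto simp: indicator_def)
qed auto

lemma (in prob_space) integral_off_event_le:
  fixes u :: "'a \<Rightarrow> real"
  assumes [measurable]: "u \<in> borel_measurable M" "D \<in> events"
    and K: "\<And>\<omega>. \<omega> \<in> space M \<Longrightarrow> \<bar>u \<omega>\<bar> \<le> K"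
  shows "\<bar>(\<integral>\<omega>. u \<omega> \<partial>M) - (\<integral>\<omega>. u \<omega> * indicator D \<omega> \<partial>M)\<bar> \<le> K * prob (space M - D)"
proof -
  have K0: "0 \<le> K" using K not_empty by (meson abs_ge_zero all_not_in_conv order_trans)
  have iu: "integrable M u" by (rule integrable_const_bound[where B = K]) (use K in auto)
  have iD: "integrable M (\<lambda>\<omega>. u \<omega> * indicator D \<omega>)"
    by (rule integrable_const_bound[where B = K]) (use K K0 in \<open>auto simp: indicator_def\<close>)
  have "\<bar>(\<integral>\<omega>. u \<omega> \<partial>M) - (\<integral>\<omega>. u \<omega> * indicator D \<omega> \<partial>M)\<bar> = \<bar>\<integral>\<omega>. u \<omega> - u \<omega> * indicator D \<omega> \<partial>M\<bar>"
    using iu iD by simp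
  also have "\<dots> \<le> (\<integral>\<omega>. \<bar>u \<omega> - u \<omega> * indicator D \<omega>\<bar> \<partial>M)" by (rule integral_abs_bound)
  also have "\<dots> \<le> (\<integral>\<omega>. K * indicator (space M - D) \<omega> \<partial>M)"
  proof (rule integral_mono)
    show "integrable M (\<lambda>\<omega>. K * indicator (space M - D) \<omega>)"
      by (rule integrable_const_bound[where B = K]) (use K0 in \<open>auto simp: indicator_def\<close>)
    show "integrable M (\<lambda>\<omega>. \<bar>u \<omega> - u \<omega> * indicator D \<omega>\<bar>)" using iu iD by simp
    show "\<bar>u \<omega> - u \<omega> * indicator D \<omega>\<bar> \<le> K * indicator (space M - D) \<omega>" if "\<omega> \<in> space M" for \<omega>
      using K[OF that] that by (auto simp: indicator_def)
  qed
  finally show ?thesis by simp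
qed

text \<open>Two measures are approximated simultaneously: later one of them is the law of \<open>R - I / 2\<close>, which may
  charge Lebesgue null sets, and the other is equivalent to Lebesgue measure.\<close>

definition approximable :: "real measure \<Rightarrow> real measure \<Rightarrow> real set \<Rightarrow> bool" where
  "approximable \<mu> \<nu> A \<longleftrightarrow> (\<forall>e>0. \<exists>g :: real \<Rightarrow> real. continuous_on UNIV g \<and> (\<forall>x. 0 \<le> g x \<and> g x \<le> 1) \<and>
     (\<integral>x. \<bar>indicator A x - g x\<bar> \<partial>\<mu>) < e \<and> (\<integral>x. \<bar>indicator A x - g x\<bar> \<partial>\<nu>) < e)"

lemma integral_abs_diff_tendsto_0:
  fixes g :: "nat \<Rightarrow> real \<Rightarrow> real"
  assumes "finite_measure \<mu>" "sets \<mu> = sets borel"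
    and [measurable]: "\<And>n. g n \<in> borel_measurable borel" "h \<in> borel_measurable borel"
    and "\<And>n x. \<bar>g n x - h x\<bar> \<le> K" and "\<And>x. (\<lambda>n. g n x) \<longlonglongrightarrow> h x"
  shows "(\<lambda>n. \<integral>x. \<bar>h x - g n x\<bar> \<partial>\<mu>) \<longlonglongrightarrow> 0"
proof -
  interpret finite_measure \<mu> by fact
  note [measurable_cong] = assms(2)
  have "(\<lambda>n. \<integral>x. \<bar>h x - g n x\<bar> \<partial>\<mu>) \<longlonglongrightarrow> (\<integral>x. 0 \<partial>\<mu>)"
  proof (rule integral_dominated_convergence[where w = "\<lambda>_. K"])
    have "(\<lambda>n. \<bar>h x - g n x\<bar>) \<longlonglongrightarrow> \<bar>h x - h x\<bar>" for x
      by (intro tendsto_intros assms(6))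
    then show "AE x in \<mu>. (\<lambda>n. \<bar>h x - g n x\<bar>) \<longlonglongrightarrow> 0" by simp
  qed (use assms(5) in \<open>auto simp: abs_minus_commute\<close>)
  then show ?thesis by simp
qed

text \<open>Half-lines are limits of piecewise linear functions, and the approximable sets form a Dynkin system.\<close>

lemma approximable_borel:
  assumes \<mu>: "finite_measure \<mu>" "sets \<mu> = sets borel" and \<nu>: "finite_measure \<nu>" "sets \<nu> = sets borel"
    and A: "A \<in> sets borel"
  shows "approximable \<mu> \<nu> A"
proof -
  have int: "integrable M' f" if "finite_measure M'" "sets M' = sets borel" "f \<in> borel_measurable borel" "\<And>x. \<bar>f x\<bar> \<le> K"
    for M' :: "real measure" and f :: "real \<Rightarrow> real" and K
  proof -
    interpret finite_measure M' by fact
    note [measurable_cong] = that(2)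
    show ?thesis by (rule integrable_const_bound[where B = K]) (use that in auto)
  qed
  note lim\<mu> = integral_abs_diff_tendsto_0[OF \<mu>] and lim\<nu> = integral_abs_diff_tendsto_0[OF \<nu>]
  let ?G = "range (\<lambda>a :: real. {..a})"
  have "Int_stable ?G" by (auto simp: Int_stable_def)
  moreover have "?G \<subseteq> Pow UNIV" by auto
  moreover have "A \<in> sigma_sets UNIV ?G" using A unfolding borel_eq_atMost by simp
  ultimately show ?thesis
  proof (induction rule: sigma_sets_induct_disjoint)
    case (basic A)
    then obtain a where a: "A = {..a}" by auto
    define g where "g n x = max 0 (min 1 (1 - real n * (x - a)))" for n x
    have gc: "continuous_on UNIV (g n)" for n unfolding g_def[abs_def] by (intro continuous_intros)
    have gm: "g n \<in> borel_measurable borel" for n using gc by (rule borel_measurable_continuous_onI)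
    have lim: "(\<lambda>n. g n x) \<longlonglongrightarrow> indicator A x" for x
    proof (cases "x \<le> a")
      case True
      then have "real n * (x - a) \<le> 0" for n by (intro mult_nonneg_nonpos) auto
      then have "g n x = 1" for n by (auto simp: g_def max_def min_def)
      with True a show ?thesis by simp
    next
      case False
      obtain n0 :: nat where n0: "1 / (x - a) < real n0" using reals_Archimedean2 by blast
      have "eventually (\<lambda>n. g n x = 0) sequentially"
        unfolding eventually_sequentially
      proof (intro exI allI impI)
        fix n assume "n0 \<le> n"
        then have "1 / (x - a) < real n" using n0 by linarith
        then have "1 < real n * (x - a)" using False by (simp add: field_simps)
        then show "g n x = 0" by (simp add: g_def)
      qed
      with False a show ?thesis by (auto intro: tendsto_eventually)
    qed
    show ?case unfolding approximable_def
    proof (intro allI impI)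
      fix e :: real assume e: "0 < e"
      have b: "\<bar>g n x - indicator A x\<bar> \<le> 1" for n x by (auto simp: g_def indicator_def)
      have Am: "indicator A \<in> borel_measurable (borel :: real measure)" using a by simp
      have "eventually (\<lambda>n. (\<integral>x. \<bar>indicator A x - g n x\<bar> \<partial>\<mu>) < e \<and> (\<integral>x. \<bar>indicator A x - g n x\<bar> \<partial>\<nu>) < e) sequentially"
        using order_tendstoD(2)[OF lim\<mu>[OF gm Am b lim] e] order_tendstoD(2)[OF lim\<nu>[OF gm Am b lim] e]
        by (rule eventually_conj)
      then obtain n where "(\<integral>x. \<bar>indicator A x - g n x\<bar> \<partial>\<mu>) < e" "(\<integral>x. \<bar>indicator A x - g n x\<bar> \<partial>\<nu>) < e"
        by (auto simp: eventually_sequentially)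
      with gc show "\<exists>g :: real \<Rightarrow> real. continuous_on UNIV g \<and> (\<forall>x. 0 \<le> g x \<and> g x \<le> 1) \<and>
          (\<integral>x. \<bar>indicator A x - g x\<bar> \<partial>\<mu>) < e \<and> (\<integral>x. \<bar>indicator A x - g x\<bar> \<partial>\<nu>) < e"
        by (intro exI[of _ "g n"]) (auto simp: g_def)
    qed
  next
    case empty
    show ?case unfolding approximable_def by (intro allI impI exI[of _ "\<lambda>_. 0"]) auto
  next
    case (compl A)
    show ?case unfolding approximable_def
    proof (intro allI impI)
      fix e :: real assume "0 < e"
      with compl.IH obtain g where g: "continuous_on UNIV g" "\<And>x. 0 \<le> g x \<and> g x \<le> 1"
        "(\<integral>x. \<bar>indicator A x - g x\<bar> \<partial>\<mu>) < e" "(\<integral>x. \<bar>indicator A x - g x\<bar> \<partial>\<nu>) < e"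
        unfolding approximable_def by blast
      have eq: "\<bar>indicator (UNIV - A) x - (1 - g x)\<bar> = \<bar>indicator A x - g x\<bar>" for x
        by (auto simp: indicator_def)
      show "\<exists>g :: real \<Rightarrow> real. continuous_on UNIV g \<and> (\<forall>x. 0 \<le> g x \<and> g x \<le> 1) \<and>
          (\<integral>x. \<bar>indicator (UNIV - A) x - g x\<bar> \<partial>\<mu>) < e \<and> (\<integral>x. \<bar>indicator (UNIV - A) x - g x\<bar> \<partial>\<nu>) < e"
        using g by (intro exI[of _ "\<lambda>x. 1 - g x"]) (auto simp: eq intro!: continuous_intros)
    qed
  next
    case (union A)
    have Am: "A i \<in> sets borel" for i using union.hyps(2) unfolding borel_eq_atMost by auto
    define U where "U N = (\<Union>i<N. A i)" for N :: nat
    have Um: "U N \<in> sets borel" for N unfolding U_def using Am by auto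
    have Um': "(\<Union>i. A i) \<in> sets borel" using Am by auto
    have lim: "(\<lambda>N. indicator (U N) x :: real) \<longlonglongrightarrow> indicator (\<Union>i. A i) x" for x
    proof (cases "x \<in> (\<Union>i. A i)")
      case True
      then obtain i where i: "x \<in> A i" by auto
      have "eventually (\<lambda>N. indicator (U N) x = (1 :: real)) sequentially"
        unfolding eventually_sequentially by (intro exI[of _ "Suc i"]) (use i in \<open>auto simp: U_def indicator_def\<close>)
      with True show ?thesis by (auto intro: tendsto_eventually)
    next
      case False
      then have "indicator (U N) x = (0 :: real)" for N by (auto simp: U_def indicator_def)
      with False show ?thesis by simp
    qed
    show ?case unfolding approximable_def
    proof (intro allI impI)
      fix e :: real assume e: "0 < e"
      then have e2: "0 < e / 2" by simp
      have b: "\<bar>indicator (U N) x - indicator (\<Union>i. A i) x\<bar> \<le> (1 :: real)" for N x by (auto simp: indicator_def)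
      have im: "indicator (U N) \<in> borel_measurable borel" "indicator (\<Union>i. A i) \<in> borel_measurable (borel :: real measure)" for N
        using Um Um' by auto
      have "eventually (\<lambda>N. (\<integral>x. \<bar>indicator (\<Union>i. A i) x - indicator (U N) x :: real\<bar> \<partial>\<mu>) < e / 2 \<and>
          (\<integral>x. \<bar>indicator (\<Union>i. A i) x - indicator (U N) x :: real\<bar> \<partial>\<nu>) < e / 2) sequentially"
        using order_tendstoD(2)[OF lim\<mu>[OF im b lim] e2] order_tendstoD(2)[OF lim\<nu>[OF im b lim] e2]
        by (rule eventually_conj)
      then obtain N where N: "(\<integral>x. \<bar>indicator (\<Union>i. A i) x - indicator (U N) x :: real\<bar> \<partial>\<mu>) < e / 2"
        "(\<integral>x. \<bar>indicator (\<Union>i. A i) x - indicator (U N) x :: real\<bar> \<partial>\<nu>) < e / 2"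
        by (auto simp: eventually_sequentially)
      define e' where "e' = e / (2 * (real N + 1))"
      have e': "0 < e'" "real N * e' \<le> e / 2" using e by (auto simp: e'_def field_simps)
      from union.IH have "\<forall>i. \<exists>g :: real \<Rightarrow> real. continuous_on UNIV g \<and> (\<forall>x. 0 \<le> g x \<and> g x \<le> 1) \<and>
          (\<integral>x. \<bar>indicator (A i) x - g x\<bar> \<partial>\<mu>) < e' \<and> (\<integral>x. \<bar>indicator (A i) x - g x\<bar> \<partial>\<nu>) < e'"
        using e' unfolding approximable_def by blast
      then obtain g where g: "\<And>i. continuous_on UNIV (g i)" "\<And>i x. 0 \<le> g i x \<and> g i x \<le> 1"
        "\<And>i. (\<integral>x. \<bar>indicator (A i) x - g i x\<bar> \<partial>\<mu>) < e'" "\<And>i. (\<integral>x. \<bar>indicator (A i) x - g i x\<bar> \<partial>\<nu>) < e'"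
        by metis
      define s where "s x = min 1 (\<Sum>i<N. g i x)" for x
      have sc: "continuous_on UNIV s" unfolding s_def[abs_def] using g(1) by (intro continuous_intros)
      have s01: "0 \<le> s x \<and> s x \<le> 1" for x unfolding s_def using g(2) by (auto intro: sum_nonneg)
      have gm: "g i \<in> borel_measurable borel" for i using g(1) by (rule borel_measurable_continuous_onI)
      have sm: "s \<in> borel_measurable borel" using sc by (rule borel_measurable_continuous_onI)
      have Uind: "indicator (U N) x = min 1 (\<Sum>i<N. indicator (A i) x :: real)" for x
      proof (cases "x \<in> U N")
        case True
        then obtain i where i: "i < N" "x \<in> A i" by (auto simp: U_def)
        have "(indicator (A i) x :: real) \<le> (\<Sum>i<N. indicator (A i) x)"
          by (rule member_le_sum) (use i in auto)
        with i True show ?thesis by (simp add: min_def)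
      next
        case False
        then have "(\<Sum>i<N. indicator (A i) x :: real) = 0" by (intro sum.neutral) (auto simp: U_def)
        with False show ?thesis by simp
      qed
      have pt: "\<bar>indicator (\<Union>i. A i) x - s x\<bar>
        \<le> \<bar>indicator (\<Union>i. A i) x - indicator (U N) x\<bar> + (\<Sum>i<N. \<bar>indicator (A i) x - g i x\<bar>)" for x
      proof -
        have "\<bar>indicator (U N) x - s x\<bar> \<le> \<bar>(\<Sum>i<N. indicator (A i) x) - (\<Sum>i<N. g i x)\<bar>"
          unfolding Uind s_def by (auto simp: min_def)
        also have "\<dots> \<le> (\<Sum>i<N. \<bar>indicator (A i) x - g i x\<bar>)"
          unfolding sum_subtractf[symmetric] by (rule sum_abs)
        finally show ?thesis by linarith
      qed
      have final: "(\<integral>x. \<bar>indicator (\<Union>i. A i) x - s x\<bar> \<partial>M') < e"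
        if M': "finite_measure M'" "sets M' = sets borel"
          and t: "(\<integral>x. \<bar>indicator (\<Union>i. A i) x - indicator (U N) x :: real\<bar> \<partial>M') < e / 2"
          and gi: "\<And>i. (\<integral>x. \<bar>indicator (A i) x - g i x\<bar> \<partial>M') < e'" for M' :: "real measure"
      proof -
        note [measurable] = Um Um' Am gm sm
        have i1: "integrable M' (\<lambda>x. \<bar>indicator (\<Union>i. A i) x - indicator (U N) x :: real\<bar>)"
          by (rule int[OF M', where K = 1], measurable) (auto simp: indicator_def)
        have i2: "integrable M' (\<lambda>x. \<bar>indicator (A i) x - g i x\<bar>)" for i
          by (rule int[OF M', where K = 1], measurable) (use g(2)[of i] in \<open>auto simp: indicator_def\<close>)
        have i3: "integrable M' (\<lambda>x. \<bar>indicator (\<Union>i. A i) x - s x\<bar>)"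
          by (rule int[OF M', where K = 1], measurable) (use s01 in \<open>auto simp: indicator_def\<close>)
        have "(\<integral>x. \<bar>indicator (\<Union>i. A i) x - s x\<bar> \<partial>M')
          \<le> (\<integral>x. \<bar>indicator (\<Union>i. A i) x - indicator (U N) x\<bar> + (\<Sum>i<N. \<bar>indicator (A i) x - g i x\<bar>) \<partial>M')"
          using i1 i2 i3 pt by (intro integral_mono Bochner_Integration.integrable_add Bochner_Integration.integrable_sum) auto
        also have "\<dots> = (\<integral>x. \<bar>indicator (\<Union>i. A i) x - indicator (U N) x\<bar> \<partial>M') + (\<Sum>i<N. \<integral>x. \<bar>indicator (A i) x - g i x\<bar> \<partial>M')"
          using i1 i2 by (simp add: Bochner_Integration.integral_add Bochner_Integration.integral_sum)
        also have "(\<Sum>i<N. \<integral>x. \<bar>indicator (A i) x - g i x\<bar> \<partial>M') \<le> (\<Sum>i<N. e')"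
          using gi by (intro sum_mono) (auto simp: less_imp_le)
        also have "\<dots> \<le> e / 2" using e' by simp
        finally show ?thesis using t by linarith
      qed
      show "\<exists>g :: real \<Rightarrow> real. continuous_on UNIV g \<and> (\<forall>x. 0 \<le> g x \<and> g x \<le> 1) \<and>
          (\<integral>x. \<bar>indicator (\<Union>i. A i) x - g x\<bar> \<partial>\<mu>) < e \<and> (\<integral>x. \<bar>indicator (\<Union>i. A i) x - g x\<bar> \<partial>\<nu>) < e"
        by (intro exI[of _ s] conjI sc allI s01[THEN conjunct1] s01[THEN conjunct2]
            final[OF \<mu> N(1) g(3)] final[OF \<nu> N(2) g(4)])
    qed
  qed
qed

text \<open>Rounding \<open>h\<close> down to multiples of \<open>t\<close> leaves finitely many level sets; truncation at \<open>C\<close> afterwards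
  only improves the approximation.\<close>

lemma continuous_dense:
  assumes \<mu>: "finite_measure \<mu>" "sets \<mu> = sets borel" and \<nu>: "finite_measure \<nu>" "sets \<nu> = sets borel"
    and h: "bounded_borel C h" and e: "0 < e"
  shows "\<exists>g :: real \<Rightarrow> real. continuous_on UNIV g \<and> bounded_borel C g \<and>
    (\<integral>x. \<bar>h x - g x\<bar> \<partial>\<mu>) < e \<and> (\<integral>x. \<bar>h x - g x\<bar> \<partial>\<nu>) < e"
proof -
  note hm [measurable] = bounded_borelD(1)[OF h]
  define t where "t = e / (2 * (measure \<mu> UNIV + measure \<nu> UNIV + 1))"
  have mpos: "0 \<le> measure \<mu> UNIV" "0 \<le> measure \<nu> UNIV" by auto
  have t: "0 < t" "t * measure \<mu> UNIV \<le> e / 2" "t * measure \<nu> UNIV \<le> e / 2"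
    using e mpos by (auto simp: t_def field_simps add_pos_nonneg)
  define J where "J = {\<lfloor>- C / t\<rfloor>..\<lfloor>C / t\<rfloor>}"
  have fl: "\<lfloor>h x / t\<rfloor> \<in> J" for x
  proof -
    have "- C \<le> h x" "h x \<le> C" using bounded_borelD(2)[OF h, of x] by (auto simp: abs_le_iff)
    then have "- C / t \<le> h x / t" "h x / t \<le> C / t" using t(1) by (intro divide_right_mono; simp)+
    then show ?thesis unfolding J_def atLeastAtMost_iff by (intro conjI floor_mono)
  qed
  define a where "a j = t * real_of_int j" for j
  define A where "A j = {x. \<lfloor>h x / t\<rfloor> = j}" for j
  have Am: "A j \<in> sets borel" for j unfolding A_def by measurable
  have rep: "(\<Sum>j\<in>J. a j * indicator (A j) x) = t * real_of_int \<lfloor>h x / t\<rfloor>" for x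
  proof -
    have "(\<Sum>j\<in>J. a j * indicator (A j) x) = (\<Sum>j\<in>J. if j = \<lfloor>h x / t\<rfloor> then a j else 0)"
      by (intro sum.cong) (auto simp: A_def indicator_def)
    also have "\<dots> = a \<lfloor>h x / t\<rfloor>" using fl by (simp add: J_def)
    finally show ?thesis by (simp add: a_def)
  qed
  have close: "\<bar>h x - (\<Sum>j\<in>J. a j * indicator (A j) x)\<bar> \<le> t" for x
  proof -
    have "real_of_int \<lfloor>h x / t\<rfloor> \<le> h x / t" "h x / t < real_of_int \<lfloor>h x / t\<rfloor> + 1" by linarith+
    then have "t * real_of_int \<lfloor>h x / t\<rfloor> \<le> t * (h x / t)" "t * (h x / t) \<le> t * (real_of_int \<lfloor>h x / t\<rfloor> + 1)"
      using t(1) by (intro mult_left_mono; linarith)+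
    then have "t * real_of_int \<lfloor>h x / t\<rfloor> \<le> h x" "h x \<le> t * real_of_int \<lfloor>h x / t\<rfloor> + t"
      using t(1) by (auto simp: distrib_left)
    then show ?thesis unfolding rep by linarith
  qed
  define e' where "e' = e / (2 * ((\<Sum>j\<in>J. \<bar>a j\<bar>) + 1))"
  have sp: "0 < (\<Sum>j\<in>J. \<bar>a j\<bar>) + 1" by (intro add_nonneg_pos sum_nonneg) auto
  have e': "0 < e'" using e sp by (simp add: e'_def)
  have e'2: "(\<Sum>j\<in>J. \<bar>a j\<bar>) * e' < e / 2"
  proof -
    have "((\<Sum>j\<in>J. \<bar>a j\<bar>) + 1) * e' = e / 2" 
    proof -
      have "q * (e / (2 * q)) = e / 2" if "0 < q" for q :: real using that by simp
      from this[OF sp] show ?thesis by (simp only: e'_def)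
    qed
    then show ?thesis using e' by (simp add: algebra_simps)
  qed
  have "\<forall>j. \<exists>g :: real \<Rightarrow> real. continuous_on UNIV g \<and> (\<forall>x. 0 \<le> g x \<and> g x \<le> 1) \<and>
     (\<integral>x. \<bar>indicator (A j) x - g x\<bar> \<partial>\<mu>) < e' \<and> (\<integral>x. \<bar>indicator (A j) x - g x\<bar> \<partial>\<nu>) < e'"
    using approximable_borel[OF \<mu> \<nu> Am] e' unfolding approximable_def by blast
  then obtain g where g: "\<And>j. continuous_on UNIV (g j)" "\<And>j x. 0 \<le> g j x \<and> g j x \<le> 1"
    "\<And>j. (\<integral>x. \<bar>indicator (A j) x - g j x\<bar> \<partial>\<mu>) < e'" "\<And>j. (\<integral>x. \<bar>indicator (A j) x - g j x\<bar> \<partial>\<nu>) < e'"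
    by metis
  define s where "s x = max (- C) (min C (\<Sum>j\<in>J. a j * g j x))" for x
  have sc: "continuous_on UNIV s" unfolding s_def[abs_def] using g(1) by (intro continuous_intros)
  have gm: "g j \<in> borel_measurable borel" for j using g(1) by (rule borel_measurable_continuous_onI)
  have sm: "s \<in> borel_measurable borel" using sc by (rule borel_measurable_continuous_onI)
  have sb: "bounded_borel C s"
    using sm bounded_borelD(3)[OF h] by (auto simp: bounded_borel_def s_def)
  have pt: "\<bar>h x - s x\<bar> \<le> t + (\<Sum>j\<in>J. \<bar>a j\<bar> * \<bar>indicator (A j) x - g j x\<bar>)" for x
  proof -
    have "\<bar>h x - s x\<bar> \<le> \<bar>h x - (\<Sum>j\<in>J. a j * g j x)\<bar>"
      using bounded_borelD(2)[OF h, of x] unfolding s_def by linarith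
    moreover have "\<bar>(\<Sum>j\<in>J. a j * indicator (A j) x) - (\<Sum>j\<in>J. a j * g j x)\<bar>
      \<le> (\<Sum>j\<in>J. \<bar>a j\<bar> * \<bar>indicator (A j) x - g j x\<bar>)"
      unfolding sum_subtractf[symmetric] right_diff_distrib[symmetric] abs_mult[symmetric] by (rule sum_abs)
    ultimately show ?thesis using close[of x] by linarith
  qed
  have final: "(\<integral>x. \<bar>h x - s x\<bar> \<partial>M') < e"
    if M': "finite_measure M'" "sets M' = sets borel" and tM: "t * measure M' UNIV \<le> e / 2"
      and gi: "\<And>j. (\<integral>x. \<bar>indicator (A j) x - g j x\<bar> \<partial>M') < e'" for M' :: "real measure"
  proof -
    interpret finite_measure M' by fact
    note [measurable_cong] = M'(2)
    have sp': "space M' = UNIV" using sets_eq_imp_space_eq[OF M'(2)] by simp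
    note [measurable] = Am gm sm
    have i2: "integrable M' (\<lambda>x. \<bar>indicator (A j) x - g j x\<bar>)" for j
    proof (rule integrable_const_bound[where B = 1])
      show "AE x in M'. norm \<bar>indicator (A j) x - g j x\<bar> \<le> 1"
        using g(2)[of j] by (intro AE_I2) (auto simp: indicator_def)
    qed measurable
    have i3: "integrable M' (\<lambda>x. \<bar>h x - s x\<bar>)"
    proof (rule integrable_const_bound[where B = "2 * C"])
      have "\<bar>h x - s x\<bar> \<le> 2 * C" for x
        using bounded_borelD(2)[OF h, of x] bounded_borelD(2)[OF sb, of x] by linarith
      then show "AE x in M'. norm \<bar>h x - s x\<bar> \<le> 2 * C" by simp
    qed measurable
    have "(\<integral>x. \<bar>h x - s x\<bar> \<partial>M') \<le> (\<integral>x. t + (\<Sum>j\<in>J. \<bar>a j\<bar> * \<bar>indicator (A j) x - g j x\<bar>) \<partial>M')"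
      using i2 i3 pt by (intro integral_mono Bochner_Integration.integrable_add Bochner_Integration.integrable_sum integrable_mult_right) auto
    also have "\<dots> = t * measure M' UNIV + (\<Sum>j\<in>J. \<bar>a j\<bar> * (\<integral>x. \<bar>indicator (A j) x - g j x\<bar> \<partial>M'))"
      using i2 sp' by (simp add: Bochner_Integration.integral_add Bochner_Integration.integral_sum)
    also have "(\<Sum>j\<in>J. \<bar>a j\<bar> * (\<integral>x. \<bar>indicator (A j) x - g j x\<bar> \<partial>M')) \<le> (\<Sum>j\<in>J. \<bar>a j\<bar> * e')"
      using gi by (intro sum_mono mult_left_mono) (auto simp: less_imp_le)
    also have "\<dots> = (\<Sum>j\<in>J. \<bar>a j\<bar>) * e'" by (simp add: sum_distrib_right)
    finally show ?thesis using tM e'2 by linarith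
  qed
  show ?thesis
    by (intro exI[of _ s] conjI sc sb final[OF \<mu> t(2) g(3)] final[OF \<nu> t(3) g(4)])
qed

lemma continuous_AE_approximation:
  assumes \<mu>: "finite_measure \<mu>" "sets \<mu> = sets borel" and \<nu>: "finite_measure \<nu>" "sets \<nu> = sets borel"
    and h: "bounded_borel C h"
  shows "\<exists>g. (\<forall>n :: nat. continuous_on UNIV (g n) \<and> bounded_borel C (g n)) \<and>
    (AE x in \<mu>. (\<lambda>n. g n x) \<longlonglongrightarrow> h x) \<and> (AE x in \<nu>. (\<lambda>n. g n x) \<longlonglongrightarrow> h x)"
proof -
  have "\<forall>n :: nat. \<exists>g :: real \<Rightarrow> real. continuous_on UNIV g \<and> bounded_borel C g \<and>
    (\<integral>x. \<bar>h x - g x\<bar> \<partial>\<mu>) < 1 / real (Suc n) \<and> (\<integral>x. \<bar>h x - g x\<bar> \<partial>\<nu>) < 1 / real (Suc n)"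
    by (intro allI continuous_dense[OF \<mu> \<nu> h]) simp
  from choice[OF this] obtain g where g': "\<forall>n. continuous_on UNIV (g n) \<and> bounded_borel C (g n) \<and>
    (\<integral>x. \<bar>h x - g n x\<bar> \<partial>\<mu>) < 1 / real (Suc n) \<and> (\<integral>x. \<bar>h x - g n x\<bar> \<partial>\<nu>) < 1 / real (Suc n)"
    by (rule exE)
  have g: "continuous_on UNIV (g n)" "bounded_borel C (g n)"
    "(\<integral>x. \<bar>h x - g n x\<bar> \<partial>\<mu>) < 1 / real (Suc n)" "(\<integral>x. \<bar>h x - g n x\<bar> \<partial>\<nu>) < 1 / real (Suc n)" for n
    using spec[OF g', of n] by (simp_all only: simp_thms)
  have int: "integrable M' (\<lambda>x. h x - g n x)" if "finite_measure M'" "sets M' = sets borel" for M' n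
  proof -
    interpret finite_measure M' by fact
    note [measurable_cong] = that(2)
    note [measurable] = bounded_borelD(1)[OF h] bounded_borelD(1)[OF g(2)]
    have "\<bar>h x - g n x\<bar> \<le> 2 * C" for x
      using bounded_borelD(2)[OF h, of x] bounded_borelD(2)[OF g(2), of n x] by linarith
    then show ?thesis by (intro integrable_const_bound[where B = "2 * C"]) auto
  qed
  have inv: "(\<lambda>n. 1 / real (Suc n)) \<longlonglongrightarrow> 0" by (rule LIMSEQ_Suc[OF lim_1_over_n])
  have L\<mu>: "(\<lambda>n. \<integral>x. norm (h x - g n x) \<partial>\<mu>) \<longlonglongrightarrow> 0"
    by (rule tendsto_sandwich[OF _ _ tendsto_const inv]) (use g(3) in \<open>auto simp: less_imp_le\<close>)
  obtain r where r: "strict_mono r" "AE x in \<mu>. (\<lambda>n. h x - g (r n) x) \<longlonglongrightarrow> 0"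
    using tendsto_L1_AE_subseq[OF int[OF \<mu>] L\<mu>] by blast
  have "(\<lambda>n. \<integral>x. norm (h x - g n x) \<partial>\<nu>) \<longlonglongrightarrow> 0"
    by (rule tendsto_sandwich[OF _ _ tendsto_const inv]) (use g(4) in \<open>auto simp: less_imp_le\<close>)
  then have L\<nu>: "(\<lambda>n. \<integral>x. norm (h x - g (r n) x) \<partial>\<nu>) \<longlonglongrightarrow> 0"
    using LIMSEQ_subseq_LIMSEQ[OF _ r(1)] by (simp add: comp_def)
  obtain q where q: "strict_mono q" "AE x in \<nu>. (\<lambda>n. h x - g (r (q n)) x) \<longlonglongrightarrow> 0"
    using tendsto_L1_AE_subseq[OF int[OF \<nu>] L\<nu>] by blast
  have conv: "(\<lambda>n. f n) \<longlonglongrightarrow> l" if "(\<lambda>n. l - f n) \<longlonglongrightarrow> 0" for f :: "nat \<Rightarrow> real" and l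
    using tendsto_diff[OF tendsto_const[of l] that] by simp
  have "AE x in \<mu>. (\<lambda>n. g (r (q n)) x) \<longlonglongrightarrow> h x"
    using r(2)
  proof eventually_elim
    case (elim x)
    from LIMSEQ_subseq_LIMSEQ[OF this q(1)] have "(\<lambda>n. h x - g (r (q n)) x) \<longlonglongrightarrow> 0" by (simp only: comp_def)
    then show ?case by (rule conv)
  qed
  moreover have "AE x in \<nu>. (\<lambda>n. g (r (q n)) x) \<longlonglongrightarrow> h x"
    using q(2) by eventually_elim (rule conv)
  ultimately show ?thesis using g(1,2) by (intro exI[of _ "\<lambda>n. g (r (q n))"]) auto
qed

section \<open>The expansion for a fixed volatility process\<close>

text \<open>On the event \<open>I < v + \<kappa>\<close> the error of the step expansion survives the limit; off this event
  the step processes have been cut off, and every term is bounded by its supremum times the probability.\<close>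

definition remainder_bound :: "'a measure \<Rightarrow> ('a \<Rightarrow> real) \<Rightarrow> real \<Rightarrow> real \<Rightarrow> real \<Rightarrow> real" where
  "remainder_bound M I \<kappa> v \<delta> = expansion_const \<kappa> \<delta> * (\<integral>\<omega>. (I \<omega> - v)\<^sup>2 * indicator {\<omega> \<in> space M. I \<omega> < v + \<kappa>} \<omega> \<partial>M)
     + deriv_bound \<kappa> * (\<delta> * (\<integral>\<omega>. \<bar>I \<omega> - v\<bar> * indicator {\<omega> \<in> space M. I \<omega> < v + \<kappa>} \<omega> \<partial>M))
     + (2 + (v + \<kappa>) * deriv_bound \<delta> + expansion_const \<kappa> \<delta> * (v + \<kappa>)\<^sup>2 + deriv_bound \<kappa> * (\<delta> * (v + \<kappa>)))
       * measure M {\<omega> \<in> space M. v + \<kappa> \<le> I \<omega>}"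

context stochastic_volatility
begin

lemma stepR_measurable [measurable]: "stepR k \<in> borel_measurable M"
  unfolding stepR_def[abs_def]
  by (intro borel_measurable_sum borel_measurable_times borel_measurable_diff measurable_B grid_nonneg T
      measurable_compose[OF V_measurable[OF grid_nonneg[OF T]]]) auto

lemma stepR_subsequence: "\<exists>r. strict_mono r \<and> (AE \<omega> in M. (\<lambda>k. stepR (r k) \<omega>) \<longlonglongrightarrow> R \<omega>)"
proof -
  interpret prob_space M by (rule M)
  define u where "u k \<omega> = min 1 \<bar>stepR k \<omega> - R \<omega>\<bar>" for k \<omega>
  have um [measurable]: "u k \<in> borel_measurable M" for k unfolding u_def[abs_def] by measurable
  have iu: "integrable M (u k)" for k
    by (rule integrable_const_bound[where B = 1]) (auto simp: u_def)
  have "(\<lambda>k. \<integral>\<omega>. norm (u k \<omega>) \<partial>M) \<longlonglongrightarrow> 0"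
  proof (rule LIMSEQ_I)
    fix e :: real assume e: "0 < e"
    have "eventually (\<lambda>k. measure M {\<omega> \<in> space M. e / 2 < \<bar>stepR k \<omega> - R \<omega>\<bar>} < e / 2) sequentially"
      using order_tendstoD(2)[OF stepR_tendsto[of "e / 2"], of "e / 2"] e by simp
    then obtain K where K: "\<And>k. K \<le> k \<Longrightarrow> measure M {\<omega> \<in> space M. e / 2 < \<bar>stepR k \<omega> - R \<omega>\<bar>} < e / 2"
      by (auto simp: eventually_sequentially)
    show "\<exists>no. \<forall>k\<ge>no. norm ((\<integral>\<omega>. norm (u k \<omega>) \<partial>M) - 0) < e"
    proof (intro exI allI impI)
      fix k assume k: "K \<le> k"
      let ?D = "{\<omega> \<in> space M. e / 2 < \<bar>stepR k \<omega> - R \<omega>\<bar>}"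
      have iD: "integrable M (\<lambda>\<omega>. e / 2 + indicator ?D \<omega> :: real)"
        by (rule integrable_const_bound[where B = "e / 2 + 1"]) (use e in \<open>auto simp: indicator_def\<close>)
      have "(\<integral>\<omega>. norm (u k \<omega>) \<partial>M) \<le> (\<integral>\<omega>. e / 2 + indicator ?D \<omega> \<partial>M)"
      proof (rule integral_mono[OF integrable_norm[OF iu] iD])
        fix \<omega> assume "\<omega> \<in> space M"
        have le: "u k \<omega> \<le> 1" "u k \<omega> \<le> \<bar>stepR k \<omega> - R \<omega>\<bar>" "0 \<le> u k \<omega>"
          unfolding u_def by auto
        show "norm (u k \<omega>) \<le> e / 2 + indicator ?D \<omega>"
        proof (cases "\<omega> \<in> ?D")
          case True
          then show ?thesis using le e by simp
        next
          case False
          then have "\<bar>stepR k \<omega> - R \<omega>\<bar> \<le> e / 2" using \<open>\<omega> \<in> space M\<close> by auto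
          with le(2) have "u k \<omega> \<le> e / 2" by (rule order_trans)
          then show ?thesis using le False by simp
        qed
      qed
      also have "\<dots> = e / 2 + measure M ?D"
        using integrable_const_bound[of "indicator ?D :: 'a \<Rightarrow> real" 1]
        by (subst Bochner_Integration.integral_add) (auto simp: prob_space indicator_def)
      finally show "norm ((\<integral>\<omega>. norm (u k \<omega>) \<partial>M) - 0) < e" using K[OF k] by simp
    qed
  qed
  from tendsto_L1_AE_subseq[OF iu this] obtain r
    where r: "strict_mono r" "AE \<omega> in M. (\<lambda>k. u (r k) \<omega>) \<longlonglongrightarrow> 0" by blast
  have "AE \<omega> in M. (\<lambda>k. stepR (r k) \<omega>) \<longlonglongrightarrow> R \<omega>"
    using r(2)
  proof eventually_elim
    case (elim \<omega>)
    have "eventually (\<lambda>k. u (r k) \<omega> < 1) sequentially" using order_tendstoD(2)[OF elim] by simp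
    then have "eventually (\<lambda>k. u (r k) \<omega> = \<bar>stepR (r k) \<omega> - R \<omega>\<bar>) sequentially"
      by eventually_elim (auto simp: u_def)
    with elim have "(\<lambda>k. \<bar>stepR (r k) \<omega> - R \<omega>\<bar>) \<longlonglongrightarrow> 0" by (rule Lim_transform_eventually)
    then show ?case using LIM_zero_cancel tendsto_rabs_zero_iff by blast
  qed
  with r(1) show ?thesis by blast
qed

lemma expansion_const_nonneg: "0 < \<kappa> \<Longrightarrow> 0 \<le> expansion_const \<kappa> \<delta>"
  using deriv_bound_ge[of \<kappa>] deriv_bound_ge[of \<delta>] by (simp add: expansion_const_def)

text \<open>Where \<open>I < v + \<kappa>\<close> the cut-off is eventually inactive along the grid, so the step quantities converge there
  to \<open>I\<close> and \<open>R\<close> almost surely along a subsequence.\<close>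

lemma expansion_continuous:
  assumes \<kappa>: "0 < \<kappa>" "\<kappa> \<le> (1 - \<rho>\<^sup>2) * v / 2" and \<delta>: "0 < \<delta>"
    and h: "bounded_borel C h" and hc: "continuous_on UNIV h"
  shows "\<bar>(\<integral>\<omega>. h (R \<omega> - I \<omega> / 2) \<partial>M) - heat v h (- v / 2)
      - (\<integral>\<omega>. (I \<omega> - v) * corrector \<delta> h (R \<omega> - v / 2) * indicator {\<omega> \<in> space M. I \<omega> < v + \<kappa>} \<omega> \<partial>M)\<bar>
    \<le> C * remainder_bound M I \<kappa> v \<delta>"
proof -
  interpret prob_space M by (rule M)
  obtain r where r: "strict_mono r" "AE \<omega> in M. (\<lambda>k. stepR (r k) \<omega>) \<longlonglongrightarrow> R \<omega>"
    using stepR_subsequence by blast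
  have "0 < (1 - \<rho>\<^sup>2) * v" using \<kappa> by linarith
  then have v0: "0 < v" using \<rho>2 by (simp add: zero_less_mult_iff)
  define c where "c = v + \<kappa>"
  have c0: "0 \<le> c" using v0 \<kappa> by (simp add: c_def)
  define d where "d k i = grid T k (Suc i) - grid T k i" for k i
  have d0: "0 \<le> d k i" for k i using grid_less[OF T] by (simp add: d_def less_imp_le)
  define \<xi> where "\<xi> k i \<omega> = sqrt (V (grid T k i) \<omega>)" for k i \<omega>
  define \<xi>c where "\<xi>c k = cut_off c (d k) (\<xi> k)" for k
  define It where "It k \<omega> = (\<Sum>i<Suc k. (\<xi>c k i \<omega>)\<^sup>2 * d k i)" for k \<omega>
  define Rt where "Rt k \<omega> = (\<Sum>i<Suc k. \<xi>c k i \<omega> * (B (grid T k (Suc i)) \<omega> - B (grid T k i) \<omega>))" for k \<omega>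
  have \<xi>G: "\<xi>c k i \<in> borel_measurable (G (grid T k i))" if "i < Suc k" for k i
    unfolding \<xi>c_def
  proof (rule measurable_cut_off)
    fix j assume j: "j \<le> i"
    then have le: "grid T k j \<le> grid T k i" using partition_mono[of "Suc k" "grid T k" j i] grid_less[OF T] that by simp
    have "V (grid T k j) \<in> borel_measurable (G (grid T k j))" using V_adapted grid_nonneg[OF T] by (auto simp: adapted_def)
    then have "V (grid T k j) \<in> borel_measurable (G (grid T k i))"
      using measurable_from_subalg[of "G (grid T k i)" "G (grid T k j)"] filG le grid_nonneg[OF T] by (auto simp: filtration_on_def)
    then show "\<xi> k j \<in> borel_measurable (G (grid T k i))" unfolding \<xi>_def[abs_def] by measurable
  qed
  have \<xi>M: "\<xi>c k i \<in> borel_measurable M" if "i < Suc k" for k i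
    using measurable_from_subalg[OF subM(2) \<xi>G[OF that]] grid_nonneg[OF T] by simp
  have Itm [measurable]: "It k \<in> borel_measurable M" for k
    unfolding It_def[abs_def] using \<xi>M by (intro borel_measurable_sum borel_measurable_times borel_measurable_power) auto
  have Rtm [measurable]: "Rt k \<in> borel_measurable M" for k
    unfolding Rt_def[abs_def] using \<xi>M
    by (intro borel_measurable_sum borel_measurable_times borel_measurable_diff measurable_B grid_nonneg[OF T]) auto
  have Itc: "It k \<omega> \<le> c" for k \<omega> unfolding It_def \<xi>c_def by (rule cut_off_energy_le[OF c0 d0])
  have It0: "0 \<le> It k \<omega>" for k \<omega> unfolding It_def by (intro sum_nonneg mult_nonneg_nonneg d0) auto
  have sI: "stepI k \<omega> = (\<Sum>i<Suc k. (\<xi> k i \<omega>)\<^sup>2 * d k i)" for k \<omega> by (simp only: stepI_def \<xi>_def d_def)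
  have eq: "It k \<omega> = stepI k \<omega>" "Rt k \<omega> = stepR k \<omega>" if "stepI k \<omega> \<le> c" for k \<omega>
  proof -
    have co: "\<xi>c k i \<omega> = \<xi> k i \<omega>" if "i < Suc k" for i
      unfolding \<xi>c_def by (rule cut_off_eq[where n = "Suc k"]) (use \<open>stepI k \<omega> \<le> c\<close> sI d0 that in auto)
    show "It k \<omega> = stepI k \<omega>" unfolding sI It_def by (intro sum.cong refl) (simp add: co)
    show "Rt k \<omega> = stepR k \<omega>" unfolding stepR_def Rt_def \<xi>_def[symmetric] by (intro sum.cong refl) (simp add: co)
  qed
  define D where "D = {\<omega> \<in> space M. I \<omega> < v + \<kappa>}"
  have Dm [measurable]: "D \<in> events" unfolding D_def by measurable
  have lim: "AE \<omega> in M. \<omega> \<in> D \<longrightarrow> ((\<lambda>k. It (r k) \<omega>) \<longlonglongrightarrow> I \<omega> \<and> (\<lambda>k. Rt (r k) \<omega>) \<longlonglongrightarrow> R \<omega>)"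
    using r(2) AE_space
  proof eventually_elim
    case (elim \<omega>)
    show ?case
    proof
      assume D: "\<omega> \<in> D"
      have sl: "(\<lambda>k. stepI (r k) \<omega>) \<longlonglongrightarrow> I \<omega>"
        using LIMSEQ_subseq_LIMSEQ[OF stepI_tendsto[OF elim(2)] r(1)] by (simp only: comp_def)
      have "I \<omega> < c" using D by (simp add: D_def c_def)
      from order_tendstoD(2)[OF sl this] have ev: "eventually (\<lambda>k. stepI (r k) \<omega> \<le> c) sequentially"
        by eventually_elim simp
      have "eventually (\<lambda>k. stepI (r k) \<omega> = It (r k) \<omega>) sequentially" using ev by eventually_elim (simp add: eq)
      moreover have "eventually (\<lambda>k. stepR (r k) \<omega> = Rt (r k) \<omega>) sequentially" using ev by eventually_elim (simp add: eq)
      ultimately show "(\<lambda>k. It (r k) \<omega>) \<longlonglongrightarrow> I \<omega> \<and> (\<lambda>k. Rt (r k) \<omega>) \<longlonglongrightarrow> R \<omega>"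
        by (intro conjI Lim_transform_eventually[OF sl] Lim_transform_eventually[OF elim(1)])
    qed
  qed
  let ?G = "corrector \<delta> h"
  have Gb: "bounded_borel (C * deriv_bound \<delta>) ?G" by (rule bounded_borel_corrector[OF h \<delta> order_refl])
  note [measurable] = bounded_borelD(1)[OF h] bounded_borelD(1)[OF Gb]
  have hcont: "isCont h x" for x using hc by (simp add: continuous_on_eq_continuous_at)
  have Gcont: "isCont ?G x" for x
  proof -
    have "isCont (heat_deriv j \<delta> h) x" if "j < 4" for j
      by (rule DERIV_isCont[OF heat_deriv_has_derivative[OF h \<delta> that]])
    then show ?thesis unfolding corrector_def[abs_def] by (intro continuous_intros) auto
  qed
  define m where "m = v + \<kappa>"
  have m0: "0 \<le> m" using v0 \<kappa> by (simp add: m_def)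
  have Dv: "\<bar>It k \<omega> - v\<bar> \<le> m" for k \<omega>
    using It0[of k \<omega>] Itc[of k \<omega>] v0 \<kappa> by (auto simp: m_def c_def abs_le_iff)
  define u1 where "u1 k \<omega> = h (Rt k \<omega> - It k \<omega> / 2)" for k \<omega>
  define u2 where "u2 k \<omega> = (It k \<omega> - v) * ?G (Rt k \<omega> - v / 2)" for k \<omega>
  define u3 where "u3 k \<omega> = (It k \<omega> - v)\<^sup>2" for k \<omega>
  define u4 where "u4 k \<omega> = \<bar>It k \<omega> - v\<bar>" for k \<omega>
  note u_defs = u1_def u2_def u3_def u4_def
  have um [measurable]: "u1 k \<in> borel_measurable M" "u2 k \<in> borel_measurable M"
    "u3 k \<in> borel_measurable M" "u4 k \<in> borel_measurable M" for k
    unfolding u_defs[abs_def] by measurable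
  have lm [measurable]: "(\<lambda>\<omega>. h (R \<omega> - I \<omega> / 2)) \<in> borel_measurable M"
    "(\<lambda>\<omega>. (I \<omega> - v) * ?G (R \<omega> - v / 2)) \<in> borel_measurable M"
    "(\<lambda>\<omega>. (I \<omega> - v)\<^sup>2) \<in> borel_measurable M" "(\<lambda>\<omega>. \<bar>I \<omega> - v\<bar>) \<in> borel_measurable M"
    by measurable
  define K2 where "K2 = m * (C * deriv_bound \<delta>)"
  have b1: "\<bar>u1 k \<omega>\<bar> \<le> C" and b2: "\<bar>u2 k \<omega>\<bar> \<le> K2" and b3: "\<bar>u3 k \<omega>\<bar> \<le> m\<^sup>2" and b4: "\<bar>u4 k \<omega>\<bar> \<le> m" for k \<omega>
  proof -
    show "\<bar>u1 k \<omega>\<bar> \<le> C" using bounded_borelD(2)[OF h] by (simp add: u1_def)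
    show "\<bar>u2 k \<omega>\<bar> \<le> K2"
      unfolding u2_def K2_def abs_mult by (intro mult_mono Dv bounded_borelD(2)[OF Gb] m0) auto
    show "\<bar>u3 k \<omega>\<bar> \<le> m\<^sup>2" unfolding u3_def using power_mono[OF Dv[of k \<omega>], of 2] by simp
    show "\<bar>u4 k \<omega>\<bar> \<le> m" unfolding u4_def using Dv by simp
  qed
  have a1: "AE \<omega> in M. \<omega> \<in> D \<longrightarrow> (\<lambda>k. u1 (r k) \<omega>) \<longlonglongrightarrow> h (R \<omega> - I \<omega> / 2)"
    and a2: "AE \<omega> in M. \<omega> \<in> D \<longrightarrow> (\<lambda>k. u2 (r k) \<omega>) \<longlonglongrightarrow> (I \<omega> - v) * ?G (R \<omega> - v / 2)"
    and a3: "AE \<omega> in M. \<omega> \<in> D \<longrightarrow> (\<lambda>k. u3 (r k) \<omega>) \<longlonglongrightarrow> (I \<omega> - v)\<^sup>2"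
    and a4: "AE \<omega> in M. \<omega> \<in> D \<longrightarrow> (\<lambda>k. u4 (r k) \<omega>) \<longlonglongrightarrow> \<bar>I \<omega> - v\<bar>"
    unfolding u_defs
    by (use lim in \<open>eventually_elim; intro impI isCont_tendsto_compose[OF hcont] tendsto_intros isCont_tendsto_compose[OF Gcont]; simp\<close>)+
  note l1 = integral_tendsto_on_event[OF um(1) lm(1) Dm b1 a1]
    and l2 = integral_tendsto_on_event[OF um(2) lm(2) Dm b2 a2]
    and l3 = integral_tendsto_on_event[OF um(3) lm(3) Dm b3 a3]
    and l4 = integral_tendsto_on_event[OF um(4) lm(4) Dm b4 a4]
  define P where "P = prob (space M - D)"
  define A where "A = expansion_const \<kappa> \<delta>"
  define L where "L = deriv_bound \<kappa>"
  have A0: "0 \<le> A" and L0: "0 \<le> L" and C0: "0 \<le> C" and P0: "0 \<le> P"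
    using expansion_const_nonneg[OF \<kappa>(1)] deriv_bound_ge[of \<kappa>] bounded_borelD(3)[OF h]
    by (auto simp: A_def L_def P_def)
  define H where "H = heat v h (- v / 2)"
  have k_bound: "\<bar>(\<integral>\<omega>. u1 (r k) \<omega> * indicator D \<omega> \<partial>M) - H - (\<integral>\<omega>. u2 (r k) \<omega> * indicator D \<omega> \<partial>M)\<bar>
    \<le> C * (A * (\<integral>\<omega>. u3 (r k) \<omega> * indicator D \<omega> \<partial>M) + L * (\<delta> * (\<integral>\<omega>. u4 (r k) \<omega> * indicator D \<omega> \<partial>M)))
      + (C * P + K2 * P + C * (A * (m\<^sup>2 * P) + L * (\<delta> * (m * P))))" for k
  proof -
    have main: "\<bar>(\<integral>\<omega>. u1 (r k) \<omega> \<partial>M) - H - (\<integral>\<omega>. u2 (r k) \<omega> \<partial>M)\<bar>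
      \<le> C * (A * (\<integral>\<omega>. u3 (r k) \<omega> \<partial>M) + L * (\<delta> * (\<integral>\<omega>. u4 (r k) \<omega> \<partial>M)))"
      unfolding u_defs H_def A_def L_def
      by (rule step_expansion[of "grid T (r k)" "Suc (r k)" "\<xi>c (r k)", OF _ _ \<xi>G _ _ \<kappa> _ h \<delta>])
         (use grid_less[OF T] grid_nonneg[OF T] Itc in \<open>simp_all add: It_def Rt_def d_def c_def del: sum.lessThan_Suc\<close>)
    note o1 = integral_off_event_le[OF um(1) Dm b1, of "r k", folded P_def]
      and o2 = integral_off_event_le[OF um(2) Dm b2, of "r k", folded P_def]
      and o3 = integral_off_event_le[OF um(3) Dm b3, of "r k", folded P_def]
      and o4 = integral_off_event_le[OF um(4) Dm b4, of "r k", folded P_def]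
    have t3: "A * (\<integral>\<omega>. u3 (r k) \<omega> \<partial>M) \<le> A * ((\<integral>\<omega>. u3 (r k) \<omega> * indicator D \<omega> \<partial>M) + m\<^sup>2 * P)"
      using o3 by (intro mult_left_mono A0) linarith
    have "\<delta> * (\<integral>\<omega>. u4 (r k) \<omega> \<partial>M) \<le> \<delta> * ((\<integral>\<omega>. u4 (r k) \<omega> * indicator D \<omega> \<partial>M) + m * P)"
      using o4 \<delta> by (intro mult_left_mono) linarith+
    then have t4: "L * (\<delta> * (\<integral>\<omega>. u4 (r k) \<omega> \<partial>M)) \<le> L * (\<delta> * ((\<integral>\<omega>. u4 (r k) \<omega> * indicator D \<omega> \<partial>M) + m * P))"
      by (rule mult_left_mono) (rule L0)
    have "C * (A * (\<integral>\<omega>. u3 (r k) \<omega> \<partial>M) + L * (\<delta> * (\<integral>\<omega>. u4 (r k) \<omega> \<partial>M)))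
      \<le> C * (A * ((\<integral>\<omega>. u3 (r k) \<omega> * indicator D \<omega> \<partial>M) + m\<^sup>2 * P)
           + L * (\<delta> * ((\<integral>\<omega>. u4 (r k) \<omega> * indicator D \<omega> \<partial>M) + m * P)))"
      by (intro mult_left_mono add_mono t3 t4 C0)
    also have "\<dots> = C * (A * (\<integral>\<omega>. u3 (r k) \<omega> * indicator D \<omega> \<partial>M) + L * (\<delta> * (\<integral>\<omega>. u4 (r k) \<omega> * indicator D \<omega> \<partial>M)))
      + C * (A * (m\<^sup>2 * P) + L * (\<delta> * (m * P)))"
      by (simp add: algebra_simps)
    finally show ?thesis using main o1 o2 by linarith
  qed
  have lim_bound: "\<bar>(\<integral>\<omega>. h (R \<omega> - I \<omega> / 2) * indicator D \<omega> \<partial>M) - H - (\<integral>\<omega>. (I \<omega> - v) * ?G (R \<omega> - v / 2) * indicator D \<omega> \<partial>M)\<bar>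
    \<le> C * (A * (\<integral>\<omega>. (I \<omega> - v)\<^sup>2 * indicator D \<omega> \<partial>M) + L * (\<delta> * (\<integral>\<omega>. \<bar>I \<omega> - v\<bar> * indicator D \<omega> \<partial>M)))
      + (C * P + K2 * P + C * (A * (m\<^sup>2 * P) + L * (\<delta> * (m * P))))"
  proof (rule LIMSEQ_le)
    show "(\<lambda>k. \<bar>(\<integral>\<omega>. u1 (r k) \<omega> * indicator D \<omega> \<partial>M) - H - (\<integral>\<omega>. u2 (r k) \<omega> * indicator D \<omega> \<partial>M)\<bar>)
      \<longlonglongrightarrow> \<bar>(\<integral>\<omega>. h (R \<omega> - I \<omega> / 2) * indicator D \<omega> \<partial>M) - H - (\<integral>\<omega>. (I \<omega> - v) * ?G (R \<omega> - v / 2) * indicator D \<omega> \<partial>M)\<bar>"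
      by (intro tendsto_rabs tendsto_diff tendsto_const l1 l2)
    show "(\<lambda>k. C * (A * (\<integral>\<omega>. u3 (r k) \<omega> * indicator D \<omega> \<partial>M) + L * (\<delta> * (\<integral>\<omega>. u4 (r k) \<omega> * indicator D \<omega> \<partial>M)))
      + (C * P + K2 * P + C * (A * (m\<^sup>2 * P) + L * (\<delta> * (m * P)))))
      \<longlonglongrightarrow> C * (A * (\<integral>\<omega>. (I \<omega> - v)\<^sup>2 * indicator D \<omega> \<partial>M) + L * (\<delta> * (\<integral>\<omega>. \<bar>I \<omega> - v\<bar> * indicator D \<omega> \<partial>M)))
      + (C * P + K2 * P + C * (A * (m\<^sup>2 * P) + L * (\<delta> * (m * P))))"
      by (intro tendsto_add tendsto_mult tendsto_const l3 l4)
  qed (use k_bound in blast)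
  have off: "\<bar>(\<integral>\<omega>. h (R \<omega> - I \<omega> / 2) \<partial>M) - (\<integral>\<omega>. h (R \<omega> - I \<omega> / 2) * indicator D \<omega> \<partial>M)\<bar> \<le> C * P"
    unfolding P_def by (rule integral_off_event_le[OF lm(1) Dm]) (rule bounded_borelD(2)[OF h])
  have Deq: "space M - D = {\<omega> \<in> space M. v + \<kappa> \<le> I \<omega>}" by (auto simp: D_def)
  have rb: "C * remainder_bound M I \<kappa> v \<delta> = C * (A * (\<integral>\<omega>. (I \<omega> - v)\<^sup>2 * indicator D \<omega> \<partial>M) + L * (\<delta> * (\<integral>\<omega>. \<bar>I \<omega> - v\<bar> * indicator D \<omega> \<partial>M)))
      + (C * P + K2 * P + C * (A * (m\<^sup>2 * P) + L * (\<delta> * (m * P)))) + C * P"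
    unfolding remainder_bound_def
    unfolding D_def[symmetric] Deq[symmetric]
    unfolding P_def[symmetric] A_def[symmetric] L_def[symmetric] m_def[symmetric] K2_def
    by (simp add: algebra_simps)
  show ?thesis
    unfolding rb D_def[symmetric] H_def[symmetric] using lim_bound off by linarith
qed

end

text \<open>Gaussian kernels are absolutely continuous, so convergence almost everywhere becomes convergence
  everywhere.\<close>

lemma heat_tendsto:
  assumes g: "\<And>n :: nat. bounded_borel C (g n)" and h: "bounded_borel C h" and s: "0 < s"
    and lim: "AE x in lborel. (\<lambda>n. g n x) \<longlonglongrightarrow> h x"
  shows "(\<lambda>n. heat s (g n) x) \<longlonglongrightarrow> heat s h x" "(\<lambda>n. heat_grad s (g n) x) \<longlonglongrightarrow> heat_grad s h x"
proof -
  note [measurable] = bounded_borelD(1)[OF g] bounded_borelD(1)[OF h]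
  from AE_E[OF lim] obtain N where N': "{x \<in> space lborel. \<not> (\<lambda>n. g n x) \<longlonglongrightarrow> h x} \<subseteq> N"
    "emeasure lborel N = 0" "N \<in> sets lborel" by blast
  then have N: "N \<in> null_sets lborel" "\<And>x. x \<notin> N \<Longrightarrow> (\<lambda>n. g n x) \<longlonglongrightarrow> h x"
    by (auto simp: null_sets_def)
  have [measurable]: "N \<in> sets borel" using N(1) by (auto simp: null_sets_def)
  have "AE x in lborel. x \<notin> N" using N(1) by (rule AE_not_in)
  then have "AE z in lborel. x + sqrt s * z \<notin> N"
    using s by (intro AE_borel_affine[where P = "\<lambda>y. y \<notin> N"]) auto
  then have ae: "AE z in \<gamma>. (\<lambda>n. g n (x + sqrt s * z)) \<longlonglongrightarrow> h (x + sqrt s * z)"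
    by (subst AE_density) (auto elim!: eventually_mono intro: N(2))
  show "(\<lambda>n. heat s (g n) x) \<longlonglongrightarrow> heat s h x"
    unfolding heat_def
    by (rule integral_dominated_convergence[where w = "\<lambda>_. C"]) (use ae bounded_borelD(2)[OF g] in auto)
  show "(\<lambda>n. heat_grad s (g n) x) \<longlonglongrightarrow> heat_grad s h x"
    unfolding heat_grad_def
  proof (rule integral_dominated_convergence[where w = "\<lambda>z. C * \<bar>z / sqrt s\<bar>"])
    show "integrable \<gamma> (\<lambda>z. C * \<bar>z / sqrt s\<bar>)"
      by (intro integrable_mult_right integrable_abs integrable_divide integrable_gauss_id)
    show "AE z in \<gamma>. (\<lambda>n. g n (x + sqrt s * z) * (z / sqrt s)) \<longlonglongrightarrow> h (x + sqrt s * z) * (z / sqrt s)"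
      using ae by eventually_elim (intro tendsto_mult tendsto_const)
    show "AE z in \<gamma>. norm (g n (x + sqrt s * z) * (z / sqrt s)) \<le> C * \<bar>z / sqrt s\<bar>" for n
      unfolding real_norm_def abs_mult by (intro AE_I2 mult_right_mono bounded_borelD(2)[OF g]) auto
  qed auto
qed

lemma corrector_tendsto:
  assumes g: "\<And>n :: nat. bounded_borel C (g n)" and h: "bounded_borel C h" and \<delta>: "0 < \<delta>"
    and lim: "AE x in lborel. (\<lambda>n. g n x) \<longlonglongrightarrow> h x"
  shows "(\<lambda>n. corrector \<delta> (g n) x) \<longlonglongrightarrow> corrector \<delta> h x"
proof -
  have s: "0 < \<delta> / 4" using \<delta> by simp
  have heat_lim: "AE x in lborel. (\<lambda>n. (heat (\<delta> / 4) ^^ k) (g n) x) \<longlonglongrightarrow> (heat (\<delta> / 4) ^^ k) h x" for k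
  proof (induction k)
    case (Suc k)
    from heat_tendsto(1)[OF bounded_borel_heat_pow[OF g] bounded_borel_heat_pow[OF h] s Suc.IH]
    show ?case by simp
  qed (use lim in simp)
  have one: "(\<lambda>n. heat_grad (\<delta> / 4) ((heat (\<delta> / 4) ^^ k) (g n)) x) \<longlonglongrightarrow> heat_grad (\<delta> / 4) ((heat (\<delta> / 4) ^^ k) h) x" for k x
    by (rule heat_tendsto(2)[OF bounded_borel_heat_pow[OF g] bounded_borel_heat_pow[OF h] s heat_lim])
  have "(\<lambda>n. heat_deriv 1 \<delta> (g n) x) \<longlonglongrightarrow> heat_deriv 1 \<delta> h x"
    using one[of 3 x] by (simp add: heat_deriv_def)
  moreover have "(\<lambda>n. heat_grad (\<delta> / 4) (heat_grad (\<delta> / 4) ((heat (\<delta> / 4) ^^ 2) (g n))) x)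
     \<longlonglongrightarrow> heat_grad (\<delta> / 4) (heat_grad (\<delta> / 4) ((heat (\<delta> / 4) ^^ 2) h)) x"
    by (rule heat_tendsto(2)[OF bounded_borel_heat_grad[OF bounded_borel_heat_pow[OF g] s]
          bounded_borel_heat_grad[OF bounded_borel_heat_pow[OF h] s] s]) (use one in simp)
  then have "(\<lambda>n. heat_deriv 2 \<delta> (g n) x) \<longlonglongrightarrow> heat_deriv 2 \<delta> h x"
    by (simp add: heat_deriv_def numeral_2_eq_2)
  ultimately show ?thesis unfolding corrector_def by (intro tendsto_intros) auto
qed

context stochastic_volatility
begin

text \<open>All three terms are continuous under bounded convergence that holds almost everywhere both for the
  law of \<open>R - I / 2\<close> and for Lebesgue measure.\<close>

lemma expansion:
  assumes \<kappa>: "0 < \<kappa>" "\<kappa> \<le> (1 - \<rho>\<^sup>2) * v / 2" and \<delta>: "0 < \<delta>"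
    and h: "bounded_borel C h"
  shows "\<bar>(\<integral>\<omega>. h (R \<omega> - I \<omega> / 2) \<partial>M) - heat v h (- v / 2)
      - (\<integral>\<omega>. (I \<omega> - v) * corrector \<delta> h (R \<omega> - v / 2) * indicator {\<omega> \<in> space M. I \<omega> < v + \<kappa>} \<omega> \<partial>M)\<bar>
    \<le> C * remainder_bound M I \<kappa> v \<delta>"
proof -
  interpret prob_space M by (rule M)
  have "0 < (1 - \<rho>\<^sup>2) * v" using \<kappa> by linarith
  then have v0: "0 < v" using \<rho>2 by (simp add: zero_less_mult_iff)
  define \<mu> where "\<mu> = distr M borel (\<lambda>\<omega>. R \<omega> - I \<omega> / 2)"
  interpret \<mu>: prob_space \<mu> unfolding \<mu>_def by (rule prob_space_distr) measurable
  have \<mu>': "finite_measure \<mu>" "sets \<mu> = sets borel"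
    by (rule \<mu>.finite_measure_axioms) (simp add: \<mu>_def)
  have \<gamma>': "finite_measure \<gamma>" "sets \<gamma> = sets borel"
    by (rule gauss.finite_measure_axioms) simp
  obtain g where g: "\<And>n :: nat. continuous_on UNIV (g n)" "\<And>n. bounded_borel C (g n)"
    "AE x in \<mu>. (\<lambda>n. g n x) \<longlonglongrightarrow> h x" "AE x in \<gamma>. (\<lambda>n. g n x) \<longlonglongrightarrow> h x"
    using continuous_AE_approximation[OF \<mu>' \<gamma>' h] by blast
  note [measurable] = bounded_borelD(1)[OF g(2)] bounded_borelD(1)[OF h]
  have leb: "AE x in lborel. (\<lambda>n. g n x) \<longlonglongrightarrow> h x"
    using g(4) by (subst (asm) AE_density) (auto simp: normal_density_pos elim!: eventually_mono)
  have law: "AE \<omega> in M. (\<lambda>n. g n (R \<omega> - I \<omega> / 2)) \<longlonglongrightarrow> h (R \<omega> - I \<omega> / 2)"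
    using g(3) unfolding \<mu>_def by (rule AE_distrD[rotated]) measurable
  have Gb: "bounded_borel (C * deriv_bound \<delta>) (corrector \<delta> k)" if "bounded_borel C k" for k
    by (rule bounded_borel_corrector[OF that \<delta> order_refl])
  note [measurable] = bounded_borelD(1)[OF Gb[OF g(2)]] bounded_borelD(1)[OF Gb[OF h]]
  let ?D = "{\<omega> \<in> space M. I \<omega> < v + \<kappa>}"
  have l1: "(\<lambda>n. \<integral>\<omega>. g n (R \<omega> - I \<omega> / 2) \<partial>M) \<longlonglongrightarrow> (\<integral>\<omega>. h (R \<omega> - I \<omega> / 2) \<partial>M)"
    by (rule integral_dominated_convergence[where w = "\<lambda>_. C"]) (use law bounded_borelD(2)[OF g(2)] in auto)
  have l2: "(\<lambda>n. heat v (g n) (- v / 2)) \<longlonglongrightarrow> heat v h (- v / 2)"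
    by (rule heat_tendsto(1)[OF g(2) h v0 leb])
  have l3: "(\<lambda>n. \<integral>\<omega>. (I \<omega> - v) * corrector \<delta> (g n) (R \<omega> - v / 2) * indicator ?D \<omega> \<partial>M)
    \<longlonglongrightarrow> (\<integral>\<omega>. (I \<omega> - v) * corrector \<delta> h (R \<omega> - v / 2) * indicator ?D \<omega> \<partial>M)"
  proof (rule integral_dominated_convergence[where w = "\<lambda>_. (v + \<kappa>) * (C * deriv_bound \<delta>)"])
    show "AE \<omega> in M. (\<lambda>n. (I \<omega> - v) * corrector \<delta> (g n) (R \<omega> - v / 2) * indicator ?D \<omega>)
        \<longlonglongrightarrow> (I \<omega> - v) * corrector \<delta> h (R \<omega> - v / 2) * indicator ?D \<omega>"
      by (intro AE_I2 tendsto_intros corrector_tendsto[OF g(2) h \<delta> leb])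
    show "AE \<omega> in M. norm ((I \<omega> - v) * corrector \<delta> (g n) (R \<omega> - v / 2) * indicator ?D \<omega>)
        \<le> (v + \<kappa>) * (C * deriv_bound \<delta>)" for n
    proof (rule AE_I2)
      fix \<omega> assume \<omega>: "\<omega> \<in> space M"
      have nn: "0 \<le> C * deriv_bound \<delta>" by (rule bounded_borelD(3)[OF Gb[OF h]])
      show "norm ((I \<omega> - v) * corrector \<delta> (g n) (R \<omega> - v / 2) * indicator ?D \<omega>) \<le> (v + \<kappa>) * (C * deriv_bound \<delta>)"
      proof (cases "\<omega> \<in> ?D")
        case True
        then have "\<bar>I \<omega> - v\<bar> \<le> v + \<kappa>" using I_nonneg[OF \<omega>] v0 \<kappa> by (auto simp: abs_le_iff)
        then show ?thesis using True bounded_borelD(2)[OF Gb[OF g(2)]] v0 \<kappa>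
          by (auto simp: abs_mult intro!: mult_mono)
      qed (use nn v0 \<kappa> in auto)
    qed
  qed auto
  show ?thesis
  proof (rule LIMSEQ_le_const2)
    show "(\<lambda>n. \<bar>(\<integral>\<omega>. g n (R \<omega> - I \<omega> / 2) \<partial>M) - heat v (g n) (- v / 2)
      - (\<integral>\<omega>. (I \<omega> - v) * corrector \<delta> (g n) (R \<omega> - v / 2) * indicator ?D \<omega> \<partial>M)\<bar>)
      \<longlonglongrightarrow> \<bar>(\<integral>\<omega>. h (R \<omega> - I \<omega> / 2) \<partial>M) - heat v h (- v / 2)
      - (\<integral>\<omega>. (I \<omega> - v) * corrector \<delta> h (R \<omega> - v / 2) * indicator ?D \<omega> \<partial>M)\<bar>"
      by (intro tendsto_rabs tendsto_diff l1 l2 l3)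
    show "\<exists>N. \<forall>n\<ge>N. \<bar>(\<integral>\<omega>. g n (R \<omega> - I \<omega> / 2) \<partial>M) - heat v (g n) (- v / 2)
      - (\<integral>\<omega>. (I \<omega> - v) * corrector \<delta> (g n) (R \<omega> - v / 2) * indicator ?D \<omega> \<partial>M)\<bar> \<le> C * remainder_bound M I \<kappa> v \<delta>"
      using expansion_continuous[OF \<kappa> \<delta> g(2,1)] by blast
  qed
qed

end

section \<open>Uniform integrability and the remainder\<close>

text \<open>Convergence in law survives test functions that move with the parameter, as long as they
  approach their limit at a rate that is linear in the argument; tightness is supplied by the limit law.\<close>

lemma tendsto_in_law_moving_test:
  fixes Z :: "'i \<Rightarrow> 'a \<Rightarrow> real \<times> real" and u :: "real \<times> real \<Rightarrow> real"
  assumes M: "prob_space M" and N: "prob_space N" and law: "tendsto_in_law M Z N L \<F>"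
    and u: "continuous_on UNIV u" "\<And>z. \<bar>u z\<bar> \<le> K"
    and w: "\<forall>\<^sub>F i in \<F>. w i \<in> borel_measurable borel" "\<And>i z. \<bar>w i z\<bar> \<le> K"
    and \<eta>: "(\<eta> \<longlongrightarrow> 0) \<F>" and near: "\<forall>\<^sub>F i in \<F>. \<forall>z. \<bar>w i z - u z\<bar> \<le> \<eta> i * (1 + \<bar>fst z\<bar> + \<bar>snd z\<bar>)"
  shows "((\<lambda>i. \<integral>\<omega>. w i (Z i \<omega>) \<partial>M) \<longlongrightarrow> (\<integral>\<omega>. u (L \<omega>) \<partial>N)) \<F>"
proof -
  interpret M: prob_space M by fact
  interpret N: prob_space N by fact
  have Zm: "\<forall>\<^sub>F i in \<F>. Z i \<in> borel_measurable M" and Lm [measurable]: "L \<in> borel_measurable N"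
    and conv: "\<And>g :: real \<times> real \<Rightarrow> real. continuous_on UNIV g \<Longrightarrow> bounded (range g) \<Longrightarrow>
        ((\<lambda>i. \<integral>\<omega>. g (Z i \<omega>) \<partial>M) \<longlongrightarrow> (\<integral>\<omega>. g (L \<omega>) \<partial>N)) \<F>"
    using law unfolding tendsto_in_law_def by blast+
  have um [measurable]: "u \<in> borel_measurable borel" using u(1) by (rule borel_measurable_continuous_onI)
  have K0: "0 \<le> K" using u(2)[of undefined] by linarith
  define \<psi> where "\<psi> t z = min (2 * K) (t * (1 + \<bar>fst z\<bar> + \<bar>snd z\<bar>))" for t :: real and z :: "real \<times> real"
  have \<psi>c: "continuous_on UNIV (\<psi> t)" for t unfolding \<psi>_def[abs_def] by (intro continuous_intros)
  have \<psi>b: "\<bar>\<psi> t z\<bar> \<le> 2 * K" if "0 \<le> t" for t z using K0 that by (simp add: \<psi>_def)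
  have \<psi>m [measurable]: "\<psi> t \<in> borel_measurable borel" for t using \<psi>c by (rule borel_measurable_continuous_onI)
  have bdd: "bounded (range g)" if "\<And>z. \<bar>g z\<bar> \<le> c" for g :: "real \<times> real \<Rightarrow> real" and c
    using that by (auto simp: bounded_iff intro!: exI[of _ c])
  have \<psi>0: "(\<lambda>n. \<integral>\<omega>. \<psi> (1 / real (Suc n)) (L \<omega>) \<partial>N) \<longlonglongrightarrow> 0"
  proof -
    have "(\<lambda>n. \<integral>\<omega>. \<psi> (1 / real (Suc n)) (L \<omega>) \<partial>N) \<longlonglongrightarrow> (\<integral>\<omega>. 0 \<partial>N)"
    proof (rule integral_dominated_convergence[where w = "\<lambda>_. 2 * K"])
      have "(\<lambda>n. \<psi> (1 / real (Suc n)) z) \<longlonglongrightarrow> min (2 * K) (0 * (1 + \<bar>fst z\<bar> + \<bar>snd z\<bar>))" for z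
        unfolding \<psi>_def by (intro tendsto_min tendsto_const tendsto_mult LIMSEQ_Suc[OF lim_1_over_n])
      then show "AE \<omega> in N. (\<lambda>n. \<psi> (1 / real (Suc n)) (L \<omega>)) \<longlonglongrightarrow> 0" using K0 by simp
      show "AE \<omega> in N. norm (\<psi> (1 / real (Suc n)) (L \<omega>)) \<le> 2 * K" for n
        by (intro AE_I2) (simp only: real_norm_def, intro \<psi>b, simp)
    qed auto
    then show ?thesis by simp
  qed
  have "((\<lambda>i. (\<integral>\<omega>. w i (Z i \<omega>) \<partial>M) - (\<integral>\<omega>. u (Z i \<omega>) \<partial>M)) \<longlongrightarrow> 0) \<F>"
  proof (rule tendstoI)
    fix e :: real assume e: "0 < e"
    from order_tendstoD(2)[OF \<psi>0 e] obtain n where n: "(\<integral>\<omega>. \<psi> (1 / real (Suc n)) (L \<omega>) \<partial>N) < e"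
      by (auto simp: eventually_sequentially)
    let ?t = "1 / real (Suc n)"
    have "((\<lambda>i. \<integral>\<omega>. \<psi> ?t (Z i \<omega>) \<partial>M) \<longlongrightarrow> (\<integral>\<omega>. \<psi> ?t (L \<omega>) \<partial>N)) \<F>"
      by (rule conv[OF \<psi>c bdd]) (rule \<psi>b, simp)
    from order_tendstoD(2)[OF this n]
    have 1: "\<forall>\<^sub>F i in \<F>. (\<integral>\<omega>. \<psi> ?t (Z i \<omega>) \<partial>M) < e" .
    have 2: "\<forall>\<^sub>F i in \<F>. \<eta> i < ?t" by (rule order_tendstoD(2)[OF \<eta>]) simp
    show "\<forall>\<^sub>F i in \<F>. dist ((\<integral>\<omega>. w i (Z i \<omega>) \<partial>M) - (\<integral>\<omega>. u (Z i \<omega>) \<partial>M)) 0 < e"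
      using 1 2 near Zm w(1)
    proof eventually_elim
      case (elim i)
      note [measurable] = elim(4,5)
      have i1: "integrable M (\<lambda>\<omega>. w i (Z i \<omega>))" "integrable M (\<lambda>\<omega>. u (Z i \<omega>))"
        by (rule M.integrable_const_bound[where B = K]; use w(2) u(2) in auto)+
      have i2: "integrable M (\<lambda>\<omega>. \<psi> ?t (Z i \<omega>))"
        by (rule M.integrable_const_bound[where B = "2 * K"]) (intro AE_I2, simp only: real_norm_def, intro \<psi>b, simp, measurable)
      have pt: "\<bar>w i z - u z\<bar> \<le> \<psi> ?t z" for z
      proof -
        have "\<bar>w i z - u z\<bar> \<le> \<bar>w i z\<bar> + \<bar>u z\<bar>" by (rule abs_triangle_ineq4)
        also have "\<dots> \<le> 2 * K" using w(2)[of i z] u(2)[of z] by linarith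
        finally have a: "\<bar>w i z - u z\<bar> \<le> 2 * K" .
        have "\<bar>w i z - u z\<bar> \<le> \<eta> i * (1 + \<bar>fst z\<bar> + \<bar>snd z\<bar>)" using elim(3) by blast
        also have "\<dots> \<le> ?t * (1 + \<bar>fst z\<bar> + \<bar>snd z\<bar>)" using elim(2) by (intro mult_right_mono) auto
        finally show ?thesis using a by (simp add: \<psi>_def)
      qed
      have "\<bar>(\<integral>\<omega>. w i (Z i \<omega>) \<partial>M) - (\<integral>\<omega>. u (Z i \<omega>) \<partial>M)\<bar> = \<bar>\<integral>\<omega>. w i (Z i \<omega>) - u (Z i \<omega>) \<partial>M\<bar>"
        using i1 by simp
      also have "\<dots> \<le> (\<integral>\<omega>. \<bar>w i (Z i \<omega>) - u (Z i \<omega>)\<bar> \<partial>M)" by (rule integral_abs_bound)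
      also have "\<dots> \<le> (\<integral>\<omega>. \<psi> ?t (Z i \<omega>) \<partial>M)"
        using i1 i2 pt by (intro integral_mono) auto
      finally show ?case using elim(1) by (simp add: dist_real_def)
    qed
  qed
  from tendsto_add[OF this conv[OF u(1) bdd[OF u(2)]]] show ?thesis by simp
qed

lemma dist_0_less: "0 \<le> x \<Longrightarrow> x \<le> e / 2 \<Longrightarrow> 0 < e \<Longrightarrow> dist x 0 < e" for x e :: real
  by (simp add: dist_real_def)

text \<open>The asymptotic part of the argument. All that it retains of the stochastic integral is the
  inequality \<open>expand\<close>, for one fixed width \<open>\<kappa>\<close>.\<close>

locale martingale_limit =
  fixes M :: "'a measure" and N :: "'b measure" and R I :: "real \<Rightarrow> 'a \<Rightarrow> real"
    and v :: "real \<Rightarrow> real" and v0 \<kappa> :: real and X Y :: "'b \<Rightarrow> real"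
  assumes M: "prob_space M" and N: "prob_space N"
    and v_pos: "\<And>\<epsilon>. 0 < \<epsilon> \<Longrightarrow> 0 < v \<epsilon>" and v_lim: "(v \<longlongrightarrow> v0) (at_right 0)" and v0: "0 < v0" and \<kappa>: "0 < \<kappa>"
    and R_meas: "\<And>\<epsilon>. 0 < \<epsilon> \<Longrightarrow> R \<epsilon> \<in> borel_measurable M" and I_meas: "\<And>\<epsilon>. 0 < \<epsilon> \<Longrightarrow> I \<epsilon> \<in> borel_measurable M"
    and I_nonneg: "\<And>\<epsilon> \<omega>. 0 < \<epsilon> \<Longrightarrow> \<omega> \<in> space M \<Longrightarrow> 0 \<le> I \<epsilon> \<omega>"
    and UI: "uniformly_integrable M {0<..} (\<lambda>\<epsilon> \<omega>. 1 / \<epsilon> * (I \<epsilon> \<omega> - v \<epsilon>))"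
    and law: "tendsto_in_law M (\<lambda>\<epsilon> \<omega>. (1 / sqrt (v \<epsilon>) * R \<epsilon> \<omega>, 1 / \<epsilon> * (I \<epsilon> \<omega> - v \<epsilon>))) N (\<lambda>\<omega>. (X \<omega>, Y \<omega>)) (at_right 0)"
    and Y_int: "integrable N Y"
    and expand: "\<forall>\<^sub>F \<epsilon> in at_right 0. \<forall>\<delta>>0. \<forall>C h. bounded_borel C h \<longrightarrow>
      \<bar>(\<integral>\<omega>. h (R \<epsilon> \<omega> - I \<epsilon> \<omega> / 2) \<partial>M) - heat (v \<epsilon>) h (- v \<epsilon> / 2)
        - (\<integral>\<omega>. (I \<epsilon> \<omega> - v \<epsilon>) * corrector \<delta> h (R \<epsilon> \<omega> - v \<epsilon> / 2) * indicator {\<omega> \<in> space M. I \<epsilon> \<omega> < v \<epsilon> + \<kappa>} \<omega> \<partial>M)\<bar>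
      \<le> C * remainder_bound M (I \<epsilon>) \<kappa> (v \<epsilon>) \<delta>"
begin

sublocale M: prob_space M by (rule M)
sublocale N: prob_space N by (rule N)

definition Ye :: "real \<Rightarrow> 'a \<Rightarrow> real" where "Ye \<epsilon> \<omega> = 1 / \<epsilon> * (I \<epsilon> \<omega> - v \<epsilon>)"

lemma eventually_pos: "\<forall>\<^sub>F \<epsilon> in at_right (0 :: real). 0 < \<epsilon>"
  by (rule eventually_at_right_less)

lemma Ye_measurable: "0 < \<epsilon> \<Longrightarrow> Ye \<epsilon> \<in> borel_measurable M"
  using I_meas[of \<epsilon>] by (simp add: Ye_def[abs_def])

lemma Ye_eq: "0 < \<epsilon> \<Longrightarrow> I \<epsilon> \<omega> - v \<epsilon> = \<epsilon> * Ye \<epsilon> \<omega>"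
  by (simp add: Ye_def)

lemma X_measurable: "X \<in> borel_measurable N" and Y_measurable: "Y \<in> borel_measurable N"
proof -
  have "(\<lambda>\<omega>. (X \<omega>, Y \<omega>)) \<in> borel_measurable N" using law unfolding tendsto_in_law_def by blast
  then show "X \<in> borel_measurable N" "Y \<in> borel_measurable N" by (rule borel_measurable_fst_snd_pair)+
qed

lemma Ye_nn_tail:
  assumes \<eta>: "0 < \<eta>"
  shows "\<exists>K>0. \<forall>\<epsilon>>0. (\<integral>\<^sup>+\<omega>. ennreal \<bar>Ye \<epsilon> \<omega>\<bar> * indicator {\<omega>. K < \<bar>Ye \<epsilon> \<omega>\<bar>} \<omega> \<partial>M) \<le> ennreal \<eta>"
proof -
  have "((\<lambda>K::real. SUP \<epsilon>\<in>{0<..}. \<integral>\<^sup>+\<omega>. ennreal \<bar>Ye \<epsilon> \<omega>\<bar> * indicator {\<omega>. K < \<bar>Ye \<epsilon> \<omega>\<bar>} \<omega> \<partial>M) \<longlongrightarrow> 0) at_top"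
    using UI unfolding uniformly_integrable_def Ye_def by blast
  from order_tendstoD(2)[OF this, of "ennreal \<eta>"] \<eta>
  have "\<forall>\<^sub>F K in at_top. (SUP \<epsilon>\<in>{0<..}. \<integral>\<^sup>+\<omega>. ennreal \<bar>Ye \<epsilon> \<omega>\<bar> * indicator {\<omega>. K < \<bar>Ye \<epsilon> \<omega>\<bar>} \<omega> \<partial>M) < ennreal \<eta>"
    by simp
  then obtain K0 where K0: "\<And>K. K0 \<le> K \<Longrightarrow> (SUP \<epsilon>\<in>{0<..}. \<integral>\<^sup>+\<omega>. ennreal \<bar>Ye \<epsilon> \<omega>\<bar> * indicator {\<omega>. K < \<bar>Ye \<epsilon> \<omega>\<bar>} \<omega> \<partial>M) < ennreal \<eta>"
    unfolding eventually_at_top_linorder by blast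
  show ?thesis
  proof (intro exI[of _ "max 1 K0"] conjI allI impI)
    fix \<epsilon> :: real assume "0 < \<epsilon>"
    then have "(\<integral>\<^sup>+\<omega>. ennreal \<bar>Ye \<epsilon> \<omega>\<bar> * indicator {\<omega>. max 1 K0 < \<bar>Ye \<epsilon> \<omega>\<bar>} \<omega> \<partial>M)
      \<le> (SUP \<epsilon>\<in>{0<..}. \<integral>\<^sup>+\<omega>. ennreal \<bar>Ye \<epsilon> \<omega>\<bar> * indicator {\<omega>. max 1 K0 < \<bar>Ye \<epsilon> \<omega>\<bar>} \<omega> \<partial>M)"
      by (intro SUP_upper) auto
    with K0[of "max 1 K0"] show "(\<integral>\<^sup>+\<omega>. ennreal \<bar>Ye \<epsilon> \<omega>\<bar> * indicator {\<omega>. max 1 K0 < \<bar>Ye \<epsilon> \<omega>\<bar>} \<omega> \<partial>M) \<le> ennreal \<eta>"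
      by simp
  qed simp
qed

lemma Ye_bound: "\<exists>K\<ge>0. \<forall>\<epsilon>>0. integrable M (Ye \<epsilon>) \<and> (\<integral>\<omega>. \<bar>Ye \<epsilon> \<omega>\<bar> \<partial>M) \<le> K"
proof -
  obtain K where K: "0 < K" "\<And>\<epsilon>. 0 < \<epsilon> \<Longrightarrow> (\<integral>\<^sup>+\<omega>. ennreal \<bar>Ye \<epsilon> \<omega>\<bar> * indicator {\<omega>. K < \<bar>Ye \<epsilon> \<omega>\<bar>} \<omega> \<partial>M) \<le> ennreal 1"
    using Ye_nn_tail[of 1] by auto
  have "integrable M (Ye \<epsilon>) \<and> (\<integral>\<omega>. \<bar>Ye \<epsilon> \<omega>\<bar> \<partial>M) \<le> K + 1" if \<epsilon>: "0 < \<epsilon>" for \<epsilon>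
  proof -
    note [measurable] = Ye_measurable[OF \<epsilon>]
    have "(\<integral>\<^sup>+\<omega>. ennreal \<bar>Ye \<epsilon> \<omega>\<bar> \<partial>M) \<le> (\<integral>\<^sup>+\<omega>. ennreal K + ennreal \<bar>Ye \<epsilon> \<omega>\<bar> * indicator {\<omega>. K < \<bar>Ye \<epsilon> \<omega>\<bar>} \<omega> \<partial>M)"
    proof (rule nn_integral_mono)
      show "ennreal \<bar>Ye \<epsilon> \<omega>\<bar> \<le> ennreal K + ennreal \<bar>Ye \<epsilon> \<omega>\<bar> * indicator {\<omega>. K < \<bar>Ye \<epsilon> \<omega>\<bar>} \<omega>" for \<omega>
        by (cases "K < \<bar>Ye \<epsilon> \<omega>\<bar>") (auto intro: ennreal_leI add_increasing)
    qed
    also have "\<dots> = ennreal K + (\<integral>\<^sup>+\<omega>. ennreal \<bar>Ye \<epsilon> \<omega>\<bar> * indicator {\<omega>. K < \<bar>Ye \<epsilon> \<omega>\<bar>} \<omega> \<partial>M)"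
      by (subst nn_integral_add) (auto simp: M.emeasure_space_1)
    also have "\<dots> \<le> ennreal K + ennreal 1" by (intro add_left_mono K(2)[OF \<epsilon>])
    also have "\<dots> = ennreal (K + 1)" using K(1) by (subst ennreal_plus) auto
    finally have le: "(\<integral>\<^sup>+\<omega>. ennreal \<bar>Ye \<epsilon> \<omega>\<bar> \<partial>M) \<le> ennreal (K + 1)" .
    then have i: "integrable M (Ye \<epsilon>)"
      by (intro integrableI_bounded) (auto intro: le_less_trans)
    moreover have "ennreal (\<integral>\<omega>. \<bar>Ye \<epsilon> \<omega>\<bar> \<partial>M) \<le> ennreal (K + 1)"
      using le i by (subst (asm) nn_integral_eq_integral) auto
    then have "(\<integral>\<omega>. \<bar>Ye \<epsilon> \<omega>\<bar> \<partial>M) \<le> K + 1" using K(1) by (subst (asm) ennreal_le_iff) auto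
    ultimately show ?thesis by simp
  qed
  then show ?thesis using K(1) by (intro exI[of _ "K + 1"]) auto
qed

lemma Ye_integrable: "0 < \<epsilon> \<Longrightarrow> integrable M (Ye \<epsilon>)"
  using Ye_bound by blast

lemma Ye_tail:
  assumes \<eta>: "0 < \<eta>"
  shows "\<exists>K>0. \<forall>\<epsilon>>0. \<forall>D\<in>sets M. (\<forall>\<omega>\<in>D. K < \<bar>Ye \<epsilon> \<omega>\<bar>) \<longrightarrow> (\<integral>\<omega>. \<bar>Ye \<epsilon> \<omega>\<bar> * indicator D \<omega> \<partial>M) \<le> \<eta>"
proof -
  obtain K where K: "0 < K" "\<And>\<epsilon>. 0 < \<epsilon> \<Longrightarrow> (\<integral>\<^sup>+\<omega>. ennreal \<bar>Ye \<epsilon> \<omega>\<bar> * indicator {\<omega>. K < \<bar>Ye \<epsilon> \<omega>\<bar>} \<omega> \<partial>M) \<le> ennreal \<eta>"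
    using Ye_nn_tail[OF \<eta>] by blast
  have "(\<integral>\<omega>. \<bar>Ye \<epsilon> \<omega>\<bar> * indicator D \<omega> \<partial>M) \<le> \<eta>"
    if \<epsilon>: "0 < \<epsilon>" and D: "D \<in> sets M" "\<And>\<omega>. \<omega> \<in> D \<Longrightarrow> K < \<bar>Ye \<epsilon> \<omega>\<bar>" for \<epsilon> D
  proof -
    note [measurable] = Ye_measurable[OF \<epsilon>] D(1)
    have i: "integrable M (\<lambda>\<omega>. \<bar>Ye \<epsilon> \<omega>\<bar> * indicator D \<omega>)"
      by (rule Bochner_Integration.integrable_bound[OF Ye_integrable[OF \<epsilon>]]) (auto simp: indicator_def)
    have "ennreal (\<integral>\<omega>. \<bar>Ye \<epsilon> \<omega>\<bar> * indicator D \<omega> \<partial>M) = (\<integral>\<^sup>+\<omega>. ennreal (\<bar>Ye \<epsilon> \<omega>\<bar> * indicator D \<omega>) \<partial>M)"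
      using i by (intro nn_integral_eq_integral[symmetric]) auto
    also have "\<dots> \<le> (\<integral>\<^sup>+\<omega>. ennreal \<bar>Ye \<epsilon> \<omega>\<bar> * indicator {\<omega>. K < \<bar>Ye \<epsilon> \<omega>\<bar>} \<omega> \<partial>M)"
      using D(2) by (intro nn_integral_mono) (auto simp: indicator_def)
    also have "\<dots> \<le> ennreal \<eta>" by (rule K(2)[OF \<epsilon>])
    finally show ?thesis using \<eta> by (subst (asm) ennreal_le_iff) auto
  qed
  with K(1) show ?thesis by blast
qed

lemma Ye_exceed_tendsto:
  "((\<lambda>\<epsilon>. \<integral>\<omega>. \<bar>Ye \<epsilon> \<omega>\<bar> * indicator {\<omega> \<in> space M. v \<epsilon> + \<kappa> \<le> I \<epsilon> \<omega>} \<omega> \<partial>M) \<longlongrightarrow> 0) (at_right 0)"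
proof (rule tendstoI)
  fix e :: real assume e: "0 < e"
  then have "0 < e / 2" by simp
  from Ye_tail[OF this] obtain K where K1: "0 < K \<and> (\<forall>\<epsilon>>0. \<forall>D\<in>sets M. (\<forall>\<omega>\<in>D. K < \<bar>Ye \<epsilon> \<omega>\<bar>) \<longrightarrow>
      (\<integral>\<omega>. \<bar>Ye \<epsilon> \<omega>\<bar> * indicator D \<omega> \<partial>M) \<le> e / 2)"
    by (rule exE)
  have K: "0 < K" "\<And>\<epsilon> D. 0 < \<epsilon> \<Longrightarrow> D \<in> sets M \<Longrightarrow> (\<forall>\<omega>\<in>D. K < \<bar>Ye \<epsilon> \<omega>\<bar>) \<Longrightarrow>
      (\<integral>\<omega>. \<bar>Ye \<epsilon> \<omega>\<bar> * indicator D \<omega> \<partial>M) \<le> e / 2"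
    using K1 by auto
  have "\<forall>\<^sub>F \<epsilon> in at_right 0. \<epsilon> < \<kappa> / K"
    using order_tendstoD(2)[OF tendsto_ident_at, of 0 "\<kappa> / K" "{0<..}"] K(1) \<kappa> by simp
  with eventually_pos
  show "\<forall>\<^sub>F \<epsilon> in at_right 0. dist (\<integral>\<omega>. \<bar>Ye \<epsilon> \<omega>\<bar> * indicator {\<omega> \<in> space M. v \<epsilon> + \<kappa> \<le> I \<epsilon> \<omega>} \<omega> \<partial>M) 0 < e"
  proof eventually_elim
    case (elim \<epsilon>)
    note [measurable] = I_meas[OF elim(1)]
    have "K < \<bar>Ye \<epsilon> \<omega>\<bar>" if "v \<epsilon> + \<kappa> \<le> I \<epsilon> \<omega>" for \<omega>
    proof -
      have "\<epsilon> * K < \<kappa>" using elim(2) K(1) by (simp add: field_simps)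
      also have "\<kappa> \<le> \<epsilon> * Ye \<epsilon> \<omega>" using that Ye_eq[OF elim(1), of \<omega>] by linarith
      finally show ?thesis using elim(1) by simp
    qed
    then have "(\<integral>\<omega>. \<bar>Ye \<epsilon> \<omega>\<bar> * indicator {\<omega> \<in> space M. v \<epsilon> + \<kappa> \<le> I \<epsilon> \<omega>} \<omega> \<partial>M) \<le> e / 2"
      by (intro K(2)[OF elim(1)]) auto
    moreover have "0 \<le> (\<integral>\<omega>. \<bar>Ye \<epsilon> \<omega>\<bar> * indicator {\<omega> \<in> space M. v \<epsilon> + \<kappa> \<le> I \<epsilon> \<omega>} \<omega> \<partial>M)" by simp
    ultimately show ?case using e by (intro dist_0_less)
  qed
qed

text \<open>On the event, \<open>\<epsilon> \<bar>Y\<bar>\<close> is bounded, so \<open>\<epsilon> Y\<^sup>2\<close> is at most \<open>\<epsilon> K\<^sup>2\<close> where \<open>\<bar>Y\<bar> \<le> K\<close>, and at most a multiple of \<open>\<bar>Y\<bar>\<close> elsewhere;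
  uniform integrability makes the latter contribution small.\<close>

lemma energy_square_tendsto:
  "((\<lambda>\<epsilon>. (\<integral>\<omega>. (I \<epsilon> \<omega> - v \<epsilon>)\<^sup>2 * indicator {\<omega> \<in> space M. I \<epsilon> \<omega> < v \<epsilon> + \<kappa>} \<omega> \<partial>M) / \<epsilon>) \<longlongrightarrow> 0) (at_right 0)"
proof (rule tendstoI)
  fix e :: real assume e: "0 < e"
  define m where "m = 2 * v0 + \<kappa>"
  have m: "0 < m" using v0 \<kappa> by (simp add: m_def)
  then have "0 < e / (4 * m)" using e by simp
  from Ye_tail[OF this] obtain K where K1: "0 < K \<and> (\<forall>\<epsilon>>0. \<forall>D\<in>sets M. (\<forall>\<omega>\<in>D. K < \<bar>Ye \<epsilon> \<omega>\<bar>) \<longrightarrow>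
      (\<integral>\<omega>. \<bar>Ye \<epsilon> \<omega>\<bar> * indicator D \<omega> \<partial>M) \<le> e / (4 * m))"
    by (rule exE)
  have K: "0 < K" "\<And>\<epsilon> D. 0 < \<epsilon> \<Longrightarrow> D \<in> sets M \<Longrightarrow> (\<forall>\<omega>\<in>D. K < \<bar>Ye \<epsilon> \<omega>\<bar>) \<Longrightarrow>
      (\<integral>\<omega>. \<bar>Ye \<epsilon> \<omega>\<bar> * indicator D \<omega> \<partial>M) \<le> e / (4 * m)"
    using K1 by auto
  have "\<forall>\<^sub>F \<epsilon> in at_right 0. \<epsilon> < e / (4 * K\<^sup>2)"
    using order_tendstoD(2)[OF tendsto_ident_at, of 0 "e / (4 * K\<^sup>2)" "{0<..}"] K(1) e by simp
  moreover have "\<forall>\<^sub>F \<epsilon> in at_right 0. v \<epsilon> < 2 * v0" using order_tendstoD(2)[OF v_lim, of "2 * v0"] v0 by simp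
  ultimately show "\<forall>\<^sub>F \<epsilon> in at_right 0. dist ((\<integral>\<omega>. (I \<epsilon> \<omega> - v \<epsilon>)\<^sup>2 * indicator {\<omega> \<in> space M. I \<epsilon> \<omega> < v \<epsilon> + \<kappa>} \<omega> \<partial>M) / \<epsilon>) 0 < e"
    using eventually_pos
  proof eventually_elim
    case (elim \<epsilon>)
    note [measurable] = I_meas[OF elim(3)] Ye_measurable[OF elim(3)]
    let ?D = "{\<omega> \<in> space M. I \<epsilon> \<omega> < v \<epsilon> + \<kappa>}" and ?T = "{\<omega> \<in> space M. K < \<bar>Ye \<epsilon> \<omega>\<bar>}"
    have iT: "integrable M (\<lambda>\<omega>. \<bar>Ye \<epsilon> \<omega>\<bar> * indicator ?T \<omega>)"
      by (rule Bochner_Integration.integrable_bound[OF Ye_integrable[OF elim(3)]]) (auto simp: indicator_def)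
    have pt: "(I \<epsilon> \<omega> - v \<epsilon>)\<^sup>2 * indicator ?D \<omega> \<le> \<epsilon>\<^sup>2 * K\<^sup>2 + \<epsilon> * m * (\<bar>Ye \<epsilon> \<omega>\<bar> * indicator ?T \<omega>)" if \<omega>: "\<omega> \<in> space M" for \<omega>
    proof (cases "\<omega> \<in> ?D")
      case D: True
      have b: "\<bar>\<epsilon> * Ye \<epsilon> \<omega>\<bar> \<le> m"
        using D I_nonneg[OF elim(3) \<omega>] elim(2) v0 \<kappa> v_pos[OF elim(3)]
        unfolding Ye_eq[OF elim(3), symmetric] by (auto simp: m_def abs_le_iff)
      show ?thesis
      proof (cases "K < \<bar>Ye \<epsilon> \<omega>\<bar>")
        case True
        have "(\<epsilon> * Ye \<epsilon> \<omega>)\<^sup>2 = \<bar>\<epsilon> * Ye \<epsilon> \<omega>\<bar> * \<bar>\<epsilon> * Ye \<epsilon> \<omega>\<bar>" by (simp add: power2_eq_square flip: abs_mult)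
        also have "\<dots> \<le> m * \<bar>\<epsilon> * Ye \<epsilon> \<omega>\<bar>" by (intro mult_right_mono b) auto
        also have "\<dots> = \<epsilon> * m * \<bar>Ye \<epsilon> \<omega>\<bar>" using elim(3) by (simp add: abs_mult)
        also have "\<dots> \<le> \<epsilon>\<^sup>2 * K\<^sup>2 + \<epsilon> * m * \<bar>Ye \<epsilon> \<omega>\<bar>" by simp
        finally show ?thesis using D True \<omega> by (simp add: Ye_eq[OF elim(3)])
      next
        case False
        then have "\<bar>Ye \<epsilon> \<omega>\<bar>\<^sup>2 \<le> K\<^sup>2" by (intro power_mono) auto
        then have "(\<epsilon> * Ye \<epsilon> \<omega>)\<^sup>2 \<le> \<epsilon>\<^sup>2 * K\<^sup>2" by (simp add: power_mult_distrib mult_left_mono)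
        then show ?thesis using D False by (simp add: Ye_eq[OF elim(3)])
      qed
    next
      case False
      have "0 \<le> \<epsilon>\<^sup>2 * K\<^sup>2 + \<epsilon> * m * (\<bar>Ye \<epsilon> \<omega>\<bar> * indicator ?T \<omega>)" using elim(3) m by (intro add_nonneg_nonneg mult_nonneg_nonneg) auto
      with False show ?thesis by simp
    qed
    have "(\<integral>\<omega>. (I \<epsilon> \<omega> - v \<epsilon>)\<^sup>2 * indicator ?D \<omega> \<partial>M) \<le> (\<integral>\<omega>. \<epsilon>\<^sup>2 * K\<^sup>2 + \<epsilon> * m * (\<bar>Ye \<epsilon> \<omega>\<bar> * indicator ?T \<omega>) \<partial>M)"
    proof (rule integral_mono_AE)
      show i2: "integrable M (\<lambda>\<omega>. \<epsilon>\<^sup>2 * K\<^sup>2 + \<epsilon> * m * (\<bar>Ye \<epsilon> \<omega>\<bar> * indicator ?T \<omega>))" using iT by simp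
      show "integrable M (\<lambda>\<omega>. (I \<epsilon> \<omega> - v \<epsilon>)\<^sup>2 * indicator ?D \<omega>)"
        by (rule Bochner_Integration.integrable_bound[OF i2]) (use pt in \<open>auto intro!: AE_I2 order_trans[OF _ abs_ge_self]\<close>)
    qed (use pt in auto)
    also have "\<dots> = \<epsilon>\<^sup>2 * K\<^sup>2 + \<epsilon> * m * (\<integral>\<omega>. \<bar>Ye \<epsilon> \<omega>\<bar> * indicator ?T \<omega> \<partial>M)"
      using iT by (simp add: M.prob_space)
    also have "\<dots> \<le> \<epsilon>\<^sup>2 * K\<^sup>2 + \<epsilon> * m * (e / (4 * m))"
    proof (intro add_left_mono mult_left_mono)
      show "(\<integral>\<omega>. \<bar>Ye \<epsilon> \<omega>\<bar> * indicator ?T \<omega> \<partial>M) \<le> e / (4 * m)"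
      proof (rule K(2)[OF elim(3)])
        show "?T \<in> sets M" by measurable
      qed blast
      show "0 \<le> \<epsilon> * m" using elim(3) m by simp
    qed
    also have "\<dots> = \<epsilon> * (\<epsilon> * K\<^sup>2 + e / 4)" using m by (simp add: power2_eq_square algebra_simps)
    also have "\<dots> \<le> \<epsilon> * (e / 4 + e / 4)"
      using elim(1,3) K(1) by (intro mult_left_mono add_right_mono) (auto simp: field_simps)
    finally have "(\<integral>\<omega>. (I \<epsilon> \<omega> - v \<epsilon>)\<^sup>2 * indicator ?D \<omega> \<partial>M) / \<epsilon> \<le> e / 2" using elim(3) by (simp add: field_simps)
    moreover have "0 \<le> (\<integral>\<omega>. (I \<epsilon> \<omega> - v \<epsilon>)\<^sup>2 * indicator ?D \<omega> \<partial>M) / \<epsilon>" using elim(3) by simp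
    ultimately show ?case using e by (intro dist_0_less)
  qed
qed

lemma exceed_prob_tendsto:
  "((\<lambda>\<epsilon>. measure M {\<omega> \<in> space M. v \<epsilon> + \<kappa> \<le> I \<epsilon> \<omega>} / \<epsilon>) \<longlongrightarrow> 0) (at_right 0)"
proof (rule Lim_null_comparison)
  show "((\<lambda>\<epsilon>. (1 / \<kappa>) * (\<integral>\<omega>. \<bar>Ye \<epsilon> \<omega>\<bar> * indicator {\<omega> \<in> space M. v \<epsilon> + \<kappa> \<le> I \<epsilon> \<omega>} \<omega> \<partial>M)) \<longlongrightarrow> 0) (at_right 0)"
    by (rule tendsto_mult_right_zero[OF Ye_exceed_tendsto])
  show "\<forall>\<^sub>F \<epsilon> in at_right 0. norm (measure M {\<omega> \<in> space M. v \<epsilon> + \<kappa> \<le> I \<epsilon> \<omega>} / \<epsilon>)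
      \<le> (1 / \<kappa>) * (\<integral>\<omega>. \<bar>Ye \<epsilon> \<omega>\<bar> * indicator {\<omega> \<in> space M. v \<epsilon> + \<kappa> \<le> I \<epsilon> \<omega>} \<omega> \<partial>M)"
    using eventually_pos
  proof eventually_elim
    case (elim \<epsilon>)
    note [measurable] = I_meas[OF elim] Ye_measurable[OF elim]
    let ?D = "{\<omega> \<in> space M. v \<epsilon> + \<kappa> \<le> I \<epsilon> \<omega>}"
    have iT: "integrable M (\<lambda>\<omega>. \<bar>Ye \<epsilon> \<omega>\<bar> * indicator ?D \<omega>)"
      by (rule Bochner_Integration.integrable_bound[OF Ye_integrable[OF elim]]) (auto simp: indicator_def)
    have "(\<integral>\<omega>. (\<kappa> / \<epsilon>) * indicator ?D \<omega> \<partial>M) \<le> (\<integral>\<omega>. \<bar>Ye \<epsilon> \<omega>\<bar> * indicator ?D \<omega> \<partial>M)"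
    proof (rule integral_mono[OF _ iT])
      show "integrable M (\<lambda>\<omega>. (\<kappa> / \<epsilon>) * indicator ?D \<omega>)"
        by (rule M.integrable_const_bound[where B = "\<kappa> / \<epsilon>"]) (use elim \<kappa> in \<open>auto simp: indicator_def\<close>)
      show "\<kappa> / \<epsilon> * indicator ?D \<omega> \<le> \<bar>Ye \<epsilon> \<omega>\<bar> * indicator ?D \<omega>" for \<omega>
      proof (cases "\<omega> \<in> ?D")
        case True
        then have "\<kappa> \<le> \<epsilon> * Ye \<epsilon> \<omega>" using Ye_eq[OF elim, of \<omega>] by simp
        then have "\<kappa> / \<epsilon> \<le> Ye \<epsilon> \<omega>" using elim by (simp add: field_simps)
        with True show ?thesis by simp
      qed simp
    qed
    then have "(\<kappa> / \<epsilon>) * measure M ?D \<le> (\<integral>\<omega>. \<bar>Ye \<epsilon> \<omega>\<bar> * indicator ?D \<omega> \<partial>M)" by simp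
    then have "(1 / \<kappa>) * ((\<kappa> / \<epsilon>) * measure M ?D) \<le> (1 / \<kappa>) * (\<integral>\<omega>. \<bar>Ye \<epsilon> \<omega>\<bar> * indicator ?D \<omega> \<partial>M)"
      using \<kappa> by (intro mult_left_mono) auto
    then show ?case using \<kappa> elim by simp
  qed
qed

text \<open>The smoothing error is of order \<open>\<epsilon>\<close> and all others are smaller; its factor \<open>\<delta>\<close> is sent to \<open>0\<close> at
  the very end.\<close>

lemma remainder_small:
  assumes \<delta>: "0 < \<delta>" and \<eta>: "0 < \<eta>"
    and K: "\<And>\<epsilon>. 0 < \<epsilon> \<Longrightarrow> (\<integral>\<omega>. \<bar>Ye \<epsilon> \<omega>\<bar> \<partial>M) \<le> K"
  shows "\<forall>\<^sub>F \<epsilon> in at_right 0. remainder_bound M (I \<epsilon>) \<kappa> (v \<epsilon>) \<delta> / \<epsilon> \<le> deriv_bound \<kappa> * (\<delta> * K) + \<eta>"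
proof -
  let ?D = "\<lambda>\<epsilon>. {\<omega> \<in> space M. I \<epsilon> \<omega> < v \<epsilon> + \<kappa>}"
  let ?q = "\<lambda>\<epsilon>. (\<integral>\<omega>. (I \<epsilon> \<omega> - v \<epsilon>)\<^sup>2 * indicator (?D \<epsilon>) \<omega> \<partial>M) / \<epsilon>"
  let ?p = "\<lambda>\<epsilon>. measure M {\<omega> \<in> space M. v \<epsilon> + \<kappa> \<le> I \<epsilon> \<omega>} / \<epsilon>"
  let ?c = "\<lambda>\<epsilon>. 2 + (v \<epsilon> + \<kappa>) * deriv_bound \<delta> + expansion_const \<kappa> \<delta> * (v \<epsilon> + \<kappa>)\<^sup>2 + deriv_bound \<kappa> * (\<delta> * (v \<epsilon> + \<kappa>))"
  have "((\<lambda>\<epsilon>. expansion_const \<kappa> \<delta> * ?q \<epsilon> + ?c \<epsilon> * ?p \<epsilon>) \<longlongrightarrow> expansion_const \<kappa> \<delta> * 0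
      + (2 + (v0 + \<kappa>) * deriv_bound \<delta> + expansion_const \<kappa> \<delta> * (v0 + \<kappa>)\<^sup>2 + deriv_bound \<kappa> * (\<delta> * (v0 + \<kappa>))) * 0) (at_right 0)"
    by (intro tendsto_intros energy_square_tendsto exceed_prob_tendsto v_lim)
  then have "((\<lambda>\<epsilon>. expansion_const \<kappa> \<delta> * ?q \<epsilon> + ?c \<epsilon> * ?p \<epsilon>) \<longlongrightarrow> 0) (at_right 0)" by simp
  from order_tendstoD(2)[OF this \<eta>] eventually_pos show ?thesis
  proof eventually_elim
    case (elim \<epsilon>)
    note [measurable] = I_meas[OF elim(2)] Ye_measurable[OF elim(2)]
    have "(\<integral>\<omega>. \<bar>I \<epsilon> \<omega> - v \<epsilon>\<bar> * indicator (?D \<epsilon>) \<omega> \<partial>M) \<le> (\<integral>\<omega>. \<epsilon> * \<bar>Ye \<epsilon> \<omega>\<bar> \<partial>M)"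
    proof (rule integral_mono_AE)
      show i2: "integrable M (\<lambda>\<omega>. \<epsilon> * \<bar>Ye \<epsilon> \<omega>\<bar>)" using Ye_integrable[OF elim(2)] by simp
      have pt: "\<bar>I \<epsilon> \<omega> - v \<epsilon>\<bar> * indicator (?D \<epsilon>) \<omega> \<le> \<epsilon> * \<bar>Ye \<epsilon> \<omega>\<bar>" for \<omega>
        using elim(2) by (auto simp: Ye_eq abs_mult indicator_def)
      show "integrable M (\<lambda>\<omega>. \<bar>I \<epsilon> \<omega> - v \<epsilon>\<bar> * indicator (?D \<epsilon>) \<omega>)"
        by (rule Bochner_Integration.integrable_bound[OF i2]) (use pt elim(2) in \<open>auto intro!: AE_I2 order_trans[OF _ abs_ge_self]\<close>)
      show "AE \<omega> in M. \<bar>I \<epsilon> \<omega> - v \<epsilon>\<bar> * indicator (?D \<epsilon>) \<omega> \<le> \<epsilon> * \<bar>Ye \<epsilon> \<omega>\<bar>" using pt by auto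
    qed
    also have "\<dots> \<le> \<epsilon> * K" using K[OF elim(2)] elim(2) by simp
    finally have w: "(\<integral>\<omega>. \<bar>I \<epsilon> \<omega> - v \<epsilon>\<bar> * indicator (?D \<epsilon>) \<omega> \<partial>M) / \<epsilon> \<le> K" using elim(2) by (simp add: field_simps)
    have "remainder_bound M (I \<epsilon>) \<kappa> (v \<epsilon>) \<delta> / \<epsilon> = (expansion_const \<kappa> \<delta> * ?q \<epsilon> + ?c \<epsilon> * ?p \<epsilon>)
      + deriv_bound \<kappa> * (\<delta> * ((\<integral>\<omega>. \<bar>I \<epsilon> \<omega> - v \<epsilon>\<bar> * indicator (?D \<epsilon>) \<omega> \<partial>M) / \<epsilon>))"
      unfolding remainder_bound_def by (simp add: add_divide_distrib)
    also have "deriv_bound \<kappa> * (\<delta> * ((\<integral>\<omega>. \<bar>I \<epsilon> \<omega> - v \<epsilon>\<bar> * indicator (?D \<epsilon>) \<omega> \<partial>M) / \<epsilon>)) \<le> deriv_bound \<kappa> * (\<delta> * K)"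
      using w \<delta> deriv_bound_ge[of \<kappa>] by (intro mult_left_mono) auto
    finally show ?case using elim(1) by linarith
  qed
qed

lemma correction_off_event_tendsto:
  assumes G: "bounded_borel K G"
  shows "((\<lambda>\<epsilon>. (\<integral>\<omega>. (I \<epsilon> \<omega> - v \<epsilon>) * G (R \<epsilon> \<omega> - v \<epsilon> / 2) * indicator {\<omega> \<in> space M. I \<epsilon> \<omega> < v \<epsilon> + \<kappa>} \<omega> \<partial>M) / \<epsilon>
     - (\<integral>\<omega>. Ye \<epsilon> \<omega> * G (R \<epsilon> \<omega> - v \<epsilon> / 2) \<partial>M)) \<longlongrightarrow> 0) (at_right 0)"
proof (rule Lim_null_comparison)
  show "((\<lambda>\<epsilon>. K * (\<integral>\<omega>. \<bar>Ye \<epsilon> \<omega>\<bar> * indicator {\<omega> \<in> space M. v \<epsilon> + \<kappa> \<le> I \<epsilon> \<omega>} \<omega> \<partial>M)) \<longlongrightarrow> 0) (at_right 0)"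
    by (rule tendsto_mult_right_zero[OF Ye_exceed_tendsto])
  show "\<forall>\<^sub>F \<epsilon> in at_right 0. norm ((\<integral>\<omega>. (I \<epsilon> \<omega> - v \<epsilon>) * G (R \<epsilon> \<omega> - v \<epsilon> / 2) * indicator {\<omega> \<in> space M. I \<epsilon> \<omega> < v \<epsilon> + \<kappa>} \<omega> \<partial>M) / \<epsilon>
     - (\<integral>\<omega>. Ye \<epsilon> \<omega> * G (R \<epsilon> \<omega> - v \<epsilon> / 2) \<partial>M))
     \<le> K * (\<integral>\<omega>. \<bar>Ye \<epsilon> \<omega>\<bar> * indicator {\<omega> \<in> space M. v \<epsilon> + \<kappa> \<le> I \<epsilon> \<omega>} \<omega> \<partial>M)"
    using eventually_pos
  proof eventually_elim
    case (elim \<epsilon>)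
    note [measurable] = I_meas[OF elim] Ye_measurable[OF elim] R_meas[OF elim] bounded_borelD(1)[OF G]
    let ?D = "{\<omega> \<in> space M. v \<epsilon> + \<kappa> \<le> I \<epsilon> \<omega>}" and ?E = "{\<omega> \<in> space M. I \<epsilon> \<omega> < v \<epsilon> + \<kappa>}"
    let ?G = "\<lambda>\<omega>. G (R \<epsilon> \<omega> - v \<epsilon> / 2)"
    have i0: "integrable M (\<lambda>\<omega>. Ye \<epsilon> \<omega> * indicator A \<omega>)" if "A \<in> sets M" for A
      using integrable_mult_indicator[OF that Ye_integrable[OF elim]] by (simp add: mult.commute)
    have i: "integrable M (\<lambda>\<omega>. ?G \<omega> * (Ye \<epsilon> \<omega> * indicator A \<omega>))" if "A \<in> sets M" for A
      by (rule integrable_bounded_mult[OF G _ i0[OF that]]) measurable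
    have "(\<integral>\<omega>. (I \<epsilon> \<omega> - v \<epsilon>) * ?G \<omega> * indicator ?E \<omega> \<partial>M) / \<epsilon> = (\<integral>\<omega>. ?G \<omega> * (Ye \<epsilon> \<omega> * indicator ?E \<omega>) \<partial>M)"
      using elim by (simp add: Ye_eq mult_ac)
    moreover have "(\<integral>\<omega>. Ye \<epsilon> \<omega> * ?G \<omega> \<partial>M) = (\<integral>\<omega>. ?G \<omega> * (Ye \<epsilon> \<omega> * indicator ?E \<omega>) + ?G \<omega> * (Ye \<epsilon> \<omega> * indicator ?D \<omega>) \<partial>M)"
      by (intro Bochner_Integration.integral_cong) (auto simp: indicator_def)
    ultimately have "(\<integral>\<omega>. (I \<epsilon> \<omega> - v \<epsilon>) * ?G \<omega> * indicator ?E \<omega> \<partial>M) / \<epsilon> - (\<integral>\<omega>. Ye \<epsilon> \<omega> * ?G \<omega> \<partial>M)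
      = - (\<integral>\<omega>. ?G \<omega> * (Ye \<epsilon> \<omega> * indicator ?D \<omega>) \<partial>M)"
      using i[of ?E] i[of ?D] by simp
    moreover have "\<bar>\<integral>\<omega>. ?G \<omega> * (Ye \<epsilon> \<omega> * indicator ?D \<omega>) \<partial>M\<bar> \<le> K * (\<integral>\<omega>. \<bar>Ye \<epsilon> \<omega> * indicator ?D \<omega>\<bar> \<partial>M)"
      by (rule abs_integral_bounded_mult_le[OF G _ i0]) measurable
    moreover have "(\<integral>\<omega>. \<bar>Ye \<epsilon> \<omega> * indicator ?D \<omega>\<bar> \<partial>M) = (\<integral>\<omega>. \<bar>Ye \<epsilon> \<omega>\<bar> * indicator ?D \<omega> \<partial>M)"
      by (simp add: abs_mult)
    ultimately show ?case by simp
  qed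
qed

end

section \<open>The limit law\<close>

lemma abs_cos_sin_diff_le:
  fixes a b :: real
  shows "\<bar>cos a - cos b\<bar> \<le> \<bar>a - b\<bar>" "\<bar>sin a - sin b\<bar> \<le> \<bar>a - b\<bar>"
proof -
  have "norm (cos a - cos b) \<le> 1 * norm (a - b)"
    by (rule field_differentiable_bound[of UNIV cos "\<lambda>x. - sin x"]) (auto intro!: derivative_eq_intros)
  then show "\<bar>cos a - cos b\<bar> \<le> \<bar>a - b\<bar>" by simp
  have "norm (sin a - sin b) \<le> 1 * norm (a - b)"
    by (rule field_differentiable_bound[of UNIV sin cos]) (auto intro!: derivative_eq_intros)
  then show "\<bar>sin a - sin b\<bar> \<le> \<bar>a - b\<bar>" by simp
qed

lemma lipschitz_continuous:
  fixes f :: "real \<Rightarrow> real"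
  assumes "\<And>x y. \<bar>f x - f y\<bar> \<le> c * \<bar>x - y\<bar>"
  shows "continuous_on UNIV f"
proof (rule continuous_at_imp_continuous_on, rule ballI, unfold isCont_def)
  fix x
  have "((\<lambda>y. c * \<bar>y - x\<bar>) \<longlongrightarrow> c * \<bar>x - x\<bar>) (at x)" by (intro tendsto_intros)
  then have lim: "((\<lambda>y. c * \<bar>y - x\<bar>) \<longlongrightarrow> 0) (at x)" by simp
  have "((\<lambda>y. f y - f x) \<longlongrightarrow> 0) (at x)"
    by (rule Lim_null_comparison[OF always_eventually lim]) (simp add: assms)
  then show "(f \<longlongrightarrow> f x) (at x)" by (rule LIM_zero_cancel)
qed

lemma linear_growth:
  fixes p q r x y :: real
  assumes "0 \<le> p" "0 \<le> q" "0 \<le> r" "0 \<le> x" "0 \<le> y"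
  shows "p * x + q + r * y \<le> (p + q + r) * (1 + x + y)"
proof -
  have "0 \<le> p + p * y + q * x + q * y + r + r * x" using assms by (intro add_nonneg_nonneg mult_nonneg_nonneg)
  then show ?thesis by (simp add: algebra_simps)
qed

definition clamp_abs :: "real \<Rightarrow> real \<Rightarrow> real" where "clamp_abs k y = max (- k) (min k y)"

lemma clamp_abs_bounds:
  assumes "0 \<le> k"
  shows "\<bar>clamp_abs k y\<bar> \<le> k" "\<bar>y - clamp_abs k y\<bar> \<le> \<bar>y\<bar> * indicator {y. k < \<bar>y\<bar>} y"
  using assms by (auto simp: clamp_abs_def indicator_def)

lemma continuous_clamp_abs: "continuous_on UNIV (clamp_abs k)"
  unfolding clamp_abs_def[abs_def] by (intro continuous_intros)

context martingale_limit
begin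

lemma sqrt_v_lim: "((\<lambda>\<epsilon>. sqrt (v \<epsilon>)) \<longlongrightarrow> sqrt v0) (at_right 0)"
  by (rule tendsto_real_sqrt[OF v_lim])

lemma R_eq: "0 < \<epsilon> \<Longrightarrow> sqrt (v \<epsilon>) * (1 / sqrt (v \<epsilon>) * R \<epsilon> \<omega>) = R \<epsilon> \<omega>"
  using v_pos[of \<epsilon>] by simp

text \<open>Truncating \<open>Y\<close> makes the test function bounded; uniform integrability controls the truncation error
  uniformly in \<open>\<epsilon>\<close>.\<close>

lemma Ye_test_limit:
  assumes G: "bounded_borel K G" and lip: "\<And>x y. \<bar>G x - G y\<bar> \<le> c * \<bar>x - y\<bar>"
  shows "((\<lambda>\<epsilon>. \<integral>\<omega>. Ye \<epsilon> \<omega> * G (R \<epsilon> \<omega> - v \<epsilon> / 2) \<partial>M) \<longlongrightarrow> (\<integral>\<omega>. Y \<omega> * G (sqrt v0 * X \<omega> - v0 / 2) \<partial>N)) (at_right 0)"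
proof (rule tendstoI)
  fix e :: real assume e: "0 < e"
  note [measurable] = bounded_borelD(1)[OF G] X_measurable Y_measurable
  have K0: "0 \<le> K" by (rule bounded_borelD(3)[OF G])
  have c0: "0 \<le> c" using lip[of 1 0] by simp
  define \<eta> where "\<eta> = e / (4 * (K + 1))"
  have \<eta>: "0 < \<eta>" "K * \<eta> \<le> e / 4" using e K0 by (auto simp: \<eta>_def field_simps)
  from Ye_tail[OF \<eta>(1)] obtain K1 where K1: "0 < K1 \<and> (\<forall>\<epsilon>>0. \<forall>D\<in>sets M. (\<forall>\<omega>\<in>D. K1 < \<bar>Ye \<epsilon> \<omega>\<bar>) \<longrightarrow>
      (\<integral>\<omega>. \<bar>Ye \<epsilon> \<omega>\<bar> * indicator D \<omega> \<partial>M) \<le> \<eta>)" by (rule exE)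
  have "(\<lambda>n. \<integral>\<omega>. \<bar>Y \<omega>\<bar> * indicator {y. real n < \<bar>y\<bar>} (Y \<omega>) \<partial>N) \<longlonglongrightarrow> (\<integral>\<omega>. 0 \<partial>N)"
  proof (rule integral_dominated_convergence[where w = "\<lambda>\<omega>. \<bar>Y \<omega>\<bar>"])
    have "(\<lambda>n. \<bar>y\<bar> * indicator {y. real n < \<bar>y\<bar>} y) \<longlonglongrightarrow> 0" for y :: real
    proof (rule tendsto_eventually)
      obtain n0 :: nat where "\<bar>y\<bar> \<le> real n0" using real_arch_simple by blast
      then show "\<forall>\<^sub>F n in sequentially. \<bar>y\<bar> * indicator {y. real n < \<bar>y\<bar>} y = 0"
        unfolding eventually_sequentially by (intro exI[of _ n0]) (auto simp: indicator_def)
    qed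
    then show "AE \<omega> in N. (\<lambda>n. \<bar>Y \<omega>\<bar> * indicator {y. real n < \<bar>y\<bar>} (Y \<omega>)) \<longlonglongrightarrow> 0" by simp
  qed (use Y_int in \<open>auto simp: indicator_def\<close>)
  then have "(\<lambda>n. \<integral>\<omega>. \<bar>Y \<omega>\<bar> * indicator {y. real n < \<bar>y\<bar>} (Y \<omega>) \<partial>N) \<longlonglongrightarrow> 0" by simp
  from order_tendstoD(2)[OF this \<eta>(1)] obtain n1 where
    n1: "\<And>n. n1 \<le> n \<Longrightarrow> (\<integral>\<omega>. \<bar>Y \<omega>\<bar> * indicator {y. real n < \<bar>y\<bar>} (Y \<omega>) \<partial>N) < \<eta>"
    by (auto simp: eventually_sequentially)
  obtain n2 :: nat where n2: "K1 \<le> real n2" using real_arch_simple by blast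
  define k where "k = real (max n1 n2)"
  have k: "0 \<le> k" "K1 \<le> k" using n2 by (auto simp: k_def)
  have N_tail: "(\<integral>\<omega>. \<bar>Y \<omega>\<bar> * indicator {y. k < \<bar>y\<bar>} (Y \<omega>) \<partial>N) \<le> \<eta>"
    using n1[of "max n1 n2"] by (simp add: k_def less_imp_le)
  note [measurable] = borel_measurable_continuous_onI[OF continuous_clamp_abs[of k]]
  let ?cl = "clamp_abs k"
  define L where "L \<omega> = sqrt v0 * X \<omega> - v0 / 2" for \<omega>
  have Lm [measurable]: "L \<in> borel_measurable N" unfolding L_def[abs_def] by measurable
  have trunc: "\<bar>(\<integral>\<omega>. y \<omega> * G (x \<omega>) \<partial>P) - (\<integral>\<omega>. ?cl (y \<omega>) * G (x \<omega>) \<partial>P)\<bar> \<le> e / 4"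
    if [measurable]: "x \<in> borel_measurable P" and y: "integrable P y" and P: "prob_space P"
      and t: "(\<integral>\<omega>. \<bar>y \<omega>\<bar> * indicator {y. k < \<bar>y\<bar>} (y \<omega>) \<partial>P) \<le> \<eta>" for P :: "'c measure" and x y
  proof -
    interpret P: prob_space P by fact
    note ym [measurable] = borel_measurable_integrable[OF y]
    have icl: "integrable P (\<lambda>\<omega>. ?cl (y \<omega>))"
      by (rule P.integrable_const_bound[where B = k]) (use clamp_abs_bounds[OF k(1)] in auto)
    have id: "integrable P (\<lambda>\<omega>. y \<omega> - ?cl (y \<omega>))" using y icl by simp
    have i: "integrable P (\<lambda>\<omega>. G (x \<omega>) * y \<omega>)" "integrable P (\<lambda>\<omega>. G (x \<omega>) * ?cl (y \<omega>))"
      using integrable_bounded_mult[OF G that(1)] y icl by auto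
    have it: "integrable P (\<lambda>\<omega>. \<bar>y \<omega>\<bar> * indicator {y. k < \<bar>y\<bar>} (y \<omega>))"
      by (rule Bochner_Integration.integrable_bound[OF y]) (auto simp: indicator_def)
    have "(\<integral>\<omega>. y \<omega> * G (x \<omega>) \<partial>P) - (\<integral>\<omega>. ?cl (y \<omega>) * G (x \<omega>) \<partial>P) = (\<integral>\<omega>. G (x \<omega>) * (y \<omega> - ?cl (y \<omega>)) \<partial>P)"
      using i by (simp add: right_diff_distrib mult.commute)
    also have "\<bar>\<integral>\<omega>. G (x \<omega>) * (y \<omega> - ?cl (y \<omega>)) \<partial>P\<bar> \<le> K * (\<integral>\<omega>. \<bar>y \<omega> - ?cl (y \<omega>)\<bar> \<partial>P)"
      by (rule abs_integral_bounded_mult_le[OF G that(1) id])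
    also have "\<dots> \<le> K * (\<integral>\<omega>. \<bar>y \<omega>\<bar> * indicator {y. k < \<bar>y\<bar>} (y \<omega>) \<partial>P)"
      using id it clamp_abs_bounds(2)[OF k(1)] by (intro mult_left_mono integral_mono K0) auto
    also have "\<dots> \<le> K * \<eta>" by (intro mult_left_mono t K0)
    finally show ?thesis using \<eta>(2) by linarith
  qed
  have main: "((\<lambda>\<epsilon>. \<integral>\<omega>. ?cl (Ye \<epsilon> \<omega>) * G (sqrt (v \<epsilon>) * (1 / sqrt (v \<epsilon>) * R \<epsilon> \<omega>) - v \<epsilon> / 2) \<partial>M)
      \<longlongrightarrow> (\<integral>\<omega>. ?cl (Y \<omega>) * G (sqrt v0 * X \<omega> - v0 / 2) \<partial>N)) (at_right 0)"
  proof -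
    let ?w = "\<lambda>\<epsilon> z. ?cl (snd z) * G (sqrt (v \<epsilon>) * fst z - v \<epsilon> / 2)"
    let ?u = "\<lambda>z. ?cl (snd z) * G (sqrt v0 * fst z - v0 / 2)"
    define \<eta>' where "\<eta>' \<epsilon> = k * (c * (\<bar>sqrt (v \<epsilon>) - sqrt v0\<bar> + \<bar>v \<epsilon> - v0\<bar> / 2))" for \<epsilon>
    have bb: "\<bar>?cl a * G b\<bar> \<le> k * K" for a b
      unfolding abs_mult by (intro mult_mono clamp_abs_bounds k bounded_borelD(2)[OF G]) auto
    have Gc: "continuous_on UNIV G" by (rule lipschitz_continuous[OF lip])
    have "((\<lambda>\<epsilon>. \<integral>\<omega>. ?w \<epsilon> ((1 / sqrt (v \<epsilon>) * R \<epsilon> \<omega>, 1 / \<epsilon> * (I \<epsilon> \<omega> - v \<epsilon>))) \<partial>M)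
        \<longlongrightarrow> (\<integral>\<omega>. ?u (X \<omega>, Y \<omega>) \<partial>N)) (at_right 0)"
    proof (rule tendsto_in_law_moving_test[OF M N law, where K = "k * K" and \<eta> = \<eta>'])
      show "continuous_on UNIV ?u"
        by (intro continuous_intros continuous_on_compose2[OF continuous_clamp_abs] continuous_on_compose2[OF Gc]) auto
      show "\<bar>?u z\<bar> \<le> k * K" for z by (rule bb)
      show "\<bar>?w \<epsilon> z\<bar> \<le> k * K" for \<epsilon> z by (rule bb)
      show "\<forall>\<^sub>F \<epsilon> in at_right 0. ?w \<epsilon> \<in> borel_measurable borel"
        by (intro always_eventually allI) (simp add: borel_prod[symmetric])
      have "(\<eta>' \<longlongrightarrow> k * (c * (\<bar>sqrt v0 - sqrt v0\<bar> + \<bar>v0 - v0\<bar> / 2))) (at_right 0)"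
        unfolding \<eta>'_def[abs_def] by (intro tendsto_intros sqrt_v_lim v_lim) auto
      then show "(\<eta>' \<longlongrightarrow> 0) (at_right 0)" by simp
      show "\<forall>\<^sub>F \<epsilon> in at_right 0. \<forall>z. \<bar>?w \<epsilon> z - ?u z\<bar> \<le> \<eta>' \<epsilon> * (1 + \<bar>fst z\<bar> + \<bar>snd z\<bar>)"
      proof (intro always_eventually allI)
        fix \<epsilon> :: real and z :: "real \<times> real"
        let ?d = "\<bar>sqrt (v \<epsilon>) - sqrt v0\<bar> + \<bar>v \<epsilon> - v0\<bar> / 2"
        have "\<bar>(sqrt (v \<epsilon>) * fst z - v \<epsilon> / 2) - (sqrt v0 * fst z - v0 / 2)\<bar>
          = \<bar>(sqrt (v \<epsilon>) - sqrt v0) * fst z - (v \<epsilon> - v0) / 2\<bar>" by (simp add: algebra_simps diff_divide_distrib)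
        also have "\<dots> \<le> \<bar>sqrt (v \<epsilon>) - sqrt v0\<bar> * \<bar>fst z\<bar> + \<bar>v \<epsilon> - v0\<bar> / 2"
          unfolding abs_mult[symmetric] using abs_triangle_ineq4[of "(sqrt (v \<epsilon>) - sqrt v0) * fst z" "(v \<epsilon> - v0) / 2"] by simp
        also have "\<dots> \<le> ?d * (1 + \<bar>fst z\<bar> + \<bar>snd z\<bar>)"
          using linear_growth[of "\<bar>sqrt (v \<epsilon>) - sqrt v0\<bar>" "\<bar>v \<epsilon> - v0\<bar> / 2" 0 "\<bar>fst z\<bar>" "\<bar>snd z\<bar>"] by simp
        finally have "c * \<bar>(sqrt (v \<epsilon>) * fst z - v \<epsilon> / 2) - (sqrt v0 * fst z - v0 / 2)\<bar> \<le> c * (?d * (1 + \<bar>fst z\<bar> + \<bar>snd z\<bar>))"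
          by (rule mult_left_mono) (rule c0)
        then have "\<bar>G (sqrt (v \<epsilon>) * fst z - v \<epsilon> / 2) - G (sqrt v0 * fst z - v0 / 2)\<bar> \<le> c * (?d * (1 + \<bar>fst z\<bar> + \<bar>snd z\<bar>))"
          using lip by (rule order_trans[rotated])
        then have "\<bar>?cl (snd z)\<bar> * \<bar>G (sqrt (v \<epsilon>) * fst z - v \<epsilon> / 2) - G (sqrt v0 * fst z - v0 / 2)\<bar>
          \<le> k * (c * (?d * (1 + \<bar>fst z\<bar> + \<bar>snd z\<bar>)))"
          by (intro mult_mono clamp_abs_bounds k) auto
        then show "\<bar>?w \<epsilon> z - ?u z\<bar> \<le> \<eta>' \<epsilon> * (1 + \<bar>fst z\<bar> + \<bar>snd z\<bar>)"
          unfolding right_diff_distrib[symmetric] abs_mult \<eta>'_def by (simp only: mult.assoc)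
      qed
    qed
    then show ?thesis unfolding Ye_def by simp
  qed
  have "0 < e / 4" using e by simp
  from tendstoD[OF main this] eventually_pos
  show "\<forall>\<^sub>F \<epsilon> in at_right 0. dist (\<integral>\<omega>. Ye \<epsilon> \<omega> * G (R \<epsilon> \<omega> - v \<epsilon> / 2) \<partial>M) (\<integral>\<omega>. Y \<omega> * G (sqrt v0 * X \<omega> - v0 / 2) \<partial>N) < e"
  proof eventually_elim
    case (elim \<epsilon>)
    note [measurable] = Ye_measurable[OF elim(2)] R_meas[OF elim(2)]
    have "{\<omega> \<in> space M. k < \<bar>Ye \<epsilon> \<omega>\<bar>} \<in> sets M" by measurable
    moreover have "\<forall>\<omega>\<in>{\<omega> \<in> space M. k < \<bar>Ye \<epsilon> \<omega>\<bar>}. K1 < \<bar>Ye \<epsilon> \<omega>\<bar>" using k(2) by auto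
    ultimately have "(\<integral>\<omega>. \<bar>Ye \<epsilon> \<omega>\<bar> * indicator {\<omega> \<in> space M. k < \<bar>Ye \<epsilon> \<omega>\<bar>} \<omega> \<partial>M) \<le> \<eta>"
      using K1 elim(2) by blast
    also have "(\<integral>\<omega>. \<bar>Ye \<epsilon> \<omega>\<bar> * indicator {\<omega> \<in> space M. k < \<bar>Ye \<epsilon> \<omega>\<bar>} \<omega> \<partial>M)
      = (\<integral>\<omega>. \<bar>Ye \<epsilon> \<omega>\<bar> * indicator {y. k < \<bar>y\<bar>} (Ye \<epsilon> \<omega>) \<partial>M)"
      by (intro Bochner_Integration.integral_cong) (auto simp: indicator_def)
    finally have "\<bar>(\<integral>\<omega>. Ye \<epsilon> \<omega> * G (R \<epsilon> \<omega> - v \<epsilon> / 2) \<partial>M) - (\<integral>\<omega>. ?cl (Ye \<epsilon> \<omega>) * G (R \<epsilon> \<omega> - v \<epsilon> / 2) \<partial>M)\<bar> \<le> e / 4"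
      by (intro trunc M Ye_integrable elim) measurable
    moreover have "\<bar>(\<integral>\<omega>. Y \<omega> * G (L \<omega>) \<partial>N) - (\<integral>\<omega>. ?cl (Y \<omega>) * G (L \<omega>) \<partial>N)\<bar> \<le> e / 4"
      by (rule trunc[OF Lm Y_int N N_tail])
    ultimately show ?case
      using elim(1) e unfolding R_eq[OF elim(2)] L_def dist_real_def by linarith
  qed
qed

text \<open>The expansion at order zero: with \<open>\<delta> = 1\<close> all its error terms are of order \<open>\<epsilon>\<close>.\<close>

lemma limit_law_integral:
  assumes h: "bounded_borel C h" and lip: "\<And>x y. \<bar>h x - h y\<bar> \<le> c * \<bar>x - y\<bar>"
  shows "(\<integral>\<omega>. h (sqrt v0 * X \<omega> - v0 / 2) \<partial>N) = heat v0 h (- v0 / 2)"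
proof -
  note [measurable] = bounded_borelD(1)[OF h]
  have c0: "0 \<le> c" using lip[of 1 0] by simp
  have hc: "continuous_on UNIV h" by (rule lipschitz_continuous[OF lip])
  have diff_lim: "((\<lambda>\<epsilon>. c * (\<bar>sqrt (v \<epsilon>) - sqrt v0\<bar> + \<bar>v \<epsilon> - v0\<bar> / 2 + \<bar>\<epsilon>\<bar> / 2)) \<longlongrightarrow> 0) (at_right 0)"
  proof -
    have "((\<lambda>\<epsilon>. c * (\<bar>sqrt (v \<epsilon>) - sqrt v0\<bar> + \<bar>v \<epsilon> - v0\<bar> / 2 + \<bar>\<epsilon>\<bar> / 2))
        \<longlongrightarrow> c * (\<bar>sqrt v0 - sqrt v0\<bar> + \<bar>v0 - v0\<bar> / 2 + \<bar>0\<bar> / 2)) (at_right 0)"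
      by (intro tendsto_intros sqrt_v_lim v_lim) auto
    then show ?thesis by simp
  qed
  have 1: "((\<lambda>\<epsilon>. \<integral>\<omega>. h (R \<epsilon> \<omega> - I \<epsilon> \<omega> / 2) \<partial>M) \<longlongrightarrow> (\<integral>\<omega>. h (sqrt v0 * X \<omega> - v0 / 2) \<partial>N)) (at_right 0)"
  proof -
    let ?w = "\<lambda>\<epsilon> z. h (sqrt (v \<epsilon>) * fst z - v \<epsilon> / 2 - \<epsilon> * snd z / 2)"
    let ?u = "\<lambda>z :: real \<times> real. h (sqrt v0 * fst z - v0 / 2)"
    have "((\<lambda>\<epsilon>. \<integral>\<omega>. ?w \<epsilon> ((1 / sqrt (v \<epsilon>) * R \<epsilon> \<omega>, 1 / \<epsilon> * (I \<epsilon> \<omega> - v \<epsilon>))) \<partial>M)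
        \<longlongrightarrow> (\<integral>\<omega>. ?u (X \<omega>, Y \<omega>) \<partial>N)) (at_right 0)"
    proof (rule tendsto_in_law_moving_test[OF M N law _ _ _ _ diff_lim, where K = C])
      show "continuous_on UNIV ?u"
        by (intro continuous_intros continuous_on_compose2[OF hc]) auto
      show "\<bar>?u z\<bar> \<le> C" for z by (rule bounded_borelD(2)[OF h])
      show "\<bar>?w \<epsilon> z\<bar> \<le> C" for \<epsilon> z by (rule bounded_borelD(2)[OF h])
      show "\<forall>\<^sub>F \<epsilon> in at_right 0. ?w \<epsilon> \<in> borel_measurable borel"
        by (intro always_eventually allI) (simp add: borel_prod[symmetric])
      show "\<forall>\<^sub>F \<epsilon> in at_right 0. \<forall>z. \<bar>?w \<epsilon> z - ?u z\<bar>
          \<le> c * (\<bar>sqrt (v \<epsilon>) - sqrt v0\<bar> + \<bar>v \<epsilon> - v0\<bar> / 2 + \<bar>\<epsilon>\<bar> / 2) * (1 + \<bar>fst z\<bar> + \<bar>snd z\<bar>)"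
      proof (intro always_eventually allI)
        fix \<epsilon> :: real and z :: "real \<times> real"
        let ?d = "\<bar>sqrt (v \<epsilon>) - sqrt v0\<bar> + \<bar>v \<epsilon> - v0\<bar> / 2 + \<bar>\<epsilon>\<bar> / 2"
        have t: "\<bar>a - b - d\<bar> \<le> \<bar>a\<bar> + \<bar>b\<bar> + \<bar>d\<bar>" for a b d :: real by linarith
        have "\<bar>(sqrt (v \<epsilon>) * fst z - v \<epsilon> / 2 - \<epsilon> * snd z / 2) - (sqrt v0 * fst z - v0 / 2)\<bar>
          = \<bar>(sqrt (v \<epsilon>) - sqrt v0) * fst z - (v \<epsilon> - v0) / 2 - \<epsilon> * snd z / 2\<bar>" by (simp add: algebra_simps diff_divide_distrib)
        also have "\<dots> \<le> \<bar>(sqrt (v \<epsilon>) - sqrt v0) * fst z\<bar> + \<bar>(v \<epsilon> - v0) / 2\<bar> + \<bar>\<epsilon> * snd z / 2\<bar>" by (rule t)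
        also have "\<dots> = \<bar>sqrt (v \<epsilon>) - sqrt v0\<bar> * \<bar>fst z\<bar> + \<bar>v \<epsilon> - v0\<bar> / 2 + \<bar>\<epsilon>\<bar> / 2 * \<bar>snd z\<bar>" by (simp add: abs_mult)
        also have "\<dots> \<le> ?d * (1 + \<bar>fst z\<bar> + \<bar>snd z\<bar>)"
          by (rule linear_growth) auto
        finally have "c * \<bar>(sqrt (v \<epsilon>) * fst z - v \<epsilon> / 2 - \<epsilon> * snd z / 2) - (sqrt v0 * fst z - v0 / 2)\<bar>
            \<le> c * (?d * (1 + \<bar>fst z\<bar> + \<bar>snd z\<bar>))"
          by (rule mult_left_mono) (rule c0)
        then show "\<bar>?w \<epsilon> z - ?u z\<bar> \<le> c * ?d * (1 + \<bar>fst z\<bar> + \<bar>snd z\<bar>)"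
          using lip unfolding mult.assoc by (rule order_trans[rotated])
      qed
    qed
    then have "((\<lambda>\<epsilon>. \<integral>\<omega>. ?w \<epsilon> ((1 / sqrt (v \<epsilon>) * R \<epsilon> \<omega>, 1 / \<epsilon> * (I \<epsilon> \<omega> - v \<epsilon>))) \<partial>M)
        \<longlongrightarrow> (\<integral>\<omega>. h (sqrt v0 * X \<omega> - v0 / 2) \<partial>N)) (at_right 0)" by simp
    moreover have "\<forall>\<^sub>F \<epsilon> in at_right 0. (\<integral>\<omega>. ?w \<epsilon> ((1 / sqrt (v \<epsilon>) * R \<epsilon> \<omega>, 1 / \<epsilon> * (I \<epsilon> \<omega> - v \<epsilon>))) \<partial>M)
        = (\<integral>\<omega>. h (R \<epsilon> \<omega> - I \<epsilon> \<omega> / 2) \<partial>M)"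
      using eventually_pos
    proof eventually_elim
      case (elim \<epsilon>)
      have "sqrt (v \<epsilon>) * (1 / sqrt (v \<epsilon>) * R \<epsilon> \<omega>) - v \<epsilon> / 2 - \<epsilon> * (1 / \<epsilon> * (I \<epsilon> \<omega> - v \<epsilon>)) / 2 = R \<epsilon> \<omega> - I \<epsilon> \<omega> / 2" for \<omega>
        unfolding R_eq[OF elim] using elim by (simp add: field_simps)
      then show ?case by simp
    qed
    ultimately show ?thesis by (rule Lim_transform_eventually)
  qed
  have 2: "((\<lambda>\<epsilon>. heat (v \<epsilon>) h (- v \<epsilon> / 2)) \<longlongrightarrow> heat v0 h (- v0 / 2)) (at_right 0)"
  proof (rule LIM_zero_cancel, rule Lim_null_comparison[OF _ diff_lim], rule always_eventually, rule allI)
    fix \<epsilon> :: real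
    have i: "integrable \<gamma> (\<lambda>z. h (a + b * z))" for a b
      by (rule integrable_bounded_borel[OF gauss.prob_space_axioms h]) measurable
    have iz: "integrable \<gamma> (\<lambda>z. c * (\<bar>v \<epsilon> - v0\<bar> / 2 + \<bar>sqrt (v \<epsilon>) - sqrt v0\<bar> * \<bar>z\<bar>))"
      using integrable_gauss_id(2) by simp
    have "\<bar>heat (v \<epsilon>) h (- v \<epsilon> / 2) - heat v0 h (- v0 / 2)\<bar>
      = \<bar>\<integral>z. h (- v \<epsilon> / 2 + sqrt (v \<epsilon>) * z) - h (- v0 / 2 + sqrt v0 * z) \<partial>\<gamma>\<bar>"
      unfolding heat_def using i[of "- v \<epsilon> / 2" "sqrt (v \<epsilon>)"] i[of "- v0 / 2" "sqrt v0"] by simp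
    also have "\<dots> \<le> (\<integral>z. \<bar>h (- v \<epsilon> / 2 + sqrt (v \<epsilon>) * z) - h (- v0 / 2 + sqrt v0 * z)\<bar> \<partial>\<gamma>)"
      by (rule integral_abs_bound)
    also have "\<dots> \<le> (\<integral>z. c * (\<bar>v \<epsilon> - v0\<bar> / 2 + \<bar>sqrt (v \<epsilon>) - sqrt v0\<bar> * \<bar>z\<bar>) \<partial>\<gamma>)"
    proof (rule integral_mono[OF _ iz])
      show "integrable \<gamma> (\<lambda>z. \<bar>h (- v \<epsilon> / 2 + sqrt (v \<epsilon>) * z) - h (- v0 / 2 + sqrt v0 * z)\<bar>)"
        using i[of "- v \<epsilon> / 2" "sqrt (v \<epsilon>)"] i[of "- v0 / 2" "sqrt v0"] by (intro integrable_abs Bochner_Integration.integrable_diff)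
      fix z :: real
      have "\<bar>(- v \<epsilon> / 2 + sqrt (v \<epsilon>) * z) - (- v0 / 2 + sqrt v0 * z)\<bar> = \<bar>(sqrt (v \<epsilon>) - sqrt v0) * z - (v \<epsilon> - v0) / 2\<bar>"
        by (simp add: algebra_simps diff_divide_distrib)
      also have "\<dots> \<le> \<bar>v \<epsilon> - v0\<bar> / 2 + \<bar>sqrt (v \<epsilon>) - sqrt v0\<bar> * \<bar>z\<bar>"
        unfolding abs_mult[symmetric] using abs_triangle_ineq4[of "(sqrt (v \<epsilon>) - sqrt v0) * z" "(v \<epsilon> - v0) / 2"] by simp
      finally have "c * \<bar>(- v \<epsilon> / 2 + sqrt (v \<epsilon>) * z) - (- v0 / 2 + sqrt v0 * z)\<bar> \<le> c * (\<bar>v \<epsilon> - v0\<bar> / 2 + \<bar>sqrt (v \<epsilon>) - sqrt v0\<bar> * \<bar>z\<bar>)"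
        by (rule mult_left_mono) (rule c0)
      then show "\<bar>h (- v \<epsilon> / 2 + sqrt (v \<epsilon>) * z) - h (- v0 / 2 + sqrt v0 * z)\<bar>
        \<le> c * (\<bar>v \<epsilon> - v0\<bar> / 2 + \<bar>sqrt (v \<epsilon>) - sqrt v0\<bar> * \<bar>z\<bar>)"
        using lip by (rule order_trans[rotated])
    qed
    also have "\<dots> = c * (\<bar>v \<epsilon> - v0\<bar> / 2 + \<bar>sqrt (v \<epsilon>) - sqrt v0\<bar> * (\<integral>z. \<bar>z\<bar> \<partial>\<gamma>))"
      using integrable_gauss_id(2) by simp
    also have "\<dots> \<le> c * (\<bar>v \<epsilon> - v0\<bar> / 2 + \<bar>sqrt (v \<epsilon>) - sqrt v0\<bar> * 1)"
      by (intro mult_left_mono add_left_mono gauss_moments(6) c0) auto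
    also have "\<dots> \<le> c * (\<bar>sqrt (v \<epsilon>) - sqrt v0\<bar> + \<bar>v \<epsilon> - v0\<bar> / 2 + \<bar>\<epsilon>\<bar> / 2)"
      by (intro mult_left_mono c0) auto
    finally show "norm (heat (v \<epsilon>) h (- v \<epsilon> / 2) - heat v0 h (- v0 / 2))
      \<le> c * (\<bar>sqrt (v \<epsilon>) - sqrt v0\<bar> + \<bar>v \<epsilon> - v0\<bar> / 2 + \<bar>\<epsilon>\<bar> / 2)" by simp
  qed
  obtain K where K: "0 \<le> K" "\<And>\<epsilon>. 0 < \<epsilon> \<Longrightarrow> (\<integral>\<omega>. \<bar>Ye \<epsilon> \<omega>\<bar> \<partial>M) \<le> K" using Ye_bound by blast
  let ?G = "corrector 1 h"
  define KG where "KG = C * deriv_bound 1"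
  have G: "bounded_borel KG ?G" unfolding KG_def by (rule bounded_borel_corrector[OF h]) auto
  note [measurable] = bounded_borelD(1)[OF G]
  have C0: "0 \<le> C" by (rule bounded_borelD(3)[OF h])
  have KG0: "0 \<le> KG" by (rule bounded_borelD(3)[OF G])
  have rs: "\<forall>\<^sub>F \<epsilon> in at_right 0. remainder_bound M (I \<epsilon>) \<kappa> (v \<epsilon>) 1 / \<epsilon> \<le> deriv_bound \<kappa> * (1 * K) + 1"
    by (rule remainder_small) (simp_all add: K(2))
  have 3: "((\<lambda>\<epsilon>. (\<integral>\<omega>. h (R \<epsilon> \<omega> - I \<epsilon> \<omega> / 2) \<partial>M) - heat (v \<epsilon>) h (- v \<epsilon> / 2)) \<longlongrightarrow> 0) (at_right 0)"
  proof (rule Lim_null_comparison)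
    have "((\<lambda>\<epsilon> :: real. \<epsilon> * (C * (deriv_bound \<kappa> * (1 * K) + 1) + KG * K)) \<longlongrightarrow> 0 * (C * (deriv_bound \<kappa> * (1 * K) + 1) + KG * K)) (at_right 0)"
      by (intro tendsto_intros)
    then show "((\<lambda>\<epsilon> :: real. \<epsilon> * (C * (deriv_bound \<kappa> * (1 * K) + 1) + KG * K)) \<longlongrightarrow> 0) (at_right 0)" by simp
    show "\<forall>\<^sub>F \<epsilon> in at_right 0. norm ((\<integral>\<omega>. h (R \<epsilon> \<omega> - I \<epsilon> \<omega> / 2) \<partial>M) - heat (v \<epsilon>) h (- v \<epsilon> / 2))
      \<le> \<epsilon> * (C * (deriv_bound \<kappa> * (1 * K) + 1) + KG * K)"
      using rs expand eventually_pos
    proof eventually_elim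
      case (elim \<epsilon>)
      note [measurable] = I_meas[OF elim(3)] Ye_measurable[OF elim(3)] R_meas[OF elim(3)]
      let ?E = "{\<omega> \<in> space M. I \<epsilon> \<omega> < v \<epsilon> + \<kappa>}"
      define q where "q = (\<integral>\<omega>. (I \<epsilon> \<omega> - v \<epsilon>) * ?G (R \<epsilon> \<omega> - v \<epsilon> / 2) * indicator ?E \<omega> \<partial>M)"
      define a where "a = (\<integral>\<omega>. h (R \<epsilon> \<omega> - I \<epsilon> \<omega> / 2) \<partial>M) - heat (v \<epsilon>) h (- v \<epsilon> / 2)"
      have "\<bar>a - q\<bar> \<le> C * remainder_bound M (I \<epsilon>) \<kappa> (v \<epsilon>) 1"
        unfolding a_def q_def by (rule elim(2)[rule_format, OF zero_less_one h])
      moreover have "remainder_bound M (I \<epsilon>) \<kappa> (v \<epsilon>) 1 \<le> \<epsilon> * (deriv_bound \<kappa> * (1 * K) + 1)"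
        using elim(1,3) by (simp add: field_simps)
      then have "C * remainder_bound M (I \<epsilon>) \<kappa> (v \<epsilon>) 1 \<le> C * (\<epsilon> * (deriv_bound \<kappa> * (1 * K) + 1))"
        by (rule mult_left_mono) (rule C0)
      moreover have "\<bar>q\<bar> \<le> KG * (\<epsilon> * K)"
      proof -
        have iE: "integrable M (\<lambda>\<omega>. (I \<epsilon> \<omega> - v \<epsilon>) * indicator ?E \<omega>)"
        proof -
          have "integrable M (\<lambda>\<omega>. \<epsilon> * (Ye \<epsilon> \<omega> * indicator ?E \<omega>))"
            using integrable_mult_indicator[of ?E M "Ye \<epsilon>"] Ye_integrable[OF elim(3)] by (simp add: mult.commute)
          then show ?thesis by (simp add: Ye_eq[OF elim(3)] mult.assoc)
        qed
        have "q = (\<integral>\<omega>. ?G (R \<epsilon> \<omega> - v \<epsilon> / 2) * ((I \<epsilon> \<omega> - v \<epsilon>) * indicator ?E \<omega>) \<partial>M)"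
          unfolding q_def by (simp add: mult_ac)
        then have "\<bar>q\<bar> \<le> KG * (\<integral>\<omega>. \<bar>(I \<epsilon> \<omega> - v \<epsilon>) * indicator ?E \<omega>\<bar> \<partial>M)"
          using abs_integral_bounded_mult_le[OF G _ iE, of "\<lambda>\<omega>. R \<epsilon> \<omega> - v \<epsilon> / 2"] by simp
        also have "\<dots> \<le> KG * (\<integral>\<omega>. \<epsilon> * \<bar>Ye \<epsilon> \<omega>\<bar> \<partial>M)"
          using iE Ye_integrable[OF elim(3)] elim(3)
          by (intro mult_left_mono integral_mono integrable_abs KG0)
             (auto simp: Ye_eq[OF elim(3)] abs_mult indicator_def)
        also have "\<dots> \<le> KG * (\<epsilon> * K)"
          using K(2)[OF elim(3)] elim(3) by (intro mult_left_mono KG0) simp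
        finally show ?thesis .
      qed
      moreover have "\<epsilon> * (C * (deriv_bound \<kappa> * (1 * K) + 1) + KG * K) = C * (\<epsilon> * (deriv_bound \<kappa> * (1 * K) + 1)) + KG * (\<epsilon> * K)"
        by (simp only: algebra_simps)
      ultimately show ?case unfolding a_def[symmetric] real_norm_def by linarith
    qed
  qed
  from tendsto_add[OF 3 2] have "((\<lambda>\<epsilon>. \<integral>\<omega>. h (R \<epsilon> \<omega> - I \<epsilon> \<omega> / 2) \<partial>M) \<longlongrightarrow> heat v0 h (- v0 / 2)) (at_right 0)" by simp
  from tendsto_unique[OF _ 1 this] show ?thesis by simp
qed

lemma X_law: "distr N borel X = \<gamma>"
proof (rule Levy_uniqueness)
  note [measurable] = X_measurable
  show "real_distribution (distr N borel X)" by simp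
  show "real_distribution \<gamma>" by (rule real_dist_normal_dist)
  show "char (distr N borel X) = char \<gamma>"
  proof (rule ext)
    fix t :: real
    have scale: "t * (sqrt v0 * x - v0 / 2 + v0 / 2) / sqrt v0 = t * x" for x using v0 by simp
    have hc: "(\<integral>\<omega>. g (t * X \<omega>) \<partial>N) = (\<integral>z. g (t * z) \<partial>\<gamma>)"
      if g: "g \<in> borel_measurable borel" "\<And>x. \<bar>g x\<bar> \<le> 1" "\<And>a b. \<bar>g a - g b\<bar> \<le> \<bar>a - b\<bar>" for g :: "real \<Rightarrow> real"
    proof -
      note [measurable] = g(1)
      define h where "h y = g (t * (y + v0 / 2) / sqrt v0)" for y
      have hb: "bounded_borel 1 h"
        using g(2) by (auto simp: bounded_borel_def h_def[abs_def])
      have "\<bar>h x - h y\<bar> \<le> \<bar>t / sqrt v0\<bar> * \<bar>x - y\<bar>" for x y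
      proof -
        have "\<bar>h x - h y\<bar> \<le> \<bar>t * (x + v0 / 2) / sqrt v0 - t * (y + v0 / 2) / sqrt v0\<bar>" unfolding h_def by (rule g(3))
        also have "\<dots> = \<bar>t / sqrt v0 * (x - y)\<bar>" by (simp add: algebra_simps diff_divide_distrib add_divide_distrib)
        finally show ?thesis by (simp only: abs_mult)
      qed
      from limit_law_integral[OF hb this] show ?thesis
        unfolding heat_def h_def using v0 by (simp add: algebra_simps)
    qed
    have int: "integrable P (\<lambda>\<omega>. iexp (t * x \<omega>))" if "prob_space P" and [measurable]: "x \<in> borel_measurable P" for P :: "'c measure" and x
    proof -
      interpret P: prob_space P by fact
      show ?thesis by (rule P.integrable_const_bound[where B = 1]) (auto simp del: of_real_mult)
    qed
    have Re_Im: "Re (iexp y) = cos y" "Im (iexp y) = sin y" for y by (simp_all add: Re_exp Im_exp)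
    have "char (distr N borel X) t = (CLINT \<omega>|N. iexp (t * X \<omega>))"
      unfolding char_def by (subst integral_distr) auto
    also have "\<dots> = char \<gamma> t"
    proof (rule complex_eqI)
      note i = int[OF N X_measurable] int[OF gauss.prob_space_axioms, of "\<lambda>z. z"]
      show "Re (CLINT \<omega>|N. iexp (t * X \<omega>)) = Re (char \<gamma> t)"
        unfolding char_def using i hc[of cos] abs_cos_sin_diff_le(1)
        by (subst (1 2) integral_Re[symmetric]) (auto simp: Re_Im simp del: of_real_mult)
      show "Im (CLINT \<omega>|N. iexp (t * X \<omega>)) = Im (char \<gamma> t)"
        unfolding char_def using i hc[of sin] abs_cos_sin_diff_le(2)
        by (subst (1 2) integral_Im[symmetric]) (auto simp: Re_Im simp del: of_real_mult)
    qed
    finally show "char (distr N borel X) t = char \<gamma> t" .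
  qed
qed

lemma regression_integral:
  assumes m: "cond_exp_version N Y X m" and g: "bounded_borel K g"
  shows "integrable \<gamma> m" "(\<integral>\<omega>. Y \<omega> * g (X \<omega>) \<partial>N) = (\<integral>x. m x * g x \<partial>\<gamma>)"
proof -
  note [measurable] = X_measurable bounded_borelD(1)[OF g]
  have mm [measurable]: "m \<in> borel_measurable borel" and Yi: "integrable N Y"
    and ae: "AE \<omega> in N. real_cond_exp N (vimage_algebra (space N) X borel) Y \<omega> = m (X \<omega>)"
    using m by (auto simp: cond_exp_version_def)
  define A where "A = vimage_algebra (space N) X borel"
  have sub: "subalgebra N A" using subalgebra_generated_by[OF X_measurable] by (simp add: A_def generated_by_def)
  interpret finite_measure_subalgebra N A by unfold_locales (rule sub)
  have XA: "X \<in> borel_measurable A" using measurable_generated_by[of X N] by (simp add: A_def generated_by_def)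
  have gA: "(\<lambda>\<omega>. g (X \<omega>)) \<in> borel_measurable A" using XA by simp
  have ci: "integrable N (real_cond_exp N A Y)" by (rule real_cond_exp_int(1)[OF Yi])
  have "integrable N (\<lambda>\<omega>. m (X \<omega>))"
    by (rule integrable_cong_AE_imp[OF ci]) (use ae in \<open>auto simp: A_def\<close>)
  then have "integrable (distr N borel X) m" by (subst integrable_distr_eq) auto
  then show "integrable \<gamma> m" by (simp only: X_law)
  have "integrable N (\<lambda>\<omega>. g (X \<omega>) * Y \<omega>)" by (rule integrable_bounded_mult[OF g X_measurable Yi])
  from real_cond_exp_intg(2)[OF this gA borel_measurable_integrable[OF Yi]]
  have "(\<integral>\<omega>. Y \<omega> * g (X \<omega>) \<partial>N) = (\<integral>\<omega>. g (X \<omega>) * real_cond_exp N A Y \<omega> \<partial>N)" by (simp add: mult.commute)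
  also have "\<dots> = (\<integral>\<omega>. m (X \<omega>) * g (X \<omega>) \<partial>N)"
    by (rule integral_cong_AE) (use ae in \<open>auto simp: A_def[symmetric] mult.commute\<close>)
  also have "\<dots> = (\<integral>x. m x * g x \<partial>distr N borel X)" by (subst integral_distr) auto
  finally show "(\<integral>\<omega>. Y \<omega> * g (X \<omega>) \<partial>N) = (\<integral>x. m x * g x \<partial>\<gamma>)" by (simp only: X_law)
qed

end

section \<open>Integration by parts and continuity in L1\<close>

lemma L1_tendsto_of_nn_integral:
  fixes f :: "nat \<Rightarrow> 'a \<Rightarrow> real"
  assumes "\<And>n. integrable M (f n)" "(\<lambda>n. \<integral>\<^sup>+x. norm (f n x) \<partial>M) \<longlonglongrightarrow> 0"
  shows "(\<lambda>n. \<integral>x. \<bar>f n x\<bar> \<partial>M) \<longlonglongrightarrow> 0"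
proof -
  have "(\<integral>\<^sup>+x. norm (f n x) \<partial>M) = ennreal (\<integral>x. \<bar>f n x\<bar> \<partial>M)" for n
    using assms(1)[of n] by (subst nn_integral_eq_integral) auto
  with assms(2) have "(\<lambda>n. ennreal (\<integral>x. \<bar>f n x\<bar> \<partial>M)) \<longlonglongrightarrow> 0" by simp
  then show ?thesis by (subst (asm) ennreal_tendsto_0_iff) auto
qed

lemma integrable_translate:
  fixes w :: "real \<Rightarrow> real"
  assumes "integrable lborel w" shows "integrable lborel (\<lambda>x. w (x - t))"
  using lborel_integrable_real_affine[OF assms, of 1 "- t"] by simp

lemma translation_L1_tendsto:
  fixes w :: "real \<Rightarrow> real"
  assumes w: "continuous_on UNIV w" "integrable lborel w" and t: "t \<longlonglongrightarrow> 0"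
  shows "(\<lambda>n. \<integral>x. \<bar>w (x - t n) - w x\<bar> \<partial>lborel) \<longlonglongrightarrow> 0"
proof (rule L1_tendsto_of_nn_integral)
  note [measurable] = borel_measurable_continuous_onI[OF w(1)]
  show "integrable lborel (\<lambda>x. w (x - t n) - w x)" for n using integrable_translate[OF w(2)] w(2) by simp
  show "(\<lambda>n. \<integral>\<^sup>+x. norm (w (x - t n) - w x) \<partial>lborel) \<longlonglongrightarrow> 0"
  proof (rule Scheffe_lemma2)
    have "(\<lambda>n. w (x - t n)) \<longlonglongrightarrow> w x" for x
    proof -
      have "(\<lambda>n. x - t n) \<longlonglongrightarrow> x - 0" by (intro tendsto_intros t)
      moreover have "isCont w x" using w(1) by (simp add: continuous_on_eq_continuous_at)
      ultimately show ?thesis using isCont_tendsto_compose[of x w] by simp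
    qed
    then show "AE x in lborel. (\<lambda>n. w (x - t n)) \<longlonglongrightarrow> w x" by simp
    show "(\<integral>\<^sup>+x. norm (w (x - t n)) \<partial>lborel) \<le> (\<integral>\<^sup>+x. norm (w x) \<partial>lborel)" for n
      using nn_integral_real_affine[of "\<lambda>x. ennreal (norm (w x))" 1 "- t n"] by simp
  qed (use w(2) in auto)
qed

text \<open>After Fubini and a translation the smoothing of the Borel function \<open>h\<close> acts on the integrable function
  \<open>w\<close> instead, which translates continuously in \<open>L\<^sup>1\<close>.\<close>

lemma heat_mollification_tendsto:
  assumes h: "bounded_borel C h" and w: "continuous_on UNIV w" "integrable lborel w"
    and a: "a \<noteq> 0" and \<delta>: "\<delta> \<longlonglongrightarrow> 0"
  shows "(\<lambda>n. \<integral>x. heat (\<delta> n) h (a * x + b) * w x \<partial>lborel) \<longlonglongrightarrow> (\<integral>x. h (a * x + b) * w x \<partial>lborel)"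
proof -
  interpret P: pair_sigma_finite lborel \<gamma> ..
  note [measurable] = bounded_borelD(1)[OF h] borel_measurable_continuous_onI[OF w(1)]
  define \<tau> where "\<tau> t = (\<integral>x. \<bar>w (x - t) - w x\<bar> \<partial>lborel)" for t
  define W where "W = (\<integral>x. \<bar>w x\<bar> \<partial>lborel)"
  have C0: "0 \<le> C" by (rule bounded_borelD(3)[OF h])
  have \<tau>m [measurable]: "\<tau> \<in> borel_measurable borel"
    unfolding \<tau>_def[abs_def] by (rule lborel.borel_measurable_lebesgue_integral) measurable
  have \<tau>0: "0 \<le> \<tau> t" for t by (simp add: \<tau>_def)
  have \<tau>b: "\<tau> t \<le> 2 * W" for t
  proof -
    have i: "integrable lborel (\<lambda>x. \<bar>w (x - t)\<bar> + \<bar>w x\<bar>)" using integrable_translate[OF w(2)] w(2) by simp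
    have "\<tau> t \<le> (\<integral>x. \<bar>w (x - t)\<bar> + \<bar>w x\<bar> \<partial>lborel)"
      unfolding \<tau>_def using integrable_translate[OF w(2)] w(2) i
      by (intro integral_mono integrable_abs Bochner_Integration.integrable_diff) (auto intro: abs_triangle_ineq4)
    also have "\<dots> = (\<integral>x. \<bar>w (x - t)\<bar> \<partial>lborel) + W" using integrable_translate[OF w(2)] w(2) by (simp add: W_def)
    also have "(\<integral>x. \<bar>w (x - t)\<bar> \<partial>lborel) = W"
      using lborel_integral_real_affine[of 1 "\<lambda>x. \<bar>w x\<bar>" "- t"] by (simp add: W_def)
    finally show ?thesis by simp
  qed
  have bound: "\<bar>(\<integral>x. heat d h (a * x + b) * w x \<partial>lborel) - (\<integral>x. h (a * x + b) * w x \<partial>lborel)\<bar>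
      \<le> (\<integral>z. C * \<tau> (sqrt d * z / a) \<partial>\<gamma>)" for d
  proof -
    have "integrable (lborel \<Otimes>\<^sub>M \<gamma>) (\<lambda>p. case p of (x, z) \<Rightarrow> w x)"
      by (rule P.Fubini_integrable) (use w(2) in auto)
    from integrable_bounded_mult[OF h _ this, of "\<lambda>(x, z). a * x + b + sqrt d * z"]
    have i: "integrable (lborel \<Otimes>\<^sub>M \<gamma>) (\<lambda>(x, z). h (a * x + b + sqrt d * z) * w x)"
      by (simp add: case_prod_beta')
    have ih: "integrable lborel (\<lambda>x. h (a * x + b) * w x)"
      by (rule integrable_bounded_mult[OF h _ w(2)]) measurable
    have iz: "integrable \<gamma> (\<lambda>z. \<integral>x. h (a * x + b + sqrt d * z) * w x \<partial>lborel)"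
      using P.integrable_snd[OF i] by simp
    have "(\<integral>x. heat d h (a * x + b) * w x \<partial>lborel) = (\<integral>x. (\<integral>z. h (a * x + b + sqrt d * z) * w x \<partial>\<gamma>) \<partial>lborel)"
      by (simp add: heat_def)
    also have "\<dots> = (\<integral>z. (\<integral>x. h (a * x + b + sqrt d * z) * w x \<partial>lborel) \<partial>\<gamma>)"
      by (rule P.Fubini_integral[OF i, symmetric])
    finally have "(\<integral>x. heat d h (a * x + b) * w x \<partial>lborel) - (\<integral>x. h (a * x + b) * w x \<partial>lborel)
      = (\<integral>z. (\<integral>x. h (a * x + b + sqrt d * z) * w x \<partial>lborel) - (\<integral>x. h (a * x + b) * w x \<partial>lborel) \<partial>\<gamma>)" (is "?l = ?r")
      using iz by simp
    then have "\<bar>?l\<bar> = \<bar>?r\<bar>" by (rule arg_cong)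
    also have "\<dots> \<le> (\<integral>z. \<bar>(\<integral>x. h (a * x + b + sqrt d * z) * w x \<partial>lborel) - (\<integral>x. h (a * x + b) * w x \<partial>lborel)\<bar> \<partial>\<gamma>)"
      by (rule integral_abs_bound)
    also have "\<dots> \<le> (\<integral>z. C * \<tau> (sqrt d * z / a) \<partial>\<gamma>)"
    proof (rule integral_mono)
      show "integrable \<gamma> (\<lambda>z. \<bar>(\<integral>x. h (a * x + b + sqrt d * z) * w x \<partial>lborel) - (\<integral>x. h (a * x + b) * w x \<partial>lborel)\<bar>)"
        using iz by (intro integrable_abs Bochner_Integration.integrable_diff) auto
      show "integrable \<gamma> (\<lambda>z. C * \<tau> (sqrt d * z / a))"
        by (intro integrable_mult_right gauss.integrable_const_bound[where B = "2 * W"]) (use \<tau>b \<tau>0 in auto)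
      fix z :: real
      let ?t = "sqrt d * z / a"
      have "(\<integral>x. h (a * x + b + sqrt d * z) * w x \<partial>lborel) = (\<integral>x. h (a * x + b) * w (x - ?t) \<partial>lborel)"
      proof -
        have "a * (x - ?t) + b + sqrt d * z = a * x + b" for x using a by (simp add: right_diff_distrib)
        moreover have "(\<integral>x. h (a * x + b + sqrt d * z) * w x \<partial>lborel)
          = (\<integral>x. h (a * (x - ?t) + b + sqrt d * z) * w (x - ?t) \<partial>lborel)"
          using lborel_integral_real_affine[of 1 "\<lambda>x. h (a * x + b + sqrt d * z) * w x" "- ?t"] by simp
        ultimately show ?thesis by (simp only:)
      qed
      then have "(\<integral>x. h (a * x + b + sqrt d * z) * w x \<partial>lborel) - (\<integral>x. h (a * x + b) * w x \<partial>lborel)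
        = (\<integral>x. h (a * x + b) * (w (x - ?t) - w x) \<partial>lborel)"
        using ih integrable_bounded_mult[OF h _ integrable_translate[OF w(2), of ?t], of "\<lambda>x. a * x + b"]
        by (simp add: right_diff_distrib)
      moreover have "\<bar>\<integral>x. h (a * x + b) * (w (x - ?t) - w x) \<partial>lborel\<bar> \<le> C * (\<integral>x. \<bar>w (x - ?t) - w x\<bar> \<partial>lborel)"
        by (rule abs_integral_bounded_mult_le[OF h]) (use integrable_translate[OF w(2)] w(2) in auto)
      ultimately show "\<bar>(\<integral>x. h (a * x + b + sqrt d * z) * w x \<partial>lborel) - (\<integral>x. h (a * x + b) * w x \<partial>lborel)\<bar> \<le> C * \<tau> ?t"
        by (simp add: \<tau>_def)
    qed
    finally show ?thesis .
  qed
  have "(\<lambda>n. \<integral>z. C * \<tau> (sqrt (\<delta> n) * z / a) \<partial>\<gamma>) \<longlonglongrightarrow> (\<integral>z. 0 \<partial>\<gamma>)"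
  proof (rule integral_dominated_convergence[where w = "\<lambda>_. C * (2 * W)"])
    have "(\<lambda>n. C * \<tau> (sqrt (\<delta> n) * z / a)) \<longlonglongrightarrow> C * 0" for z
    proof (intro tendsto_mult tendsto_const)
      have "(\<lambda>n. sqrt (\<delta> n) * z / a) \<longlonglongrightarrow> sqrt 0 * z / a" by (intro tendsto_intros \<delta> a)
      then show "(\<lambda>n. \<tau> (sqrt (\<delta> n) * z / a)) \<longlonglongrightarrow> 0"
        unfolding \<tau>_def by (intro translation_L1_tendsto[OF w]) simp
    qed
    then show "AE z in \<gamma>. (\<lambda>n. C * \<tau> (sqrt (\<delta> n) * z / a)) \<longlonglongrightarrow> 0" by simp
    show "AE z in \<gamma>. norm (C * \<tau> (sqrt (\<delta> n) * z / a)) \<le> C * (2 * W)" for n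
      using \<tau>b \<tau>0 C0 by (intro AE_I2) (auto simp: abs_mult intro!: mult_left_mono)
  qed auto
  then have "(\<lambda>n. \<integral>z. C * \<tau> (sqrt (\<delta> n) * z / a) \<partial>\<gamma>) \<longlonglongrightarrow> 0" by simp
  then have "(\<lambda>n. (\<integral>x. heat (\<delta> n) h (a * x + b) * w x \<partial>lborel) - (\<integral>x. h (a * x + b) * w x \<partial>lborel)) \<longlonglongrightarrow> 0"
    by (rule Lim_null_comparison[rotated]) (use bound in \<open>intro always_eventually allI, simp\<close>)
  then show ?thesis by (rule LIM_zero_cancel)
qed

text \<open>Moving the parameter from the bounded function to the density by an affine substitution makes
  the integrands converge pointwise and in norm, hence in \<open>L\<^sup>1\<close>, by Scheffe's lemma.\<close>

lemma affine_parameter_tendsto: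
  fixes a b h :: "real \<Rightarrow> real" and v :: "nat \<Rightarrow> real"
  assumes h: "bounded_borel C h" and a: "continuous_on UNIV a" "integrable lborel a"
    and b: "continuous_on UNIV b" "integrable lborel b"
    and v: "v \<longlonglongrightarrow> v0" "\<And>n. 0 < v n" "0 < v0"
  shows "(\<lambda>n. \<integral>x. h (sqrt (v n) * x - v n / 2) * (a x / sqrt (v n) + b x / v n) \<partial>lborel)
    \<longlonglongrightarrow> (\<integral>x. h (sqrt v0 * x - v0 / 2) * (a x / sqrt v0 + b x / v0) \<partial>lborel)"
proof -
  note [measurable] = bounded_borelD(1)[OF h] borel_measurable_continuous_onI[OF a(1)] borel_measurable_continuous_onI[OF b(1)]
  define w where "w s x = a x / sqrt s + b x / s" for s x
  have wi: "integrable lborel (w s)" for s unfolding w_def[abs_def] using a(2) b(2) by simp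
  have wm [measurable]: "w s \<in> borel_measurable borel" for s unfolding w_def[abs_def] by measurable
  define F where "F s z = 1 / sqrt s * w s (sqrt s / 2 + 1 / sqrt s * z)" for s z
  have Fm [measurable]: "F s \<in> borel_measurable borel" for s unfolding F_def[abs_def] by measurable
  have Fi: "integrable lborel (F s)" if "0 < s" for s
    unfolding F_def[abs_def] using that by (intro integrable_mult_right lborel_integrable_real_affine[OF wi]) auto
  have Fn: "(\<integral>\<^sup>+z. norm (F s z) \<partial>lborel) = ennreal (\<integral>x. \<bar>w s x\<bar> \<partial>lborel)" if s: "0 < s" for s
  proof -
    have "(\<integral>\<^sup>+z. norm (F s z) \<partial>lborel) = (\<integral>\<^sup>+z. ennreal (1 / sqrt s) * ennreal (norm (w s (sqrt s / 2 + 1 / sqrt s * z))) \<partial>lborel)"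
      using s by (intro nn_integral_cong) (simp add: F_def abs_mult ennreal_mult[symmetric])
    also have "\<dots> = \<bar>1 / sqrt s\<bar> * (\<integral>\<^sup>+z. ennreal (norm (w s (sqrt s / 2 + 1 / sqrt s * z))) \<partial>lborel)"
      using s by (subst nn_integral_cmult) auto
    also have "\<dots> = (\<integral>\<^sup>+x. ennreal (norm (w s x)) \<partial>lborel)"
      using s by (intro nn_integral_real_affine[symmetric]) auto
    also have "\<dots> = ennreal (\<integral>x. \<bar>w s x\<bar> \<partial>lborel)"
      using wi[of s] by (subst nn_integral_eq_integral) auto
    finally show ?thesis .
  qed
  have G: "(\<integral>x. h (sqrt s * x - s / 2) * (a x / sqrt s + b x / s) \<partial>lborel) = (\<integral>z. h z * F s z \<partial>lborel)" if s: "0 < s" for s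
  proof -
    have e: "sqrt s * (sqrt s / 2 + 1 / sqrt s * z) - s / 2 = z" for z
      using s by (simp add: distrib_left)
    have "(\<integral>x. h (sqrt s * x - s / 2) * w s x \<partial>lborel)
      = \<bar>1 / sqrt s\<bar> *\<^sub>R (\<integral>z. h (sqrt s * (sqrt s / 2 + 1 / sqrt s * z) - s / 2) * w s (sqrt s / 2 + 1 / sqrt s * z) \<partial>lborel)"
      using s by (intro lborel_integral_real_affine) simp
    also have "\<dots> = (\<integral>z. 1 / sqrt s * (h z * w s (sqrt s / 2 + 1 / sqrt s * z)) \<partial>lborel)"
      unfolding e using s by simp
    also have "\<dots> = (\<integral>z. h z * F s z \<partial>lborel)"
      by (intro Bochner_Integration.integral_cong) (simp_all add: F_def)
    finally show ?thesis by (simp add: w_def)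
  qed
  have vs: "(\<lambda>n. sqrt (v n)) \<longlonglongrightarrow> sqrt v0" by (rule tendsto_real_sqrt[OF v(1)])
  have s0: "sqrt v0 \<noteq> 0" "v0 \<noteq> 0" using v(3) by auto
  have norm_lim: "(\<lambda>n. \<integral>x. \<bar>w (v n) x\<bar> \<partial>lborel) \<longlonglongrightarrow> (\<integral>x. \<bar>w v0 x\<bar> \<partial>lborel)"
  proof (rule LIM_zero_cancel, rule Lim_null_comparison)
    let ?c = "\<lambda>n. \<bar>1 / sqrt (v n) - 1 / sqrt v0\<bar> * (\<integral>x. \<bar>a x\<bar> \<partial>lborel) + \<bar>1 / v n - 1 / v0\<bar> * (\<integral>x. \<bar>b x\<bar> \<partial>lborel)"
    have "?c \<longlonglongrightarrow> \<bar>1 / sqrt v0 - 1 / sqrt v0\<bar> * (\<integral>x. \<bar>a x\<bar> \<partial>lborel) + \<bar>1 / v0 - 1 / v0\<bar> * (\<integral>x. \<bar>b x\<bar> \<partial>lborel)"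
      by (intro tendsto_intros vs v(1) s0)
    then show "?c \<longlonglongrightarrow> 0" by simp
    show "\<forall>\<^sub>F n in sequentially. norm ((\<integral>x. \<bar>w (v n) x\<bar> \<partial>lborel) - (\<integral>x. \<bar>w v0 x\<bar> \<partial>lborel)) \<le> ?c n"
    proof (intro always_eventually allI)
      fix n
      let ?p = "1 / sqrt (v n) - 1 / sqrt v0" and ?q = "1 / v n - 1 / v0"
      have i: "integrable lborel (\<lambda>x. \<bar>?p\<bar> * \<bar>a x\<bar> + \<bar>?q\<bar> * \<bar>b x\<bar>)" using a(2) b(2) by simp
      have iw: "integrable lborel (\<lambda>x. \<bar>w (v n) x\<bar>)" "integrable lborel (\<lambda>x. \<bar>w v0 x\<bar>)" using wi by auto
      have "norm ((\<integral>x. \<bar>w (v n) x\<bar> \<partial>lborel) - (\<integral>x. \<bar>w v0 x\<bar> \<partial>lborel)) = \<bar>\<integral>x. \<bar>w (v n) x\<bar> - \<bar>w v0 x\<bar> \<partial>lborel\<bar>"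
        using iw by simp
      also have "\<dots> \<le> (\<integral>x. \<bar>\<bar>w (v n) x\<bar> - \<bar>w v0 x\<bar>\<bar> \<partial>lborel)" by (rule integral_abs_bound)
      also have "\<dots> \<le> (\<integral>x. \<bar>?p\<bar> * \<bar>a x\<bar> + \<bar>?q\<bar> * \<bar>b x\<bar> \<partial>lborel)"
      proof (rule integral_mono[OF _ i])
        show "integrable lborel (\<lambda>x. \<bar>\<bar>w (v n) x\<bar> - \<bar>w v0 x\<bar>\<bar>)" using iw by simp
        fix x
        have "\<bar>\<bar>w (v n) x\<bar> - \<bar>w v0 x\<bar>\<bar> \<le> \<bar>w (v n) x - w v0 x\<bar>" by (rule abs_triangle_ineq3)
        also have "w (v n) x - w v0 x = ?p * a x + ?q * b x" by (simp add: w_def algebra_simps)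
        also have "\<bar>?p * a x + ?q * b x\<bar> \<le> \<bar>?p\<bar> * \<bar>a x\<bar> + \<bar>?q\<bar> * \<bar>b x\<bar>"
          unfolding abs_mult[symmetric] by (rule abs_triangle_ineq)
        finally show "\<bar>\<bar>w (v n) x\<bar> - \<bar>w v0 x\<bar>\<bar> \<le> \<bar>?p\<bar> * \<bar>a x\<bar> + \<bar>?q\<bar> * \<bar>b x\<bar>" .
      qed
      also have "\<dots> = ?c n" using a(2) b(2) by simp
      finally show "norm ((\<integral>x. \<bar>w (v n) x\<bar> \<partial>lborel) - (\<integral>x. \<bar>w v0 x\<bar> \<partial>lborel)) \<le> ?c n" .
    qed
  qed
  have pointwise: "(\<lambda>n. F (v n) z) \<longlonglongrightarrow> F v0 z" for z
  proof -
    have arg: "(\<lambda>n. sqrt (v n) / 2 + 1 / sqrt (v n) * z) \<longlonglongrightarrow> sqrt v0 / 2 + 1 / sqrt v0 * z"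
      by (intro tendsto_intros vs s0) auto
    have "isCont a y" "isCont b y" for y using a(1) b(1) by (simp_all add: continuous_on_eq_continuous_at)
    then show ?thesis unfolding F_def w_def
      by (intro tendsto_intros vs v(1) s0 isCont_tendsto_compose[OF _ arg]) auto
  qed
  have "(\<lambda>n. \<integral>z. \<bar>F (v n) z - F v0 z\<bar> \<partial>lborel) \<longlonglongrightarrow> 0"
  proof (rule L1_tendsto_of_nn_integral)
    show "integrable lborel (\<lambda>z. F (v n) z - F v0 z)" for n using Fi v by simp
    show "(\<lambda>n. \<integral>\<^sup>+z. norm (F (v n) z - F v0 z) \<partial>lborel) \<longlonglongrightarrow> 0"
    proof (rule Scheffe_lemma1)
      have "(\<lambda>n. \<integral>\<^sup>+z. norm (F (v n) z) \<partial>lborel) \<longlonglongrightarrow> (\<integral>\<^sup>+z. norm (F v0 z) \<partial>lborel)"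
        unfolding Fn[OF v(2)] Fn[OF v(3)] by (rule tendsto_ennrealI[OF norm_lim])
      then show "limsup (\<lambda>n. \<integral>\<^sup>+z. norm (F (v n) z) \<partial>lborel) \<le> (\<integral>\<^sup>+z. norm (F v0 z) \<partial>lborel)"
        using lim_imp_Limsup[OF sequentially_bot] by fastforce
    qed (use Fi v pointwise in auto)
  qed
  then have "(\<lambda>n. C * (\<integral>z. \<bar>F (v n) z - F v0 z\<bar> \<partial>lborel)) \<longlonglongrightarrow> 0" by (rule tendsto_mult_right_zero)
  then have "(\<lambda>n. (\<integral>z. h z * F (v n) z \<partial>lborel) - (\<integral>z. h z * F v0 z \<partial>lborel)) \<longlonglongrightarrow> 0"
  proof (rule Lim_null_comparison[rotated], intro always_eventually allI)
    fix n
    have i: "integrable lborel (\<lambda>z. h z * F s z)" if "0 < s" for s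
      by (rule integrable_bounded_mult[OF h _ Fi[OF that]]) simp
    have "(\<integral>z. h z * F (v n) z \<partial>lborel) - (\<integral>z. h z * F v0 z \<partial>lborel) = (\<integral>z. h z * (F (v n) z - F v0 z) \<partial>lborel)"
      using i v by (simp add: right_diff_distrib)
    moreover have "\<bar>\<integral>z. h z * (F (v n) z - F v0 z) \<partial>lborel\<bar> \<le> C * (\<integral>z. \<bar>F (v n) z - F v0 z\<bar> \<partial>lborel)"
      by (rule abs_integral_bounded_mult_le[OF h]) (use Fi v in auto)
    ultimately show "norm ((\<integral>z. h z * F (v n) z \<partial>lborel) - (\<integral>z. h z * F v0 z \<partial>lborel)) \<le> C * (\<integral>z. \<bar>F (v n) z - F v0 z\<bar> \<partial>lborel)"
      by simp
  qed
  then show ?thesis unfolding G[OF v(2)] G[OF v(3)] by (rule LIM_zero_cancel)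
qed

lemma std_normal_density_derivative:
  "(std_normal_density has_real_derivative - x * std_normal_density x) (at x)"
proof -
  have "((\<lambda>x. exp (- x\<^sup>2 / 2)) has_real_derivative exp (- x\<^sup>2 / 2) * (- x)) (at x)"
    by (auto intro!: derivative_eq_intros)
  from DERIV_cmult[OF this, of "1 / sqrt (2 * pi)"] show ?thesis
    by (simp add: std_normal_density_def[abs_def] mult_ac)
qed

lemma twice_differentiable_times_density:
  assumes m: "twice_continuously_differentiable m"
  defines "u \<equiv> \<lambda>x. m x * std_normal_density x"
  shows "(u has_real_derivative deriv u x) (at x)"
    and "(deriv u has_real_derivative deriv (deriv u) x) (at x)"
    and "continuous_on UNIV (deriv (deriv u))"
proof -
  have m1: "(m has_real_derivative deriv m x) (at x)" for x
  proof -
    have "m differentiable at x" using m by (simp add: twice_continuously_differentiable_def differentiable_on_def)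
    then show ?thesis by (simp add: DERIV_deriv_iff_real_differentiable)
  qed
  obtain D where D: "\<And>x. (deriv m has_vector_derivative D x) (at x)" "continuous_on UNIV D"
    using m by (auto simp: twice_continuously_differentiable_def C1_differentiable_on_def)
  have m2: "(deriv m has_real_derivative D x) (at x)" for x
    using D(1)[of x] by (simp add: has_real_derivative_iff_has_vector_derivative)
  define u1 where "u1 x = (deriv m x - x * m x) * std_normal_density x" for x
  define u2 where "u2 x = (D x - 2 * x * deriv m x + (x\<^sup>2 - 1) * m x) * std_normal_density x" for x
  have d1: "(u has_real_derivative u1 x) (at x)" for x
    unfolding u_def u1_def
    by (rule DERIV_cong[OF DERIV_mult[OF m1 std_normal_density_derivative]]) (simp add: algebra_simps)
  have d2: "(u1 has_real_derivative u2 x) (at x)" for x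
    unfolding u1_def[abs_def] u2_def
    by (rule DERIV_cong[OF DERIV_mult[OF DERIV_diff[OF m2 DERIV_mult[OF DERIV_ident m1]] std_normal_density_derivative]])
       (simp add: algebra_simps power2_eq_square)
  have e1: "deriv u = u1" using d1 by (auto intro: DERIV_imp_deriv)
  have e2: "deriv (deriv u) = u2" unfolding e1 using d2 by (auto intro: DERIV_imp_deriv)
  show "(u has_real_derivative deriv u x) (at x)" unfolding e1 by (rule d1)
  show "(deriv u has_real_derivative deriv (deriv u) x) (at x)" unfolding e2 unfolding e1 by (rule d2)
  have c: "continuous_on UNIV m" "continuous_on UNIV (deriv m)" "continuous_on UNIV std_normal_density"
    using m1 m2 std_normal_density_derivative
    by (auto intro!: continuous_at_imp_continuous_on DERIV_isCont)
  show "continuous_on UNIV (deriv (deriv u))"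
    unfolding e2 u2_def[abs_def] by (intro continuous_intros c D(2))
qed

text \<open>Two integrations by parts at once: the difference of the integrands is the derivative of a function
  that vanishes at both ends.\<close>

lemma integral_by_parts_corrector:
  fixes u k k1 k2 :: "real \<Rightarrow> real"
  assumes u: "\<And>x. (u has_real_derivative deriv u x) (at x)" "\<And>x. (deriv u has_real_derivative deriv (deriv u) x) (at x)"
      "continuous_on UNIV (deriv (deriv u))" "integrable lborel u"
      "(u \<longlongrightarrow> 0) at_infinity" "(deriv u \<longlongrightarrow> 0) at_infinity"
    and v: "0 < v" and w: "integrable lborel (\<lambda>x. deriv u x / sqrt v + deriv (deriv u) x / v)"
    and k: "\<And>x. (k has_real_derivative k1 x) (at x)" "\<And>x. (k1 has_real_derivative k2 x) (at x)" "continuous_on UNIV k2"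
      "bounded_borel K k" "bounded_borel K k1" "bounded_borel K k2"
  shows "(\<integral>x. u x * (k2 (sqrt v * x - v / 2) - k1 (sqrt v * x - v / 2)) \<partial>lborel)
    = (\<integral>x. k (sqrt v * x - v / 2) * (deriv u x / sqrt v + deriv (deriv u) x / v) \<partial>lborel)"
proof -
  define l where "l x = sqrt v * x - v / 2" for x
  define W where "W x = deriv u x / sqrt v + deriv (deriv u) x / v" for x
  have sv: "sqrt v \<noteq> 0" "sqrt v * sqrt v = v" using v by auto
  have lm [measurable]: "l \<in> borel_measurable borel" unfolding l_def[abs_def] by measurable
  have ld: "(l has_real_derivative sqrt v) (at x)" for x
    unfolding l_def[abs_def] by (auto intro!: derivative_eq_intros)
  have kl: "((\<lambda>x. k (l x)) has_real_derivative sqrt v * k1 (l x)) (at x)" for x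
    using DERIV_chain2[OF k(1) ld] by (simp add: mult.commute)
  have k1l: "((\<lambda>x. k1 (l x)) has_real_derivative sqrt v * k2 (l x)) (at x)" for x
    using DERIV_chain2[OF k(2) ld] by (simp add: mult.commute)
  define P where "P x = u x * k1 (l x) / sqrt v - deriv u x * k (l x) / v - u x * k (l x) / sqrt v" for x
  define p where "p x = u x * (k2 (l x) - k1 (l x)) - k (l x) * W x" for x
  have alg: "(a1 * q1 + r * q2 * a0) / r - (a2 * q0 + r * q1 * a1) / (r * r) - (a1 * q0 + r * q1 * a0) / r
      = a0 * (q2 - q1) - q0 * (a1 / r + a2 / (r * r))" if "r \<noteq> 0" for a0 a1 a2 q0 q1 q2 r :: real
    using that by (simp add: field_simps)
  have Pd: "(P has_real_derivative p x) (at x)" for x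
    unfolding P_def[abs_def] p_def W_def
    by (rule DERIV_cong[OF DERIV_diff[OF DERIV_diff[OF DERIV_cdivide[OF DERIV_mult[OF u(1) k1l]]
            DERIV_cdivide[OF DERIV_mult[OF u(2) kl]]] DERIV_cdivide[OF DERIV_mult[OF u(1) kl]]]
          alg[OF sv(1), unfolded sv(2)]])
  have cont: "continuous_on UNIV u" "continuous_on UNIV (deriv u)" "continuous_on UNIV k" "continuous_on UNIV k1" "continuous_on UNIV l"
    using u(1,2) k(1,2) ld by (auto intro!: continuous_at_imp_continuous_on DERIV_isCont)
  have pc: "continuous_on UNIV p"
    unfolding p_def[abs_def] W_def using sv v
    by (intro continuous_intros cont u(3) continuous_on_compose2[OF k(3) cont(5)]
        continuous_on_compose2[OF cont(3) cont(5)] continuous_on_compose2[OF cont(4) cont(5)]) auto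
  have wm: "integrable lborel W" using w by (simp add: W_def[abs_def])
  have i1: "integrable lborel (\<lambda>x. k2 (l x) * u x)" "integrable lborel (\<lambda>x. k1 (l x) * u x)"
    using integrable_bounded_mult[OF k(6) _ u(4)] integrable_bounded_mult[OF k(5) _ u(4)] by auto
  have i2: "integrable lborel (\<lambda>x. k (l x) * W x)" using integrable_bounded_mult[OF k(4) _ wm] by auto
  have i3: "integrable lborel (\<lambda>x. u x * (k2 (l x) - k1 (l x)))"
    using Bochner_Integration.integrable_diff[OF i1] by (simp add: algebra_simps)
  have pint: "integrable lborel p" unfolding p_def[abs_def] using i3 i2 by (rule Bochner_Integration.integrable_diff)
  have zero: "((\<lambda>x. f x * g (l x)) \<longlongrightarrow> 0) F" if "(f \<longlongrightarrow> 0) F" "bounded_borel K g" for f g :: "real \<Rightarrow> real" and F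
  proof (rule Lim_null_comparison)
    show "((\<lambda>x. K * \<bar>f x\<bar>) \<longlongrightarrow> 0) F" using that(1) by (intro tendsto_mult_right_zero tendsto_rabs_zero)
    show "\<forall>\<^sub>F x in F. norm (f x * g (l x)) \<le> K * \<bar>f x\<bar>"
      using bounded_borelD(2)[OF that(2)] by (intro always_eventually allI) (simp add: abs_mult mult.commute[of K] mult_left_mono)
  qed
  have Plim: "(P \<longlongrightarrow> 0) F" if "F \<le> at_infinity" for F
  proof -
    have a: "(u \<longlongrightarrow> 0) F" "(deriv u \<longlongrightarrow> 0) F" using u(5,6) that by (auto intro: tendsto_mono)
    have "(P \<longlongrightarrow> 0 / sqrt v - 0 / v - 0 / sqrt v) F"
      unfolding P_def[abs_def] using sv v by (intro tendsto_intros zero a k) auto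
    then show ?thesis by simp
  qed
  have "(LBINT x=-\<infinity>..\<infinity>. p x) = 0 - 0"
  proof (rule interval_integral_FTC_integrable)
    show "(P has_vector_derivative p x) (at x)" for x
      using Pd[of x] by (simp add: has_real_derivative_iff_has_vector_derivative)
    show "isCont p x" for x using pc by (simp add: continuous_on_eq_continuous_at)
    show "set_integrable lborel (einterval (-\<infinity>) \<infinity>) p" using pint by (simp add: set_integrable_def)
    show "((P \<circ> real_of_ereal) \<longlongrightarrow> 0) (at_right (-\<infinity>))"
      unfolding ereal_tendsto_simps by (rule Plim) (rule at_bot_le_at_infinity)
    show "((P \<circ> real_of_ereal) \<longlongrightarrow> 0) (at_left \<infinity>)"
      unfolding ereal_tendsto_simps by (rule Plim) (rule at_top_le_at_infinity)
  qed simp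
  then have "(\<integral>x. p x \<partial>lborel) = 0"
    by (simp add: interval_lebesgue_integral_def set_lebesgue_integral_def)
  then have "(\<integral>x. u x * (k2 (l x) - k1 (l x)) \<partial>lborel) = (\<integral>x. k (l x) * W x \<partial>lborel)"
    unfolding p_def using i2 i3 by simp
  then show ?thesis by (simp add: l_def W_def)
qed

section \<open>The asymptotic expansion\<close>

lemma corrector_lipschitz:
  assumes h: "bounded_borel C h" and \<delta>: "0 < \<delta>"
  shows "\<bar>corrector \<delta> h x - corrector \<delta> h y\<bar> \<le> C * deriv_bound \<delta> * \<bar>x - y\<bar>"
proof -
  have "\<bar>heat_deriv j \<delta> h x - heat_deriv j \<delta> h y\<bar> \<le> C * deriv_bound \<delta> * \<bar>x - y\<bar>" if "j < 4" for j
    using heat_deriv_taylor[OF h \<delta> order_refl, of j 0 y "x - y"] that by simp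
  then show ?thesis unfolding corrector_def by (intro abs_half_diff_le) auto
qed

lemma corrected_density_eq:
  fixes m :: "real \<Rightarrow> real"
  defines "u \<equiv> \<lambda>y. m y * std_normal_density y"
  shows "corrected_density m s \<epsilon> x = std_normal_density x + \<epsilon> / 2 * (deriv u x / sqrt s + deriv (deriv u) x / s)"
  by (simp add: corrected_density_def u_def field_simps)

context martingale_limit
begin

text \<open>At time \<open>\<delta> > 0\<close> the corrector is smooth, so the law of \<open>(X, Y)\<close> determines the limit of its
  expectation; integrating by parts then moves both derivatives from the test function to the density.\<close>

lemma corrector_limit:
  assumes m: "cond_exp_version N Y X m" "twice_continuously_differentiable m"
    and u0: "((\<lambda>x. m x * std_normal_density x) \<longlongrightarrow> 0) at_infinity"
      "(deriv (\<lambda>x. m x * std_normal_density x) \<longlongrightarrow> 0) at_infinity"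
    and w: "integrable lborel (\<lambda>x. deriv (\<lambda>x. m x * std_normal_density x) x / sqrt v0
        + deriv (deriv (\<lambda>x. m x * std_normal_density x)) x / v0)"
    and h: "bounded_borel C h" and \<delta>: "0 < \<delta>"
  shows "((\<lambda>\<epsilon>. (\<integral>\<omega>. (I \<epsilon> \<omega> - v \<epsilon>) * corrector \<delta> h (R \<epsilon> \<omega> - v \<epsilon> / 2) * indicator {\<omega> \<in> space M. I \<epsilon> \<omega> < v \<epsilon> + \<kappa>} \<omega> \<partial>M) / \<epsilon>)
    \<longlongrightarrow> 1 / 2 * (\<integral>x. heat \<delta> h (sqrt v0 * x + - v0 / 2) * (deriv (\<lambda>x. m x * std_normal_density x) x / sqrt v0
        + deriv (deriv (\<lambda>x. m x * std_normal_density x)) x / v0) \<partial>lborel)) (at_right 0)"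
proof -
  let ?u = "\<lambda>x. m x * std_normal_density x"
  let ?G = "corrector \<delta> h"
  have G: "bounded_borel (C * deriv_bound \<delta>) ?G" by (rule bounded_borel_corrector[OF h \<delta> order_refl])
  note [measurable] = bounded_borelD(1)[OF G]
  have mm [measurable]: "m \<in> borel_measurable borel" using m(1) by (simp add: cond_exp_version_def)
  note td = twice_differentiable_times_density[OF m(2)]
  have G': "bounded_borel (C * deriv_bound \<delta>) (\<lambda>x. ?G (sqrt v0 * x - v0 / 2))"
    using bounded_borelD(2)[OF G] by (auto simp: bounded_borel_def)
  have reg: "integrable \<gamma> m" "(\<integral>\<omega>. Y \<omega> * ?G (sqrt v0 * X \<omega> - v0 / 2) \<partial>N) = (\<integral>x. m x * ?G (sqrt v0 * x - v0 / 2) \<partial>\<gamma>)"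
    using regression_integral[OF m(1) G'] by auto
  have ui: "integrable lborel ?u" using reg(1) by (subst (asm) integrable_gauss_iff) (auto simp: mult.commute)
  have bd: "bounded_borel (C * deriv_bound \<delta>) (heat_deriv j \<delta> h)" if "j \<le> 4" for j
    by (rule heat_deriv_bound[OF h \<delta> order_refl that])
  have "(\<integral>x. m x * ?G (sqrt v0 * x - v0 / 2) \<partial>\<gamma>) = (\<integral>x. std_normal_density x * (m x * ?G (sqrt v0 * x - v0 / 2)) \<partial>lborel)"
    by (rule integral_gauss_eq) measurable
  also have "\<dots> = 1 / 2 * (\<integral>x. ?u x * (heat_deriv 2 \<delta> h (sqrt v0 * x - v0 / 2) - heat_deriv 1 \<delta> h (sqrt v0 * x - v0 / 2)) \<partial>lborel)"
    unfolding integral_mult_right_zero[symmetric]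
    by (intro Bochner_Integration.integral_cong) (simp_all add: corrector_def)
  also have "(\<integral>x. ?u x * (heat_deriv 2 \<delta> h (sqrt v0 * x - v0 / 2) - heat_deriv 1 \<delta> h (sqrt v0 * x - v0 / 2)) \<partial>lborel)
    = (\<integral>x. heat_deriv 0 \<delta> h (sqrt v0 * x - v0 / 2) * (deriv ?u x / sqrt v0 + deriv (deriv ?u) x / v0) \<partial>lborel)"
  proof (rule integral_by_parts_corrector[OF td ui u0 v0 w _ _ _ bd bd bd])
    show "(heat_deriv 0 \<delta> h has_real_derivative heat_deriv 1 \<delta> h x) (at x)" for x
      using heat_deriv_has_derivative[OF h \<delta>, of 0] by simp
    show "(heat_deriv 1 \<delta> h has_real_derivative heat_deriv 2 \<delta> h x) (at x)" for x
      using heat_deriv_has_derivative[OF h \<delta>, of 1] by (simp add: numeral_2_eq_2)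
    have "isCont (heat_deriv 2 \<delta> h) x" for x
      by (rule DERIV_isCont[OF heat_deriv_has_derivative[OF h \<delta>]]) simp
    then show "continuous_on UNIV (heat_deriv 2 \<delta> h)" by (simp add: continuous_at_imp_continuous_on)
  qed auto
  finally have lim_eq: "(\<integral>\<omega>. Y \<omega> * ?G (sqrt v0 * X \<omega> - v0 / 2) \<partial>N)
    = 1 / 2 * (\<integral>x. heat \<delta> h (sqrt v0 * x + - v0 / 2) * (deriv ?u x / sqrt v0 + deriv (deriv ?u) x / v0) \<partial>lborel)"
    unfolding reg(2) heat_deriv_0[OF h \<delta>] by simp
  have "((\<lambda>\<epsilon>. \<integral>\<omega>. Ye \<epsilon> \<omega> * ?G (R \<epsilon> \<omega> - v \<epsilon> / 2) \<partial>M) \<longlongrightarrow> (\<integral>\<omega>. Y \<omega> * ?G (sqrt v0 * X \<omega> - v0 / 2) \<partial>N)) (at_right 0)"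
    by (rule Ye_test_limit[OF G corrector_lipschitz[OF h \<delta>]])
  from tendsto_add[OF correction_off_event_tendsto[OF G] this]
  show ?thesis unfolding lim_eq by simp
qed

text \<open>The order of limits matters: for fixed \<open>\<delta>\<close> first \<open>\<epsilon>\<close> tends to \<open>0\<close>, which leaves an error proportional to
  \<open>\<delta>\<close> and the difference between \<open>P\<^sub>\<delta> h\<close> and \<open>h\<close> under the integral.\<close>

lemma martingale_expansion:
  assumes m: "cond_exp_version N Y X m" "twice_continuously_differentiable m"
    and u0: "((\<lambda>x. m x * std_normal_density x) \<longlongrightarrow> 0) at_infinity"
      "(deriv (\<lambda>x. m x * std_normal_density x) \<longlongrightarrow> 0) at_infinity"
    and cd: "\<And>\<epsilon>. 0 < \<epsilon> \<Longrightarrow> integrable lborel (corrected_density m (v \<epsilon>) \<epsilon>)"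
    and h: "bounded_borel C h"
  shows "(\<lambda>\<epsilon>. (\<integral>\<omega>. h (R \<epsilon> \<omega> - I \<epsilon> \<omega> / 2) \<partial>M)
      - (\<integral>x. h (sqrt (v \<epsilon>) * x - v \<epsilon> / 2) * corrected_density m (v \<epsilon>) \<epsilon> x \<partial>lborel)) \<in> o[at_right 0](\<lambda>\<epsilon>. \<epsilon>)"
proof -
  note [measurable] = bounded_borelD(1)[OF h]
  have C0: "0 \<le> C" by (rule bounded_borelD(3)[OF h])
  let ?u = "\<lambda>x. m x * std_normal_density x"
  define a where "a = deriv ?u"
  define b where "b = deriv a"
  note td = twice_differentiable_times_density[OF m(2), folded a_def, folded b_def]
  have ac: "continuous_on UNIV a" using td(2) by (auto intro!: continuous_at_imp_continuous_on DERIV_isCont)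
  have bc: "continuous_on UNIV b" by (rule td(3))
  define w where "w s x = a x / sqrt s + b x / s" for s x
  have cde: "corrected_density m s \<epsilon> x = std_normal_density x + \<epsilon> / 2 * w s x" for s \<epsilon> x
    unfolding corrected_density_eq w_def a_def b_def ..
  have wi: "integrable lborel (w (v \<epsilon>))" if \<epsilon>: "0 < \<epsilon>" for \<epsilon>
  proof -
    have "integrable lborel (\<lambda>x. 2 / \<epsilon> * (corrected_density m (v \<epsilon>) \<epsilon> x - std_normal_density x))"
      using cd[OF \<epsilon>] by (intro integrable_mult_right Bochner_Integration.integrable_diff) auto
    then show ?thesis using \<epsilon> by (simp add: cde)
  qed
  define J where "J s = (\<integral>x. h (sqrt s * x - s / 2) * w s x \<partial>lborel)" for s
  \<comment> \<open>If \<open>v\<close> takes two values, integrability for both of them separates the two derivatives.\<close>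
  have J: "integrable lborel (w v0) \<and> ((\<lambda>\<epsilon>. J (v \<epsilon>)) \<longlongrightarrow> J v0) (at_right 0)"
  proof (cases "\<exists>\<epsilon>1>0. \<exists>\<epsilon>2>0. v \<epsilon>1 \<noteq> v \<epsilon>2")
    case True
    then obtain \<epsilon>1 \<epsilon>2 where e: "0 < \<epsilon>1" "0 < \<epsilon>2" "v \<epsilon>1 \<noteq> v \<epsilon>2" by blast
    have sc: "integrable lborel (\<lambda>x. b x + sqrt (v \<epsilon>) * a x)" if \<epsilon>: "0 < \<epsilon>" for \<epsilon>
    proof -
      have sq: "v \<epsilon> / sqrt (v \<epsilon>) = sqrt (v \<epsilon>)" using v_pos[OF \<epsilon>] by (simp add: real_div_sqrt)
      have "v \<epsilon> * w (v \<epsilon>) x = b x + v \<epsilon> / sqrt (v \<epsilon>) * a x" for x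
        using v_pos[OF \<epsilon>] by (simp add: w_def distrib_left)
      then have "(\<lambda>x. v \<epsilon> * w (v \<epsilon>) x) = (\<lambda>x. b x + sqrt (v \<epsilon>) * a x)" unfolding sq by (rule ext)
      moreover have "integrable lborel (\<lambda>x. v \<epsilon> * w (v \<epsilon>) x)" using wi[OF \<epsilon>] by (rule integrable_mult_right)
      ultimately show ?thesis by simp
    qed
    let ?r = "sqrt (v \<epsilon>1) - sqrt (v \<epsilon>2)"
    have r: "?r \<noteq> 0" using e(3) by simp
    have "integrable lborel (\<lambda>x. 1 / ?r * ((b x + sqrt (v \<epsilon>1) * a x) - (b x + sqrt (v \<epsilon>2) * a x)))"
      by (intro integrable_mult_right Bochner_Integration.integrable_diff sc e)
    also have "(\<lambda>x. 1 / ?r * ((b x + sqrt (v \<epsilon>1) * a x) - (b x + sqrt (v \<epsilon>2) * a x))) = a"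
    proof
      fix x
      have "(b x + sqrt (v \<epsilon>1) * a x) - (b x + sqrt (v \<epsilon>2) * a x) = ?r * a x" by (simp add: algebra_simps)
      then show "1 / ?r * ((b x + sqrt (v \<epsilon>1) * a x) - (b x + sqrt (v \<epsilon>2) * a x)) = a x" using r by simp
    qed
    finally have ai: "integrable lborel a" .
    have "integrable lborel (\<lambda>x. (b x + sqrt (v \<epsilon>1) * a x) - sqrt (v \<epsilon>1) * a x)"
      using sc[OF e(1)] ai by (intro Bochner_Integration.integrable_diff) auto
    then have bi: "integrable lborel b" by simp
    have "integrable lborel (w v0)" unfolding w_def[abs_def] using ai bi by simp
    moreover have "((\<lambda>\<epsilon>. J (v \<epsilon>)) \<longlongrightarrow> J v0) (at_right 0)"
      unfolding tendsto_at_iff_sequentially comp_def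
    proof (intro allI impI)
      fix X :: "nat \<Rightarrow> real" assume X: "\<forall>i. X i \<in> {0<..} - {0}" "X \<longlonglongrightarrow> 0"
      have "\<forall>\<^sub>F i in sequentially. X i \<in> {0<..} \<and> X i \<noteq> 0" using X(1) by (intro always_eventually) blast
      then have "filterlim X (at_right 0) sequentially" using X(2) by (simp add: filterlim_at)
      from filterlim_compose[OF v_lim this] have "(\<lambda>i. v (X i)) \<longlonglongrightarrow> v0" .
      from affine_parameter_tendsto[OF h ac ai bc bi this _ v0] v_pos X(1)
      show "(\<lambda>i. J (v (X i))) \<longlonglongrightarrow> J v0" unfolding J_def w_def by simp
    qed
    ultimately show ?thesis by simp
  next
    case False
    then have vc: "v \<epsilon> = v 1" if "0 < \<epsilon>" for \<epsilon> using that zero_less_one by blast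
    have "\<forall>\<^sub>F \<epsilon> in at_right 0. v \<epsilon> = v 1" using eventually_pos by eventually_elim (rule vc)
    then have "(v \<longlongrightarrow> v 1) (at_right 0)" by (rule tendsto_eventually)
    then have "v 1 = v0" using v_lim tendsto_unique[of "at_right (0 :: real)"] by simp
    then have v0c: "v \<epsilon> = v0" if "0 < \<epsilon>" for \<epsilon> using vc[OF that] by simp
    have "\<forall>\<^sub>F \<epsilon> in at_right 0. J (v \<epsilon>) = J v0" using eventually_pos by eventually_elim (simp add: v0c)
    then show ?thesis using wi[of 1] v0c[of 1] by (auto intro: tendsto_eventually)
  qed
  have w0: "integrable lborel (w v0)" and Jlim: "((\<lambda>\<epsilon>. J (v \<epsilon>)) \<longlongrightarrow> J v0) (at_right 0)" using J by auto
  have w0c: "continuous_on UNIV (w v0)"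
    unfolding w_def[abs_def] using v0 by (intro continuous_intros ac bc) auto
  obtain K where K: "0 \<le> K" "\<And>\<epsilon>. 0 < \<epsilon> \<Longrightarrow> (\<integral>\<omega>. \<bar>Ye \<epsilon> \<omega>\<bar> \<partial>M) \<le> K" using Ye_bound by blast
  define \<Delta> where "\<Delta> \<epsilon> = (\<integral>\<omega>. h (R \<epsilon> \<omega> - I \<epsilon> \<omega> / 2) \<partial>M)
      - (\<integral>x. h (sqrt (v \<epsilon>) * x - v \<epsilon> / 2) * corrected_density m (v \<epsilon>) \<epsilon> x \<partial>lborel)" for \<epsilon>
  define E where "E \<epsilon> = (\<integral>\<omega>. h (R \<epsilon> \<omega> - I \<epsilon> \<omega> / 2) \<partial>M) - heat (v \<epsilon>) h (- v \<epsilon> / 2)" for \<epsilon>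
  have \<Delta>_eq: "\<Delta> \<epsilon> = E \<epsilon> - \<epsilon> / 2 * J (v \<epsilon>)" if \<epsilon>: "0 < \<epsilon>" for \<epsilon>
  proof -
    have i1: "integrable lborel (\<lambda>x. h (sqrt (v \<epsilon>) * x - v \<epsilon> / 2) * std_normal_density x)"
      by (rule integrable_bounded_mult[OF h]) auto
    have i2: "integrable lborel (\<lambda>x. h (sqrt (v \<epsilon>) * x - v \<epsilon> / 2) * w (v \<epsilon>) x)"
      by (rule integrable_bounded_mult[OF h _ wi[OF \<epsilon>]]) auto
    have "(\<integral>x. h (sqrt (v \<epsilon>) * x - v \<epsilon> / 2) * corrected_density m (v \<epsilon>) \<epsilon> x \<partial>lborel)
      = (\<integral>x. h (sqrt (v \<epsilon>) * x - v \<epsilon> / 2) * std_normal_density x + \<epsilon> / 2 * (h (sqrt (v \<epsilon>) * x - v \<epsilon> / 2) * w (v \<epsilon>) x) \<partial>lborel)"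
      unfolding cde by (intro Bochner_Integration.integral_cong) (simp_all add: algebra_simps)
    also have "\<dots> = (\<integral>x. h (sqrt (v \<epsilon>) * x - v \<epsilon> / 2) * std_normal_density x \<partial>lborel) + \<epsilon> / 2 * J (v \<epsilon>)"
      using i1 i2 by (simp add: J_def)
    also have "(\<integral>x. h (sqrt (v \<epsilon>) * x - v \<epsilon> / 2) * std_normal_density x \<partial>lborel) = heat (v \<epsilon>) h (- v \<epsilon> / 2)"
      unfolding heat_def by (subst integral_gauss_eq) (auto simp: algebra_simps)
    finally show ?thesis by (simp add: \<Delta>_def E_def)
  qed
  have "((\<lambda>\<epsilon>. \<Delta> \<epsilon> / \<epsilon>) \<longlongrightarrow> 0) (at_right 0)"
  proof (rule tendstoI)
    fix e :: real assume e: "0 < e"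
    let ?\<delta> = "\<lambda>n. 1 / real (Suc n)"
    let ?H = "\<lambda>n. \<integral>x. heat (?\<delta> n) h (sqrt v0 * x + - v0 / 2) * w v0 x \<partial>lborel"
    have \<delta>0: "?\<delta> \<longlonglongrightarrow> 0" by (rule LIMSEQ_Suc[OF lim_1_over_n])
    have "?H \<longlonglongrightarrow> (\<integral>x. h (sqrt v0 * x + - v0 / 2) * w v0 x \<partial>lborel)"
      by (rule heat_mollification_tendsto[OF h w0c w0 _ \<delta>0]) (use v0 in simp)
    then have "?H \<longlonglongrightarrow> J v0" by (simp add: J_def)
    from tendstoD[OF this, of "e / 4"] e have ev1: "\<forall>\<^sub>F n in sequentially. dist (?H n) (J v0) < e / 4" by simp
    have "(\<lambda>n. C * (deriv_bound \<kappa> * (?\<delta> n * K))) \<longlonglongrightarrow> C * (deriv_bound \<kappa> * (0 * K))"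
      by (intro tendsto_intros \<delta>0)
    then have "(\<lambda>n. C * (deriv_bound \<kappa> * (?\<delta> n * K))) \<longlonglongrightarrow> 0" by simp
    from order_tendstoD(2)[OF this, of "e / 4"] e have ev2: "\<forall>\<^sub>F n in sequentially. C * (deriv_bound \<kappa> * (?\<delta> n * K)) < e / 4" by simp
    from eventually_conj[OF ev1 ev2] obtain n where n: "dist (?H n) (J v0) < e / 4" "C * (deriv_bound \<kappa> * (?\<delta> n * K)) < e / 4"
      by (auto simp: eventually_sequentially)
    define \<delta> where "\<delta> = ?\<delta> n"
    have \<delta>: "0 < \<delta>" by (simp add: \<delta>_def)
    define \<eta> where "\<eta> = e / (4 * (C + 1))"
    have \<eta>: "0 < \<eta>" "C * \<eta> \<le> e / 4" using e C0 by (auto simp: \<eta>_def field_simps)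
    define q where "q \<epsilon> = (\<integral>\<omega>. (I \<epsilon> \<omega> - v \<epsilon>) * corrector \<delta> h (R \<epsilon> \<omega> - v \<epsilon> / 2) * indicator {\<omega> \<in> space M. I \<epsilon> \<omega> < v \<epsilon> + \<kappa>} \<omega> \<partial>M)" for \<epsilon>
    have "((\<lambda>\<epsilon>. q \<epsilon> / \<epsilon>) \<longlongrightarrow> 1 / 2 * ?H n) (at_right 0)"
    proof -
      have "integrable lborel (\<lambda>x. a x / sqrt v0 + b x / v0)" using w0 by (simp only: w_def[abs_def])
      from corrector_limit[OF m u0 this[unfolded b_def a_def] h \<delta>]
      show ?thesis unfolding q_def w_def \<delta>_def a_def b_def .
    qed
    from tendsto_diff[OF this tendsto_mult[OF tendsto_const[of "1 / 2"] Jlim]]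
    have lim: "((\<lambda>\<epsilon>. q \<epsilon> / \<epsilon> - 1 / 2 * J (v \<epsilon>)) \<longlongrightarrow> 1 / 2 * ?H n - 1 / 2 * J v0) (at_right 0)" .
    have "0 < e / 4" using e by simp
    from tendstoD[OF lim this]
    have ev3: "\<forall>\<^sub>F \<epsilon> in at_right 0. dist (q \<epsilon> / \<epsilon> - 1 / 2 * J (v \<epsilon>)) (1 / 2 * ?H n - 1 / 2 * J v0) < e / 4" .
    have ev4: "\<forall>\<^sub>F \<epsilon> in at_right 0. remainder_bound M (I \<epsilon>) \<kappa> (v \<epsilon>) \<delta> / \<epsilon> \<le> deriv_bound \<kappa> * (\<delta> * K) + \<eta>"
      by (rule remainder_small[OF \<delta> \<eta>(1)]) (rule K(2))
    show "\<forall>\<^sub>F \<epsilon> in at_right 0. dist (\<Delta> \<epsilon> / \<epsilon>) 0 < e"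
      using ev3 ev4 expand eventually_pos
    proof eventually_elim
      case (elim \<epsilon>)
      have "\<bar>E \<epsilon> - q \<epsilon>\<bar> \<le> C * remainder_bound M (I \<epsilon>) \<kappa> (v \<epsilon>) \<delta>"
        unfolding E_def q_def by (rule elim(3)[rule_format, OF \<delta> h])
      then have "\<bar>E \<epsilon> - q \<epsilon>\<bar> / \<epsilon> \<le> C * remainder_bound M (I \<epsilon>) \<kappa> (v \<epsilon>) \<delta> / \<epsilon>"
        using elim(4) by (intro divide_right_mono) auto
      also have "\<dots> = C * (remainder_bound M (I \<epsilon>) \<kappa> (v \<epsilon>) \<delta> / \<epsilon>)" by simp
      also have "\<dots> \<le> C * (deriv_bound \<kappa> * (\<delta> * K) + \<eta>)" by (rule mult_left_mono[OF elim(2) C0])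
      also have "\<dots> = C * (deriv_bound \<kappa> * (\<delta> * K)) + C * \<eta>" by (simp add: distrib_left)
      finally have "\<bar>E \<epsilon> - q \<epsilon>\<bar> / \<epsilon> < e / 2" using n(2)[folded \<delta>_def] \<eta>(2) by linarith
      then have 1: "\<bar>(E \<epsilon> - q \<epsilon>) / \<epsilon>\<bar> < e / 2" using elim(4) by (simp add: abs_divide)
      have 2: "\<Delta> \<epsilon> / \<epsilon> = (E \<epsilon> - q \<epsilon>) / \<epsilon> + (q \<epsilon> / \<epsilon> - 1 / 2 * J (v \<epsilon>))"
        using elim(4) by (simp add: \<Delta>_eq[OF elim(4)] diff_divide_distrib)
      have 3: "\<bar>q \<epsilon> / \<epsilon> - 1 / 2 * J (v \<epsilon>)\<bar> < e / 2"
        using elim(1) n(1) unfolding dist_real_def by linarith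
      show ?case unfolding dist_real_def 2 using 1 3 by linarith
    qed
  qed
  moreover have "\<forall>\<^sub>F \<epsilon> in at_right (0 :: real). \<epsilon> \<noteq> 0" using eventually_pos by eventually_elim simp
  ultimately have "\<Delta> \<in> o[at_right 0](\<lambda>\<epsilon>. \<epsilon>)" by (intro smalloI_tendsto)
  then show ?thesis by (simp add: \<Delta>_def[abs_def])
qed

end

theorem theorem1:
  fixes M :: "'a measure" and F G :: "real \<Rightarrow> 'a measure"
    and W W' B :: "real \<Rightarrow> 'a \<Rightarrow> real"
    and \<rho> T S0 v0 :: real
    and V S R :: "real \<Rightarrow> real \<Rightarrow> 'a \<Rightarrow> real"
    and v :: "real \<Rightarrow> real"
    and Xe Ye :: "real \<Rightarrow> 'a \<Rightarrow> real"
    and N :: "'b measure" and X Y :: "'b \<Rightarrow> real" and m :: "real \<Rightarrow> real"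
    and f :: "real \<Rightarrow> real"
  assumes "prob_space M"
    and "filtration_on M F"
    and "brownian_motion M F (\<lambda>t \<omega>. (W t \<omega>, W' t \<omega>))"
    and "filtration_on M G"
    and "\<And>t. 0 \<le> t \<Longrightarrow> sets (G t) \<subseteq> sets (F t)"
    and "adapted G W"
    and "process_indep_of_filtration M W' G"
    and "-1 < \<rho>" "\<rho> < 1" and "0 < T" and "0 < S0"
    and B: "\<And>t \<omega>. B t \<omega> = \<rho> * W t \<omega> + sqrt (1 - \<rho>\<^sup>2) * W' t \<omega>"
    and "\<And>\<epsilon>. 0 < \<epsilon> \<Longrightarrow> adapted G (V \<epsilon>)"
    and "\<And>\<epsilon> t \<omega>. 0 < \<epsilon> \<Longrightarrow> 0 \<le> t \<Longrightarrow> \<omega> \<in> space M \<Longrightarrow> 0 \<le> V \<epsilon> t \<omega>"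
    and "\<And>\<epsilon> \<omega>. 0 < \<epsilon> \<Longrightarrow> \<omega> \<in> space M \<Longrightarrow> cadlag (\<lambda>t. V \<epsilon> t \<omega>)"
    and R: "\<And>\<epsilon> t. 0 < \<epsilon> \<Longrightarrow> t \<in> {0..T} \<Longrightarrow> has_ito_integral M F B (\<lambda>s \<omega>. sqrt (V \<epsilon> s \<omega>)) t (R \<epsilon> t)"
    and "\<And>\<epsilon> t. 0 < \<epsilon> \<Longrightarrow> t \<in> {0..T} \<Longrightarrow> S \<epsilon> t \<in> borel_measurable M"
    and S: "\<And>\<epsilon> t. 0 < \<epsilon> \<Longrightarrow> t \<in> {0..T} \<Longrightarrow>
          AE \<omega> in M. S \<epsilon> t \<omega> = S0 * exp (R \<epsilon> t \<omega> - 1 / 2 * (LBINT s:{0..t}. V \<epsilon> s \<omega>))"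
    and "\<And>\<epsilon>. 0 < \<epsilon> \<Longrightarrow> 0 < v \<epsilon>"
    and "(v \<longlongrightarrow> v0) (at_right 0)" and "0 < v0"
    and "tendsto_in_prob M (\<lambda>\<epsilon> \<omega>. (LBINT t:{0..T}. V \<epsilon> t \<omega>) - v \<epsilon>) (\<lambda>\<omega>. 0) (at_right 0)"
    and Xe: "\<And>\<epsilon> \<omega>. Xe \<epsilon> \<omega> = 1 / sqrt (v \<epsilon>) * R \<epsilon> T \<omega>"
    and Ye: "\<And>\<epsilon> \<omega>. Ye \<epsilon> \<omega> = 1 / \<epsilon> * ((LBINT t:{0..T}. V \<epsilon> t \<omega>) - v \<epsilon>)"
    and "uniformly_integrable M {0<..} Ye"
    and "prob_space N"
    and "tendsto_in_law M (\<lambda>\<epsilon> \<omega>. (Xe \<epsilon> \<omega>, Ye \<epsilon> \<omega>)) N (\<lambda>\<omega>. (X \<omega>, Y \<omega>)) (at_right 0)"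
    and "cond_exp_version N Y X m"
    and "twice_continuously_differentiable m"
    and "((\<lambda>x. m x * std_normal_density x) \<longlongrightarrow> 0) at_infinity"
    and "(deriv (\<lambda>x. m x * std_normal_density x) \<longlongrightarrow> 0) at_infinity"
    and "\<And>\<epsilon>. 0 < \<epsilon> \<Longrightarrow> integrable lborel (corrected_density m (v \<epsilon>) \<epsilon>)"
    and "f \<in> borel_measurable borel" and "bounded (range f)"
  shows "(\<lambda>\<epsilon>. prob_space.expectation M (\<lambda>\<omega>. f (S \<epsilon> T \<omega>))
            - (LBINT x. f (S0 * exp (sqrt (v \<epsilon>) * x - v \<epsilon> / 2)) * corrected_density m (v \<epsilon>) \<epsilon> x))
         \<in> o[at_right 0](\<lambda>\<epsilon>. \<epsilon>)"
proof -
  interpret cb: correlated_brownian M F G W W' \<rho> by (rule correlated_brownian.intro) fact+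
  have BB: "B = cb.B" by (intro ext) (simp add: B cb.B_def)
  have sv: "stochastic_volatility M F G W W' \<rho> T (V \<epsilon>) (R \<epsilon> T)" if \<epsilon>: "0 < \<epsilon>" for \<epsilon>
  proof (intro stochastic_volatility.intro stochastic_volatility_axioms.intro)
    show "correlated_brownian M F G W W' \<rho>" by (rule cb.correlated_brownian_axioms)
    show "has_ito_integral M F cb.B (\<lambda>s \<omega>. sqrt (V \<epsilon> s \<omega>)) T (R \<epsilon> T)"
      using R[OF \<epsilon>, of T] \<open>0 < T\<close> by (simp add: BB)
  qed (use assms \<epsilon> in auto)
  define I where "I \<epsilon> \<omega> = (LBINT t:{0..T}. V \<epsilon> t \<omega>)" for \<epsilon> \<omega>
  have I_eq: "stochastic_volatility.I T (V \<epsilon>) = I \<epsilon>" if \<epsilon>: "0 < \<epsilon>" for \<epsilon>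
    by (intro ext) (simp add: stochastic_volatility.I_def[OF sv[OF \<epsilon>]] I_def)
  \<comment> \<open>As soon as \<open>v \<epsilon> > v0 / 2\<close>, this \<open>\<kappa>\<close> is at most half of \<open>(1 - \<rho>\<^sup>2) v \<epsilon>\<close>.\<close>
  define \<kappa> where "\<kappa> = (1 - \<rho>\<^sup>2) * v0 / 4"
  have \<kappa>: "0 < \<kappa>" using cb.\<rho>2(1) \<open>0 < v0\<close> by (simp add: \<kappa>_def)
  interpret martingale_limit M N "\<lambda>\<epsilon>. R \<epsilon> T" I v v0 \<kappa> X Y
  proof (rule martingale_limit.intro)
    show "R \<epsilon> T \<in> borel_measurable M" if "0 < \<epsilon>" for \<epsilon> by (rule stochastic_volatility.R_measurable[OF sv[OF that]])
    show "I \<epsilon> \<in> borel_measurable M" if "0 < \<epsilon>" for \<epsilon>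
      using stochastic_volatility.I_measurable[OF sv[OF that]] I_eq[OF that] by simp
    show "0 \<le> I \<epsilon> \<omega>" if "0 < \<epsilon>" "\<omega> \<in> space M" for \<epsilon> \<omega>
      using stochastic_volatility.I_nonneg[OF sv[OF that(1)] that(2)] I_eq[OF that(1)] by simp
    have Ye': "Ye = (\<lambda>\<epsilon> \<omega>. 1 / \<epsilon> * (I \<epsilon> \<omega> - v \<epsilon>))" by (intro ext) (simp add: Ye I_def)
    then show "uniformly_integrable M {0<..} (\<lambda>\<epsilon> \<omega>. 1 / \<epsilon> * (I \<epsilon> \<omega> - v \<epsilon>))"
      using \<open>uniformly_integrable M {0<..} Ye\<close> by simp
    have "(\<lambda>\<epsilon> \<omega>. (Xe \<epsilon> \<omega>, Ye \<epsilon> \<omega>)) = (\<lambda>\<epsilon> \<omega>. (1 / sqrt (v \<epsilon>) * R \<epsilon> T \<omega>, 1 / \<epsilon> * (I \<epsilon> \<omega> - v \<epsilon>)))"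
      by (intro ext) (simp add: Xe Ye I_def)
    with \<open>tendsto_in_law M (\<lambda>\<epsilon> \<omega>. (Xe \<epsilon> \<omega>, Ye \<epsilon> \<omega>)) N (\<lambda>\<omega>. (X \<omega>, Y \<omega>)) (at_right 0)\<close>
    show "tendsto_in_law M (\<lambda>\<epsilon> \<omega>. (1 / sqrt (v \<epsilon>) * R \<epsilon> T \<omega>, 1 / \<epsilon> * (I \<epsilon> \<omega> - v \<epsilon>))) N (\<lambda>\<omega>. (X \<omega>, Y \<omega>)) (at_right 0)"
      by simp
    show "integrable N Y" using \<open>cond_exp_version N Y X m\<close> by (simp add: cond_exp_version_def)
    have "\<forall>\<^sub>F \<epsilon> in at_right 0. v0 / 2 < v \<epsilon>"
      using order_tendstoD(1)[OF \<open>(v \<longlongrightarrow> v0) (at_right 0)\<close>, of "v0 / 2"] \<open>0 < v0\<close> by simp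
    with eventually_at_right_less
    show "\<forall>\<^sub>F \<epsilon> in at_right 0. \<forall>\<delta>>0. \<forall>C h. bounded_borel C h \<longrightarrow>
      \<bar>(\<integral>\<omega>. h (R \<epsilon> T \<omega> - I \<epsilon> \<omega> / 2) \<partial>M) - heat (v \<epsilon>) h (- v \<epsilon> / 2)
        - (\<integral>\<omega>. (I \<epsilon> \<omega> - v \<epsilon>) * corrector \<delta> h (R \<epsilon> T \<omega> - v \<epsilon> / 2) * indicator {\<omega> \<in> space M. I \<epsilon> \<omega> < v \<epsilon> + \<kappa>} \<omega> \<partial>M)\<bar>
      \<le> C * remainder_bound M (I \<epsilon>) \<kappa> (v \<epsilon>) \<delta>"
    proof eventually_elim
      case (elim \<epsilon>)
      have "(1 - \<rho>\<^sup>2) * (v0 / 2) \<le> (1 - \<rho>\<^sup>2) * v \<epsilon>" using elim(2) cb.\<rho>2(1) by (intro mult_left_mono) auto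
      then have k: "\<kappa> \<le> (1 - \<rho>\<^sup>2) * v \<epsilon> / 2" by (simp add: \<kappa>_def mult.commute)
      show ?case
        using stochastic_volatility.expansion[OF sv[OF elim(1)] \<kappa> k] unfolding I_eq[OF elim(1)] by blast
    qed
  qed (use assms \<kappa> in auto)
  define h where "h z = f (S0 * exp z)" for z
  obtain C where C: "\<And>x. \<bar>f x\<bar> \<le> C" using \<open>bounded (range f)\<close> by (auto simp: bounded_iff)
  note [measurable] = \<open>f \<in> borel_measurable borel\<close>
  have h: "bounded_borel C h" using C by (simp add: bounded_borel_def h_def[abs_def])
  note [measurable] = bounded_borelD(1)[OF h]
  have "\<forall>\<^sub>F \<epsilon> in at_right 0. (\<integral>\<omega>. f (S \<epsilon> T \<omega>) \<partial>M)
            - (LBINT x. f (S0 * exp (sqrt (v \<epsilon>) * x - v \<epsilon> / 2)) * corrected_density m (v \<epsilon>) \<epsilon> x)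
      = (\<integral>\<omega>. h (R \<epsilon> T \<omega> - I \<epsilon> \<omega> / 2) \<partial>M)
      - (\<integral>x. h (sqrt (v \<epsilon>) * x - v \<epsilon> / 2) * corrected_density m (v \<epsilon>) \<epsilon> x \<partial>lborel)"
    using eventually_at_right_less
  proof eventually_elim
    case (elim \<epsilon>)
    have T: "T \<in> {0..T}" using \<open>0 < T\<close> by simp
    note [measurable] = R_meas[OF elim] I_meas[OF elim]
    have Sm [measurable]: "S \<epsilon> T \<in> borel_measurable M" by (rule assms(17)[OF elim T])
    have "(\<integral>\<omega>. f (S \<epsilon> T \<omega>) \<partial>M) = (\<integral>\<omega>. h (R \<epsilon> T \<omega> - I \<epsilon> \<omega> / 2) \<partial>M)"
    proof (rule integral_cong_AE)
      show "AE \<omega> in M. f (S \<epsilon> T \<omega>) = h (R \<epsilon> T \<omega> - I \<epsilon> \<omega> / 2)"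
        using S[OF elim T] by eventually_elim (simp add: h_def I_def)
    qed measurable
    then show ?case by (simp add: h_def)
  qed
  moreover have "(\<lambda>\<epsilon>. (\<integral>\<omega>. h (R \<epsilon> T \<omega> - I \<epsilon> \<omega> / 2) \<partial>M)
      - (\<integral>x. h (sqrt (v \<epsilon>) * x - v \<epsilon> / 2) * corrected_density m (v \<epsilon>) \<epsilon> x \<partial>lborel)) \<in> o[at_right 0](\<lambda>\<epsilon>. \<epsilon>)"
    by (rule martingale_expansion[OF assms(28-32) h])
  ultimately show ?thesis by (subst landau_o.small.in_cong)
qed

end
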